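(* Let $\alpha\in\mathbb{R}$ and $f\in C^\infty(\mathcal{M})$. Suppose $\hat\rho$ satisfies $\sup_{x\in\mathcal{M}}\frac{|\hat\rho(x)-\bar\rho(x)|}{|\bar\rho(x)|}<\varepsilon_\rho<0.1$, and that as $N\to\infty$, $$\epsilon=o(1),\qquad \epsilon N=\Omega(\log N),\qquad \varepsilon_\rho=o(1).$$ Then for any $\varphi\in C^\infty(\mathcal{M})$, when $N$ is large, with probability $>1-2N^{-10}$, with $p_\alpha:=p^{1+\frac{2(\alpha-1)}{d}}$, $$\langle\varphi,L^{(\alpha)}_{un}f\rangle_p=\langle\varphi,\Delta_{p_\alpha}f\rangle_{p_\alpha}+O^{[p,f,\varphi]}(\epsilon,\ \varepsilon_\rho)+O^{[1]}\!\left(\|\varphi\|_\infty\|p^{\alpha/d}\|_\infty\sqrt{\frac{\log N}{N\epsilon}\int_{\mathcal{M}}p_\alpha|\nabla f|^2\,dV}\right).$$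
   Context: $\mathcal{M}$ is a $d$-dimensional $C^\infty$ compact manifold without boundary, isometrically embedded in $\mathbb{R}^D$ ($\|\cdot\|$ is the Euclidean norm of $\mathbb{R}^D$), with Riemannian volume measure $dV$, Laplace–Beltrami operator $\Delta$ and manifold gradient $\nabla$. $p\in C^\infty(\mathcal{M})$ is a probability density with respect to $dV$ with $0<p_{min}\le p\le p_{max}<\infty$; $\bar\rho:=p^{-1/d}$. Kernel: $k_0:[0,\infty)\to\mathbb{R}$ is continuous on $[0,\infty)$, $C^4$ on $(0,\infty)$, $k_0\ge0$, $\|k_0\|_\infty>0$, and there are $a,a_l>0$ with $|k_0^{(l)}(\xi)|\le a_le^{-a\xi}$ for all $\xi>0$, $l=0,\dots,4$. $m_2:=\frac1d\int_{\mathbb{R}^d}|u|^2k_0(|u|^2)\,du$. Data: $X=\{x_i\}_{i=1}^N$ are i.i.d. from $p$. $\hat\rho$ is the kNN bandwidth function computed from a separate dataset $Y=\{y_j\}_{j=1}^{N_y}$ independent of $X$: $\hat\rho(x)=\hat R(x)\big(\frac{1}{v_d}\frac{k}{N_y}\big)^{-1/d}$, where $v_d$ is the volume of the unit ball of $\mathbb{R}^d$ and $\hat R(x)=\inf\{r>0:\sum_j\mathbf 1_{\{\|y_j-x\|<r\}}\ge k\}$. One conditions on $Y$, so that $\hat\rho$ is a fixed (non-random) function and probability is over $X$. $\epsilon>0$, $\varepsilon_\rho$ and $\hat\rho$ may vary with $N$. Un-normalized graph Laplacian operator: $$L^{(\alpha)}_{un}f(x)=\frac{2\epsilon^{-\frac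 d2-1}}{m_2}\frac{1}{\hat\rho(x)^\alpha}\frac1N\sum_{j=1}^Nk_0\!\left(\frac{\|x-x_j\|^2}{\epsilon\hat\rho(x)\hat\rho(x_j)}\right)\frac{f(x_j)-f(x)}{\hat\rho(x_j)^\alpha}.$$ For a positive density $q$ on $\mathcal{M}$: $\langle f,g\rangle_q=\int_{\mathcal{M}}fg\,q\,dV$ and $\Delta_q=\Delta+\frac{\nabla q}{q}\cdot\nabla$. Asymptotic notation: $f=O(g)$ means $|f|\le C|g|$ in the limit; $O(g_1,g_2)$ means $O(|g_1|+|g_2|)$; $f=o(g)$ means $|f|/g\to0$; $f=\Omega(g)$ (for $f,g>0$) means $f/g\to\infty$. Superscripts such as $^{[p,f,\varphi]}$ list what the constant may depend on, $^{[1]}$ meaning an absolute constant; dependence on $\mathcal{M}$ (including $d$), $k_0$ is always allowed, and dependence on $\alpha$ is not declared. *)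

theory Defs
  imports "HOL-Probability.Probability"
begin

text \<open>
  A compact manifold isometrically embedded in Euclidean space is represented by its image: a
  compact embedded submanifold \<open>M\<close> of \<open>real ^ 'D\<close> with the induced metric. Its dimension \<open>d\<close> is
  \<open>CARD('d)\<close>, and local parametrizations are maps from open subsets of \<open>real ^ 'd\<close> into
  \<open>real ^ 'D\<close>. Since \<open>'d\<close> does not occur in the type of \<open>M\<close>, it is passed as \<open>TYPE('d)\<close>.
\<close>

subsection \<open>Smoothness\<close>

text \<open>\<open>S\<close> is meant to be open and the domain finite-dimensional; then this is the usual \<open>C^k\<close>.\<close>

primrec Ck_on :: "nat \<Rightarrow> ('a::real_normed_vector \<Rightarrow> 'b::real_normed_vector) \<Rightarrow> 'a set \<Rightarrow> bool" where
  "Ck_on 0 f S \<longleftrightarrow> continuous_on S f"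
| "Ck_on (Suc k) f S \<longleftrightarrow>
     (\<forall>x\<in>S. f differentiable (at x)) \<and> (\<forall>v. Ck_on k (\<lambda>x. frechet_derivative f (at x) v) S)"

definition smooth_on :: "('a::real_normed_vector \<Rightarrow> 'b::real_normed_vector) \<Rightarrow> 'a set \<Rightarrow> bool" where
  "smooth_on f S \<longleftrightarrow> (\<forall>k. Ck_on k f S)"

subsection \<open>Embedded submanifolds and their Riemannian geometry\<close>

definition local_param :: "(real ^ 'D) set \<Rightarrow> (real ^ 'd) set \<Rightarrow> (real ^ 'd \<Rightarrow> real ^ 'D) \<Rightarrow> bool" where
  "local_param M U \<psi> \<longleftrightarrow>
     open U \<and> smooth_on \<psi> U \<and> (\<forall>u\<in>U. inj (frechet_derivative \<psi> (at u))) \<and>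
     openin (top_of_set M) (\<psi> ` U) \<and> (\<exists>\<theta>. homeomorphism U (\<psi> ` U) \<psi> \<theta>)"

definition embedded_submanifold :: "'d::finite itself \<Rightarrow> (real ^ 'D) set \<Rightarrow> bool" where
  "embedded_submanifold _ M \<longleftrightarrow>
     (\<forall>x\<in>M. \<exists>(U :: (real ^ 'd) set) \<psi>. local_param M U \<psi> \<and> x \<in> \<psi> ` U)"

definition smooth_fun_on_manifold :: "'d::finite itself \<Rightarrow> (real ^ 'D) set \<Rightarrow> (real ^ 'D \<Rightarrow> real) \<Rightarrow> bool" where
  "smooth_fun_on_manifold _ M f \<longleftrightarrow>
     (\<forall>(U :: (real ^ 'd) set) \<psi>. local_param M U \<psi> \<longrightarrow> smooth_on (f \<circ> \<psi>) U)"

definition partial :: "'d::finite \<Rightarrow> (real ^ 'd \<Rightarrow> 'b::real_normed_vector) \<Rightarrow> real ^ 'd \<Rightarrow> 'b" where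
  "partial i h u = frechet_derivative h (at u) (axis i 1)"

definition metric_matrix :: "(real ^ 'd::finite \<Rightarrow> real ^ 'D) \<Rightarrow> real ^ 'd \<Rightarrow> real ^ 'd ^ 'd" where
  "metric_matrix \<psi> u = (\<chi> i j. partial i \<psi> u \<bullet> partial j \<psi> u)"

definition volume_density :: "(real ^ 'd::finite \<Rightarrow> real ^ 'D) \<Rightarrow> real ^ 'd \<Rightarrow> real" where
  "volume_density \<psi> u = sqrt (det (metric_matrix \<psi> u))"

text \<open>The Riemannian volume is the unique Borel measure on \<open>M\<close> that is \<open>sqrt (det g) du\<close> in each
  local parametrization.\<close>

definition riemannian_volume :: "'d::finite itself \<Rightarrow> (real ^ 'D) set \<Rightarrow> (real ^ 'D) measure \<Rightarrow> bool" where
  "riemannian_volume _ M V \<longleftrightarrow>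
     sets V = sets (restrict_space borel M) \<and>
     (\<forall>(U :: (real ^ 'd) set) \<psi>. local_param M U \<psi> \<longrightarrow>
        (\<forall>A\<in>sets V. A \<subseteq> \<psi> ` U \<longrightarrow>
           emeasure V A = (\<integral>\<^sup>+u\<in>{u\<in>U. \<psi> u \<in> A}. ennreal (volume_density \<psi> u) \<partial>lborel)))"

definition tangent_space :: "'d::finite itself \<Rightarrow> (real ^ 'D) set \<Rightarrow> real ^ 'D \<Rightarrow> (real ^ 'D) set" where
  "tangent_space _ M x =
     {w. \<exists>(U :: (real ^ 'd) set) \<psi> u h. local_param M U \<psi> \<and> u \<in> U \<and> \<psi> u = x \<and>
           w = frechet_derivative \<psi> (at u) h}"

text \<open>The gradient is the tangent vector representing the differential of \<open>f\<close>; here the differential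
  maps \<open>d\<psi> h\<close> to \<open>d(f \<circ> \<psi>) h\<close>. Both \<open>THE\<close> below are well-defined for \<open>x \<in> M\<close> and smooth \<open>f\<close>.\<close>

definition manifold_grad :: "'d::finite itself \<Rightarrow> (real ^ 'D) set \<Rightarrow> (real ^ 'D \<Rightarrow> real) \<Rightarrow> real ^ 'D \<Rightarrow> real ^ 'D" where
  "manifold_grad T M f x =
     (THE v. v \<in> tangent_space T M x \<and>
        (\<forall>(U :: (real ^ 'd) set) \<psi> u. local_param M U \<psi> \<and> u \<in> U \<and> \<psi> u = x \<longrightarrow>
           (\<forall>h. v \<bullet> frechet_derivative \<psi> (at u) h = frechet_derivative (f \<circ> \<psi>) (at u) h)))"

definition laplace_local :: "(real ^ 'd::finite \<Rightarrow> real ^ 'D) \<Rightarrow> (real ^ 'D \<Rightarrow> real) \<Rightarrow> real ^ 'd \<Rightarrow> real" where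
  "laplace_local \<psi> f u =
     1 / volume_density \<psi> u *
     (\<Sum>i\<in>UNIV. partial i
        (\<lambda>w. volume_density \<psi> w *
           (\<Sum>j\<in>UNIV. matrix_inv (metric_matrix \<psi> w) $ i $ j * partial j (f \<circ> \<psi>) w)) u)"

definition laplace_beltrami :: "'d::finite itself \<Rightarrow> (real ^ 'D) set \<Rightarrow> (real ^ 'D \<Rightarrow> real) \<Rightarrow> real ^ 'D \<Rightarrow> real" where
  "laplace_beltrami _ M f x =
     (THE c. \<forall>(U :: (real ^ 'd) set) \<psi> u. local_param M U \<psi> \<and> u \<in> U \<and> \<psi> u = x \<longrightarrow>
        laplace_local \<psi> f u = c)"

definition weighted_laplacian ::
  "'d::finite itself \<Rightarrow> (real ^ 'D) set \<Rightarrow> (real ^ 'D \<Rightarrow> real) \<Rightarrow> (real ^ 'D \<Rightarrow> real) \<Rightarrow> real ^ 'D \<Rightarrow> real" where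
  "weighted_laplacian T M q f x =
     laplace_beltrami T M f x + (1 / q x) * (manifold_grad T M q x \<bullet> manifold_grad T M f x)"

definition weighted_inner :: "'a measure \<Rightarrow> ('a \<Rightarrow> real) \<Rightarrow> ('a \<Rightarrow> real) \<Rightarrow> ('a \<Rightarrow> real) \<Rightarrow> real" where
  "weighted_inner V q f g = (\<integral>x. f x * g x * q x \<partial>V)"

text \<open>Used only for bounded functions on non-empty sets.\<close>

definition sup_norm_on :: "'a set \<Rightarrow> ('a \<Rightarrow> real) \<Rightarrow> real" where
  "sup_norm_on S f = (SUP x\<in>S. \<bar>f x\<bar>)"

subsection \<open>Density, kernel, bandwidth and graph Laplacian\<close>

definition smooth_density ::
  "'d::finite itself \<Rightarrow> (real ^ 'D) set \<Rightarrow> (real ^ 'D) measure \<Rightarrow> (real ^ 'D \<Rightarrow> real) \<Rightarrow> bool" where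
  "smooth_density T M V p \<longleftrightarrow>
     smooth_fun_on_manifold T M p \<and> (\<integral>x. p x \<partial>V) = 1 \<and>
     (\<exists>pmin pmax. 0 < pmin \<and> (\<forall>x\<in>M. pmin \<le> p x \<and> p x \<le> pmax))"

definition rho_bar :: "'d::finite itself \<Rightarrow> ('a \<Rightarrow> real) \<Rightarrow> 'a \<Rightarrow> real" where
  "rho_bar _ p x = p x powr (- 1 / real CARD('d))"

definition p_alpha :: "'d::finite itself \<Rightarrow> real \<Rightarrow> ('a \<Rightarrow> real) \<Rightarrow> 'a \<Rightarrow> real" where
  "p_alpha _ \<alpha> p x = p x powr (1 + 2 * (\<alpha> - 1) / real CARD('d))"

definition admissible_kernel :: "(real \<Rightarrow> real) \<Rightarrow> bool" where
  "admissible_kernel k0 \<longleftrightarrow>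
     continuous_on {0..} k0 \<and>
     (\<forall>l<4. (deriv ^^ l) k0 differentiable_on {0<..}) \<and>
     continuous_on {0<..} ((deriv ^^ 4) k0) \<and>
     (\<forall>\<xi>\<ge>0. k0 \<xi> \<ge> 0) \<and>
     sup_norm_on {0..} k0 > 0 \<and>
     (\<exists>a>0. \<exists>A. \<forall>l\<le>4. A l > 0 \<and> (\<forall>\<xi>>0. \<bar>(deriv ^^ l) k0 \<xi>\<bar> \<le> A l * exp (- a * \<xi>)))"

definition kernel_m2 :: "'d::finite itself \<Rightarrow> (real \<Rightarrow> real) \<Rightarrow> real" where
  "kernel_m2 _ k0 =
     1 / real CARD('d) * (\<integral>u. (norm u)\<^sup>2 * k0 ((norm u)\<^sup>2) \<partial>(lborel :: (real ^ 'd) measure))"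

definition knn_radius :: "nat \<Rightarrow> nat \<Rightarrow> (nat \<Rightarrow> 'a::real_normed_vector) \<Rightarrow> 'a \<Rightarrow> real" where
  "knn_radius k Ny Y x = Inf {r. r > 0 \<and> (\<Sum>j<Ny. of_bool (norm (Y j - x) < r) :: nat) \<ge> k}"

definition knn_bandwidth ::
  "'d::finite itself \<Rightarrow> nat \<Rightarrow> nat \<Rightarrow> (nat \<Rightarrow> 'a::real_normed_vector) \<Rightarrow> 'a \<Rightarrow> real" where
  "knn_bandwidth _ k Ny Y x =
     knn_radius k Ny Y x *
     (1 / measure lborel (ball (0 :: real ^ 'd) 1) * (real k / real Ny)) powr (- 1 / real CARD('d))"

definition graph_laplacian_un ::
  "'d::finite itself \<Rightarrow> (real \<Rightarrow> real) \<Rightarrow> real \<Rightarrow> real \<Rightarrow> ('a \<Rightarrow> real) \<Rightarrow> nat \<Rightarrow>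
   (nat \<Rightarrow> 'a::real_normed_vector) \<Rightarrow> ('a \<Rightarrow> real) \<Rightarrow> 'a \<Rightarrow> real" where
  "graph_laplacian_un T k0 \<alpha> \<epsilon> \<rho> N X f x =
     2 * \<epsilon> powr (- real CARD('d) / 2 - 1) / kernel_m2 T k0 * (1 / \<rho> x powr \<alpha>) *
     (1 / real N * (\<Sum>j<N. k0 ((norm (x - X j))\<^sup>2 / (\<epsilon> * \<rho> x * \<rho> (X j))) *
                            ((f (X j) - f x) / \<rho> (X j) powr \<alpha>)))"

text \<open>The joint law of \<open>N\<close> i.i.d. points with density \<open>p\<close>; points of its space are the samples
  \<open>X = (X 0, \<dots>, X (N - 1))\<close>.\<close>

definition iid_sample :: "'a measure \<Rightarrow> ('a \<Rightarrow> real) \<Rightarrow> nat \<Rightarrow> (nat \<Rightarrow> 'a) measure" where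
  "iid_sample V p N = Pi\<^sub>M {..<N} (\<lambda>_. density V (\<lambda>x. ennreal (p x)))"

end

theory Submission
  imports Defs
begin

text \<open>By symmetry of the kernel, the expectation of the weak form is minus a Dirichlet form
  \<open>\<integral>\<integral> k (\<phi> x - \<phi> y) (f x - f y)\<close>. In a chart, around the midpoint of the two arguments, the integrand is even up
  to third order, so Lipschitz bounds for \<open>k0\<close> suffice for an error \<open>O(\<epsilon>)\<close>, and Green's formula identifies
  the limit. The kernel is Lipschitz in the logarithm of the bandwidth, which gives the error \<open>O(\<epsilon>\<^sub>\<rho>)\<close>.
  The fluctuation is controlled by Bernstein's inequality: by Cauchy--Schwarz the variance is at most the
  kernel mass times the Dirichlet form of \<open>f\<close> with exponent \<open>2\<alpha>\<close>, whose density is \<open>p\<^sub>\<alpha> p\<close> to the \<open>2\<alpha>/d\<close>.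
  If \<open>\<integral> p\<^sub>\<alpha> |\<nabla>f|\<^sup>2 = 0\<close> this bound degenerates; then \<open>f\<close> is locally constant, and the sum is itself
  exponentially small.\<close>

text \<open>The order of the quantifiers shapes the proof: \<open>C2\<close> is fixed before
  \<open>p\<close>, \<alpha>, \<open>f\<close> and \<phi>, while \<open>C1\<close> and the threshold
  for N may depend on all of them. Hence nothing that depends on \<open>p\<close> may enter the
  leading variance. Crude bounds on the summands appear only in the side condition of Bernstein's
  inequality, which holds eventually; the error in the variance is absorbed by doubling its limit,
  which requires a positive limit and so separates off the degenerate case. With only Lipschitz
  bounds on the kernel, odd error terms have to vanish pointwise and not merely after integration.
  Midpoint coordinates achieve this: about the midpoint increments are odd up to third order,
  products of weights are even up to second order. Three derivatives are all that this expansion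
  uses, so regularity is tracked at finite order and cutoffs may be truncated fourth powers.
  Gradient and Laplacian are descriptions over all charts, so each needs a proof of chart
  independence before it can be computed in one chart.\<close>

abbreviation fderiv :: "('a::real_normed_vector \<Rightarrow> 'b::real_normed_vector) \<Rightarrow> 'a \<Rightarrow> 'a \<Rightarrow> 'b" where
  "fderiv f x \<equiv> frechet_derivative f (at x)"

abbreviation gauss :: "real \<Rightarrow> 'a::real_normed_vector \<Rightarrow> real" where "gauss b w \<equiv> exp (- b * (norm w)\<^sup>2)"

abbreviation vol :: "(real ^ 'd::finite \<Rightarrow> real ^ 'D::finite) \<Rightarrow> real ^ 'd \<Rightarrow> real" where "vol \<equiv> volume_density"

lemmas LINT_cong = Bochner_Integration.integral_cong[OF refl]

abbreviation lborel2 :: "('a::euclidean_space \<times> 'b::euclidean_space) measure" where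
  "lborel2 \<equiv> lborel \<Otimes>\<^sub>M lborel"

section \<open>Calculus of functions of class C^k on open sets\<close>

lemma Ck_on_imp_continuous_on: "Ck_on k f S \<Longrightarrow> continuous_on S f"
  by (cases k) (auto intro!: continuous_at_imp_continuous_on differentiable_imp_continuous_within)

lemma Ck_on_SucD: "Ck_on (Suc k) f S \<Longrightarrow> Ck_on k f S"
proof (induction k arbitrary: f)
  case 0
  then show ?case using Ck_on_imp_continuous_on by fastforce
qed auto

lemma Ck_on_mono: "Ck_on k f S \<Longrightarrow> j \<le> k \<Longrightarrow> Ck_on j f S"
  by (induction k) (auto simp: le_Suc_eq simp del: Ck_on.simps dest: Ck_on_SucD)

lemma Ck_on_has_derivative:
  "Ck_on (Suc k) f S \<Longrightarrow> x \<in> S \<Longrightarrow> (f has_derivative fderiv f x) (at x)"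
  using frechet_derivative_works by auto

lemma Ck_on_cong:
  assumes "open S" "\<And>x. x \<in> S \<Longrightarrow> f x = g x" "Ck_on k f S"
  shows "Ck_on k g S"
  using assms(2,3)
proof (induction k arbitrary: f g)
  case 0
  then show ?case by (auto cong: continuous_on_cong)
next
  case (Suc k)
  have d: "g differentiable (at x)" if "x \<in> S" for x
  proof -
    have "(f has_derivative fderiv f x) (at x)"
      using Suc.prems that Ck_on_has_derivative by blast
    then have "(g has_derivative fderiv f x) (at x)"
      using has_derivative_transform_within_open[OF _ assms(1) that] Suc.prems(1) by blast
    then show ?thesis unfolding differentiable_def by blast
  qed
  have e: "fderiv f x = fderiv g x" if "x \<in> S" for x
    using Suc.prems that assms(1)
    by (intro frechet_derivative_transform_within_open[where X=S]) auto
  have "Ck_on k (\<lambda>x. fderiv g x v) S" for v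
    using Suc.prems(2) by (intro Suc.IH[of "\<lambda>x. fderiv f x v" "\<lambda>x. fderiv g x v"])
      (simp_all add: e)
  then show ?case using d by auto
qed

lemma Ck_on_const [simp]: "Ck_on k (\<lambda>x. c) S"
  by (induction k arbitrary: c) auto

text \<open>\<open>Ck_on\<close> is phrased with \<open>frechet_derivative\<close>; on an open set
  any explicit derivative agrees with it, so the inductions below only have to exhibit a
  derivative.\<close>

lemma Ck_on_SucI:
  assumes "open S" "\<And>x. x \<in> S \<Longrightarrow> (f has_derivative f' x) (at x)"
    "\<And>v. Ck_on k (\<lambda>x. f' x v) S"
  shows "Ck_on (Suc k) f S"
proof -
  have "fderiv f x = f' x" if "x \<in> S" for x
    using frechet_derivative_at[OF assms(2)[OF that]] by simp
  then have "Ck_on k (\<lambda>x. fderiv f x v) S" for v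
    using Ck_on_cong[OF assms(1) _ assms(3)[of v]] by simp
  then show ?thesis using assms(2) by (auto simp: differentiable_def)
qed

lemma Ck_on_add:
  assumes "open S" "Ck_on k f S" "Ck_on k g S"
  shows "Ck_on k (\<lambda>x. f x + g x) S"
  using assms(2,3)
proof (induction k arbitrary: f g)
  case 0
  then show ?case by (auto intro: continuous_on_add)
next
  case (Suc k)
  show ?case
  proof (rule Ck_on_SucI[OF assms(1)])
    show "((\<lambda>x. f x + g x) has_derivative
        (\<lambda>v. fderiv f x v + fderiv g x v)) (at x)" if "x \<in> S" for x
      by (intro has_derivative_add Ck_on_has_derivative[OF Suc.prems(1) that]
          Ck_on_has_derivative[OF Suc.prems(2) that])
    show "Ck_on k (\<lambda>x. fderiv f x v + fderiv g x v) S" for v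
      using Suc by auto
  qed
qed

text \<open>The product rule yields two products under the same bilinear map, one order lower, so a
  single induction serves multiplication, inner products and scaling.\<close>

lemma (in bounded_bilinear) Ck_on_bilinear:
  assumes "open S" "Ck_on k f S" "Ck_on k g S"
  shows "Ck_on k (\<lambda>x. prod (f x) (g x)) S"
  using assms(2,3)
proof (induction k arbitrary: f g)
  case 0
  then show ?case by (auto intro: continuous_on)
next
  case (Suc k)
  show ?case
  proof (rule Ck_on_SucI[OF assms(1)])
    show "((\<lambda>x. prod (f x) (g x)) has_derivative
        (\<lambda>v. prod (f x) (fderiv g x v) + prod (fderiv f x v) (g x))) (at x)"
      if "x \<in> S" for x
      by (intro FDERIV Ck_on_has_derivative[OF Suc.prems(1) that]
          Ck_on_has_derivative[OF Suc.prems(2) that])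
    have "Ck_on k f S" "Ck_on k g S" using Suc.prems Ck_on_SucD by blast+
    then show "Ck_on k (\<lambda>x. prod (f x) (fderiv g x v)
        + prod (fderiv f x v) (g x)) S" for v
      using Suc by (intro Ck_on_add[OF assms(1)] Suc.IH) auto
  qed
qed

lemmas Ck_on_mult = bounded_bilinear.Ck_on_bilinear[OF bounded_bilinear_mult]
lemmas Ck_on_inner = bounded_bilinear.Ck_on_bilinear[OF bounded_bilinear_inner]
lemmas Ck_on_scaleR = bounded_bilinear.Ck_on_bilinear[OF bounded_bilinear_scaleR]

lemma Ck_on_diff:
  assumes "open S" "Ck_on k f S" "Ck_on k g S"
  shows "Ck_on k (\<lambda>x. f x - g x) S"
  using Ck_on_add[OF assms(1,2) Ck_on_scaleR[OF assms(1) Ck_on_const[of k "-1"] assms(3)]] by simp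

lemma Ck_on_sum:
  assumes "open S" "\<And>i. i \<in> I \<Longrightarrow> Ck_on k (f i) S"
  shows "Ck_on k (\<lambda>x. \<Sum>i\<in>I. f i x) S"
  using assms(2) by (induction I rule: infinite_finite_induct) (auto intro: Ck_on_add[OF assms(1)])

lemma Ck_on_prod:
  fixes f :: "'i \<Rightarrow> 'a::real_normed_vector \<Rightarrow> real"
  assumes "open S" "\<And>i. i \<in> I \<Longrightarrow> Ck_on k (f i) S"
  shows "Ck_on k (\<lambda>x. \<Prod>i\<in>I. f i x) S"
  using assms(2) by (induction I rule: infinite_finite_induct) (auto intro: Ck_on_mult[OF assms(1)])

lemma Ck_on_power:
  fixes f :: "'a::real_normed_vector \<Rightarrow> real"
  assumes "open S" "Ck_on k f S"
  shows "Ck_on k (\<lambda>x. f x ^ n) S"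
  by (induction n) (auto intro: Ck_on_mult[OF assms(1)] assms)

text \<open>The derivative of 1/f is built from f' and 1/f itself, and the induction hypothesis
  already supplies 1/f at the lower order.\<close>

lemma Ck_on_inverse:
  fixes f :: "'a::real_normed_vector \<Rightarrow> real"
  assumes "open S" "Ck_on k f S" "\<And>x. x \<in> S \<Longrightarrow> f x \<noteq> 0"
  shows "Ck_on k (\<lambda>x. inverse (f x)) S"
  using assms(2)
proof (induction k)
  case 0
  then show ?case using assms(3) by (auto intro!: continuous_intros)
next
  case (Suc k)
  show ?case
  proof (rule Ck_on_SucI[OF assms(1)])
    show "((\<lambda>x. inverse (f x)) has_derivative
        (\<lambda>v. - (inverse (f x) * fderiv f x v * inverse (f x)))) (at x)" if "x \<in> S" for x
      by (rule Deriv.has_derivative_inverse[OF assms(3)[OF that] Ck_on_has_derivative[OF Suc.prems(1) that]])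
    have "Ck_on k f S" using Suc.prems Ck_on_SucD by blast
    then have i: "Ck_on k (\<lambda>x. inverse (f x)) S" by (rule Suc.IH)
    have "Ck_on k (\<lambda>x. (-1) * (inverse (f x) * fderiv f x v * inverse (f x))) S" for v
      using Suc.prems i by (intro Ck_on_mult[OF assms(1)]) auto
    then show "Ck_on k (\<lambda>x. - (inverse (f x) * fderiv f x v * inverse (f x))) S" for v
      by simp
  qed
qed

lemma Ck_on_divide:
  fixes f g :: "'a::real_normed_vector \<Rightarrow> real"
  assumes "open S" "Ck_on k f S" "Ck_on k g S" "\<And>x. x \<in> S \<Longrightarrow> g x \<noteq> 0"
  shows "Ck_on k (\<lambda>x. f x / g x) S"
  unfolding divide_inverse by (intro Ck_on_mult Ck_on_inverse assms)

text \<open>At the kink t = 0 the difference quotient is itself a truncated power of one degree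
  less, which tends to 0.\<close>

lemma has_real_derivative_max_power:
  "((\<lambda>t::real. max 0 t ^ (n + 2)) has_real_derivative real (n + 2) * max 0 t ^ (n + 1)) (at t)"
proof -
  consider "t > 0" | "t < 0" | "t = 0" by linarith
  then show ?thesis
  proof cases
    case 1
    have "((\<lambda>t::real. t ^ (n + 2)) has_real_derivative real (n + 2) * max 0 t ^ (n + 1)) (at t)"
      using DERIV_pow[of "n + 2" t] 1 by simp
    then show ?thesis
      by (rule has_field_derivative_transform_within_open[where S="{0<..}"]) (use 1 in auto)
  next
    case 2
    have "((\<lambda>t::real. 0) has_real_derivative real (n + 2) * max 0 t ^ (n + 1)) (at t)"
      using 2 by (auto intro!: derivative_eq_intros)
    then show ?thesis
      by (rule has_field_derivative_transform_within_open[where S="{..<0}"]) (use 2 in auto)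
  next
    case 3
    have "((\<lambda>h::real. max 0 h ^ (n + 1)) \<longlongrightarrow> max 0 0 ^ (n + 1)) (at 0)"
      by (intro tendsto_intros)
    moreover have "max 0 h ^ (n + 1) = max 0 h ^ (n + 2) / h" if "h \<noteq> 0" for h :: real
      using that by (auto simp: max_def)
    ultimately have "((\<lambda>h::real. max 0 h ^ (n + 2) / h) \<longlongrightarrow> max 0 0 ^ (n + 1)) (at 0)"
      using LIM_equal[of 0 "\<lambda>h. max 0 h ^ (n + 1)" "\<lambda>h. max 0 h ^ (n + 2) / h"] by blast
    then show ?thesis using 3 by (simp add: DERIV_def)
  qed
qed

text \<open>Each differentiation lowers the exponent and the order together. This is the source of
  the cutoff functions: a truncated power of degree k + 1 is of class C^k.\<close>

lemma Ck_on_max_power: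
  fixes u :: "'a::real_normed_vector \<Rightarrow> real"
  assumes "open S" "Ck_on k u S"
  shows "Ck_on k (\<lambda>x. max 0 (u x) ^ Suc k) S"
  using assms(2)
proof (induction k)
  case 0
  then show ?case by (auto intro!: continuous_intros)
next
  case (Suc k)
  show ?case
  proof (rule Ck_on_SucI[OF assms(1)])
    show "((\<lambda>x. max 0 (u x) ^ Suc (Suc k)) has_derivative
        (\<lambda>v. (real (k + 2) * max 0 (u x) ^ Suc k) * fderiv u x v)) (at x)" if "x \<in> S" for x
      using has_derivative_compose[OF Ck_on_has_derivative[OF Suc.prems(1) that]
          has_real_derivative_max_power[of k "u x", unfolded has_field_derivative_def]] by simp
    show "Ck_on k (\<lambda>x. (real (k + 2) * max 0 (u x) ^ Suc k) * fderiv u x v) S" for v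
      using Suc.prems Suc.IH[OF Ck_on_SucD[OF Suc.prems]] by (intro Ck_on_mult[OF assms(1)] Ck_on_const) auto
  qed
qed

lemma Ck_on_det:
  fixes G :: "'a::real_normed_vector \<Rightarrow> real ^ 'n ^ 'n"
  assumes "open S" "\<And>i j. Ck_on k (\<lambda>x. G x $ i $ j) S"
  shows "Ck_on k (\<lambda>x. det (G x)) S"
  unfolding det_def by (intro Ck_on_sum Ck_on_mult Ck_on_prod Ck_on_const assms)

section \<open>Taylor bounds along segments in compact sets\<close>

lemma onorm_le_sum_Basis:
  fixes L :: "'a::euclidean_space \<Rightarrow> 'b::real_normed_vector"
  assumes "bounded_linear L"
  shows "onorm L \<le> (\<Sum>b\<in>Basis. norm (L b))"
proof (rule onorm_bound)
  fix x
  interpret bounded_linear L by fact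
  have "L x = L (\<Sum>b\<in>Basis. (x \<bullet> b) *\<^sub>R b)" by (simp add: euclidean_representation)
  also have "\<dots> = (\<Sum>b\<in>Basis. (x \<bullet> b) *\<^sub>R L b)" by (simp add: sum scaleR)
  also have "norm \<dots> \<le> (\<Sum>b\<in>Basis. norm x * norm (L b))"
    by (intro order_trans[OF norm_sum] sum_mono) (auto intro!: mult_right_mono simp: Basis_le_norm)
  finally show "norm (L x) \<le> (\<Sum>b\<in>Basis. norm (L b)) * norm x"
    by (simp add: sum_distrib_left mult.commute)
qed (auto intro: sum_nonneg)

lemma Ck_on_bounded_linear:
  "Ck_on (Suc k) f S \<Longrightarrow> x \<in> S \<Longrightarrow> bounded_linear (fderiv f x)"
  using Ck_on_has_derivative has_derivative_bounded_linear by blast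

lemma compact_continuous_bound:
  fixes f :: "'a::metric_space \<Rightarrow> 'b::real_normed_vector"
  assumes "compact K" "continuous_on K f"
  obtains C where "C \<ge> 0" "\<And>x. x \<in> K \<Longrightarrow> norm (f x) \<le> C"
proof -
  have "bounded (f ` K)" using assms compact_continuous_image compact_imp_bounded by blast
  then obtain C where "\<And>x. x \<in> K \<Longrightarrow> norm (f x) \<le> C" by (auto simp: bounded_iff)
  then show ?thesis by (intro that[of "max 0 C"]) force+
qed

text \<open>The bound is indexed by segments inside \<open>K\<close>, because the compact sets met
  later are thickened preimages of supports and need not be convex.\<close>

lemma C1_segment_bound:
  fixes f :: "'a::euclidean_space \<Rightarrow> 'b::real_normed_vector"
  assumes "Ck_on (Suc 0) f U" "compact K" "K \<subseteq> U"
  shows "\<exists>C\<ge>0. \<forall>a w. closed_segment a (a + w) \<subseteq> K \<longrightarrow> norm (f (a + w) - f a) \<le> C * norm w"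
proof -
  have "continuous_on K (\<lambda>x. \<Sum>b\<in>Basis. norm (fderiv f x b))"
    using assms by (intro continuous_intros) (auto intro: continuous_on_subset)
  then obtain C where C: "C \<ge> 0" "\<And>x. x \<in> K \<Longrightarrow> norm (\<Sum>b\<in>Basis. norm (fderiv f x b)) \<le> C"
    using compact_continuous_bound[OF assms(2)] by blast
  show ?thesis
  proof (intro exI[of _ C] conjI allI impI C(1))
    fix a w :: 'a
    assume s: "closed_segment a (a + w) \<subseteq> K"
    have "norm (f (a + w) - f a) \<le> norm w * C"
    proof (rule differentiable_bound_segment[where G=K])
      show "a + t *\<^sub>R w \<in> K" if "t \<in> {0..1}" for t
        using that s by (auto simp: closed_segment_def algebra_simps)
      show "(f has_derivative fderiv f x) (at x within K)" if "x \<in> K" for x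
        using Ck_on_has_derivative[OF assms(1), of x] that assms(3) has_derivative_at_withinI by blast
      fix t :: real assume "t \<in> {0..1}"
      then have x: "a + t *\<^sub>R w \<in> K" (is "?x \<in> K")
        using s by (auto simp: closed_segment_def algebra_simps)
      show "onorm (fderiv f ?x) \<le> C"
        using onorm_le_sum_Basis[OF Ck_on_bounded_linear[OF assms(1), of ?x]] C(2)[OF x] x assms(3)
        by (auto simp: abs_of_nonneg sum_nonneg)
    qed
    then show "norm (f (a + w) - f a) \<le> C * norm w" by (simp add: mult.commute)
  qed
qed

lemma uniform_bound_sum:
  fixes f :: "'i \<Rightarrow> 'a \<Rightarrow> 'b \<Rightarrow> 'c::real_normed_vector"
  assumes "\<And>i. i \<in> I \<Longrightarrow> \<exists>C\<ge>0. \<forall>x y. P x y \<longrightarrow> norm (f i x y) \<le> C * g x y"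
  shows "\<exists>C\<ge>(0::real). \<forall>x y. P x y \<longrightarrow> (\<Sum>i\<in>I. norm (f i x y)) \<le> C * g x y"
proof -
  obtain C where C: "\<And>i. i \<in> I \<Longrightarrow> C i \<ge> 0 \<and> (\<forall>x y. P x y \<longrightarrow> norm (f i x y) \<le> C i * g x y)"
    using assms by metis
  have "(\<Sum>i\<in>I. norm (f i x y)) \<le> sum C I * g x y" if "P x y" for x y
    unfolding sum_distrib_right by (rule sum_mono) (use C that in blast)
  moreover have "sum C I \<ge> 0" using C by (auto intro: sum_nonneg)
  ultimately show ?thesis by blast
qed

text \<open>The first-order bound, applied to each directional derivative, lets the derivative vary
  by O(|w|) along the segment; the mean value inequality for \<open>f\<close> minus its
  linearization contributes the second factor |w|.\<close>

lemma C2_segment_bound: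
  fixes f :: "'a::euclidean_space \<Rightarrow> 'b::real_normed_vector"
  assumes "Ck_on 2 f U" "compact K" "K \<subseteq> U"
  shows "\<exists>C\<ge>0. \<forall>a w. closed_segment a (a + w) \<subseteq> K \<longrightarrow>
       norm (f (a + w) - f a - fderiv f a w) \<le> C * norm w ^ 2"
proof -
  have f2: "Ck_on (Suc (Suc 0)) f U" using assms(1) by (simp add: numeral_2_eq_2)
  let ?D = "\<lambda>b a w. fderiv f (a + w) b - fderiv f a b"
  have "\<exists>C\<ge>0. \<forall>a w. closed_segment a (a + w) \<subseteq> K \<longrightarrow> norm (?D b a w) \<le> C * norm w" for b
    using f2 by (intro C1_segment_bound[OF _ assms(2,3)]) simp
  from uniform_bound_sum[where f="?D" and I=Basis, OF this]
  obtain C where C: "C \<ge> 0" "\<And>a w. closed_segment a (a + w) \<subseteq> K \<Longrightarrow>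
     (\<Sum>b\<in>Basis. norm (?D b a w)) \<le> C * norm w" by blast
  show ?thesis
  proof (intro exI[of _ C] conjI allI impI C(1))
    fix a w :: 'a
    let ?S = "closed_segment a (a + w)"
    assume s: "?S \<subseteq> K"
    have "norm (f (a + w) - f a - fderiv f a (a + w - a)) \<le> norm (a + w - a) * (C * norm w)"
    proof (rule differentiable_bound_linearization[where S="?S" and f'="\<lambda>x. fderiv f x"])
      show "a + t *\<^sub>R (a + w - a) \<in> ?S" if "t \<in> {0..1}" for t
        using that by (auto simp: closed_segment_def algebra_simps)
      fix x assume x: "x \<in> ?S"
      have xU: "x \<in> U" "a \<in> U" using x s assms(3) by auto
      show "(f has_derivative fderiv f x) (at x within ?S)"
        using Ck_on_has_derivative[OF f2 xU(1)] has_derivative_at_withinI by blast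
      from x obtain t where t: "0 \<le> t" "t \<le> 1" "x = a + t *\<^sub>R w" by (auto simp: closed_segment_def algebra_simps)
      have "closed_segment a (a + t *\<^sub>R w) \<subseteq> ?S"
        using x t by (simp add: closed_segment_subset)
      then have "closed_segment a (a + t *\<^sub>R w) \<subseteq> K" using s by blast
      note c = C(2)[OF this]
      have "bounded_linear (\<lambda>v. fderiv f x v - fderiv f a v)"
        using Ck_on_bounded_linear[OF f2] xU by (intro bounded_linear_sub) auto
      from onorm_le_sum_Basis[OF this]
      have "onorm (\<lambda>v. fderiv f x v - fderiv f a v) \<le> C * norm (t *\<^sub>R w)"
        unfolding t(3) by (rule order_trans[OF _ c])
      also have "\<dots> \<le> C * norm w" using C(1) t by (auto intro!: mult_left_mono mult_left_le_one_le)
      finally show "onorm (fderiv f x - fderiv f a) \<le> C * norm w"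
        by (simp add: fun_diff_def)
    qed simp
    then show "norm (f (a + w) - f a - fderiv f a w) \<le> C * norm w ^ 2"
      by (simp add: power2_eq_square algebra_simps)
  qed
qed

lemma closed_segment_symmetric_subset:
  fixes m w :: "'a::euclidean_space"
  assumes "closed_segment (m - w) (m + w) \<subseteq> K" "\<bar>t\<bar> \<le> 1" "\<bar>s\<bar> \<le> 1"
  shows "closed_segment (m + t *\<^sub>R w) (m + s *\<^sub>R w) \<subseteq> K"
proof -
  have "m + t *\<^sub>R w \<in> closed_segment (m - w) (m + w)" if "\<bar>t\<bar> \<le> 1" for t
  proof -
    have "m + t *\<^sub>R w = (1 - (1 + t) / 2) *\<^sub>R (m - w) + ((1 + t) / 2) *\<^sub>R (m + w)"
      by (simp add: algebra_simps flip: scaleR_add_left scaleR_diff_left) (simp add: scaleR_2[symmetric] divide_simps algebra_simps flip: scaleR_add_left)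
    then show ?thesis using that unfolding closed_segment_def by (auto intro!: exI[of _ "(1 + t) / 2"])
  qed
  then show ?thesis using assms by (meson closed_segment_subset convex_closed_segment subset_trans)
qed

text \<open>Expand at \<open>m\<close> in the directions w and -w: the linear terms cancel in the
  sum.\<close>

lemma C2_symmetric_bound:
  fixes f :: "'a::euclidean_space \<Rightarrow> 'b::real_normed_vector"
  assumes "Ck_on 2 f U" "compact K" "K \<subseteq> U"
  shows "\<exists>C\<ge>0. \<forall>m w. closed_segment (m - w) (m + w) \<subseteq> K \<longrightarrow>
       norm (f (m + w) + f (m - w) - 2 *\<^sub>R f m) \<le> C * norm w ^ 2"
proof -
  from C2_segment_bound[OF assms] obtain C where C: "C \<ge> 0" 
    "\<And>a w. closed_segment a (a + w) \<subseteq> K \<Longrightarrow>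
       norm (f (a + w) - f a - fderiv f a w) \<le> C * norm w ^ 2" by blast
  have f2: "Ck_on (Suc (Suc 0)) f U" using assms(1) by (simp add: numeral_2_eq_2)
  show ?thesis
  proof (intro exI[of _ "2 * C"] conjI allI impI)
    fix m w :: 'a assume s: "closed_segment (m - w) (m + w) \<subseteq> K"
    have 1: "closed_segment m (m + w) \<subseteq> K" "closed_segment m (m + (-w)) \<subseteq> K"
      using closed_segment_symmetric_subset[OF s, of 0 1] closed_segment_symmetric_subset[OF s, of 0 "-1"] by auto
    then have "m \<in> U" using assms(3) by auto
    then have "fderiv f m (- w) = - fderiv f m w"
      using Ck_on_bounded_linear[OF f2] bounded_linear.linear linear_neg by blast
    then have "f (m + w) + f (m - w) - 2 *\<^sub>R f m = (f (m + w) - f m - fderiv f m w)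
      + (f (m + -w) - f m - fderiv f m (-w))" by (simp add: scaleR_2)
    also have "norm \<dots> \<le> C * norm w ^ 2 + C * norm (-w) ^ 2"
      by (intro order_trans[OF norm_triangle_ineq] add_mono C(2) 1)
    finally show "norm (f (m + w) + f (m - w) - 2 *\<^sub>R f m) \<le> 2 * C * norm w ^ 2" by simp
  qed (use C in auto)
qed

text \<open>The map v to f (m + v) - f (m - v) has derivative f' (m + v) + f' (m - v), which by the
  second-order symmetric bound for f' differs from its value at v = 0 by O(|v|^2). The mean value
  inequality adds one factor |w|; no quadratic term survives.\<close>

lemma C3_symmetric_bound:
  fixes f :: "'a::euclidean_space \<Rightarrow> 'b::real_normed_vector"
  assumes "Ck_on 3 f U" "compact K" "K \<subseteq> U"
  shows "\<exists>C\<ge>0. \<forall>m w. closed_segment (m - w) (m + w) \<subseteq> K \<longrightarrow>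
       norm (f (m + w) - f (m - w) - 2 *\<^sub>R fderiv f m w) \<le> C * norm w ^ 3"
proof -
  have f3: "Ck_on (Suc 2) f U" using assms(1) by (simp only: numeral_2_eq_2 numeral_3_eq_3)
  let ?D = "\<lambda>b m w. fderiv f (m + w) b + fderiv f (m - w) b
      - 2 *\<^sub>R fderiv f m b"
  have "\<exists>C\<ge>0. \<forall>m w. closed_segment (m - w) (m + w) \<subseteq> K \<longrightarrow> norm (?D b m w) \<le> C * norm w ^ 2" for b
    using f3[unfolded Ck_on.simps] by (intro C2_symmetric_bound[OF _ assms(2,3)]) blast
  from uniform_bound_sum[where f="?D" and I=Basis, OF this]
  obtain C where C: "C \<ge> 0" "\<And>m w. closed_segment (m - w) (m + w) \<subseteq> K \<Longrightarrow>
     (\<Sum>b\<in>Basis. norm (?D b m w)) \<le> C * norm w ^ 2" by blast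
  show ?thesis
  proof (intro exI[of _ C] conjI allI impI C(1))
    fix m w :: 'a
    assume s: "closed_segment (m - w) (m + w) \<subseteq> K"
    let ?S = "closed_segment 0 w"
    let ?g = "\<lambda>v. f (m + v) - f (m - v)"
    let ?g' = "\<lambda>x v. fderiv f (m + x) v + fderiv f (m - x) v"
    have "norm (?g w - ?g 0 - ?g' 0 (w - 0)) \<le> norm (w - 0) * (C * norm w ^ 2)"
    proof (rule differentiable_bound_linearization[where S="?S" and f'="?g'"])
      show "0 + t *\<^sub>R (w - 0) \<in> ?S" if "t \<in> {0..1}" for t
        using that by (auto simp: closed_segment_def)
      fix x assume x: "x \<in> ?S"
      from x obtain t where t: "0 \<le> t" "t \<le> 1" "x = t *\<^sub>R w" by (auto simp: closed_segment_def)
      have sx: "closed_segment (m - x) (m + x) \<subseteq> K"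
        using closed_segment_symmetric_subset[OF s, of "-t" t] t by simp
      have "m + 0 *\<^sub>R x \<in> K"
        using closed_segment_symmetric_subset[OF sx, of 0 0] by simp
      then have xU: "m + x \<in> U" "m - x \<in> U" "m \<in> U" using sx assms(3) by auto
      have "((\<lambda>v. f (m + v)) has_derivative (\<lambda>v. fderiv f (m + x) v)) (at x)"
        by (rule has_derivative_compose[where f="\<lambda>v. m + v"])
          (auto intro!: derivative_eq_intros Ck_on_has_derivative[OF f3] xU)
      moreover have "((\<lambda>v. f (m - v)) has_derivative (\<lambda>v. fderiv f (m - x) (-v))) (at x)"
        by (rule has_derivative_compose[where f="\<lambda>v. m - v"])
          (auto intro!: derivative_eq_intros Ck_on_has_derivative[OF f3] xU)
      moreover have "fderiv f (m - x) (-v) = - fderiv f (m - x) v" for v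
        using Ck_on_bounded_linear[OF f3 xU(2)] bounded_linear.linear linear_neg by blast
      ultimately have "(?g has_derivative ?g' x) (at x)"
        by (auto intro!: derivative_eq_intros)
      then show "(?g has_derivative ?g' x) (at x within ?S)" using has_derivative_at_withinI by blast
      note c = C(2)[OF sx]
      have "bounded_linear (\<lambda>v. ?g' x v - ?g' 0 v)"
        using Ck_on_bounded_linear[OF f3] xU by (intro bounded_linear_sub bounded_linear_add) auto
      from onorm_le_sum_Basis[OF this]
      have "onorm (\<lambda>v. ?g' x v - ?g' 0 v) \<le> C * norm x ^ 2"
        using c by (simp add: scaleR_2 algebra_simps)
      also have "norm x \<le> norm w" using t by (auto intro!: mult_left_le_one_le)
      then have "C * norm x ^ 2 \<le> C * norm w ^ 2" using C(1) by (intro mult_left_mono power_mono) auto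
      finally show "onorm (?g' x - ?g' 0) \<le> C * norm w ^ 2"
        by (simp add: fun_diff_def)
    qed simp
    then show "norm (f (m + w) - f (m - w) - 2 *\<^sub>R fderiv f m w) \<le> C * norm w ^ 3"
      by (simp add: power3_eq_cube power2_eq_square algebra_simps scaleR_2)
  qed
qed

section \<open>Linear changes of variables and radial moments\<close>

lemma Basis_vec_real: "(Basis :: (real ^ 'n) set) = range (\<lambda>i. axis i 1)"
  by (auto simp: Basis_vec_def)

lemma prod_Basis_vec_real: "(\<Prod>b\<in>(Basis :: (real ^ 'n) set). g b) = (\<Prod>i\<in>UNIV. g (axis i 1))"
  unfolding Basis_vec_real by (subst prod.reindex) (auto simp: inj_on_def axis_eq_axis)

lemma linear_borel_measurable:
  fixes f :: "'a::euclidean_space \<Rightarrow> 'b::real_normed_vector"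
  shows "linear f \<Longrightarrow> f \<in> borel_measurable borel"
  by (intro borel_measurable_continuous_onI linear_continuous_on) (simp add: linear_conv_bounded_linear)

lemma nn_integral_lborel_translate:
  assumes "F \<in> borel_measurable borel"
  shows "(\<integral>\<^sup>+x. F (x + c) \<partial>lborel) = (\<integral>\<^sup>+x. F x \<partial>(lborel :: 'a::euclidean_space measure))"
proof -
  have "(\<integral>\<^sup>+x. F x \<partial>lborel) = (\<integral>\<^sup>+x. F x \<partial>distr lborel borel ((+) c))" by (simp add: lborel_distr_plus)
  also have "\<dots> = (\<integral>\<^sup>+x. F (c + x) \<partial>lborel)" using assms by (intro nn_integral_distr) auto
  finally show ?thesis by (simp add: add.commute)
qed

text \<open>The shear moves the coordinate along \<open>m\<close> by an amount that depends on
  another coordinate. With that coordinate integrated innermost it is a translation of the real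
  line.\<close>

lemma nn_integral_shear:
  fixes F :: "'a::euclidean_space \<Rightarrow> ennreal"
  assumes [measurable]: "F \<in> borel_measurable borel" and m: "m \<in> Basis" and n: "n \<in> Basis" and mn: "m \<noteq> n"
  shows "(\<integral>\<^sup>+x. F (x + (x \<bullet> n) *\<^sub>R m) \<partial>lborel) = (\<integral>\<^sup>+x. F x \<partial>lborel)"
proof -
  interpret product_sigma_finite "\<lambda>_::'a. lborel :: real measure" by standard
  let ?B = "Basis - {m}"
  have B: "(Basis :: 'a set) = insert m ?B" using m by auto
  have *: "(\<integral>\<^sup>+x. G x \<partial>lborel) = (\<integral>\<^sup>+x. (\<integral>\<^sup>+y. G ((\<Sum>b\<in>?B. x b *\<^sub>R b) + y *\<^sub>R m) \<partial>lborel) \<partial>(Pi\<^sub>M ?B (\<lambda>_. lborel)))"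
    if [measurable]: "G \<in> borel_measurable borel" for G :: "'a \<Rightarrow> ennreal"
  proof -
    have "(\<integral>\<^sup>+x. G x \<partial>lborel) = (\<integral>\<^sup>+x. G (\<Sum>b\<in>Basis. x b *\<^sub>R b) \<partial>(Pi\<^sub>M Basis (\<lambda>_. lborel)))"
      by (subst lborel_eq, subst nn_integral_distr) auto
    also have "\<dots> = (\<integral>\<^sup>+x. G (\<Sum>b\<in>insert m ?B. x b *\<^sub>R b) \<partial>(Pi\<^sub>M (insert m ?B) (\<lambda>_. lborel)))"
      using B by simp
    also have "\<dots> = (\<integral>\<^sup>+x. (\<integral>\<^sup>+y. G (\<Sum>b\<in>insert m ?B. (x(m := y)) b *\<^sub>R b) \<partial>lborel) \<partial>(Pi\<^sub>M ?B (\<lambda>_. lborel)))"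
      by (subst product_nn_integral_insert) auto
    also have "\<dots> = (\<integral>\<^sup>+x. (\<integral>\<^sup>+y. G ((\<Sum>b\<in>?B. x b *\<^sub>R b) + y *\<^sub>R m) \<partial>lborel) \<partial>(Pi\<^sub>M ?B (\<lambda>_. lborel)))"
    proof -
      have "(\<Sum>b\<in>insert m ?B. (x(m := y)) b *\<^sub>R b) = (\<Sum>b\<in>?B. x b *\<^sub>R b) + y *\<^sub>R m" for x y
        by (subst sum.insert) (auto simp: add.commute intro!: sum.cong)
      then show ?thesis by simp
    qed
    finally show ?thesis .
  qed
  have nB: "n \<in> ?B" using n mn by auto
  have inn: "((\<Sum>b\<in>?B. x b *\<^sub>R b) + y *\<^sub>R m) \<bullet> n = x n" for x :: "'a \<Rightarrow> real" and y
  proof -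
    have "(\<Sum>b\<in>?B. x b *\<^sub>R b) \<bullet> n = (\<Sum>b\<in>?B. x b * (if b = n then 1 else 0))"
      unfolding inner_sum_left inner_scaleR_left using n by (intro sum.cong) (auto simp: inner_Basis)
    also have "\<dots> = x n" using nB by (simp add: if_distrib cong: if_cong)
    finally show ?thesis using m n mn by (simp add: inner_left_distrib inner_Basis)
  qed
  have "(\<integral>\<^sup>+x. F (x + (x \<bullet> n) *\<^sub>R m) \<partial>lborel) =
     (\<integral>\<^sup>+x. (\<integral>\<^sup>+y. F ((\<Sum>b\<in>?B. x b *\<^sub>R b) + (y + x n) *\<^sub>R m) \<partial>lborel) \<partial>(Pi\<^sub>M ?B (\<lambda>_. lborel)))"
    by (subst *) (simp_all add: inn scaleR_add_left add.assoc)
  also have "\<dots> = (\<integral>\<^sup>+x. (\<integral>\<^sup>+y. F ((\<Sum>b\<in>?B. x b *\<^sub>R b) + y *\<^sub>R m) \<partial>lborel) \<partial>(Pi\<^sub>M ?B (\<lambda>_. lborel)))"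
  proof (rule nn_integral_cong)
    fix x
    show "(\<integral>\<^sup>+y. F ((\<Sum>b\<in>?B. x b *\<^sub>R b) + (y + x n) *\<^sub>R m) \<partial>lborel)
        = (\<integral>\<^sup>+y. F ((\<Sum>b\<in>?B. x b *\<^sub>R b) + y *\<^sub>R m) \<partial>lborel)"
      by (rule nn_integral_lborel_translate[where F="\<lambda>y. F ((\<Sum>b\<in>?B. x b *\<^sub>R b) + y *\<^sub>R m)"]) measurable
  qed
  also have "\<dots> = (\<integral>\<^sup>+x. F x \<partial>lborel)" by (subst *) auto
  finally show ?thesis .
qed

lemma nn_integral_stretch:
  fixes F :: "real ^ 'n \<Rightarrow> ennreal"
  assumes [measurable]: "F \<in> borel_measurable borel" and c: "\<And>i. c i \<noteq> 0"
  shows "(\<integral>\<^sup>+x. F (\<chi> i. c i * x $ i) \<partial>lborel) * ennreal \<bar>\<Prod>i\<in>UNIV. c i\<bar> = (\<integral>\<^sup>+x. F x \<partial>lborel)"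
proof -
  let ?c = "\<lambda>b. (\<chi> i. c i) \<bullet> b"
  let ?T = "\<lambda>x::real^'n. (0 + (\<Sum>j\<in>Basis. (?c j * (x \<bullet> j)) *\<^sub>R j))"
  have cb: "?c b \<noteq> 0" if "b \<in> Basis" for b
    using that c by (auto simp: Basis_vec_real inner_axis)
  have T: "?T x = (\<chi> i. c i * x $ i)" for x
  proof -
    have "?T x = (\<Sum>j\<in>Basis. ((\<chi> i. c i * x $ i) \<bullet> j) *\<^sub>R j)"
      unfolding add_0 by (intro sum.cong) (auto simp: Basis_vec_real inner_axis)
    then show ?thesis by (simp only: euclidean_representation)
  qed
  have [measurable]: "(\<lambda>x::real^'n. \<chi> i. c i * x $ i) \<in> borel_measurable borel"
    by (intro linear_borel_measurable linearI) (auto simp: vec_eq_iff algebra_simps)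
  have "(\<integral>\<^sup>+x. F x \<partial>lborel) = (\<integral>\<^sup>+x. F x \<partial>density (distr lborel borel ?T) (\<lambda>_. (\<Prod>j\<in>Basis. \<bar>?c j\<bar>)))"
    using lborel_affine_euclidean[of ?c 0, OF cb] by simp
  also have "\<dots> = (\<integral>\<^sup>+x. ennreal (\<Prod>j\<in>Basis. \<bar>?c j\<bar>) * F (\<chi> i. c i * x $ i) \<partial>lborel)"
    unfolding T by (subst nn_integral_density) (auto simp: nn_integral_distr)
  also have "(\<Prod>j\<in>Basis. \<bar>?c j\<bar>) = \<bar>\<Prod>i\<in>UNIV. c i\<bar>"
    by (simp add: prod_Basis_vec_real inner_axis abs_prod)
  finally show ?thesis by (simp add: nn_integral_cmult mult.commute)
qed

lemma lborel_distr_swap: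
  "distr lborel borel (\<lambda>x::real^'n. \<chi> i. x $ Transposition.transpose m n i) = lborel"
proof (rule lborel_eqI[symmetric])
  let ?t = "Transposition.transpose m n"
  let ?T = "\<lambda>x::real^'n. \<chi> i. x $ ?t i"
  have [measurable]: "?T \<in> borel_measurable borel"
    by (intro linear_borel_measurable linearI) (auto simp: vec_eq_iff)
  show "sets (distr lborel borel ?T) = sets borel" by simp
  fix l u :: "real^'n" assume le: "\<And>b. b \<in> Basis \<Longrightarrow> l \<bullet> b \<le> u \<bullet> b"
  have le': "l $ i \<le> u $ i" for i using le[of "axis i 1"] by (simp add: inner_axis)
  have eq: "?T -` box l u = box (?T l) (?T u)"
    by (auto simp: mem_box_cart) (metis transpose_involutory)+
  have "emeasure (distr lborel borel ?T) (box l u) = emeasure lborel (box (?T l) (?T u))"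
    by (simp add: emeasure_distr eq)
  also have "\<dots> = (\<Prod>b\<in>Basis. (?T u - ?T l) \<bullet> b)"
    using le' by (intro emeasure_lborel_box) (auto simp: Basis_vec_real inner_axis)
  also have "(\<Prod>b\<in>Basis. (?T u - ?T l) \<bullet> b) = (\<Prod>i\<in>UNIV. (u - l) $ ?t i)"
    by (simp add: prod_Basis_vec_real inner_axis)
  also have "\<dots> = (\<Prod>i\<in>UNIV. (u - l) $ i)"
    by (rule prod.permute[OF permutes_swap_id, where S=UNIV and g="\<lambda>i. (u - l)$i", unfolded o_def, symmetric]) auto
  also have "\<dots> = (\<Prod>b\<in>Basis. (u - l) \<bullet> b)" by (simp add: prod_Basis_vec_real inner_axis)
  finally show "emeasure (distr lborel borel ?T) (box l u) = (\<Prod>b\<in>Basis. (u - l) \<bullet> b)" .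
qed

lemma det_matrix_swap:
  assumes "m \<noteq> n"
  shows "\<bar>det (matrix (\<lambda>x::real^'n. \<chi> i. x $ Transposition.transpose m n i))\<bar> = 1"
proof -
  have "(\<chi> i j. if Transposition.transpose m n i = j then 1 else 0) = (\<chi> i j. if j = Transposition.transpose m n i then 1 else (0::real))"
    by (auto intro!: Cart_lambda_cong)
  then have "matrix (\<lambda>x::real^'n. \<chi> i. x $ Transposition.transpose m n i) = transpose(\<chi> i j. mat 1 $ i $ Transposition.transpose m n j)"
    by (auto simp: matrix_eq transpose_def axis_def mat_def matrix_def)
  then show ?thesis using assms
    by (simp add: det_permute_columns permutes_swap_id sign_swap_id abs_mult)
qed

text \<open>Induction over compositions of elementary maps. The formula is carried as an implication
  from a nonzero determinant: the singular generator, with a vanishing coordinate, is then vacuous,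
  and both factors of an invertible composition inherit invertibility.\<close>

lemma nn_integral_linear_image:
  fixes f :: "real ^ 'n \<Rightarrow> real ^ 'n"
  assumes "linear f" "det (matrix f) \<noteq> 0" "F \<in> borel_measurable borel"
  shows "(\<integral>\<^sup>+x. F (f x) \<partial>lborel) * ennreal \<bar>det (matrix f)\<bar> = (\<integral>\<^sup>+x. F x \<partial>lborel)"
proof -
  let ?P = "\<lambda>f :: real ^ 'n \<Rightarrow> real ^ 'n. det (matrix f) \<noteq> 0 \<longrightarrow> (\<forall>F\<in>borel_measurable borel.
     (\<integral>\<^sup>+x. F (f x) \<partial>lborel) * ennreal \<bar>det (matrix f)\<bar> = (\<integral>\<^sup>+x. F x \<partial>lborel))"
  have "?P f"
  proof (rule induct_linear_elementary[OF assms(1), of ?P])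
    fix f g :: "real^'n \<Rightarrow> real^'n"
    assume l: "linear f" "linear g" and f: "?P f" and g: "?P g"
    show "?P (f \<circ> g)"
    proof (intro impI ballI)
      fix F :: "real^'n \<Rightarrow> ennreal" assume d: "det (matrix (f \<circ> g)) \<noteq> 0" and F: "F \<in> borel_measurable borel"
      have m: "matrix (f \<circ> g) = matrix f ** matrix g" using l by (intro matrix_compose)
      have d2: "det (matrix f) \<noteq> 0" "det (matrix g) \<noteq> 0" using d by (auto simp: m det_mul)
      have Ff: "(\<lambda>x. F (f x)) \<in> borel_measurable borel" 
        using measurable_compose[OF linear_borel_measurable[OF l(1)] F] .
      have "(\<integral>\<^sup>+x. F ((f \<circ> g) x) \<partial>lborel) * ennreal \<bar>det (matrix (f \<circ> g))\<bar>
        = (\<integral>\<^sup>+x. F (f (g x)) \<partial>lborel) * ennreal \<bar>det (matrix g)\<bar> * ennreal \<bar>det (matrix f)\<bar>"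
        by (simp add: m det_mul abs_mult ennreal_mult mult_ac)
      also have "\<dots> = (\<integral>\<^sup>+x. F (f x) \<partial>lborel) * ennreal \<bar>det (matrix f)\<bar>"
        using g[rule_format, OF d2(2) Ff] by simp
      also have "\<dots> = (\<integral>\<^sup>+x. F x \<partial>lborel)" using f d2 F by simp
      finally show "(\<integral>\<^sup>+x. F ((f \<circ> g) x) \<partial>lborel) * ennreal \<bar>det (matrix (f \<circ> g))\<bar> = (\<integral>\<^sup>+x. F x \<partial>lborel)" .
    qed
  next
    fix f :: "real^'n \<Rightarrow> real^'n" and i
    assume "linear f" and 0: "\<And>x. f x $ i = 0"
    then have "\<not> inj f"
      by (metis (full_types) linear_injective_imp_surjective one_neq_zero surjE vec_component)
    then have "det (matrix f) = 0" using \<open>linear f\<close> det_nz_iff_inj by blast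
    then show "?P f" by simp
  next
    fix c :: "'n \<Rightarrow> real"
    have d: "det (matrix (\<lambda>x::real^'n. \<chi> i. c i * x $ i)) = (\<Prod>i\<in>UNIV. c i)"
      by (subst det_diagonal) (auto simp: matrix_def axis_def)
    show "?P (\<lambda>x. \<chi> i. c i * x $ i)"
      unfolding d using nn_integral_stretch by auto
  next
    fix m n :: 'n assume "m \<noteq> n"
    have [measurable]: "(\<lambda>x::real^'n. \<chi> i. x $ Transposition.transpose m n i) \<in> borel_measurable borel"
      by (intro linear_borel_measurable linearI) (auto simp: vec_eq_iff)
    show "?P (\<lambda>x. \<chi> i. x $ Transposition.transpose m n i)"
      unfolding det_matrix_swap[OF \<open>m \<noteq> n\<close>]
    proof (intro impI ballI)
      fix F :: "real^'n \<Rightarrow> ennreal" assume F: "F \<in> borel_measurable borel"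
      have "(\<integral>\<^sup>+x. F x \<partial>lborel) = (\<integral>\<^sup>+x. F x \<partial>distr lborel borel (\<lambda>x. \<chi> i. x $ Transposition.transpose m n i))"
        unfolding lborel_distr_swap ..
      also have "\<dots> = (\<integral>\<^sup>+x. F (\<chi> i. x $ Transposition.transpose m n i) \<partial>lborel)"
        by (rule nn_integral_distr) (use F in auto)
      finally show "(\<integral>\<^sup>+x. F (\<chi> i. x $ Transposition.transpose m n i) \<partial>lborel) * ennreal 1 = (\<integral>\<^sup>+x. F x \<partial>lborel)"
        by simp
    qed
  next
    fix m n :: 'n assume mn: "m \<noteq> n"
    have s: "(\<chi> i. if i = m then x $ m + x $ n else x $ i) = x + (x \<bullet> axis n 1) *\<^sub>R axis m 1" for x :: "real^'n"
      unfolding inner_axis by (simp add: vec_eq_iff axis_def)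
    have "matrix (\<lambda>x::real^'n. \<chi> i. if i = m then x $ m + x $ n else x $ i)
       = (\<chi> k. if k = m then row m (mat 1) + 1 *s row n (mat 1) else row k (mat 1))"
      by (auto simp: vec_eq_iff matrix_def row_def mat_def axis_def)
    then have d: "det (matrix (\<lambda>x::real^'n. \<chi> i. if i = m then x $ m + x $ n else x $ i)) = 1"
      using det_row_operation[OF mn, of "mat 1" 1] by simp
    show "?P (\<lambda>x. \<chi> i. if i = m then x $ m + x $ n else x $ i)"
      unfolding d unfolding s
      using nn_integral_shear[of _ "axis m 1 :: real^'n" "axis n 1"] mn
      by (auto simp: axis_in_Basis_iff axis_eq_axis)
  qed
  then show ?thesis using assms by blast
qed

lemma lborel_linear_image:
  fixes f :: "real ^ 'n \<Rightarrow> real ^ 'n"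
  assumes "linear f" "det (matrix f) \<noteq> 0"
  shows "lborel = density (distr lborel borel f) (\<lambda>_. ennreal \<bar>det (matrix f)\<bar>)"
proof (rule measure_eqI)
  note [measurable] = linear_borel_measurable[OF assms(1)]
  fix A :: "(real ^ 'n) set" assume "A \<in> sets lborel"
  then have [measurable]: "A \<in> sets borel" by simp
  have "emeasure lborel A = (\<integral>\<^sup>+x. indicator A x \<partial>lborel)" by simp
  also have "\<dots> = (\<integral>\<^sup>+x. indicator A (f x) \<partial>lborel) * ennreal \<bar>det (matrix f)\<bar>"
    by (intro nn_integral_linear_image[OF assms, symmetric]) auto
  also have "\<dots> = emeasure (density (distr lborel borel f) (\<lambda>_. ennreal \<bar>det (matrix f)\<bar>)) A"
  proof -
    have "(\<integral>\<^sup>+x. indicator A (f x) \<partial>lborel) = (\<integral>\<^sup>+x. indicator A x \<partial>distr lborel borel f)"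
      by (rule nn_integral_distr[symmetric]) measurable
    then show ?thesis by (simp add: emeasure_density_const mult.commute)
  qed
  finally show "emeasure lborel A = \<dots>" .
qed simp

lemma integral_linear_image:
  fixes f :: "real ^ 'n \<Rightarrow> real ^ 'n" and F :: "real ^ 'n \<Rightarrow> real"
  assumes "linear f" "det (matrix f) \<noteq> 0" and [measurable]: "F \<in> borel_measurable borel"
  shows "(LINT x|lborel. F x) = \<bar>det (matrix f)\<bar> * (LINT x|lborel. F (f x))"
proof -
  note [measurable] = linear_borel_measurable[OF assms(1)]
  have "(LINT x|lborel. F x) = (\<integral>x. F x \<partial>density (distr lborel borel f) (\<lambda>_. ennreal \<bar>det (matrix f)\<bar>))"
    using lborel_linear_image[OF assms(1,2)] by simp
  also have "\<dots> = \<bar>det (matrix f)\<bar> * (LINT x|lborel. F (f x))"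
    by (subst integral_density) (auto simp: integral_distr)
  finally show ?thesis .
qed

text \<open>Symmetry determines the second-moment matrix of a radial weight up to its trace:
  reflecting one coordinate kills the off-diagonal entries, and swapping two coordinates equates the
  diagonal ones.\<close>

lemma radial_second_moment:
  fixes k :: "real \<Rightarrow> real" and a b :: "real ^ 'n"
  assumes [measurable]: "k \<in> borel_measurable borel"
    and int: "integrable lborel (\<lambda>z::real^'n. (norm z)\<^sup>2 * k ((norm z)\<^sup>2))"
  shows "(LINT z|lborel. k ((norm z)\<^sup>2) * ((a \<bullet> z) * (b \<bullet> z))) =
      (a \<bullet> b) * (1 / real CARD('n) * (LINT z|(lborel :: (real^'n) measure). (norm z)\<^sup>2 * k ((norm z)\<^sup>2)))"
proof -
  let ?k = "\<lambda>z::real^'n. k ((norm z)\<^sup>2)"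
  define T where "T i j = (LINT z|lborel. ?k z * (z $ i * z $ j))" for i j
  have [measurable]: "(\<lambda>z::real^'n. z $ i) \<in> borel_measurable borel" for i
    by (intro borel_measurable_continuous_onI continuous_intros)
  have intT: "integrable lborel (\<lambda>z. ?k z * (z $ i * z $ j))" for i j
  proof (rule Bochner_Integration.integrable_bound[OF int])
    have "\<bar>k ((norm z)\<^sup>2) * (z $ i * z $ j)\<bar> \<le> \<bar>(norm z)\<^sup>2 * k ((norm z)\<^sup>2)\<bar>" for z :: "real^'n"
    proof -
      have "\<bar>z $ i\<bar> * \<bar>z $ j\<bar> \<le> norm z * norm z" by (intro mult_mono component_le_norm_cart) auto
      from mult_left_mono[OF this, of "\<bar>k ((norm z)\<^sup>2)\<bar>"] show ?thesis
        by (simp add: abs_mult power2_eq_square mult_ac)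
    qed
    then show "AE z in lborel. norm (?k z * (z $ i * z $ j)) \<le> norm ((norm z)\<^sup>2 * k ((norm z)\<^sup>2))" by simp
  qed measurable
  have norm2: "(norm z)\<^sup>2 = (\<Sum>i\<in>UNIV. (z $ i)\<^sup>2)" for z :: "real^'n"
    by (simp add: norm_vec_def L2_set_def sum_nonneg)
  have off: "T i j = 0" if ij: "i \<noteq> j" for i j
  proof -
    let ?f = "\<lambda>x::real^'n. \<chi> l. (if l = i then -1 else 1) * x $ l"
    have d: "det (matrix ?f) = (\<Prod>l\<in>UNIV. if l = i then -1 else 1)"
      by (subst det_diagonal) (auto simp: matrix_def axis_def)
    then have d: "det (matrix ?f) = -1" by simp
    have "linear ?f" by (intro linearI) (auto simp: vec_eq_iff algebra_simps)
    then have "T i j = \<bar>-1\<bar> * (LINT z|lborel. ?k (?f z) * (?f z $ i * ?f z $ j))"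
      unfolding T_def by (subst integral_linear_image[of ?f]) (auto simp: d)
    also have "\<dots> = (LINT z|lborel. - (?k z * (z $ i * z $ j)))"
    proof -
      have "?k (?f z) = ?k z" for z
        unfolding norm2 by (intro arg_cong[of _ _ k] sum.cong) auto
      then show ?thesis using ij by simp
    qed
    finally show ?thesis by (simp add: T_def)
  qed
  have diag: "T i i = T j j" for i j
  proof (cases "i = j")
    case False
    let ?f = "\<lambda>x::real^'n. \<chi> l. x $ Transposition.transpose i j l"
    have "linear ?f" by (intro linearI) (auto simp: vec_eq_iff)
    moreover have d: "\<bar>det (matrix ?f)\<bar> = 1" using det_matrix_swap[OF False] .
    ultimately have "T i i = \<bar>det (matrix ?f)\<bar> * (LINT z|lborel. ?k (?f z) * (?f z $ i * ?f z $ i))"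
      unfolding T_def by (intro integral_linear_image[of ?f]) auto
    moreover have "?k (?f z) = ?k z" for z :: "real^'n"
    proof -
      have "(\<Sum>l\<in>UNIV. (z $ Transposition.transpose i j l)\<^sup>2) = (\<Sum>l\<in>UNIV. (z $ l)\<^sup>2)"
        by (rule sum.permute[OF permutes_swap_id, where S=UNIV and g="\<lambda>i. (z $ i)\<^sup>2", unfolded o_def, symmetric]) auto
      then show ?thesis unfolding norm2 by simp
    qed
    ultimately show ?thesis using d by (simp add: T_def)
  qed simp
  have tr: "real CARD('n) * T i i = (LINT z|(lborel :: (real^'n) measure). (norm z)\<^sup>2 * k ((norm z)\<^sup>2))" for i
  proof -
    have "(\<Sum>j\<in>UNIV. T j j) = (\<Sum>j\<in>(UNIV::'n set). T i i)" by (intro sum.cong refl diag)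
    then have "real CARD('n) * T i i = (\<Sum>j\<in>UNIV. T j j)" by simp
    also have "\<dots> = (LINT z|lborel. (\<Sum>j\<in>UNIV. ?k z * (z $ j * z $ j)))"
      unfolding T_def using intT by (intro Bochner_Integration.integral_sum[symmetric]) auto
    also have "\<dots> = (LINT z|(lborel :: (real ^ 'n) measure). (norm z)\<^sup>2 * k ((norm z)\<^sup>2))"
    proof (rule LINT_cong)
      fix z :: "real^'n"
      have "(\<Sum>j\<in>UNIV. ?k z * (z $ j * z $ j)) = ?k z * (\<Sum>j\<in>UNIV. (z $ j)\<^sup>2)"
        by (simp add: sum_distrib_left power2_eq_square)
      then show "(\<Sum>j\<in>UNIV. ?k z * (z $ j * z $ j)) = (norm z)\<^sup>2 * k ((norm z)\<^sup>2)"
        by (simp only: norm2[symmetric] mult.commute)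
    qed
    finally show ?thesis .
  qed
  have "(LINT z|lborel. ?k z * ((a \<bullet> z) * (b \<bullet> z))) =
    (LINT z|lborel. (\<Sum>i\<in>UNIV. \<Sum>j\<in>UNIV. (a $ i * b $ j) * (?k z * (z $ i * z $ j))))"
  proof (rule LINT_cong)
    fix z :: "real ^ 'n"
    show "?k z * ((a \<bullet> z) * (b \<bullet> z)) = (\<Sum>i\<in>UNIV. \<Sum>j\<in>UNIV. (a $ i * b $ j) * (?k z * (z $ i * z $ j)))"
      by (simp only: inner_vec_def inner_real_def sum_product) (simp only: sum_distrib_left mult_ac)
  qed
  also have "\<dots> = (\<Sum>i\<in>UNIV. \<Sum>j\<in>UNIV. (a $ i * b $ j) * T i j)"
    unfolding T_def using intT by (simp add: Bochner_Integration.integral_sum integrable_sum)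
  also have "\<dots> = (\<Sum>i\<in>UNIV. (a $ i * b $ i) * T i i)"
  proof (rule sum.cong[OF refl])
    fix i
    have "(\<Sum>j\<in>UNIV. (a $ i * b $ j) * T i j) = (\<Sum>j\<in>UNIV. if j = i then (a $ i * b $ i) * T i i else 0)"
      by (intro sum.cong) (auto simp: off)
    then show "(\<Sum>j\<in>UNIV. (a $ i * b $ j) * T i j) = (a $ i * b $ i) * T i i" by simp
  qed
  also have "\<dots> = (\<Sum>i\<in>UNIV. a $ i * b $ i) * (1 / real CARD('n) * (LINT z|(lborel :: (real^'n) measure). (norm z)\<^sup>2 * k ((norm z)\<^sup>2)))"
    unfolding sum_distrib_right
  proof (rule sum.cong[OF refl])
    fix i
    show "a $ i * b $ i * T i i = a $ i * b $ i * (1 / real CARD('n) * (LINT z|(lborel :: (real ^ 'n) measure). (norm z)\<^sup>2 * k ((norm z)\<^sup>2)))"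
      using tr[of i] by (simp add: field_simps)
  qed
  finally show ?thesis by (simp add: inner_vec_def)
qed

section \<open>Gram matrices and integrals over tangent spaces\<close>

lemma linear_isometry_range:
  fixes A :: "real ^ 'd \<Rightarrow> real ^ 'D"
  assumes "linear A" "inj A"
  obtains J :: "real ^ 'D \<Rightarrow> real ^ 'd" where "linear J"
    "\<And>x y. x \<in> range A \<Longrightarrow> y \<in> range A \<Longrightarrow> J x \<bullet> J y = x \<bullet> y" "det (matrix (J \<circ> A)) \<noteq> 0"
proof -
  have sub: "subspace (range A)" using assms(1) by (simp add: linear_subspace_image subspace_UNIV)
  have "dim (range A) = dim (UNIV :: (real^'d) set)"
    using assms by (intro dim_image_eq) auto
  then obtain J :: "real ^ 'D \<Rightarrow> real ^ 'd" where J: "linear J" "\<And>x. x \<in> range A \<Longrightarrow> norm (J x) = norm x"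
    using isometries_subspaces[OF sub subspace_UNIV] by metis
  show ?thesis
  proof (rule that[OF J(1)])
    show "J x \<bullet> J y = x \<bullet> y" if "x \<in> range A" "y \<in> range A" for x y
    proof -
      have "x + y \<in> range A" using that sub subspace_add by blast
      then have "norm (J x + J y) = norm (x + y)" using J by (metis linear_add)
      then show ?thesis using J(2)[OF that(1)] J(2)[OF that(2)] by (simp add: dot_norm)
    qed
    have "linear (J \<circ> A)" using assms(1) J(1) linear_compose by blast
    moreover have "inj (J \<circ> A)"
    proof (subst linear_injective_0[OF calculation], safe)
      fix x assume "(J \<circ> A) x = 0"
      then have "A x = 0" using J(2)[of "A x"] by auto
      then show "x = 0" using assms linear_injective_0 by blast
    qed
    ultimately show "det (matrix (J \<circ> A)) \<noteq> 0" using det_nz_iff_inj by blast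
  qed
qed

text \<open>For the differential of a chart this is the metric tensor. Stated for an arbitrary
  linear map, it turns integrals over tangent spaces into linear algebra.\<close>

definition gram_matrix :: "(real ^ 'd \<Rightarrow> real ^ 'D) \<Rightarrow> real ^ 'd ^ 'd" where
  "gram_matrix A = (\<chi> i j. A (axis i 1) \<bullet> A (axis j 1))"

lemma gram_matrix_isometry:
  fixes A :: "real ^ 'd \<Rightarrow> real ^ 'D"
  assumes "linear A" "linear J" "\<And>x y. x \<in> range A \<Longrightarrow> y \<in> range A \<Longrightarrow> J x \<bullet> J y = x \<bullet> y"
  shows "gram_matrix A = transpose (matrix (J \<circ> A)) ** matrix (J \<circ> A)"
proof -
  have "gram_matrix A $ i $ j = (transpose (matrix (J \<circ> A)) ** matrix (J \<circ> A)) $ i $ j" for i j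
  proof -
    have "gram_matrix A $ i $ j = J (A (axis i 1)) \<bullet> J (A (axis j 1))"
      using assms(3) by (simp add: gram_matrix_def)
    also have "\<dots> = (transpose (matrix (J \<circ> A)) ** matrix (J \<circ> A)) $ i $ j"
      by (simp add: matrix_matrix_mult_def transpose_def matrix_def inner_vec_def)
    finally show ?thesis .
  qed
  then show ?thesis by (simp add: vec_eq_iff)
qed

text \<open>The map \<open>J\<close>, isometric on the range of \<open>A\<close>, replaces the
  rectangular \<open>A\<close> by the square matrix of J o A, and the Gram matrix is the transpose
  of that matrix times itself. So the volume density of a chart is a Jacobian in the ordinary
  sense.\<close>

lemma det_gram_matrix:
  fixes A :: "real ^ 'd \<Rightarrow> real ^ 'D"
  assumes "linear A" "linear J" "\<And>x y. x \<in> range A \<Longrightarrow> y \<in> range A \<Longrightarrow> J x \<bullet> J y = x \<bullet> y"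
  shows "sqrt (det (gram_matrix A)) = \<bar>det (matrix (J \<circ> A))\<bar>"
  using gram_matrix_isometry[OF assms] by (simp add: det_mul power2_eq_square[symmetric])

lemma det_gram_matrix_pos:
  fixes A :: "real ^ 'd \<Rightarrow> real ^ 'D"
  assumes "linear A" "inj A"
  shows "det (gram_matrix A) > 0"
proof -
  obtain J where J: "linear J" "\<And>x y. x \<in> range A \<Longrightarrow> y \<in> range A \<Longrightarrow> J x \<bullet> J y = x \<bullet> y"
     "det (matrix (J \<circ> A)) \<noteq> 0" using linear_isometry_range[OF assms] by blast
  then have "sqrt (det (gram_matrix A)) > 0" using det_gram_matrix[OF assms(1) J(1,2)] by simp
  then show ?thesis by simp
qed

lemma gram_matrix_inner:
  fixes A :: "real ^ 'n \<Rightarrow> real ^ 'D"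
  assumes "linear A"
  shows "A h \<bullet> A k = h \<bullet> (gram_matrix A *v k)"
proof -
  have A: "A h = (\<Sum>i\<in>UNIV. h $ i *\<^sub>R A (axis i 1))" for h :: "real^'n"
  proof -
    have "A h = A (\<Sum>i\<in>UNIV. h $ i *\<^sub>R axis i 1)"
      by (rule arg_cong[of _ _ A]) (simp add: vec_eq_iff axis_def if_distrib cong: if_cong)
    then show ?thesis by (simp add: linear_sum[OF assms] linear_scale[OF assms])
  qed
  show ?thesis
    by (subst (1 2) A) (simp add: inner_sum_left inner_sum_right inner_vec_def[of h] gram_matrix_def
      matrix_vector_mult_def sum_distrib_left mult_ac, rule sum.swap)
qed

text \<open>Substituting z = J (A h) / r reduces this to the radial moment. The Jacobian accounts
  for the Gram determinant and for r^d; moving r into the vectors \<open>v\<close> and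
  \<open>w\<close> gives the remaining r^2.\<close>

lemma tangent_second_moment:
  fixes k :: "real \<Rightarrow> real" and A :: "real ^ 'd \<Rightarrow> real ^ 'D"
  assumes "linear A" "inj A" and [measurable]: "k \<in> borel_measurable borel"
    and int: "integrable lborel (\<lambda>z::real^'d. (norm z)\<^sup>2 * k ((norm z)\<^sup>2))"
    and "v \<in> range A" "w \<in> range A" "r > 0"
  shows "sqrt (det (gram_matrix A)) * (LINT h|lborel. k ((norm (A h))\<^sup>2 / r\<^sup>2) * ((v \<bullet> A h) * (w \<bullet> A h)))
    = (1 / real CARD('d) * (LINT z|(lborel :: (real^'d) measure). (norm z)\<^sup>2 * k ((norm z)\<^sup>2))) * r ^ (CARD('d) + 2) * (v \<bullet> w)"
proof -
  obtain J where J: "linear J" "\<And>x y. x \<in> range A \<Longrightarrow> y \<in> range A \<Longrightarrow> J x \<bullet> J y = x \<bullet> y"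
     "det (matrix (J \<circ> A)) \<noteq> 0" using linear_isometry_range[OF assms(1,2)] by blast
  let ?g = "\<lambda>h. (1 / r) *\<^sub>R (J \<circ> A) h"
  have lJA: "linear (J \<circ> A)" using assms(1) J(1) linear_compose by blast
  have lg: "linear ?g" using lJA linear_compose_scale_right by blast
  have m: "matrix ?g = (\<chi> i j. (1 / r) * matrix (J \<circ> A) $ i $ j)"
    by (auto simp: matrix_def vec_eq_iff)
  then have m': "matrix ?g = (\<chi> i. (1 / r) *s (matrix (J \<circ> A) $ i))"
    by (simp add: vec_eq_iff)
  have d: "det (matrix ?g) = (1 / r) ^ CARD('d) * det (matrix (J \<circ> A))"
    unfolding m' det_rows_mul by simp
  then have dnz: "det (matrix ?g) \<noteq> 0" using J(3) assms(7) by simp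
  let ?F = "\<lambda>z. k ((norm z)\<^sup>2) * (((r *\<^sub>R J v) \<bullet> z) * ((r *\<^sub>R J w) \<bullet> z))"
  have F: "?F (?g h) = k ((norm (A h))\<^sup>2 / r\<^sup>2) * ((v \<bullet> A h) * (w \<bullet> A h))" for h
  proof -
    have "(norm (?g h))\<^sup>2 = (norm (A h))\<^sup>2 / r\<^sup>2"
      using J(2)[of "A h" "A h"] by (simp add: power2_norm_eq_inner power_divide power_mult_distrib)
    moreover have "(r *\<^sub>R J x) \<bullet> ?g h = x \<bullet> A h" if "x \<in> range A" for x
      using J(2)[OF that, of "A h"] assms(7) by simp
    ultimately show ?thesis using assms(5,6) by simp
  qed
  have "(LINT z|lborel. ?F z) = \<bar>det (matrix ?g)\<bar> * (LINT h|lborel. ?F (?g h))"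
    by (rule integral_linear_image[OF lg dnz]) measurable
  also have "\<bar>det (matrix ?g)\<bar> = (1 / r) ^ CARD('d) * sqrt (det (gram_matrix A))"
    using assms(7) det_gram_matrix[OF assms(1) J(1,2)] unfolding d by (simp add: abs_mult power_divide)
  finally have "sqrt (det (gram_matrix A)) * (LINT h|lborel. ?F (?g h)) = r ^ CARD('d) * (LINT z|lborel. ?F z)"
    using assms(7) by (simp add: field_simps power_divide)
  also have "(LINT z|lborel. ?F z) = ((r *\<^sub>R J v) \<bullet> (r *\<^sub>R J w)) * (1 / real CARD('d) * (LINT z|(lborel :: (real^'d) measure). (norm z)\<^sup>2 * k ((norm z)\<^sup>2)))"
    by (rule radial_second_moment[OF _ int]) simp
  also have "(r *\<^sub>R J v) \<bullet> (r *\<^sub>R J w) = r\<^sup>2 * (v \<bullet> w)"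
    using J(2)[OF assms(5,6)] by (simp add: power2_eq_square)
  finally show ?thesis by (simp only: F) (simp add: power_add power2_eq_square algebra_simps)
qed

section \<open>Regularity of matrix inverses, roots and powers\<close>

lemma matrix_inv_works:
  fixes A :: "real ^ 'n ^ 'n"
  assumes "det A \<noteq> 0"
  shows "A ** matrix_inv A = mat 1" "matrix_inv A ** A = mat 1"
proof -
  have "\<exists>A'. A ** A' = mat 1 \<and> A' ** A = mat 1"
    using assms invertible_det_nz invertible_def by blast
  from someI_ex[OF this] show "A ** matrix_inv A = mat 1" "matrix_inv A ** A = mat 1"
    unfolding matrix_inv_def by auto
qed

text \<open>Cramer's rule for the columns of the identity. Entries of the inverse become quotients
  of determinants, to which the C^k calculus applies.\<close>

lemma matrix_inv_entry:
  fixes A :: "real ^ 'n ^ 'n"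
  assumes "det A \<noteq> 0"
  shows "matrix_inv A $ i $ j = det (\<chi> a b. if b = i then axis j 1 $ a else A $ a $ b) / det A"
proof -
  have "A *v (matrix_inv A *v axis j 1) = axis j 1"
    using matrix_inv_works[OF assms] by (simp add: matrix_vector_mul_assoc)
  then have e: "matrix_inv A *v axis j 1 = (\<chi> k. det (\<chi> a b. if b = k then axis j 1 $ a else A $ a $ b) / det A)"
    using cramer[OF assms] by blast
  have "matrix_inv A $ i $ j = (matrix_inv A *v axis j 1) $ i"
    by (simp add: matrix_vector_mult_basis column_def)
  then show ?thesis unfolding e by simp
qed

lemma Ck_on_matrix_inv:
  fixes G :: "'a::real_normed_vector \<Rightarrow> real ^ 'n ^ 'n"
  assumes "open S" "\<And>i j. Ck_on k (\<lambda>x. G x $ i $ j) S" "\<And>x. x \<in> S \<Longrightarrow> det (G x) \<noteq> 0"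
  shows "Ck_on k (\<lambda>x. matrix_inv (G x) $ i $ j) S"
proof -
  have "Ck_on k (\<lambda>x. (\<chi> a b. if b = i then axis j 1 $ a else G x $ a $ b) $ p $ q) S" for p q
    using assms(2) by (cases "q = i") auto
  then have "Ck_on k (\<lambda>x. det (\<chi> a b. if b = i then axis j 1 $ a else G x $ a $ b) / det (G x)) S"
    using assms by (intro Ck_on_divide Ck_on_det) auto
  then show ?thesis
    by (rule Ck_on_cong[OF assms(1), rotated]) (simp add: matrix_inv_entry[OF assms(3)])
qed

lemma Ck_on_sqrt:
  fixes f :: "'a::real_normed_vector \<Rightarrow> real"
  assumes "open S" "Ck_on (Suc 0) f S" "\<And>x. x \<in> S \<Longrightarrow> f x > 0"
  shows "Ck_on (Suc 0) (\<lambda>x. sqrt (f x)) S"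
proof (rule Ck_on_SucI[OF assms(1)])
  fix x assume x: "x \<in> S"
  from has_derivative_compose[OF Ck_on_has_derivative[OF assms(2) x]
      DERIV_real_sqrt[OF assms(3)[OF x], unfolded has_field_derivative_def]]
  show "((\<lambda>x. sqrt (f x)) has_derivative (\<lambda>v. inverse (sqrt (f x)) / 2 * fderiv f x v)) (at x)" .
next
  fix v
  have "continuous_on S (\<lambda>x. sqrt (f x))"
    using Ck_on_imp_continuous_on[OF assms(2)] by (intro continuous_intros)
  moreover have "\<forall>x\<in>S. sqrt (f x) \<noteq> 0" using assms(3) by force
  moreover have "continuous_on S (\<lambda>x. fderiv f x v)" using assms(2) by simp
  ultimately show "Ck_on 0 (\<lambda>x. inverse (sqrt (f x)) / 2 * fderiv f x v) S"
    unfolding Ck_on.simps by (intro continuous_on_mult continuous_on_divide continuous_on_inverse continuous_on_const) auto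
qed

lemma Ck_on_powr:
  fixes f :: "'a::real_normed_vector \<Rightarrow> real"
  assumes "open S" "Ck_on (Suc 0) f S" "\<And>x. x \<in> S \<Longrightarrow> f x > 0"
  shows "Ck_on (Suc 0) (\<lambda>x. f x powr a) S"
proof (rule Ck_on_SucI[OF assms(1)])
  fix x assume x: "x \<in> S"
  have "((\<lambda>t. t powr a) has_real_derivative (a * f x powr (a - 1))) (at (f x))"
    using assms(3)[OF x] by (rule has_real_derivative_powr)
  from has_derivative_compose[OF Ck_on_has_derivative[OF assms(2) x] this[unfolded has_field_derivative_def]]
  show "((\<lambda>x. f x powr a) has_derivative (\<lambda>v. a * f x powr (a - 1) * fderiv f x v)) (at x)" .
next
  fix v
  have "continuous_on S (\<lambda>x. f x powr (a - 1))"
    using Ck_on_imp_continuous_on[OF assms(2)] assms(3)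
    by (intro continuous_on_powr continuous_on_const) force+
  moreover have "continuous_on S (\<lambda>x. fderiv f x v)" using assms(2) by simp
  ultimately show "Ck_on 0 (\<lambda>x. a * f x powr (a - 1) * fderiv f x v) S"
    unfolding Ck_on.simps by (intro continuous_on_mult continuous_on_const)
qed

subsection \<open>Charts\<close>

text \<open>A chart only asserts that some continuous inverse exists; it is traded for the canonical
  \<open>inv_into U \<psi>\<close>, which can be named in later statements.\<close>

lemma local_paramD:
  assumes "local_param M U \<psi>"
  shows "open U" "\<And>k. Ck_on k \<psi> U" "\<And>u. u \<in> U \<Longrightarrow> inj (fderiv \<psi> u)"
    "openin (top_of_set M) (\<psi> ` U)" "\<psi> ` U \<subseteq> M" "inj_on \<psi> U" "continuous_on (\<psi> ` U) (inv_into U \<psi>)"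
proof -
  show "open U" "\<And>k. Ck_on k \<psi> U" "\<And>u. u \<in> U \<Longrightarrow> inj (fderiv \<psi> u)" "openin (top_of_set M) (\<psi> ` U)"
    using assms by (auto simp: local_param_def smooth_on_def)
  then show "\<psi> ` U \<subseteq> M" using openin_imp_subset by blast
  obtain \<theta> where h: "homeomorphism U (\<psi> ` U) \<psi> \<theta>" using assms by (auto simp: local_param_def)
  then have "\<theta> (\<psi> u) = u" if "u \<in> U" for u using that homeomorphism_apply1 by blast
  then show i: "inj_on \<psi> U" by (rule inj_on_inverseI)
  have "inv_into U \<psi> y = \<theta> y" if "y \<in> \<psi> ` U" for y
    using that h i by (auto simp: homeomorphism_def)
  then show "continuous_on (\<psi> ` U) (inv_into U \<psi>)"
    using h by (simp add: homeomorphism_def cong: continuous_on_cong)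
qed

lemma local_param_deriv:
  assumes "local_param M U \<psi>" "u \<in> U"
  shows "(\<psi> has_derivative fderiv \<psi> u) (at u)"
    "linear (fderiv \<psi> u)" "inj (fderiv \<psi> u)"
proof -
  have c: "Ck_on (Suc 0) \<psi> U" using local_paramD(2)[OF assms(1)] .
  then show 1: "(\<psi> has_derivative fderiv \<psi> u) (at u)"
    using assms(2) Ck_on_has_derivative by blast
  then show "linear (fderiv \<psi> u)" using has_derivative_linear by blast
  show "inj (fderiv \<psi> u)" using local_paramD(3) assms by blast
qed

lemma metric_matrix_eq_gram: "metric_matrix \<psi> u = gram_matrix (fderiv \<psi> u)"
  by (simp add: metric_matrix_def gram_matrix_def partial_def)

lemma det_metric_pos:
  "local_param M U \<psi> \<Longrightarrow> u \<in> U \<Longrightarrow> det (metric_matrix \<psi> u) > 0"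
  unfolding metric_matrix_eq_gram using det_gram_matrix_pos local_param_deriv by blast

lemma volume_density_pos: "local_param M U \<psi> \<Longrightarrow> u \<in> U \<Longrightarrow> vol \<psi> u > 0"
  using det_metric_pos by (simp add: volume_density_def)

lemma Ck_on_metric_matrix:
  assumes "local_param M U \<psi>"
  shows "Ck_on k (\<lambda>u. metric_matrix \<psi> u $ i $ j) U"
proof -
  have "Ck_on k (\<lambda>u. partial i \<psi> u) U" for i
    using local_paramD(2)[OF assms, of "Suc k"] by (simp add: partial_def)
  then show ?thesis unfolding metric_matrix_def vec_lambda_beta
    by (intro Ck_on_inner local_paramD(1)[OF assms])
qed

lemma Ck_on_det_metric: "local_param M U \<psi> \<Longrightarrow> Ck_on k (\<lambda>u. det (metric_matrix \<psi> u)) U"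
  by (intro Ck_on_det Ck_on_metric_matrix local_paramD(1))

lemma Ck_on_volume_density: "local_param M U \<psi> \<Longrightarrow> Ck_on (Suc 0) (vol \<psi>) U"
  unfolding volume_density_def[abs_def]
  by (intro Ck_on_sqrt Ck_on_det_metric det_metric_pos local_paramD(1))

lemma Ck_on_metric_inv:
  "local_param M U \<psi> \<Longrightarrow> Ck_on k (\<lambda>u. matrix_inv (metric_matrix \<psi> u) $ i $ j) U"
  using det_metric_pos by (intro Ck_on_matrix_inv Ck_on_metric_matrix local_paramD(1)) fastforce+

text \<open>The differential at \<open>u0\<close> expands lengths by at least \<open>c\<close>. On a
  small ball the chart minus this linear map is Lipschitz with constant c / 2, by continuity of the
  derivative, so the chart itself still expands by c / 2.\<close>

lemma chart_local_lower_bound: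
  assumes "local_param M U \<psi>" "u0 \<in> U"
  obtains \<delta> c where "\<delta> > 0" "c > 0" "ball u0 \<delta> \<subseteq> U"
    "\<And>a b. a \<in> ball u0 \<delta> \<Longrightarrow> b \<in> ball u0 \<delta> \<Longrightarrow> c * norm (a - b) \<le> norm (\<psi> a - \<psi> b)"
proof -
  let ?D = "\<lambda>u. fderiv \<psi> u"
  note d = local_param_deriv[OF assms]
  obtain c where c: "c > 0" "\<And>h. c * norm h \<le> norm (?D u0 h)"
    using linear_inj_bounded_below_pos[OF d(2,3)] by blast
  have C1: "Ck_on (Suc 0) \<psi> U" using local_paramD(2)[OF assms(1)] .
  have "continuous_on U (\<lambda>u. \<Sum>b\<in>Basis. norm (?D u b - ?D u0 b))"
    using C1 by (intro continuous_intros) auto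
  then have "isCont (\<lambda>u. \<Sum>b\<in>Basis. norm (?D u b - ?D u0 b)) u0"
    using local_paramD(1)[OF assms(1)] assms(2) continuous_on_eq_continuous_at by blast
  then have "\<exists>\<delta>>0. \<forall>u. dist u u0 < \<delta> \<longrightarrow> dist (\<Sum>b\<in>Basis. norm (?D u b - ?D u0 b)) 0 < c / 2"
    unfolding continuous_at_eps_delta using c(1) by (auto dest!: spec[of _ "c / 2"])
  then obtain \<delta>1 where \<delta>1: "\<delta>1 > 0" "\<And>u. dist u u0 < \<delta>1 \<Longrightarrow> (\<Sum>b\<in>Basis. norm (?D u b - ?D u0 b)) < c / 2"
    by (auto simp: dist_real_def sum_nonneg)
  obtain \<delta>2 where \<delta>2: "\<delta>2 > 0" "ball u0 \<delta>2 \<subseteq> U"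
    using local_paramD(1)[OF assms(1)] assms(2) openE by blast
  let ?B = "ball u0 (min \<delta>1 \<delta>2)"
  have sub: "?B \<subseteq> U" using \<delta>2 by auto
  have "c / 2 * norm (a - b) \<le> norm (\<psi> a - \<psi> b)" if ab: "a \<in> ?B" "b \<in> ?B" for a b
  proof -
    have "norm ((\<lambda>u. \<psi> u - ?D u0 u) a - (\<lambda>u. \<psi> u - ?D u0 u) b) \<le> c / 2 * norm (a - b)"
    proof (rule differentiable_bound[where S="?B" and f'="\<lambda>u v. ?D u v - ?D u0 v"])
      fix u assume u: "u \<in> ?B"
      then have uU: "u \<in> U" using sub by blast
      have "bounded_linear (?D u0)" using d(2) by (simp add: linear_conv_bounded_linear)
      then show "((\<lambda>u. \<psi> u - ?D u0 u) has_derivative (\<lambda>v. ?D u v - ?D u0 v)) (at u within ?B)"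
        by (intro has_derivative_at_withinI[OF has_derivative_diff] local_param_deriv[OF assms(1) uU]
            bounded_linear_imp_has_derivative)
      have "onorm (\<lambda>v. ?D u v - ?D u0 v) \<le> (\<Sum>b\<in>Basis. norm (?D u b - ?D u0 b))"
        using local_param_deriv(2)[OF assms(1)] uU assms(2)
        by (intro onorm_le_sum_Basis bounded_linear_sub) (auto simp: linear_conv_bounded_linear[symmetric])
      also have "\<dots> \<le> c / 2" using u \<delta>1(2)[of u] by (auto simp: dist_commute)
      finally show "onorm (\<lambda>v. ?D u v - ?D u0 v) \<le> c / 2" .
    qed (use ab in auto)
    moreover have "c * norm (a - b) \<le> norm (?D u0 (a - b))" using c by blast
    moreover have "?D u0 (a - b) = (\<psi> a - \<psi> b) - ((\<lambda>u. \<psi> u - ?D u0 u) a - (\<lambda>u. \<psi> u - ?D u0 u) b)"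
      using linear_diff[OF d(2)] by simp
    then have "norm (?D u0 (a - b)) \<le> norm (\<psi> a - \<psi> b) + norm ((\<lambda>u. \<psi> u - ?D u0 u) a - (\<lambda>u. \<psi> u - ?D u0 u) b)"
      by (metis norm_triangle_ineq4)
    ultimately show ?thesis by (simp add: field_simps)
  qed
  then show ?thesis using that[of "min \<delta>1 \<delta>2" "c / 2"] \<delta>1 \<delta>2 c(1) sub by auto
qed

text \<open>An expansion bound for the chart is a Lipschitz bound for its inverse. The chart is a
  homeomorphism onto a relatively open set, so the image of the small ball contains a neighbourhood
  of the point in \<open>M\<close>.\<close>

lemma inv_chart_local_lipschitz:
  assumes "local_param M U \<psi>" "u0 \<in> U"
  obtains e L where "e > 0" "cball (\<psi> u0) e \<inter> M \<subseteq> \<psi> ` U"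
    "L-lipschitz_on (cball (\<psi> u0) e \<inter> M) (inv_into U \<psi>)"
proof -
  obtain \<delta> c where \<delta>: "\<delta> > 0" "c > 0" "ball u0 \<delta> \<subseteq> U"
    "\<And>a b. a \<in> ball u0 \<delta> \<Longrightarrow> b \<in> ball u0 \<delta> \<Longrightarrow> c * norm (a - b) \<le> norm (\<psi> a - \<psi> b)"
    using chart_local_lower_bound[OF assms] by blast
  note D = local_paramD[OF assms(1)]
  obtain \<theta> where h: "homeomorphism U (\<psi> ` U) \<psi> \<theta>" using assms by (auto simp: local_param_def)
  have "openin (top_of_set U) (ball u0 \<delta>)" using \<delta>(3) by (simp add: open_subset)
  then have "openin (top_of_set (\<psi> ` U)) (\<psi> ` ball u0 \<delta>)"
    using homeomorphism_imp_open_map[OF h] by blast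
  then have "openin (top_of_set M) (\<psi> ` ball u0 \<delta>)" using D(4) openin_trans by blast
  moreover have "\<psi> u0 \<in> \<psi> ` ball u0 \<delta>" using \<delta>(1) by auto
  ultimately obtain e where e: "e > 0" "cball (\<psi> u0) e \<inter> M \<subseteq> \<psi> ` ball u0 \<delta>"
    by (metis openin_contains_cball)
  have "(1 / c)-lipschitz_on (\<psi> ` ball u0 \<delta>) (inv_into U \<psi>)"
  proof (rule lipschitz_onI)
    fix x y assume "x \<in> \<psi> ` ball u0 \<delta>" "y \<in> \<psi> ` ball u0 \<delta>"
    then obtain a b where ab: "a \<in> ball u0 \<delta>" "b \<in> ball u0 \<delta>" "x = \<psi> a" "y = \<psi> b" by blast
    have "inv_into U \<psi> (\<psi> a) = a" "inv_into U \<psi> (\<psi> b) = b" using ab \<delta>(3) D(6) by auto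
    then show "dist (inv_into U \<psi> x) (inv_into U \<psi> y) \<le> 1 / c * dist x y"
      using \<delta>(2) \<delta>(4)[OF ab(1,2)] ab(3,4) by (simp add: dist_norm field_simps)
  qed (use \<delta> in auto)
  then have "(1 / c)-lipschitz_on (cball (\<psi> u0) e \<inter> M) (inv_into U \<psi>)"
    using e(2) lipschitz_on_subset by blast
  then show ?thesis using that e \<delta>(3) by blast
qed

text \<open>\<open>local_lipschitz\<close> concerns families indexed by time. A constant family over
  the single time 0 gives access to the passage from local to global Lipschitz constants on compact
  sets.\<close>

lemma local_lipschitz_singletonI:
  assumes "\<And>x. x \<in> X \<Longrightarrow> \<exists>e>0. \<exists>L. L-lipschitz_on (cball x e \<inter> X) f"
  shows "local_lipschitz {0::real} X (\<lambda>_. f)"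
  unfolding local_lipschitz_def using assms by blast

lemma local_lipschitz_compact:
  assumes "compact X" "\<And>x. x \<in> X \<Longrightarrow> \<exists>e>0. \<exists>L. L-lipschitz_on (cball x e \<inter> X) f"
  obtains L where "L-lipschitz_on X f"
  using local_lipschitz_compact_implies_lipschitz[OF local_lipschitz_singletonI[OF assms(2)] assms(1)]
  by (metis compact_sing continuous_on_const singletonI)

lemma chart_compact_lower_bound:
  assumes "local_param M U \<psi>" "compact K" "K \<subseteq> U"
  obtains c where "c > 0" "\<And>a b. a \<in> K \<Longrightarrow> b \<in> K \<Longrightarrow> c * norm (a - b) \<le> norm (\<psi> a - \<psi> b)"
proof -
  note D = local_paramD[OF assms(1)]
  have "continuous_on K \<psi>" using Ck_on_imp_continuous_on[OF D(2)] assms(3) continuous_on_subset by blast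
  then have c: "compact (\<psi> ` K)" using assms(2) compact_continuous_image by blast
  obtain L where L: "L-lipschitz_on (\<psi> ` K) (inv_into U \<psi>)"
  proof (rule local_lipschitz_compact[OF c])
    fix x assume "x \<in> \<psi> ` K"
    then obtain u where u: "u \<in> U" "x = \<psi> u" using assms(3) by blast
    obtain e L where "e > 0" "cball (\<psi> u) e \<inter> M \<subseteq> \<psi> ` U" "L-lipschitz_on (cball (\<psi> u) e \<inter> M) (inv_into U \<psi>)"
      by (rule inv_chart_local_lipschitz[OF assms(1) u(1)])
    moreover have "cball x e \<inter> \<psi> ` K \<subseteq> cball (\<psi> u) e \<inter> M" using u assms(3) D(5) by blast
    ultimately show "\<exists>e>0. \<exists>L. L-lipschitz_on (cball x e \<inter> \<psi> ` K) (inv_into U \<psi>)"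
      using lipschitz_on_subset by blast
  qed blast
  show ?thesis
  proof (rule that[of "1 / (\<bar>L\<bar> + 1)"])
    fix a b assume ab: "a \<in> K" "b \<in> K"
    have "inv_into U \<psi> (\<psi> a) = a" "inv_into U \<psi> (\<psi> b) = b" using ab assms(3) D(6) by auto
    then have "norm (a - b) \<le> L * norm (\<psi> a - \<psi> b)"
      using lipschitz_onD[OF L, of "\<psi> a" "\<psi> b"] ab by (simp add: dist_norm)
    also have "\<dots> \<le> (\<bar>L\<bar> + 1) * norm (\<psi> a - \<psi> b)" by (intro mult_right_mono) auto
    finally show "1 / (\<bar>L\<bar> + 1) * norm (a - b) \<le> norm (\<psi> a - \<psi> b)"
      by (simp add: field_simps)
  qed simp
qed

text \<open>\<open>A\<close> is the derivative at \<open>u2\<close> of the transition map, the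
  inverse of the first chart after the second. A left inverse \<open>P\<close> of the differential
  of the first chart predicts it, and the Lipschitz bound on the inverse chart makes the remainder
  small; differentiability at this one point is enough to compare gradients.\<close>

lemma chart_transition:
  assumes 1: "local_param M U1 \<psi>1" "u1 \<in> U1" and 2: "local_param M U2 \<psi>2" "u2 \<in> U2" and eq: "\<psi>1 u1 = \<psi>2 u2"
  obtains A where "linear A"
    "\<And>h. fderiv \<psi>2 u2 h = fderiv \<psi>1 u1 (A h)"
    "\<And>f :: real ^ 'D::finite \<Rightarrow> real. (f \<circ> \<psi>1) differentiable (at u1) \<Longrightarrow>
       fderiv (f \<circ> \<psi>2) u2 = (\<lambda>h. fderiv (f \<circ> \<psi>1) u1 (A h))"
proof -
  let ?D1 = "fderiv \<psi>1 u1" and ?D2 = "fderiv \<psi>2 u2"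
  let ?\<theta> = "inv_into U1 \<psi>1"
  define \<tau> where "\<tau> = ?\<theta> \<circ> \<psi>2"
  note D1 = local_paramD[OF 1(1)] and D2 = local_paramD[OF 2(1)]
  note d1 = local_param_deriv[OF 1] and d2 = local_param_deriv[OF 2]
  obtain P where P: "linear P" "P \<circ> ?D1 = id" using linear_injective_left_inverse[OF d1(2,3)] by blast
  obtain e L where e: "e > 0" "cball (\<psi>1 u1) e \<inter> M \<subseteq> \<psi>1 ` U1" "L-lipschitz_on (cball (\<psi>1 u1) e \<inter> M) ?\<theta>"
    using inv_chart_local_lipschitz[OF 1] by blast
  let ?x = "\<psi>1 u1"
  have tx: "?\<theta> ?x = u1" using 1 D1(6) by auto
  obtain B where B: "B > 0" "\<And>h. norm (?D2 h) \<le> B * norm h"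
    using linear_bounded_pos[OF d2(2)] by blast
  obtain BP where BP: "BP > 0" "\<And>h. norm (P h) \<le> BP * norm h"
    using linear_bounded_pos[OF P(1)] by blast
  obtain r0 where r0: "r0 > 0" "ball u2 r0 \<subseteq> U2" using D2(1) 2(2) openE by blast
  have L0: "L \<ge> 0" using e(3) lipschitz_on_nonneg by blast
  have "\<exists>d>0. \<forall>y. norm (y - u2) < d \<longrightarrow> norm (\<psi>2 y - \<psi>2 u2 - ?D2 (y - u2)) \<le> 1 * norm (y - u2)"
    using d2(1) unfolding has_derivative_at_alt by (meson zero_less_one)
  then obtain r1 where r1: "r1 > 0"
    "\<And>y. norm (y - u2) < r1 \<Longrightarrow> norm (\<psi>2 y - \<psi>2 u2 - ?D2 (y - u2)) \<le> norm (y - u2)" by auto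
  \<comment> \<open>Within this radius \<open>y\<close> stays in \<open>U2\<close>, the second chart
    is linear up to relative error 1, and its value stays where the inverse of the first chart is
    Lipschitz.\<close>
  define r where "r = Min {r0, r1, e / (B + 1)}"
  have r: "r > 0" using r0 r1 e B by (auto simp: r_def)
  have near: "y \<in> U2 \<and> norm (\<psi>2 y - ?x) \<le> (B + 1) * norm (y - u2) \<and> \<psi>2 y \<in> cball ?x e \<inter> M
      \<and> \<tau> y \<in> U1 \<and> \<psi>1 (\<tau> y) = \<psi>2 y \<and> norm (\<tau> y - u1) \<le> L * (B + 1) * norm (y - u2)" if y: "norm (y - u2) < r" for y
  proof -
    have yU: "y \<in> U2" using y r0(2) by (auto simp: r_def dist_norm norm_minus_commute)
    have "norm (\<psi>2 y - \<psi>2 u2) \<le> norm (\<psi>2 y - \<psi>2 u2 - ?D2 (y - u2)) + norm (?D2 (y - u2))"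
      by (metis diff_add_cancel norm_triangle_ineq)
    also have "\<dots> \<le> norm (y - u2) + B * norm (y - u2)"
      using r1(2)[of y] y B(2) by (intro add_mono) (auto simp: r_def)
    finally have b: "norm (\<psi>2 y - ?x) \<le> (B + 1) * norm (y - u2)" unfolding eq by (simp add: algebra_simps)
    also have "\<dots> \<le> (B + 1) * (e / (B + 1))" using y B by (intro mult_left_mono) (auto simp: r_def)
    also have "\<dots> = e" using B by simp
    finally have c: "\<psi>2 y \<in> cball ?x e \<inter> M" using yU D2(5) by (auto simp: dist_norm norm_minus_commute)
    then have "\<psi>2 y \<in> \<psi>1 ` U1" using e by blast
    then have t: "\<tau> y \<in> U1" "\<psi>1 (\<tau> y) = \<psi>2 y" by (auto simp: \<tau>_def inv_into_into f_inv_into_f)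
    have "?x \<in> cball ?x e \<inter> M" using e 1 D1(5) by auto
    from lipschitz_onD[OF e(3) c this] have "norm (\<tau> y - u1) \<le> L * norm (\<psi>2 y - ?x)"
      unfolding tx \<tau>_def dist_norm comp_apply .
    also have "\<dots> \<le> L * ((B + 1) * norm (y - u2))" using b L0 by (intro mult_left_mono)
    finally show ?thesis using yU b c t by simp
  qed
  have PD: "P (?D1 h) = h" for h using P(2) by (metis comp_apply id_apply)
  have der: "(\<tau> has_derivative (P \<circ> ?D2)) (at u2)"
    unfolding has_derivative_at_alt
  proof (intro conjI allI impI)
    show "bounded_linear (P \<circ> ?D2)" using P(1) d2(2) linear_compose linear_conv_bounded_linear by blast
    fix \<epsilon> :: real assume \<epsilon>: "\<epsilon> > 0"
    define C where "C = L * (B + 1) + 1"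
    have C: "C > 0" using L0 B by (simp add: C_def add_nonneg_pos)
    define \<eta> where "\<eta> = \<epsilon> / (BP * (C + 1))"
    have \<eta>: "\<eta> > 0" using \<epsilon> BP C by (simp add: \<eta>_def)
    obtain s1 where s1: "s1 > 0"
      "\<And>y. norm (y - u1) < s1 \<Longrightarrow> norm (\<psi>1 y - \<psi>1 u1 - ?D1 (y - u1)) \<le> \<eta> * norm (y - u1)"
      using d1(1) \<eta> unfolding has_derivative_at_alt by blast
    obtain s2 where s2: "s2 > 0"
      "\<And>y. norm (y - u2) < s2 \<Longrightarrow> norm (\<psi>2 y - \<psi>2 u2 - ?D2 (y - u2)) \<le> \<eta> * norm (y - u2)"
      using d2(1) \<eta> unfolding has_derivative_at_alt by blast
    show "\<exists>d>0. \<forall>y. norm (y - u2) < d \<longrightarrow> norm (\<tau> y - \<tau> u2 - (P \<circ> ?D2) (y - u2)) \<le> \<epsilon> * norm (y - u2)"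
    proof (intro exI[of _ "Min {r, s2, s1 / C}"] conjI allI impI)
      show "Min {r, s2, s1 / C} > 0" using r s2 s1 C by auto
      fix y assume y: "norm (y - u2) < Min {r, s2, s1 / C}"
      then have yr: "norm (y - u2) < r" by simp
      note n = near[OF yr]
      have tu: "\<tau> u2 = u1" using tx eq by (simp add: \<tau>_def)
      have n2: "norm (\<tau> y - u1) \<le> C * norm (y - u2)"
        using n by (auto simp: C_def algebra_simps intro: order_trans)
      also have "\<dots> < C * (s1 / C)" using y C by (intro mult_strict_left_mono) auto
      also have "\<dots> = s1" using C by simp
      finally have n3: "norm (\<psi>1 (\<tau> y) - \<psi>1 u1 - ?D1 (\<tau> y - u1)) \<le> \<eta> * norm (\<tau> y - u1)" by (rule s1(2))
      \<comment> \<open>Both charts take the same value at \<open>\<tau> y\<close> and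
        \<open>y\<close>, and likewise at the base points. So the difference of the two
        linearization remainders is \<open>?D1 (\<tau> y - u1)\<close> minus
        \<open>?D2 (y - u2)\<close>, and \<open>P\<close> undoes \<open>?D1\<close>.\<close>
      have "\<tau> y - \<tau> u2 - (P \<circ> ?D2) (y - u2) =
         P ((\<psi>2 y - \<psi>2 u2 - ?D2 (y - u2)) - (\<psi>1 (\<tau> y) - \<psi>1 u1 - ?D1 (\<tau> y - u1)))"
        using n eq tu by (simp add: linear_diff[OF P(1)] PD)
      also have "norm \<dots> \<le> BP * norm ((\<psi>2 y - \<psi>2 u2 - ?D2 (y - u2)) - (\<psi>1 (\<tau> y) - \<psi>1 u1 - ?D1 (\<tau> y - u1)))"
        by (rule BP(2))
      also have "\<dots> \<le> BP * (norm (\<psi>2 y - \<psi>2 u2 - ?D2 (y - u2)) + norm (\<psi>1 (\<tau> y) - \<psi>1 u1 - ?D1 (\<tau> y - u1)))"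
        using BP(1) by (intro mult_left_mono norm_triangle_ineq4) auto
      also have "\<dots> \<le> BP * (\<eta> * norm (y - u2) + \<eta> * (C * norm (y - u2)))"
        using s2(2)[of y] y order_trans[OF n3 mult_left_mono[OF n2, of \<eta>]] \<eta> BP(1)
        by (intro mult_left_mono add_mono) simp_all
      also have "\<dots> = (\<eta> * (BP * (C + 1))) * norm (y - u2)" by (simp add: algebra_simps)
      also have "\<eta> * (BP * (C + 1)) = \<epsilon>" using BP C by (simp add: \<eta>_def)
      finally show "norm (\<tau> y - \<tau> u2 - (P \<circ> ?D2) (y - u2)) \<le> \<epsilon> * norm (y - u2)" .
    qed
  qed
  have tu: "\<tau> u2 = u1" using tx eq by (simp add: \<tau>_def)
  have ball: "\<psi>1 (\<tau> y) = \<psi>2 y" if "y \<in> ball u2 r" for y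
    using that near[of y] by (simp add: dist_norm norm_minus_commute)
  have u2b: "u2 \<in> ball u2 r" using r by simp
  show ?thesis
  proof (rule that[of "P \<circ> ?D2"])
    show "linear (P \<circ> ?D2)" using P(1) d2(2) linear_compose by blast
    have "((\<lambda>y. \<psi>1 (\<tau> y)) has_derivative (\<lambda>h. ?D1 ((P \<circ> ?D2) h))) (at u2)"
      by (rule has_derivative_compose[OF der]) (use d1(1) tu in simp)
    then have "(\<psi>2 has_derivative (\<lambda>h. ?D1 ((P \<circ> ?D2) h))) (at u2)"
      by (rule has_derivative_transform_within_open[OF _ open_ball u2b ball])
    then show "?D2 h = ?D1 ((P \<circ> ?D2) h)" for h using d2(1) has_derivative_unique by metis
    fix f :: "real ^ 'D \<Rightarrow> real" assume "(f \<circ> \<psi>1) differentiable (at u1)"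
    then have "((f \<circ> \<psi>1) has_derivative fderiv (f \<circ> \<psi>1) u1) (at (\<tau> u2))"
      using tu frechet_derivative_works by metis
    from has_derivative_compose[OF der this]
    have "((\<lambda>y. (f \<circ> \<psi>1) (\<tau> y)) has_derivative (\<lambda>h. fderiv (f \<circ> \<psi>1) u1 ((P \<circ> ?D2) h))) (at u2)" .
    then have "((f \<circ> \<psi>2) has_derivative (\<lambda>h. fderiv (f \<circ> \<psi>1) u1 ((P \<circ> ?D2) h))) (at u2)"
      by (rule has_derivative_transform_within_open[OF _ open_ball u2b]) (simp add: ball)
    then show "fderiv (f \<circ> \<psi>2) u2 = (\<lambda>h. fderiv (f \<circ> \<psi>1) u1 ((P \<circ> ?D2) h))"
      using frechet_derivative_at by metis
  qed
qed

subsection \<open>Functions on the manifold and their gradients\<close>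

locale manifold =
  fixes dT :: "'d::finite itself" and M :: "(real ^ 'D::finite) set" and V :: "(real ^ 'D) measure"
  assumes compact_M: "compact M"
    and submanifold: "embedded_submanifold dT M"
    and volume: "riemannian_volume dT M V"
begin

abbreviation grd :: "(real ^ 'D \<Rightarrow> real) \<Rightarrow> real ^ 'D \<Rightarrow> real ^ 'D" where "grd \<equiv> manifold_grad dT M"
abbreviation chart :: "(real ^ 'd) set \<Rightarrow> (real ^ 'd \<Rightarrow> real ^ 'D) \<Rightarrow> bool" where "chart \<equiv> local_param M"
abbreviation VV :: "((real ^ 'D) \<times> (real ^ 'D)) measure" where "VV \<equiv> V \<Otimes>\<^sub>M V"

definition bounded_by :: "(real ^ 'D \<Rightarrow> real) \<Rightarrow> real \<Rightarrow> bool" where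
  "bounded_by g B \<longleftrightarrow> 0 \<le> B \<and> (\<forall>x\<in>M. \<bar>g x\<bar> \<le> B)"

lemma bounded_byD: "bounded_by g B \<Longrightarrow> 0 \<le> B" "bounded_by g B \<Longrightarrow> x \<in> M \<Longrightarrow> \<bar>g x\<bar> \<le> B"
  by (auto simp: bounded_by_def)

lemma bounded_byI:
  assumes "continuous_on M g"
  obtains B where "bounded_by g B"
  using compact_continuous_bound[OF compact_M assms] unfolding bounded_by_def real_norm_def by metis

text \<open>Finite order is tracked because the cutoff functions are only known to be C^3.\<close>

definition Ck_manifold :: "nat \<Rightarrow> (real ^ 'D \<Rightarrow> real) \<Rightarrow> bool" where
  "Ck_manifold k f \<longleftrightarrow> (\<forall>(U :: (real ^ 'd) set) \<psi>. chart U \<psi> \<longrightarrow> Ck_on k (f \<circ> \<psi>) U)"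

lemma Ck_manifoldD: "Ck_manifold k f \<Longrightarrow> chart U \<psi> \<Longrightarrow> Ck_on k (\<lambda>u. f (\<psi> u)) U"
  by (auto simp: Ck_manifold_def o_def)

lemma Ck_manifoldI:
  "(\<And>(U :: (real ^ 'd) set) \<psi>. chart U \<psi> \<Longrightarrow> Ck_on k (\<lambda>u. f (\<psi> u)) U) \<Longrightarrow> Ck_manifold k f"
  by (auto simp: Ck_manifold_def o_def)

lemma smooth_Ck_manifold: "smooth_fun_on_manifold dT M f \<Longrightarrow> Ck_manifold k f"
  by (auto simp: Ck_manifold_def smooth_fun_on_manifold_def smooth_on_def)

lemma Ck_manifold_mono: "Ck_manifold k f \<Longrightarrow> j \<le> k \<Longrightarrow> Ck_manifold j f"
  unfolding Ck_manifold_def by (meson Ck_on_mono)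

lemma chart_exists:
  assumes "x \<in> M"
  obtains U :: "(real ^ 'd) set" and \<psi> u where "chart U \<psi>" "u \<in> U" "\<psi> u = x"
proof -
  have "\<exists>(U :: (real ^ 'd) set) \<psi>. chart U \<psi> \<and> x \<in> \<psi> ` U"
    using submanifold assms unfolding embedded_submanifold_def by (rule bspec)
  then show ?thesis using that by auto
qed

text \<open>Raising an index: the covector \<open>l\<close> has coordinates \<open>b\<close>, and
  the inverse metric turns them into the tangent vector that represents \<open>l\<close>.\<close>

lemma grad_representable:
  assumes c: "chart U \<psi>" "u \<in> U" and "linear l"
  defines "b \<equiv> (\<chi> i. l (axis i 1))"
  defines "v \<equiv> fderiv \<psi> u (matrix_inv (metric_matrix \<psi> u) *v b)"
  shows "v \<bullet> fderiv \<psi> u h = (l h :: real)"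
proof -
  let ?G = "metric_matrix \<psi> u" and ?D = "fderiv \<psi> u"
  note lin = local_param_deriv(2)[OF c]
  have g: "det ?G \<noteq> 0" using det_metric_pos[OF c] by simp
  have "v \<bullet> ?D h = h \<bullet> (?G *v (matrix_inv ?G *v b))"
    using gram_matrix_inner[OF lin, of h "matrix_inv ?G *v b"] unfolding v_def metric_matrix_eq_gram[symmetric] by (simp add: inner_commute)
  also have "\<dots> = h \<bullet> b" using matrix_inv_works[OF g] by (simp add: matrix_vector_mul_assoc)
  also have "\<dots> = (\<Sum>i\<in>UNIV. h $ i *\<^sub>R l (axis i 1))" by (simp add: inner_vec_def b_def)
  also have "\<dots> = l (\<Sum>i\<in>UNIV. h $ i *\<^sub>R axis i 1)"
    using assms(3) by (simp only: linear_sum linear_scale)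
  also have "(\<Sum>i\<in>UNIV. h $ i *\<^sub>R axis i 1) = h"
    by (simp add: vec_eq_iff axis_def if_distrib cong: if_cong)
  finally show ?thesis .
qed

lemma orthogonal_range_zero:
  assumes "linear A" "v \<in> range A" "\<And>h. v \<bullet> A h = 0"
  shows "v = 0"
proof -
  obtain h where "v = A h" using assms(2) by blast
  then have "v \<bullet> v = 0" using assms(3)[of h] by simp
  then show ?thesis by simp
qed

text \<open>Reduces the gradient, a description over all charts, to a single chart. The transition
  derivative carries the defining identity to every other chart; two representatives differ by a
  tangent vector orthogonal to all tangent vectors.\<close>

lemma grad_eqI:
  assumes c: "chart U \<psi>" "u \<in> U" and d: "(f \<circ> \<psi>) differentiable (at u)"
    and v: "v \<in> range (fderiv \<psi> u)"
    "\<And>h. v \<bullet> fderiv \<psi> u h = fderiv (f \<circ> \<psi>) u h"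
  shows "grd f (\<psi> u) = v"
  unfolding manifold_grad_def
proof (rule the_equality)
  let ?D = "fderiv \<psi> u"
  show "v \<in> tangent_space dT M (\<psi> u) \<and> (\<forall>(U :: (real ^ 'd) set) \<psi>' u'. chart U \<psi>' \<and> u' \<in> U \<and> \<psi>' u' = \<psi> u \<longrightarrow>
           (\<forall>h. v \<bullet> fderiv \<psi>' u' h = fderiv (f \<circ> \<psi>') u' h))"
  proof (intro conjI allI impI)
    show "v \<in> tangent_space dT M (\<psi> u)" unfolding tangent_space_def using c v(1) by blast
    fix U' :: "(real ^ 'd) set" and \<psi>' u' h
    assume c': "chart U' \<psi>' \<and> u' \<in> U' \<and> \<psi>' u' = \<psi> u"
    obtain A where A: "linear A" "\<And>h. fderiv \<psi>' u' h = ?D (A h)"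
     "fderiv (f \<circ> \<psi>') u' = (\<lambda>h. fderiv (f \<circ> \<psi>) u (A h))"
      using chart_transition[OF c, of U' \<psi>' u'] c' d by metis
    then show "v \<bullet> fderiv \<psi>' u' h = fderiv (f \<circ> \<psi>') u' h"
      using v(2) by simp
  qed
  fix w assume w: "w \<in> tangent_space dT M (\<psi> u) \<and> (\<forall>(U :: (real ^ 'd) set) \<psi>' u'. chart U \<psi>' \<and> u' \<in> U \<and> \<psi>' u' = \<psi> u \<longrightarrow>
           (\<forall>h. w \<bullet> fderiv \<psi>' u' h = fderiv (f \<circ> \<psi>') u' h))"
  then have "w \<in> tangent_space dT M (\<psi> u)" ..
  then obtain U' :: "(real ^ 'd) set" and \<psi>' u' h where c': "chart U' \<psi>'" "u' \<in> U'" "\<psi>' u' = \<psi> u"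
    and wh: "w = fderiv \<psi>' u' h" unfolding tangent_space_def by blast
  obtain A where A: "\<And>h. fderiv \<psi>' u' h = ?D (A h)"
    using chart_transition[OF c c'(1,2) c'(3)[symmetric]] by metis
  have lin: "linear ?D" using local_param_deriv(2)[OF c] .
  obtain k where k: "v = ?D k" using v(1) by blast
  have "w - v = ?D (A h - k)" unfolding wh A k by (rule linear_diff[OF lin, symmetric])
  then have "w - v \<in> range ?D" by blast
  moreover have "(w - v) \<bullet> ?D h = 0" for h
    using w c v(2)[of h] by (auto simp: inner_diff_left)
  ultimately have "w - v = 0" using orthogonal_range_zero[OF lin] by blast
  then show "w = v" by simp
qed

lemma grad_chart:
  assumes c: "chart U \<psi>" "u \<in> U" and d: "(f \<circ> \<psi>) differentiable (at u)"
  shows "grd f (\<psi> u) = fderiv \<psi> u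
      (matrix_inv (metric_matrix \<psi> u) *v (\<chi> i. fderiv (f \<circ> \<psi>) u (axis i 1)))"
    "grd f (\<psi> u) \<in> range (fderiv \<psi> u)"
    "grd f (\<psi> u) \<bullet> fderiv \<psi> u h = fderiv (f \<circ> \<psi>) u h"
proof -
  have "linear (fderiv (f \<circ> \<psi>) u)" using d linear_frechet_derivative by blast
  note g = grad_representable[OF c this]
  show e: "grd f (\<psi> u) = fderiv \<psi> u
      (matrix_inv (metric_matrix \<psi> u) *v (\<chi> i. fderiv (f \<circ> \<psi>) u (axis i 1)))"
    using g by (intro grad_eqI[OF c d]) auto
  show "grd f (\<psi> u) \<in> range (fderiv \<psi> u)"
    "grd f (\<psi> u) \<bullet> fderiv \<psi> u h = fderiv (f \<circ> \<psi>) u h"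
    unfolding e using g by auto
qed

lemma Ck_manifold_differentiable:
  "Ck_manifold (Suc k) f \<Longrightarrow> chart U \<psi> \<Longrightarrow> u \<in> U \<Longrightarrow> (f \<circ> \<psi>) differentiable (at u)"
  unfolding Ck_manifold_def by auto

lemma grad_inner_chart:
  assumes c: "chart U \<psi>" "u \<in> U"
    and d: "(f \<circ> \<psi>) differentiable (at u)" "(g \<circ> \<psi>) differentiable (at u)"
  shows "grd f (\<psi> u) \<bullet> grd g (\<psi> u) =
    (\<Sum>i\<in>UNIV. partial i (f \<circ> \<psi>) u * (\<Sum>j\<in>UNIV. matrix_inv (metric_matrix \<psi> u) $ i $ j * partial j (g \<circ> \<psi>) u))"
proof -
  let ?b = "\<chi> i. fderiv (g \<circ> \<psi>) u (axis i 1)"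
  let ?w = "matrix_inv (metric_matrix \<psi> u) *v ?b"
  have lin: "linear (fderiv (f \<circ> \<psi>) u)" using d linear_frechet_derivative by blast
  have "grd f (\<psi> u) \<bullet> grd g (\<psi> u) = fderiv (f \<circ> \<psi>) u ?w"
    unfolding grad_chart(1)[OF c d(2)] using grad_chart(3)[OF c d(1)] by blast
  also have "\<dots> = fderiv (f \<circ> \<psi>) u (\<Sum>i\<in>UNIV. ?w $ i *\<^sub>R axis i 1)"
    by (rule arg_cong[of _ _ "fderiv (f \<circ> \<psi>) u"])
      (simp add: vec_eq_iff axis_def if_distrib cong: if_cong)
  also have "\<dots> = (\<Sum>i\<in>UNIV. ?w $ i * partial i (f \<circ> \<psi>) u)"
    using lin by (simp add: linear_sum linear_scale partial_def)
  finally show ?thesis by (simp add: matrix_vector_mult_def partial_def mult.commute)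
qed

lemma continuous_on_manifoldI:
  assumes "\<And>(U :: (real ^ 'd) set) \<psi>. chart U \<psi> \<Longrightarrow> continuous_on U (\<lambda>u. f (\<psi> u))"
  shows "continuous_on M f"
proof -
  have "continuous (at x within M) f" if x: "x \<in> M" for x
  proof -
    obtain U and \<psi> u where c: "chart U \<psi>" "u \<in> U" "\<psi> u = x" using chart_exists[OF x] .
    note D = local_paramD[OF c(1)]
    have "inv_into U \<psi> ` \<psi> ` U = U" using D(6) by simp
    then have "continuous_on (\<psi> ` U) (\<lambda>y. f (\<psi> (inv_into U \<psi> y)))"
      by (intro continuous_on_compose2[OF assms[OF c(1)] D(7)]) simp
    then have "continuous_on (\<psi> ` U) f"
      by (rule continuous_on_eq) (auto simp: f_inv_into_f)
    then have "continuous (at x within \<psi> ` U) f" using c imageI continuous_on_eq_continuous_within by metis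
    moreover have "at x within \<psi> ` U = at x within M"
    proof -
      obtain T where "open T" "\<psi> ` U = M \<inter> T" using D(4) openin_open by blast
      then show ?thesis using c by (intro at_within_nhd[of x T]) auto
    qed
    ultimately show ?thesis by (simp add: continuous_within)
  qed
  then show ?thesis by (simp add: continuous_on_eq_continuous_within)
qed

lemma Ck_manifold_continuous: "Ck_manifold k f \<Longrightarrow> continuous_on M f"
  by (rule continuous_on_manifoldI) (auto intro: Ck_on_imp_continuous_on Ck_manifoldD)

lemma Ck_manifold_partial:
  "Ck_manifold (Suc k) f \<Longrightarrow> chart U \<psi> \<Longrightarrow> Ck_on k (partial i (f \<circ> \<psi>)) U"
  unfolding Ck_manifold_def partial_def[abs_def] by auto

lemma continuous_grad_inner:
  assumes "Ck_manifold (Suc 0) f" "Ck_manifold (Suc 0) g"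
  shows "continuous_on M (\<lambda>x. grd f x \<bullet> grd g x)"
proof (rule continuous_on_manifoldI)
  fix U \<psi> assume c: "chart U \<psi>"
  have "continuous_on U (\<lambda>u. \<Sum>i\<in>UNIV. partial i (f \<circ> \<psi>) u *
      (\<Sum>j\<in>UNIV. matrix_inv (metric_matrix \<psi> u) $ i $ j * partial j (g \<circ> \<psi>) u))"
    using assms[THEN Ck_manifold_partial[OF _ c]] Ck_on_imp_continuous_on[OF Ck_on_metric_inv[OF c]]
    by (intro continuous_on_sum continuous_on_mult) auto
  then show "continuous_on U (\<lambda>u. grd f (\<psi> u) \<bullet> grd g (\<psi> u))"
    by (rule continuous_on_eq)
      (use grad_inner_chart[OF c] Ck_manifold_differentiable[OF _ c] assms in auto)
qed

lemma Ck_manifold_sum: "(\<And>i. i \<in> I \<Longrightarrow> Ck_manifold k (f i)) \<Longrightarrow> Ck_manifold k (\<lambda>x. \<Sum>i\<in>I. f i x)"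
  by (rule Ck_manifoldI, rule Ck_on_sum) (auto intro: local_paramD(1) Ck_manifoldD)

lemma Ck_manifold_mult: "Ck_manifold k f \<Longrightarrow> Ck_manifold k g \<Longrightarrow> Ck_manifold k (\<lambda>x. f x * g x)"
  by (rule Ck_manifoldI, rule Ck_on_mult) (auto intro: local_paramD(1) Ck_manifoldD)

lemma Ck_manifold_divide:
  assumes "Ck_manifold k f" "Ck_manifold k g" "\<And>x. x \<in> M \<Longrightarrow> g x \<noteq> 0"
  shows "Ck_manifold k (\<lambda>x. f x / g x)"
proof (rule Ck_manifoldI)
  fix U \<psi> assume c: "chart U \<psi>"
  show "Ck_on k (\<lambda>u. f (\<psi> u) / g (\<psi> u)) U"
    using assms(3) local_paramD(5)[OF c]
    by (intro Ck_on_divide local_paramD(1)[OF c] Ck_manifoldD[OF _ c] assms(1,2)) auto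
qed

lemma Ck_manifold_powr:
  assumes "Ck_manifold (Suc 0) f" "\<And>x. x \<in> M \<Longrightarrow> f x > 0"
  shows "Ck_manifold (Suc 0) (\<lambda>x. f x powr a)"
proof (rule Ck_manifoldI)
  fix U \<psi> assume c: "chart U \<psi>"
  show "Ck_on (Suc 0) (\<lambda>u. f (\<psi> u) powr a) U"
    using assms(2) local_paramD(5)[OF c]
    by (intro Ck_on_powr local_paramD(1)[OF c] Ck_manifoldD[OF _ c] assms(1)) auto
qed

text \<open>The exponent 4 makes the cutoff C^3, the order that the cubic midpoint expansion
  demands. Under the power stands a polynomial in the point, so its composition with a chart is as
  regular as the chart.\<close>

definition bump :: "real ^ 'D \<Rightarrow> real \<Rightarrow> real ^ 'D \<Rightarrow> real" where
  "bump z \<delta> x = max 0 (\<delta>\<^sup>2 - (x - z) \<bullet> (x - z)) ^ 4"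

lemma bump_nonneg: "bump z \<delta> x \<ge> 0"
  by (simp add: bump_def)

lemma bump_pos: "dist z x < \<delta> \<Longrightarrow> bump z \<delta> x > 0"
proof -
  assume a: "dist z x < \<delta>"
  have "(norm (x - z))\<^sup>2 < \<delta>\<^sup>2" using a by (intro power_strict_mono) (auto simp: dist_norm norm_minus_commute)
  then show ?thesis by (simp add: bump_def power2_norm_eq_inner)
qed

lemma bump_zero: "\<delta> \<ge> 0 \<Longrightarrow> dist z x \<ge> \<delta> \<Longrightarrow> bump z \<delta> x = 0"
proof -
  assume a: "\<delta> \<ge> 0" "dist z x \<ge> \<delta>"
  have "\<delta>\<^sup>2 \<le> (norm (x - z))\<^sup>2" using a by (intro power_mono) (auto simp: dist_norm norm_minus_commute)
  then show ?thesis by (simp add: bump_def power2_norm_eq_inner)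
qed

lemma Ck_manifold_bump: "Ck_manifold 3 (bump z \<delta>)"
proof (rule Ck_manifoldI)
  fix U \<psi> assume c: "chart U \<psi>"
  note D = local_paramD[OF c]
  have "Ck_on 3 (\<lambda>u. max 0 (\<delta>\<^sup>2 - (\<psi> u - z) \<bullet> (\<psi> u - z)) ^ Suc 3) U"
    by (intro Ck_on_max_power Ck_on_diff Ck_on_inner Ck_on_const D(1,2))
  then show "Ck_on 3 (\<lambda>u. bump z \<delta> (\<psi> u)) U" by (simp add: bump_def)
qed

text \<open>The bound is in the ambient Euclidean distance, which is the distance inside the kernel.
  Locally it comes from a Lipschitz inverse chart followed by a C^1 chart expression; compactness
  makes it global, also between different components of \<open>M\<close>.\<close>

lemma Ck_manifold_lipschitz:
  assumes "Ck_manifold (Suc 0) f"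
  obtains L where "L \<ge> 0" "\<And>x y. x \<in> M \<Longrightarrow> y \<in> M \<Longrightarrow> \<bar>f x - f y\<bar> \<le> L * norm (x - y)"
proof -
  obtain L where L: "L-lipschitz_on M f"
  proof (rule local_lipschitz_compact[OF compact_M])
    fix x assume x: "x \<in> M"
    obtain U and \<psi> u where c: "chart U \<psi>" "u \<in> U" "\<psi> u = x" using chart_exists[OF x] .
    note D = local_paramD[OF c(1)]
    obtain e L where e: "e > 0" "cball x e \<inter> M \<subseteq> \<psi> ` U" "L-lipschitz_on (cball x e \<inter> M) (inv_into U \<psi>)"
      using inv_chart_local_lipschitz[OF c(1,2)] unfolding c(3) by blast
    obtain s where s: "s > 0" "cball u s \<subseteq> U" using D(1) c(2) open_contains_cball by blast
    from C1_segment_bound[OF Ck_manifoldD[OF assms c(1)] compact_cball s(2)]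
    obtain C where C: "C \<ge> 0" "\<And>a w. closed_segment a (a + w) \<subseteq> cball u s \<Longrightarrow> norm (f (\<psi> (a + w)) - f (\<psi> a)) \<le> C * norm w"
      by blast
    have lipf: "C-lipschitz_on (cball u s) (\<lambda>u. f (\<psi> u))"
    proof (rule lipschitz_onI[OF _ C(1)])
      fix a b assume "a \<in> cball u s" "b \<in> cball u s"
      then have "closed_segment b (b + (a - b)) \<subseteq> cball u s"
        by (simp add: closed_segment_subset)
      from C(2)[OF this] show "dist (f (\<psi> a)) (f (\<psi> b)) \<le> C * dist a b" by (simp add: dist_norm)
    qed
    \<comment> \<open>Small enough for the inverse chart to stay in the ball on which the chart
      expression of \<open>f\<close> is Lipschitz.\<close>
    define e' where "e' = min e (s / (\<bar>L\<bar> + 1))"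
    have e': "e' > 0" using e s by (simp add: e'_def)
    have lip: "L-lipschitz_on (cball x e' \<inter> M) (inv_into U \<psi>)"
      by (rule lipschitz_on_subset[OF e(3)]) (auto simp: e'_def)
    have ux: "inv_into U \<psi> x = u" using c D(6) by auto
    have "inv_into U \<psi> ` (cball x e' \<inter> M) \<subseteq> cball u s"
    proof
      fix w assume "w \<in> inv_into U \<psi> ` (cball x e' \<inter> M)"
      then obtain y where y: "y \<in> cball x e' \<inter> M" "w = inv_into U \<psi> y" by blast
      have "dist u w \<le> L * dist x y" using lipschitz_onD[OF lip _ y(1), of x] x e' ux y(2) by auto
      also have "\<dots> \<le> (\<bar>L\<bar> + 1) * (s / (\<bar>L\<bar> + 1))" using y by (intro mult_mono) (auto simp: e'_def)
      also have "\<dots> = s" by (simp add: field_simps)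
      finally show "w \<in> cball u s" by simp
    qed
    from lipschitz_on_compose[OF lip lipschitz_on_subset[OF lipf this]]
    have "(C * L)-lipschitz_on (cball x e' \<inter> M) ((\<lambda>u. f (\<psi> u)) \<circ> inv_into U \<psi>)" .
    then have "(C * L)-lipschitz_on (cball x e' \<inter> M) f"
      using e(2) by (auto simp: lipschitz_on_def e'_def f_inv_into_f subset_iff)
    then show "\<exists>e>0. \<exists>L. L-lipschitz_on (cball x e \<inter> M) f" using e' by blast
  qed
  then show ?thesis using that[of L] lipschitz_onD[OF L] lipschitz_on_nonneg[OF L]
    by (auto simp: dist_norm)
qed

text \<open>\<open>M\<close> may have several components, so a vanishing gradient gives only local
  constancy. A Lebesgue number of a cover by open sets of constancy makes the distance
  uniform.\<close>

lemma grad_zero_locally_constant: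
  assumes "Ck_manifold (Suc 0) f" "\<And>x. x \<in> M \<Longrightarrow> grd f x = 0"
  obtains \<delta> where "\<delta> > 0" "\<And>x y. x \<in> M \<Longrightarrow> y \<in> M \<Longrightarrow> dist x y < \<delta> \<Longrightarrow> f x = f y"
proof -
  have loc: "\<exists>B. open B \<and> x \<in> B \<and> (\<forall>y\<in>B \<inter> M. f y = f x)" if x: "x \<in> M" for x
  proof -
    obtain U and \<psi> u where c: "chart U \<psi>" "u \<in> U" "\<psi> u = x" using chart_exists[OF x] .
    note D = local_paramD[OF c(1)]
    obtain s where s: "s > 0" "ball u s \<subseteq> U" using D(1) c(2) openE by blast
    obtain \<theta> where h: "homeomorphism U (\<psi> ` U) \<psi> \<theta>" using c by (auto simp: local_param_def)
    have "openin (top_of_set (\<psi> ` U)) (\<psi> ` ball u s)"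
      by (rule homeomorphism_imp_open_map[OF h open_subset[OF s(2) open_ball]])
    then have "openin (top_of_set M) (\<psi> ` ball u s)" using D(4) openin_trans by blast
    then obtain B where B: "open B" "\<psi> ` ball u s = M \<inter> B" using openin_open by blast
    have "((f \<circ> \<psi>) has_derivative (\<lambda>h. 0)) (at w within ball u s)" if w: "w \<in> ball u s" for w
    proof -
      have wU: "w \<in> U" using w s by blast
      note d = Ck_manifold_differentiable[OF assms(1) c(1) wU]
      have "fderiv (f \<circ> \<psi>) w = (\<lambda>h. 0)"
        using grad_chart(3)[OF c(1) wU d] assms(2)[of "\<psi> w"] wU D(5) by fastforce
      then show ?thesis using d frechet_derivative_works has_derivative_at_withinI by metis
    qed
    from has_derivative_zero_constant[OF convex_ball this]
    obtain k where k: "\<forall>w\<in>ball u s. (f \<circ> \<psi>) w = k" by blast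
    have us: "u \<in> ball u s" using s(1) by simp
    have const: "f y = f x" if "y \<in> B \<inter> M" for y
    proof -
      have "y \<in> \<psi> ` ball u s" using that B(2) by blast
      then obtain w where "w \<in> ball u s" "y = \<psi> w" by (rule imageE)
      then show ?thesis using k us c(3) by auto
    qed
    have "\<psi> u \<in> \<psi> ` ball u s" using us by (rule imageI)
    then have "x \<in> B" unfolding B(2) c(3) by (rule IntD2)
    then show ?thesis by (intro exI[of _ B] conjI ballI B(1) const)
  qed
  define C where "C = {B. open B \<and> (\<exists>k. \<forall>y\<in>B \<inter> M. f y = k)}"
  have C0: "C \<noteq> {}" by (auto simp: C_def intro!: exI[of _ "{}"])
  have CM: "M \<subseteq> \<Union>C"
  proof
    fix x assume "x \<in> M"
    from loc[OF this] obtain B where "open B" "x \<in> B" "\<forall>y\<in>B \<inter> M. f y = f x" by (elim exE conjE)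
    then show "x \<in> \<Union>C" unfolding C_def by (intro UnionI[of B] CollectI conjI exI[of _ "f x"])
  qed
  have Co: "open B" if "B \<in> C" for B using that by (simp add: C_def)
  obtain \<delta> where \<delta>: "\<delta> > 0" "\<And>T. T \<subseteq> M \<Longrightarrow> diameter T < \<delta> \<Longrightarrow> \<exists>B\<in>C. T \<subseteq> B"
    using Lebesgue_number_lemma[OF compact_M C0 CM Co] by metis
  show ?thesis
  proof (rule that[OF \<delta>(1)])
    fix x y assume xy: "x \<in> M" "y \<in> M" "dist x y < \<delta>"
    have "diameter {x, y} = dist x y"
    proof (rule antisym)
      show "diameter {x, y} \<le> dist x y" by (rule diameter_le) (auto simp: dist_norm norm_minus_commute)
      show "dist x y \<le> diameter {x, y}" by (rule diameter_bounded_bound) auto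
    qed
    then have "\<exists>B\<in>C. {x, y} \<subseteq> B" using \<delta>(2)[of "{x, y}"] xy by auto
    then obtain B k where "{x, y} \<subseteq> B" "\<forall>y\<in>B \<inter> M. f y = k" unfolding C_def by blast
    then show "f x = f y" using xy by simp
  qed
qed

end

section \<open>Gaussian integrals in Euclidean space\<close>

lemma nn_integral_gaussian_real_finite: "(\<integral>\<^sup>+x. ennreal (exp (- (x\<^sup>2))) \<partial>(lborel :: real measure)) < \<infinity>"
proof -
  have "integrable lborel (normal_density 0 (1 / sqrt 2))" by (intro integrable_normal_density) auto
  then have "integrable lborel (\<lambda>x. sqrt pi * normal_density 0 (1 / sqrt 2) x)" by simp
  also have "(\<lambda>x. sqrt pi * normal_density 0 (1 / sqrt 2) x) = (\<lambda>x. exp (- (x\<^sup>2)))"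
    by (auto simp: normal_density_def fun_eq_iff power_divide real_sqrt_divide)
  finally show ?thesis by (simp add: integrable_iff_bounded)
qed

text \<open>Only the power of \<beta> matters, and it comes from scaling. At \<beta> = 1 finiteness
  is enough, and this follows by factorization into coordinates.\<close>

lemma nn_integral_gaussian:
  "\<exists>C>0. \<forall>\<beta>>0. (\<integral>\<^sup>+u. ennreal (gauss \<beta> u) \<partial>(lborel :: (real ^ 'd) measure)) \<le>
       ennreal (C * \<beta> powr (- real CARD('d) / 2))"
proof -
  let ?J = "\<lambda>\<beta>. \<integral>\<^sup>+u. ennreal (gauss \<beta> u) \<partial>(lborel :: (real ^ 'd) measure)"
  let ?I = "\<integral>\<^sup>+u. ennreal (exp (- ((norm u)\<^sup>2))) \<partial>(lborel :: (real ^ 'd) measure)"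
  have "?I = (\<integral>\<^sup>+u. (\<Prod>b\<in>Basis. ennreal (exp (- ((u \<bullet> b)\<^sup>2)))) \<partial>(lborel :: (real ^ 'd) measure))"
  proof (rule nn_integral_cong)
    fix u :: "real ^ 'd"
    have "(norm u)\<^sup>2 = (\<Sum>b\<in>Basis. (u \<bullet> b)\<^sup>2)"
      unfolding power2_norm_eq_inner by (subst euclidean_inner) (simp add: power2_eq_square)
    then show "ennreal (exp (- ((norm u)\<^sup>2))) = (\<Prod>b\<in>Basis. ennreal (exp (- ((u \<bullet> b)\<^sup>2))))"
      by (simp add: prod_ennreal exp_sum sum_negf[symmetric])
  qed
  also have "\<dots> = (\<Prod>b\<in>(Basis :: (real ^ 'd) set). (\<integral>\<^sup>+x. ennreal (exp (- (x\<^sup>2))) \<partial>lborel))"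
    by (rule nn_integral_lborel_prod) auto
  also have "\<dots> < \<infinity>"
    using nn_integral_gaussian_real_finite by (simp add: prod_constant power_less_top_ennreal)
  finally have fin: "?I < \<infinity>" .
  define C where "C = enn2real ?I + 1"
  show ?thesis
  proof (intro exI[of _ C] conjI allI impI)
    show "C > 0" by (simp add: C_def add_nonneg_pos)
    fix \<beta> :: real assume \<beta>: "\<beta> > 0"
    let ?F = "\<lambda>u::real^'d. ennreal (exp (- ((norm u)\<^sup>2)))"
    have "(\<chi> i. sqrt \<beta> * u $ i) = sqrt \<beta> *\<^sub>R u" for u :: "real ^ 'd" by (simp add: vec_eq_iff)
    then have e: "?F (\<chi> i. sqrt \<beta> * u $ i) = ennreal (gauss \<beta> u)" for u
      using \<beta> by (simp add: power_mult_distrib)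
    have p: "\<bar>\<Prod>i\<in>(UNIV::'d set). sqrt \<beta>\<bar> = \<beta> powr (real CARD('d) / 2)"
    proof -
      have "sqrt \<beta> = \<beta> powr (1 / 2)" using \<beta> by (simp add: powr_half_sqrt)
      then show ?thesis using \<beta> by (simp add: powr_powr powr_realpow[symmetric])
    qed
    have "(\<integral>\<^sup>+u. ?F (\<chi> i. sqrt \<beta> * u $ i) \<partial>lborel) * ennreal \<bar>\<Prod>i\<in>(UNIV::'d set). sqrt \<beta>\<bar> = ?I"
      by (rule nn_integral_stretch) (use \<beta> in auto)
    then have eq: "?J \<beta> * ennreal (\<beta> powr (real CARD('d) / 2)) = ?I"
      unfolding e p .
    have "?I \<le> ennreal C"
      using fin by (cases ?I) (auto simp: C_def ennreal_leI simp flip: ennreal_1 ennreal_plus)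
    have "?J \<beta> =
       ?J \<beta> *
       (ennreal (\<beta> powr (real CARD('d) / 2)) * ennreal (\<beta> powr (- real CARD('d) / 2)))"
      using \<beta> by (simp add: ennreal_mult[symmetric] powr_add[symmetric])
    also have "\<dots> = ?I * ennreal (\<beta> powr (- real CARD('d) / 2))" unfolding mult.assoc[symmetric] eq ..
    also have "\<dots> \<le> ennreal C * ennreal (\<beta> powr (- real CARD('d) / 2))" by (rule mult_right_mono) (fact, simp)
    also have "\<dots> = ennreal (C * \<beta> powr (- real CARD('d) / 2))"
      by (rule ennreal_mult[symmetric]) (simp_all add: C_def)
    finally show "?J \<beta> \<le>
       ennreal (C * \<beta> powr (- real CARD('d) / 2))" .
  qed
qed

section \<open>Integration against the Riemannian volume\<close>

context manifold
begin

lemma sets_V: "sets V = sets (restrict_space borel M)"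
  using volume by (simp add: riemannian_volume_def)

lemma space_V: "space V = M"
  using sets_eq_imp_space_eq[OF sets_V] by (simp add: space_restrict_space)

lemma M_borel: "M \<in> sets borel"
  using compact_M by (simp add: borel_closed compact_imp_closed)

lemma in_sets_V: "A \<in> sets V \<longleftrightarrow> A \<subseteq> M \<and> A \<in> sets borel"
  unfolding sets_V by (rule sets_restrict_space_iff) (simp add: M_borel)

lemma continuous_measurable_V: "continuous_on M f \<Longrightarrow> f \<in> borel_measurable V"
  by (simp add: measurable_cong_sets[OF sets_V refl] borel_measurable_continuous_on_restrict)

lemma borel_measurable_V: "f \<in> borel_measurable borel \<Longrightarrow> f \<in> borel_measurable V"
  by (simp add: measurable_cong_sets[OF sets_V refl] measurable_restrict_space1)

lemma id_measurable_V: "(\<lambda>x. x) \<in> measurable V borel"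
  by (rule borel_measurable_V) simp

lemma emeasure_chart:
  assumes "chart U \<psi>" "A \<in> sets V" "A \<subseteq> \<psi> ` U"
  shows "emeasure V A = (\<integral>\<^sup>+u\<in>{u\<in>U. \<psi> u \<in> A}. ennreal (vol \<psi> u) \<partial>lborel)"
  using volume assms unfolding riemannian_volume_def by blast

lemma chart_image_sets:
  assumes "chart U \<psi>"
  shows "\<psi> ` U \<in> sets V"
proof -
  obtain T where "open T" "\<psi> ` U = M \<inter> T"
    using local_paramD(4)[OF assms] openin_open by blast
  then show ?thesis using M_borel by (simp add: in_sets_V)
qed

text \<open>The defining property of the volume concerns sets inside one chart image. Rewritten as
  an equality with an image measure, it yields the change of variables for integrals.\<close>

lemma restrict_V_eq:
  assumes "chart U \<psi>"
  shows "restrict_space V (\<psi> ` U) =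
    distr (density (restrict_space lborel U) (\<lambda>u. ennreal (vol \<psi> u))) (restrict_space V (\<psi> ` U)) \<psi>"
    "\<psi> \<in> measurable (restrict_space lborel U) (restrict_space V (\<psi> ` U))"
    "vol \<psi> \<in> borel_measurable (restrict_space lborel U)"
proof -
  note D = local_paramD[OF assms]
  have sl: "sets (restrict_space lborel U) = sets (restrict_space borel U)" for U :: "(real ^ 'd) set" by (simp add: sets_restrict_space)
  have im: "\<psi> ` U \<inter> space V \<in> sets V" using chart_image_sets[OF assms] D(5) by (simp add: space_V Int_absorb2)
  have Ub: "U \<in> sets borel" using D(1) by auto
  have "\<psi> \<in> borel_measurable (restrict_space lborel U)"
    unfolding measurable_cong_sets[OF sl refl]
    by (rule borel_measurable_continuous_on_restrict[OF Ck_on_imp_continuous_on[OF D(2)[of 0]]])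
  then have "\<psi> \<in> measurable (restrict_space lborel U) (restrict_space borel M)"
    using D(5) by (intro measurable_restrict_space2) (auto simp: space_restrict_space)
  then have "\<psi> \<in> measurable (restrict_space lborel U) V"
    by (simp add: measurable_cong_sets[OF refl sets_V])
  then show m: "\<psi> \<in> measurable (restrict_space lborel U) (restrict_space V (\<psi> ` U))"
    by (intro measurable_restrict_space2) (auto simp: space_restrict_space)
  show v: "vol \<psi> \<in> borel_measurable (restrict_space lborel U)"
    unfolding measurable_cong_sets[OF sl refl]
    by (rule borel_measurable_continuous_on_restrict[OF Ck_on_imp_continuous_on[OF Ck_on_volume_density[OF assms]]])
  show "restrict_space V (\<psi> ` U) =
    distr (density (restrict_space lborel U) (\<lambda>u. ennreal (vol \<psi> u))) (restrict_space V (\<psi> ` U)) \<psi>"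
  proof (rule measure_eqI)
    fix A assume A: "A \<in> sets (restrict_space V (\<psi> ` U))"
    then have A': "A \<subseteq> \<psi> ` U" "A \<in> sets V" using sets_restrict_space_iff[OF im] by auto
    let ?d = "density (restrict_space lborel U) (\<lambda>u. ennreal (vol \<psi> u))"
    have pre: "\<psi> -` A \<inter> space (restrict_space lborel U) \<in> sets (restrict_space lborel U)"
      using m A by (rule measurable_sets)
    have sp: "space (restrict_space lborel U) = U" by (simp add: space_restrict_space)
    have "emeasure (distr ?d (restrict_space V (\<psi> ` U)) \<psi>) A = emeasure ?d (\<psi> -` A \<inter> U)"
      using m A by (subst emeasure_distr) (auto simp: sp)
    also have "\<dots> = (\<integral>\<^sup>+u. ennreal (vol \<psi> u) * indicator (\<psi> -` A \<inter> U) u \<partial>restrict_space lborel U)"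
      using v pre by (subst emeasure_density) (auto simp: sp)
    also have "\<dots> = (\<integral>\<^sup>+u. ennreal (vol \<psi> u) * indicator (\<psi> -` A \<inter> U) u * indicator U u \<partial>lborel)"
      using Ub by (subst nn_integral_restrict_space) auto
    also have "\<dots> = (\<integral>\<^sup>+u\<in>{u\<in>U. \<psi> u \<in> A}. ennreal (vol \<psi> u) \<partial>lborel)"
      by (intro nn_integral_cong) (auto split: split_indicator)
    also have "\<dots> = emeasure V A" using emeasure_chart[OF assms A'(2,1)] ..
    also have "\<dots> = emeasure (restrict_space V (\<psi> ` U)) A" using A' im by (simp add: emeasure_restrict_space)
    finally show "emeasure (restrict_space V (\<psi> ` U)) A = emeasure (distr ?d (restrict_space V (\<psi> ` U)) \<psi>) A" ..
  qed simp
qed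

lemma chart_nn_integral:
  assumes c: "chart U \<psi>" and F: "F \<in> borel_measurable V"
    and z: "\<And>x. x \<in> M \<Longrightarrow> x \<notin> \<psi> ` U \<Longrightarrow> F x = 0"
  shows "(\<integral>\<^sup>+x. F x \<partial>V) = (\<integral>\<^sup>+u. ennreal (vol \<psi> u) * F (\<psi> u) * indicator U u \<partial>lborel)"
proof -
  note D = local_paramD[OF c] and m = restrict_V_eq[OF c]
  have im: "\<psi> ` U \<inter> space V \<in> sets V" using chart_image_sets[OF c] D(5) by (simp add: space_V Int_absorb2)
  have F': "F \<in> borel_measurable (restrict_space V (\<psi> ` U))" using F by (rule measurable_restrict_space1)
  have "(\<integral>\<^sup>+x. F x \<partial>V) = (\<integral>\<^sup>+x. F x * indicator (\<psi> ` U) x \<partial>V)"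
    using z by (intro nn_integral_cong) (auto simp: space_V split: split_indicator)
  also have "\<dots> = (\<integral>\<^sup>+x. F x \<partial>restrict_space V (\<psi> ` U))" using im by (simp add: nn_integral_restrict_space)
  also have "\<dots> = (\<integral>\<^sup>+u. F (\<psi> u) \<partial>density (restrict_space lborel U) (\<lambda>u. ennreal (vol \<psi> u)))"
    using m(2) F' by (subst m(1), subst nn_integral_distr) auto
  also have "\<dots> = (\<integral>\<^sup>+u. ennreal (vol \<psi> u) * F (\<psi> u) \<partial>restrict_space lborel U)"
    using m measurable_compose[OF m(2) F'] by (subst nn_integral_density) auto
  also have "\<dots> = (\<integral>\<^sup>+u. ennreal (vol \<psi> u) * F (\<psi> u) * indicator U u \<partial>lborel)"
    using D(1) by (subst nn_integral_restrict_space) auto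
  finally show ?thesis .
qed

lemma chart_integral:
  fixes F :: "real ^ 'D \<Rightarrow> real"
  assumes c: "chart U \<psi>" and F: "F \<in> borel_measurable V"
    and z: "\<And>x. x \<in> M \<Longrightarrow> x \<notin> \<psi> ` U \<Longrightarrow> F x = 0"
  shows "(LINT x|V. F x) = (LINT u|lborel. indicator U u * (vol \<psi> u * F (\<psi> u)))"
proof -
  note D = local_paramD[OF c] and m = restrict_V_eq[OF c]
  have im: "\<psi> ` U \<inter> space V \<in> sets V" using chart_image_sets[OF c] D(5) by (simp add: space_V Int_absorb2)
  have F': "F \<in> borel_measurable (restrict_space V (\<psi> ` U))" using F by (rule measurable_restrict_space1)
  have "(LINT x|V. F x) = (LINT x|V. indicator (\<psi> ` U) x *\<^sub>R F x)"
    using z by (intro LINT_cong) (auto simp: space_V split: split_indicator)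
  also have "\<dots> = (\<integral>x. F x \<partial>restrict_space V (\<psi> ` U))" using im by (simp add: integral_restrict_space)
  also have "\<dots> = (\<integral>u. F (\<psi> u) \<partial>density (restrict_space lborel U) (\<lambda>u. ennreal (vol \<psi> u)))"
    using m(2) F' by (subst m(1), subst integral_distr) auto
  also have "\<dots> = (\<integral>u. vol \<psi> u *\<^sub>R F (\<psi> u) \<partial>restrict_space lborel U)"
  proof (rule integral_density)
    show "(\<lambda>u. F (\<psi> u)) \<in> borel_measurable (restrict_space lborel U)" using measurable_compose[OF m(2) F'] .
    show "AE u in restrict_space lborel U. 0 \<le> vol \<psi> u"
      using volume_density_pos[OF c] by (intro AE_I2) (auto simp: space_restrict_space less_imp_le)
  qed (rule m(3))
  also have "\<dots> = (LINT u|lborel. indicator U u *\<^sub>R (vol \<psi> u *\<^sub>R F (\<psi> u)))"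
    using D(1) by (subst integral_restrict_space) auto
  finally show ?thesis by simp
qed

lemma inv_chart_compact:
  assumes c: "chart U \<psi>" and K: "compact K" "K \<subseteq> \<psi> ` U"
  shows "compact (inv_into U \<psi> ` K)" "inv_into U \<psi> ` K \<subseteq> U" "\<psi> ` inv_into U \<psi> ` K = K"
    "\<And>u. u \<in> U \<Longrightarrow> \<psi> u \<in> K \<longleftrightarrow> u \<in> inv_into U \<psi> ` K"
proof -
  note D = local_paramD[OF c]
  show "compact (inv_into U \<psi> ` K)"
    using D(7) K compact_continuous_image continuous_on_subset by blast
  show "inv_into U \<psi> ` K \<subseteq> U" using K(2) by (auto intro: inv_into_into)
  show eq: "\<psi> ` inv_into U \<psi> ` K = K" using K(2) by (force simp: f_inv_into_f subset_iff image_iff)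
  show "\<And>u. u \<in> U \<Longrightarrow> \<psi> u \<in> K \<longleftrightarrow> u \<in> inv_into U \<psi> ` K"
    using eq D(6) by (metis (no_types, lifting) imageI inv_into_f_f)
qed

lemma chart_cball:
  assumes c: "chart U \<psi>" "u \<in> U"
  obtains \<delta> where "\<delta> > 0" "cball (\<psi> u) \<delta> \<inter> M \<subseteq> \<psi> ` U"
  using local_paramD(4)[OF c(1)] c(2) by (metis imageI openin_contains_cball)

text \<open>\<open>K i\<close> plays the role of the support of \<open>\<eta> i\<close>: a compact
  set inside the chart image, outside of which \<open>\<eta> i\<close> vanishes on
  \<open>M\<close>.\<close>

definition chart_partition :: "(real ^ 'D) set \<Rightarrow> (real ^ 'D \<Rightarrow> real ^ 'D \<Rightarrow> real) \<Rightarrow> (real ^ 'D \<Rightarrow> (real ^ 'D) set) \<Rightarrow>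
    (real ^ 'D \<Rightarrow> (real ^ 'd) set) \<Rightarrow> (real ^ 'D \<Rightarrow> real ^ 'd \<Rightarrow> real ^ 'D) \<Rightarrow> bool" where
  "chart_partition X \<eta> K U \<psi> \<longleftrightarrow> finite X \<and>
     (\<forall>i\<in>X. Ck_manifold 3 (\<eta> i) \<and> chart (U i) (\<psi> i) \<and> compact (K i) \<and> K i \<subseteq> \<psi> i ` U i \<and>
        (\<forall>y\<in>M. y \<notin> K i \<longrightarrow> \<eta> i y = 0)) \<and>
     (\<forall>y\<in>M. (\<Sum>i\<in>X. \<eta> i y) = 1)"

lemma chart_partitionD:
  assumes "chart_partition X \<eta> K U \<psi>"
  shows "finite X" "\<And>i. i \<in> X \<Longrightarrow> Ck_manifold 3 (\<eta> i)" "\<And>i. i \<in> X \<Longrightarrow> chart (U i) (\<psi> i)"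
    "\<And>i. i \<in> X \<Longrightarrow> compact (K i)" "\<And>i. i \<in> X \<Longrightarrow> K i \<subseteq> \<psi> i ` U i"
    "\<And>i y. i \<in> X \<Longrightarrow> y \<in> M \<Longrightarrow> y \<notin> K i \<Longrightarrow> \<eta> i y = 0" "\<And>y. y \<in> M \<Longrightarrow> (\<Sum>i\<in>X. \<eta> i y) = 1"
  using assms unfolding chart_partition_def by blast+

text \<open>Open balls whose closures meet \<open>M\<close> inside chart images cover
  \<open>M\<close>; finitely many suffice. The bumps on them are positive on the open balls and
  vanish off the closed ones, so their sum is positive on \<open>M\<close> and can be divided
  by.\<close>

lemma partition_of_unity:
  obtains X \<eta> K U \<psi> where "chart_partition X \<eta> K U \<psi>"
proof -
  have "\<forall>x\<in>M. \<exists>\<delta> (U :: (real ^ 'd) set) \<psi>. \<delta> > 0 \<and> chart U \<psi> \<and> cball x \<delta> \<inter> M \<subseteq> \<psi> ` U"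
  proof
    fix x assume "x \<in> M"
    from chart_exists[OF this] obtain U and \<psi> u where c: "chart U \<psi>" "u \<in> U" "\<psi> u = x" .
    show "\<exists>\<delta> (U :: (real ^ 'd) set) \<psi>. \<delta> > 0 \<and> chart U \<psi> \<and> cball x \<delta> \<inter> M \<subseteq> \<psi> ` U"
      using chart_cball[OF c(1,2)] c by metis
  qed
  then obtain \<delta> and U :: "real ^ 'D \<Rightarrow> (real ^ 'd) set" and \<psi> where
    \<delta>: "\<And>x. x \<in> M \<Longrightarrow> \<delta> x > 0" and c: "\<And>x. x \<in> M \<Longrightarrow> chart (U x) (\<psi> x)"
    and sub: "\<And>x. x \<in> M \<Longrightarrow> cball x (\<delta> x) \<inter> M \<subseteq> \<psi> x ` U x"
    by metis
  obtain X where X: "X \<subseteq> M" "finite X" "M \<subseteq> (\<Union>x\<in>X. ball x (\<delta> x))"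
    using compactE_image[OF compact_M, of M "\<lambda>x. ball x (\<delta> x)"] \<delta> by force
  define S where "S y = (\<Sum>x\<in>X. bump x (\<delta> x) y)" for y
  have S: "S y > 0" if y: "y \<in> M" for y
  proof -
    obtain x where x: "x \<in> X" "y \<in> ball x (\<delta> x)" using X(3) y by blast
    have "0 < bump x (\<delta> x) y" using x by (intro bump_pos) auto
    also have "\<dots> \<le> S y" unfolding S_def using X(2) x(1) bump_nonneg by (intro member_le_sum) auto
    finally show ?thesis .
  qed
  have "chart_partition X (\<lambda>x y. bump x (\<delta> x) y / S y) (\<lambda>x. cball x (\<delta> x) \<inter> M) U \<psi>"
    unfolding chart_partition_def
  proof (intro conjI ballI impI)
    show "finite X" by fact
    fix x assume x: "x \<in> X"
    then have xM: "x \<in> M" using X(1) by blast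
    show "Ck_manifold 3 (\<lambda>y. bump x (\<delta> x) y / S y)"
      unfolding S_def using S[unfolded S_def]
      by (intro Ck_manifold_divide Ck_manifold_sum Ck_manifold_bump) fastforce
    show "chart (U x) (\<psi> x)" "cball x (\<delta> x) \<inter> M \<subseteq> \<psi> x ` U x" using c[OF xM] sub[OF xM] by simp_all
    show "compact (cball x (\<delta> x) \<inter> M)" using compact_M by (simp add: compact_Int)
    fix y assume "y \<in> M" "y \<notin> cball x (\<delta> x) \<inter> M"
    then show "bump x (\<delta> x) y / S y = 0" using \<delta>[OF xM] bump_zero[of "\<delta> x" x y] by force
  next
    fix y assume "y \<in> M"
    from S[OF this] show "(\<Sum>x\<in>X. bump x (\<delta> x) y / S y) = 1"
      by (simp add: sum_divide_distrib[symmetric] S_def)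
  qed
  then show ?thesis by (rule that)
qed

text \<open>On compact sets the chart expands distances by at least \<open>a\<close>, so the
  integral compares with a Euclidean Gaussian. The centre \<open>y\<close> may lie anywhere;
  replacing it by a nearest point of \<open>K\<close> at most doubles distances, which turns
  \<open>a\<close> into a / 2 and explains a^2 / 4.\<close>

lemma chart_gaussian_bound:
  assumes c: "chart U \<psi>" and K: "compact K" "K \<subseteq> \<psi> ` U"
  shows "\<exists>C>0. \<forall>b y. b > 0 \<longrightarrow> (\<integral>\<^sup>+x\<in>K. ennreal (gauss b (x - y)) \<partial>V)
      \<le> ennreal (C * b powr (- real CARD('d) / 2))"
proof (cases "K = {}")
  case True
  then show ?thesis by (intro exI[of _ 1]) auto
next
  case False
  note D = local_paramD[OF c]
  let ?L = "inv_into U \<psi> ` K"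
  note L = inv_chart_compact[OF c K]
  obtain a where a: "a > 0" "\<And>u v. u \<in> ?L \<Longrightarrow> v \<in> ?L \<Longrightarrow> a * norm (u - v) \<le> norm (\<psi> u - \<psi> v)"
    using chart_compact_lower_bound[OF c L(1,2)] by blast
  have "continuous_on ?L (vol \<psi>)"
    using Ck_on_imp_continuous_on[OF Ck_on_volume_density[OF c]] L(2) continuous_on_subset by blast
  then obtain B where B: "B \<ge> 0" "\<And>u. u \<in> ?L \<Longrightarrow> norm (vol \<psi> u) \<le> B"
    using compact_continuous_bound[OF L(1)] by blast
  obtain G where G: "G > 0"
    "\<And>\<beta>. \<beta> > 0 \<Longrightarrow> (\<integral>\<^sup>+u. ennreal (gauss \<beta> u) \<partial>(lborel :: (real ^ 'd) measure)) \<le>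
       ennreal (G * \<beta> powr (- real CARD('d) / 2))" using nn_integral_gaussian by blast
  let ?C = "(B + 1) * G * (a\<^sup>2 / 4) powr (- real CARD('d) / 2)"
  show ?thesis
  proof (intro exI[of _ ?C] conjI allI impI)
    show "?C > 0" using B G a by (simp add: add_nonneg_pos)
    fix b :: real and y assume b: "b > 0"
    have KV: "K \<in> sets V" using K D(5) by (auto simp: in_sets_V borel_closed compact_imp_closed)
    obtain y' where y': "y' \<in> K" "\<And>x. x \<in> K \<Longrightarrow> dist y y' \<le> dist y x"
      using distance_attains_inf[OF compact_imp_closed[OF K(1)] False] by metis
    obtain v where v: "v \<in> ?L" "\<psi> v = y'" using L(3) y'(1) by (metis imageE)
    let ?\<beta> = "b * (a\<^sup>2 / 4)"
    have [measurable]: "(\<lambda>x. x) \<in> borel_measurable V" by (rule id_measurable_V)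
    have [measurable]: "K \<in> sets V" by (rule KV)
    have "(\<integral>\<^sup>+x\<in>K. ennreal (gauss b (x - y)) \<partial>V)
       = (\<integral>\<^sup>+u. ennreal (vol \<psi> u) * (ennreal (gauss b (\<psi> u - y)) * indicator K (\<psi> u)) * indicator U u \<partial>lborel)"
      by (rule chart_nn_integral[OF c]) (use K(2) in \<open>auto split: split_indicator\<close>)
    also have "\<dots> \<le> (\<integral>\<^sup>+u. ennreal (B + 1) * ennreal (gauss ?\<beta> (u + - v)) \<partial>lborel)"
    proof (rule nn_integral_mono)
      fix u :: "real ^ 'd"
      show "ennreal (vol \<psi> u) * (ennreal (gauss b (\<psi> u - y)) * indicator K (\<psi> u)) * indicator U u
          \<le> ennreal (B + 1) * ennreal (gauss ?\<beta> (u + - v))"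
      proof (cases "u \<in> U \<and> \<psi> u \<in> K")
        case True
        then have uL: "u \<in> ?L" using L(4) by blast
        have "a * norm (u - v) \<le> norm (\<psi> u - y')" using a(2)[OF uL v(1)] v(2) by simp
        also have "\<dots> \<le> norm (\<psi> u - y) + norm (y - y')" by (rule norm_triangle_sub[of "\<psi> u - y'" "\<psi> u - y", THEN order_trans]) simp
        also have "norm (y - y') \<le> norm (\<psi> u - y)" using y'(2)[of "\<psi> u"] True by (simp add: dist_norm norm_minus_commute)
        finally have "a / 2 * norm (u - v) \<le> norm (\<psi> u - y)" by simp
        then have "(a / 2 * norm (u - v))\<^sup>2 \<le> (norm (\<psi> u - y))\<^sup>2" using a by (intro power_mono) auto
        then have "b * (a / 2 * norm (u - v))\<^sup>2 \<le> b * (norm (\<psi> u - y))\<^sup>2" using b by (intro mult_left_mono) auto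
        then have "?\<beta> * (norm (u - v))\<^sup>2 \<le> b * (norm (\<psi> u - y))\<^sup>2" by (simp add: power_mult_distrib power_divide)
        then have "gauss b (\<psi> u - y) \<le> gauss ?\<beta> (u - v)" by simp
        moreover have "vol \<psi> u \<le> B + 1" using B(2)[OF uL] by simp
        ultimately show ?thesis using True by (auto intro!: mult_mono ennreal_leI)
      next
        case False
        then have z: "(indicator K (\<psi> u) :: ennreal) * indicator U u = 0" by (auto split: split_indicator)
        have "ennreal (vol \<psi> u) * (ennreal (gauss b (\<psi> u - y)) * indicator K (\<psi> u)) * indicator U u
          = ennreal (vol \<psi> u) * ennreal (gauss b (\<psi> u - y)) * (indicator K (\<psi> u) * indicator U u)"
          by (simp only: mult.assoc)
        then show ?thesis unfolding z mult_zero_right by (rule ord_eq_le_trans) (rule zero_le)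
      qed
    qed
    also have "\<dots> = ennreal (B + 1) * (\<integral>\<^sup>+u. ennreal (gauss ?\<beta> (u + - v)) \<partial>lborel)"
      by (rule nn_integral_cmult) simp
    also have "(\<integral>\<^sup>+u. ennreal (gauss ?\<beta> (u + - v)) \<partial>lborel) = (\<integral>\<^sup>+u. ennreal (gauss ?\<beta> u) \<partial>(lborel :: (real ^ 'd) measure))"
      by (rule nn_integral_lborel_translate[where F="\<lambda>u. ennreal (gauss ?\<beta> u)"]) simp
    also have "ennreal (B + 1) * \<dots> \<le> ennreal (B + 1) * ennreal (G * ?\<beta> powr (- real CARD('d) / 2))"
      using b a by (intro mult_left_mono G(2)) auto
    also have "\<dots> = ennreal ((B + 1) * (G * ?\<beta> powr (- real CARD('d) / 2)))"
      using B G by (intro ennreal_mult[symmetric]) auto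
    also have "(B + 1) * (G * ?\<beta> powr (- real CARD('d) / 2)) = ?C * b powr (- real CARD('d) / 2)"
    proof -
      have "?\<beta> powr (- real CARD('d) / 2) = b powr (- real CARD('d) / 2) * (a\<^sup>2 / 4) powr (- real CARD('d) / 2)"
        by (rule powr_mult)
      then show ?thesis by (simp only: mult_ac)
    qed
    finally show "(\<integral>\<^sup>+x\<in>K. ennreal (gauss b (x - y)) \<partial>V) \<le> ennreal (?C * b powr (- real CARD('d) / 2))" .
  qed
qed

lemma gaussian_bound:
  "\<exists>C>0. \<forall>b y. b > 0 \<longrightarrow> (\<integral>\<^sup>+x. ennreal (gauss b (x - y)) \<partial>V)
      \<le> ennreal (C * b powr (- real CARD('d) / 2))"
proof -
  obtain X \<eta> K U \<psi> where P: "chart_partition X \<eta> K U \<psi>" by (rule partition_of_unity)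
  note X = chart_partitionD(1)[OF P] and c = chart_partitionD(3)[OF P] and K = chart_partitionD(4,5)[OF P]
    and z = chart_partitionD(6)[OF P] and s = chart_partitionD(7)[OF P]
  have "\<forall>i\<in>X. \<exists>C>0. \<forall>b y. b > 0 \<longrightarrow> (\<integral>\<^sup>+x\<in>K i. ennreal (gauss b (x - y)) \<partial>V)
      \<le> ennreal (C * b powr (- real CARD('d) / 2))"
  proof
    fix i assume i: "i \<in> X"
    show "\<exists>C>0. \<forall>b y. b > 0 \<longrightarrow> (\<integral>\<^sup>+x\<in>K i. ennreal (gauss b (x - y)) \<partial>V)
      \<le> ennreal (C * b powr (- real CARD('d) / 2))"
      by (rule chart_gaussian_bound[OF c[OF i] K(1)[OF i] K(2)[OF i]])
  qed
  from bchoice[OF this] obtain C where C': "\<forall>i\<in>X. C i > 0 \<and> (\<forall>b y. b > 0 \<longrightarrow> (\<integral>\<^sup>+x\<in>K i. ennreal (gauss b (x - y)) \<partial>V)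
      \<le> ennreal (C i * b powr (- real CARD('d) / 2)))" by (elim exE)
  have C: "\<And>i. i \<in> X \<Longrightarrow> C i > 0"
    "\<And>i b y. i \<in> X \<Longrightarrow> b > 0 \<Longrightarrow> (\<integral>\<^sup>+x\<in>K i. ennreal (gauss b (x - y)) \<partial>V)
      \<le> ennreal (C i * b powr (- real CARD('d) / 2))" using C' by simp_all
  show ?thesis
  proof (intro exI[of _ "sum C X + 1"] conjI allI impI)
    have "sum C X \<ge> 0" using C(1) by (intro sum_nonneg) (auto simp: less_imp_le)
    then show "sum C X + 1 > 0" by simp
    fix b :: real and y assume b: "b > 0"
    have [measurable]: "(\<lambda>x. x) \<in> borel_measurable V" by (rule id_measurable_V)
    have [measurable]: "K i \<in> sets V" if "i \<in> X" for i
      using K[OF that] local_paramD(5)[OF c[OF that]] by (auto simp: in_sets_V borel_closed compact_imp_closed)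
    have "(\<integral>\<^sup>+x. ennreal (gauss b (x - y)) \<partial>V) \<le> (\<integral>\<^sup>+x. (\<Sum>i\<in>X. ennreal (gauss b (x - y)) * indicator (K i) x) \<partial>V)"
    proof (rule nn_integral_mono)
      fix x assume "x \<in> space V"
      then have x: "x \<in> M" by (simp add: space_V)
      have "\<exists>i\<in>X. x \<in> K i"
      proof (rule ccontr)
        assume "\<not> (\<exists>i\<in>X. x \<in> K i)"
        then have "(\<Sum>i\<in>X. \<eta> i x) = 0" using z x by (intro sum.neutral) auto
        then show False using s[OF x] by simp
      qed
      then obtain i where i: "i \<in> X" "x \<in> K i" by blast
      have "ennreal (gauss b (x - y)) = ennreal (gauss b (x - y)) * indicator (K i) x" using i by simp
      also have "\<dots> \<le> (\<Sum>i\<in>X. ennreal (gauss b (x - y)) * indicator (K i) x)"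
        using X i by (intro member_le_sum) auto
      finally show "ennreal (gauss b (x - y)) \<le> (\<Sum>i\<in>X. ennreal (gauss b (x - y)) * indicator (K i) x)" .
    qed
    also have "\<dots> = (\<Sum>i\<in>X. (\<integral>\<^sup>+x\<in>K i. ennreal (gauss b (x - y)) \<partial>V))"
      by (rule nn_integral_sum) measurable
    also have "\<dots> \<le> (\<Sum>i\<in>X. ennreal (C i * b powr (- real CARD('d) / 2)))"
      using C(2) b by (intro sum_mono) auto
    also have "\<dots> = ennreal (sum C X * b powr (- real CARD('d) / 2))"
      using C(1) by (subst sum_ennreal) (auto simp: less_imp_le sum_distrib_right)
    also have "\<dots> \<le> ennreal ((sum C X + 1) * b powr (- real CARD('d) / 2))"
      by (intro ennreal_leI mult_right_mono) auto
    finally show "(\<integral>\<^sup>+x. ennreal (gauss b (x - y)) \<partial>V) \<le> ennreal ((sum C X + 1) * b powr (- real CARD('d) / 2))" .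
  qed
qed

text \<open>Naming the constant allows \<open>C2\<close> to be formed from it before any density is
  given.\<close>

definition gaussian_const :: "real \<Rightarrow> bool" where
  "gaussian_const G \<longleftrightarrow> G > 0 \<and> (\<forall>b y. b > 0 \<longrightarrow> (\<integral>\<^sup>+x. ennreal (gauss b (x - y)) \<partial>V)
     \<le> ennreal (G * b powr (- real CARD('d) / 2)))"

lemma gaussian_constD:
  assumes "gaussian_const G"
  shows "G > 0" "\<And>b y. b > 0 \<Longrightarrow> (\<integral>\<^sup>+x. ennreal (gauss b (x - y)) \<partial>V) \<le> ennreal (G * b powr (- real CARD('d) / 2))"
  using assms unfolding gaussian_const_def by blast+

lemma gaussian_constE: obtains G where "gaussian_const G"
  using gaussian_bound unfolding gaussian_const_def by blast

text \<open>On the bounded set \<open>M\<close> the constant 1 is dominated by a multiple of one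
  fixed Gaussian, so finiteness of the volume is a special case of the Gaussian bound.\<close>

lemma finite_measure_V: "finite_measure V"
proof
  obtain R where R: "R > 0" "M \<subseteq> ball 0 R" using compact_M compact_imp_bounded bounded_subset_ballD by blast
  obtain C where C: "C > 0" "\<And>b y. b > 0 \<Longrightarrow> (\<integral>\<^sup>+x. ennreal (gauss b (x - y)) \<partial>V)
      \<le> ennreal (C * b powr (- real CARD('d) / 2))" using gaussian_bound by blast
  have [measurable]: "(\<lambda>x. x) \<in> borel_measurable V" by (rule id_measurable_V)
  have "emeasure V (space V) = (\<integral>\<^sup>+x. 1 \<partial>V)" by simp
  also have "\<dots> \<le> (\<integral>\<^sup>+x. ennreal (exp (R\<^sup>2)) * ennreal (gauss 1 (x - 0)) \<partial>V)"
  proof (rule nn_integral_mono)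
    fix x assume "x \<in> space V"
    then have "norm x \<le> R" using R by (auto simp: space_V)
    then have "(norm x)\<^sup>2 \<le> R\<^sup>2" by (intro power_mono) auto
    then have "1 \<le> exp (R\<^sup>2) * gauss 1 (x - 0)" by (simp add: exp_add[symmetric])
    then show "1 \<le> ennreal (exp (R\<^sup>2)) * ennreal (gauss 1 (x - 0))"
      by (simp add: ennreal_mult[symmetric] ennreal_leI flip: ennreal_1)
  qed
  also have "\<dots> = ennreal (exp (R\<^sup>2)) * (\<integral>\<^sup>+x. ennreal (gauss 1 (x - 0)) \<partial>V)"
    by (rule nn_integral_cmult) measurable
  also have "\<dots> \<le> ennreal (exp (R\<^sup>2)) * ennreal (C * 1 powr (- real CARD('d) / 2))"
    by (intro mult_left_mono C(2)) auto
  also have "\<dots> < \<infinity>" by (simp add: ennreal_mult_less_top)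
  finally show "emeasure V (space V) \<noteq> \<infinity>" by simp
qed

lemma continuous_integrable_V:
  fixes f :: "real ^ 'D \<Rightarrow> real"
  assumes "continuous_on M f"
  shows "integrable V f"
proof -
  interpret finite_measure V by (rule finite_measure_V)
  obtain B where "\<And>x. x \<in> M \<Longrightarrow> norm (f x) \<le> B" using compact_continuous_bound[OF compact_M assms] by blast
  then show ?thesis
    by (intro integrable_const_bound[of _ B] continuous_measurable_V[OF assms] AE_I2) (simp add: space_V)
qed

end

section \<open>Integration by parts in Euclidean space\<close>

lemma compact_support_integrable:
  fixes g :: "'a::euclidean_space \<Rightarrow> real"
  assumes "compact K" "continuous_on K g" "\<And>x. x \<notin> K \<Longrightarrow> g x = 0"
  shows "integrable lborel g"
proof -
  have "integrable lborel (\<lambda>x. indicator K x *\<^sub>R g x)" using assms(1,2) by (rule borel_integrable_compact)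
  also have "(\<lambda>x. indicator K x *\<^sub>R g x) = g" using assms(3) by (auto simp: fun_eq_iff indicator_def)
  finally show ?thesis .
qed

lemma integral_lborel_translate:
  fixes F :: "'a::euclidean_space \<Rightarrow> real"
  assumes "F \<in> borel_measurable borel"
  shows "(LINT x|lborel. F (x + c)) = (LINT x|lborel. F x)"
proof -
  have "(LINT x|lborel. F x) = (\<integral>x. F x \<partial>distr lborel borel ((+) c))" by (simp add: lborel_distr_plus)
  also have "\<dots> = (LINT x|lborel. F (c + x))" using assms by (intro integral_distr) auto
  finally show ?thesis by (simp add: add.commute)
qed

text \<open>Difference quotients of a compactly supported function have integral zero by translation
  invariance. With steps of size at most 1 they are bounded and supported in one ball, so dominated
  convergence passes to the derivative.\<close>

lemma integral_directional_derivative_zero: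
  fixes H :: "'a::euclidean_space \<Rightarrow> real"
  assumes diff: "\<And>x. (H has_derivative H' x) (at x)" and cont: "continuous_on UNIV (\<lambda>x. H' x e)"
    and K: "compact K" "\<And>x. x \<notin> K \<Longrightarrow> H x = 0"
  shows "(LINT x|lborel. H' x e) = 0"
proof -
  obtain R where R: "R > 0" "K \<subseteq> ball 0 R" using K(1) compact_imp_bounded bounded_subset_ballD by blast
  have Hc: "continuous_on A H" for A by (intro continuous_at_imp_continuous_on ballI has_derivative_continuous[OF diff])
  then have Hm[measurable]: "H \<in> borel_measurable borel" by (rule borel_measurable_continuous_onI)
  have Hi: "integrable lborel H" using compact_support_integrable[OF K(1) Hc K(2)] .
  have [measurable]: "(\<lambda>x. H' x e) \<in> borel_measurable borel" using cont by (rule borel_measurable_continuous_onI)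
  define s where "s n x = real (Suc n) * (H (x + (1 / real (Suc n)) *\<^sub>R e) - H x)" for n x
  obtain B where B: "B \<ge> 0" "\<And>x. x \<in> cball 0 (R + 2 * norm e) \<Longrightarrow> norm (H' x e) \<le> B"
    using compact_continuous_bound[OF compact_cball continuous_on_subset[OF cont subset_UNIV]] by blast
  have der: "((\<lambda>t. H (x + t *\<^sub>R e)) has_real_derivative H' (x + t *\<^sub>R e) e) (at t)" for x t
  proof -
    have "((\<lambda>t. H (x + t *\<^sub>R e)) has_derivative (\<lambda>h. H' (x + t *\<^sub>R e) (h *\<^sub>R e))) (at t)"
      by (rule has_derivative_compose[OF _ diff]) (auto intro!: derivative_eq_intros)
    moreover have "H' (x + t *\<^sub>R e) (h *\<^sub>R e) = H' (x + t *\<^sub>R e) e * h" for h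
      using has_derivative_linear[OF diff] by (simp add: linear_scale)
    ultimately show ?thesis by (simp add: has_field_derivative_def)
  qed
  have lim: "(\<lambda>n. s n x) \<longlonglongrightarrow> H' x e" for x
  proof -
    have "((\<lambda>h. (H (x + h *\<^sub>R e) - H x) / h) \<longlongrightarrow> H' x e) (at 0)"
      using der[of x 0] by (simp add: DERIV_def)
    moreover have "filterlim (\<lambda>n. 1 / real (Suc n)) (at 0) sequentially"
      using LIMSEQ_inverse_real_of_nat by (auto simp: filterlim_at inverse_eq_divide)
    ultimately have "(\<lambda>n. (H (x + (1 / real (Suc n)) *\<^sub>R e) - H x) / (1 / real (Suc n))) \<longlonglongrightarrow> H' x e"
      by (rule filterlim_compose)
    then show ?thesis by (simp add: s_def mult.commute)
  qed
  have bnd: "norm (s n x) \<le> B * indicator (cball 0 (R + norm e)) x" for n x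
  proof -
    define t where "t = 1 / real (Suc n)"
    have t: "0 < t" "t \<le> 1" by (auto simp: t_def)
    show ?thesis
    proof (cases "x \<in> cball 0 (R + norm e)")
      case True
      have "norm (H (x + t *\<^sub>R e) - H (x + 0 *\<^sub>R e)) \<le> B * norm (t - 0)"
      proof (rule field_differentiable_bound[where S="{0..1}"])
        fix z :: real assume z: "z \<in> {0..1}"
        show "((\<lambda>t. H (x + t *\<^sub>R e)) has_field_derivative H' (x + z *\<^sub>R e) e) (at z within {0..1})"
          using der has_field_derivative_at_within by blast
        have "norm (x + z *\<^sub>R e) \<le> norm x + norm e"
          using z by (intro order_trans[OF norm_triangle_ineq] add_left_mono) (auto intro: mult_left_le_one_le)
        then show "norm (H' (x + z *\<^sub>R e) e) \<le> B" using True by (intro B(2)) auto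
      qed (use t in auto)
      then have "real (Suc n) * \<bar>H (x + t *\<^sub>R e) - H x\<bar> \<le> real (Suc n) * (B * t)"
        using t by (intro mult_left_mono) auto
      also have "\<dots> = B" by (simp add: t_def)
      finally show ?thesis using True by (simp add: s_def t_def abs_mult)
    next
      case False
      then have x: "norm x > R + norm e" by simp
      then have "norm (x + t *\<^sub>R e) > R"
        using norm_triangle_ineq2[of x "- (t *\<^sub>R e)"] t mult_left_le_one_le[of "norm e" t] by simp
      then have "x + t *\<^sub>R e \<notin> K" using R(2) by (auto simp: subset_iff)
      moreover have "x \<notin> K"
      proof
        assume "x \<in> K"
        then have "norm x < R" using R(2) by auto
        then show False using x norm_ge_zero[of e] by linarith
      qed
      ultimately show ?thesis using K(2) B(1) by (simp add: s_def t_def)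
    qed
  qed
  have int0: "(LINT x|lborel. s n x) = 0" for n
  proof -
    let ?c = "(1 / real (Suc n)) *\<^sub>R e"
    have "integrable lborel (\<lambda>x. H (x + ?c))"
    proof (rule compact_support_integrable[of "(\<lambda>x. x - ?c) ` K"])
      show "compact ((\<lambda>x. x - ?c) ` K)" using K(1) by (intro compact_continuous_image continuous_intros)
      show "continuous_on ((\<lambda>x. x - ?c) ` K) (\<lambda>x. H (x + ?c))"
        by (intro continuous_on_compose2[OF Hc[of UNIV]] continuous_intros) auto
      show "H (x + ?c) = 0" if "x \<notin> (\<lambda>x. x - ?c) ` K" for x
        using that K(2)[of "x + ?c"] by (force simp: image_iff)
    qed
    then have "(LINT x|lborel. s n x) = real (Suc n) * ((LINT x|lborel. H (x + ?c)) - (LINT x|lborel. H x))"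
      unfolding s_def using Hi by simp
    then show ?thesis using integral_lborel_translate[OF Hm] by simp
  qed
  have "(\<lambda>n. \<integral>x. s n x \<partial>lborel) \<longlonglongrightarrow> (LINT x|lborel. H' x e)"
  proof (rule integral_dominated_convergence[where w="\<lambda>x. B * indicator (cball 0 (R + norm e)) x"])
    show "s n \<in> borel_measurable lborel" for n unfolding s_def[abs_def] by measurable
    show "integrable lborel (\<lambda>x. B * indicator (cball 0 (R + norm e)) x)"
      by (intro integrable_mult_right integrable_real_indicator emeasure_bounded_finite) auto
  qed (use lim bnd in auto)
  then show ?thesis unfolding int0 by (simp add: LIMSEQ_const_iff)
qed

section \<open>Green's formula and chart independence of the Laplacian\<close>

context manifold
begin

text \<open>Non-empty relatively open subsets of \<open>M\<close> have positive volume, because the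
  density is positive in a chart. So an almost everywhere property holds at points arbitrarily near
  any given one.\<close>

lemma AE_V_dense:
  assumes ae: "AE y in V. P y" and x: "x \<in> M" and \<delta>: "\<delta> > 0"
  obtains y where "y \<in> M" "dist x y < \<delta>" "P y"
proof (rule ccontr)
  assume c: "\<not> thesis"
  then have np: "\<And>y. y \<in> M \<Longrightarrow> dist x y < \<delta> \<Longrightarrow> \<not> P y" using that by blast
  obtain U and \<psi> u where c: "chart U \<psi>" "u \<in> U" "\<psi> u = x" using chart_exists[OF x] .
  note D = local_paramD[OF c(1)]
  have "\<psi> ` U \<in> sets borel" using chart_image_sets[OF c(1)] in_sets_V by blast
  then have A: "ball x \<delta> \<inter> \<psi> ` U \<in> sets V" using D(5) unfolding in_sets_V by (intro conjI sets.Int) auto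
  have "AE y in V. y \<notin> ball x \<delta> \<inter> \<psi> ` U"
    using ae by eventually_elim (use np D(5) in auto)
  then have "emeasure V (ball x \<delta> \<inter> \<psi> ` U) = 0"
  proof (rule AE_iff_measurable[OF A, THEN iffD1, rotated])
    show "{y \<in> space V. \<not> (y \<notin> ball x \<delta> \<inter> \<psi> ` U)} = ball x \<delta> \<inter> \<psi> ` U"
      using D(5) by (auto simp: space_V)
  qed
  then have z: "(\<integral>\<^sup>+v\<in>{v\<in>U. \<psi> v \<in> ball x \<delta> \<inter> \<psi> ` U}. ennreal (vol \<psi> v) \<partial>lborel) = 0"
    using emeasure_chart[OF c(1) A] by simp
  have "continuous_on U \<psi>" using Ck_on_imp_continuous_on D(2) by blast
  then have "open (U \<inter> \<psi> -` ball x \<delta>)" using D(1) by (intro continuous_open_preimage) auto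
  moreover have "u \<in> U \<inter> \<psi> -` ball x \<delta>" using c \<delta> by auto
  ultimately obtain r where r: "r > 0" "ball u r \<subseteq> U \<inter> \<psi> -` ball x \<delta>" using openE by blast
  have vm: "(\<lambda>v. ennreal (vol \<psi> v) * indicator (ball u r) v) \<in> borel_measurable lborel"
  proof -
    have "continuous_on (ball u r) (vol \<psi>)"
      using Ck_on_imp_continuous_on[OF Ck_on_volume_density[OF c(1)]] r(2) continuous_on_subset by blast
    then have "(\<lambda>v. indicator (ball u r) v *\<^sub>R vol \<psi> v) \<in> borel_measurable borel"
      by (intro borel_measurable_continuous_on_indicator) auto
    then have "(\<lambda>v. ennreal (indicator (ball u r) v *\<^sub>R vol \<psi> v)) \<in> borel_measurable lborel" by simp
    then show ?thesis by (rule measurable_cong[THEN iffD1, rotated]) (auto split: split_indicator)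
  qed
  have "(\<integral>\<^sup>+v. ennreal (vol \<psi> v) * indicator (ball u r) v \<partial>lborel) \<le> 0"
    unfolding z[symmetric] using r(2) by (intro nn_integral_mono) (auto split: split_indicator)
  then have "AE v in lborel. ennreal (vol \<psi> v) * indicator (ball u r) v = 0"
    using nn_integral_0_iff_AE[OF vm] by simp
  then have "AE v in lborel. v \<notin> ball u r"
  proof eventually_elim
    case (elim v)
    show ?case
    proof
      assume v: "v \<in> ball u r"
      then have "vol \<psi> v > 0" using r(2) volume_density_pos[OF c(1)] by blast
      then show False using elim v by simp
    qed
  qed
  then have "emeasure lborel (ball u r) = 0"
    by (rule AE_iff_measurable[THEN iffD1, rotated 2]) auto
  then show False using content_ball_pos[OF r(1), of u] by (simp add: measure_def)
qed

lemma integral_zero_imp_zero: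
  assumes g: "continuous_on M g" "\<And>x. x \<in> M \<Longrightarrow> g x \<ge> 0" and z: "(LINT x|V. g x) = (0::real)" and x: "x \<in> M"
  shows "g x = 0"
proof (rule ccontr)
  assume "g x \<noteq> 0"
  then have p: "g x > 0" using g(2)[OF x] by simp
  have "AE y in V. 0 \<le> g y" using g(2) by (intro AE_I2) (simp add: space_V)
  then have ae: "AE y in V. g y = 0"
    using z integral_nonneg_eq_0_iff_AE[OF continuous_integrable_V[OF g(1)]] by simp
  obtain \<delta> where \<delta>: "\<delta> > 0" "\<And>y. y \<in> M \<Longrightarrow> dist y x < \<delta> \<Longrightarrow> dist (g y) (g x) < g x"
    using g(1) x p unfolding continuous_on_iff by metis
  obtain y where "y \<in> M" "dist x y < \<delta>" "g y = 0" using AE_V_dense[OF ae x \<delta>(1)] .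
  then show False using \<delta>(2)[of y] by (simp add: dist_commute dist_real_def)
qed

text \<open>The gradient depends only on values near the point, and the complement of
  \<open>K\<close> is open.\<close>

lemma grad_zero_outside:
  assumes K: "closed K" "\<And>y. y \<in> M \<Longrightarrow> y \<notin> K \<Longrightarrow> \<eta> y = 0" and x: "x \<in> M" "x \<notin> K"
  shows "grd \<eta> x = 0"
proof -
  obtain U and \<psi> u where c: "chart U \<psi>" "u \<in> U" "\<psi> u = x" using chart_exists[OF x(1)] .
  note D = local_paramD[OF c(1)]
  have "continuous_on U \<psi>" using Ck_on_imp_continuous_on D(2) by blast
  then have o: "open (U \<inter> \<psi> -` (- K))" using D(1) K(1) by (intro continuous_open_preimage) auto
  have d: "((\<eta> \<circ> \<psi>) has_derivative (\<lambda>h. 0)) (at u)"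
  proof (rule has_derivative_transform_within_open[OF has_derivative_const o])
    show "u \<in> U \<inter> \<psi> -` (- K)" using c x by auto
    show "0 = (\<eta> \<circ> \<psi>) v" if "v \<in> U \<inter> \<psi> -` (- K)" for v using that K(2)[of "\<psi> v"] D(5) by auto
  qed
  have "0 \<in> range (fderiv \<psi> u)"
    using linear_0[OF local_param_deriv(2)[OF c(1,2)]] by (metis rangeI)
  then show ?thesis unfolding c(3)[symmetric]
    using d frechet_derivative_at[OF d, symmetric] by (intro grad_eqI[OF c(1,2)]) (auto simp: differentiable_def)
qed

text \<open>This is the coordinate field whose divergence, divided by the volume density, is the
  Laplacian; integration by parts needs it to be C^1.\<close>

lemma Ck_on_flux:
  assumes c: "chart U \<psi>" and f: "Ck_manifold 2 f"
  shows "Ck_on (Suc 0) (\<lambda>w. vol \<psi> w *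
           (\<Sum>j\<in>UNIV. matrix_inv (metric_matrix \<psi> w) $ i $ j * partial j (f \<circ> \<psi>) w)) U"
proof -
  have "Ck_on (Suc 0) (partial j (f \<circ> \<psi>)) U" for j
  proof -
    have "Ck_manifold (Suc (Suc 0)) f" using f by (simp add: numeral_2_eq_2)
    then show ?thesis by (rule Ck_manifold_partial[OF _ c])
  qed
  then show ?thesis
    by (intro Ck_on_mult Ck_on_sum Ck_on_volume_density[OF c] Ck_on_metric_inv[OF c] local_paramD(1)[OF c])
qed

lemma continuous_laplace_local:
  assumes c: "chart U \<psi>" and f: "Ck_manifold 2 f"
  shows "continuous_on U (laplace_local \<psi> f)"
proof -
  have "continuous_on U (\<lambda>u. partial i (\<lambda>w. vol \<psi> w *
           (\<Sum>j\<in>UNIV. matrix_inv (metric_matrix \<psi> w) $ i $ j * partial j (f \<circ> \<psi>) w)) u)" for i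
    using Ck_on_flux[OF c f, of i] by (simp add: partial_def)
  moreover have "continuous_on U (vol \<psi>)"
    using Ck_on_imp_continuous_on[OF Ck_on_volume_density[OF c]] .
  moreover have "\<forall>u\<in>U. vol \<psi> u \<noteq> 0" using volume_density_pos[OF c] by force
  ultimately show ?thesis unfolding laplace_local_def[abs_def]
    by (intro continuous_on_mult continuous_on_divide continuous_on_const continuous_on_sum) auto
qed

text \<open>The divergence of \<eta> times the flux integrates to zero, and the product rule splits
  it into the Laplacian term and the inner product of gradients.\<close>

lemma green_chart:
  assumes c: "chart U \<psi>" and f: "Ck_manifold 2 f" and \<eta>: "Ck_manifold (Suc 0) \<eta>"
    and K: "compact K" "K \<subseteq> \<psi> ` U" and z: "\<And>y. y \<in> M \<Longrightarrow> y \<notin> K \<Longrightarrow> \<eta> y = 0"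
  shows "(LINT u|lborel. indicator U u * (vol \<psi> u * (\<eta> (\<psi> u) * laplace_local \<psi> f u)))
     = - (LINT x|V. grd \<eta> x \<bullet> grd f x)"
proof -
  note D = local_paramD[OF c] and L = inv_chart_compact[OF c K]
  let ?L = "inv_into U \<psi> ` K"
  define W where "W i w = vol \<psi> w *
           (\<Sum>j\<in>UNIV. matrix_inv (metric_matrix \<psi> w) $ i $ j * partial j (f \<circ> \<psi>) w)" for i w
  have W: "Ck_on (Suc 0) (W i) U" for i unfolding W_def[abs_def] by (rule Ck_on_flux[OF c f])
  have \<eta>c: "Ck_on (Suc 0) (\<eta> \<circ> \<psi>) U" using \<eta> c by (auto simp: Ck_manifold_def)
  have f1: "Ck_manifold (Suc 0) f" using f Ck_manifold_mono by (metis One_nat_def Suc_1 le_SucI le_refl)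
  have oL: "open (- ?L)" using L(1) compact_imp_closed by blast
  have z0: "\<eta> (\<psi> u) = 0" if "u \<in> U" "u \<notin> ?L" for u using that z[of "\<psi> u"] L(4) D(5) by blast
  \<comment> \<open>Extension by zero to the whole space. Differentiability is checked on two open
    sets that cover it: the chart domain, and the complement of the compact preimage of
    \<open>K\<close>, where \<open>H i\<close> vanishes.\<close>
  define H where "H i u = (if u \<in> U then \<eta> (\<psi> u) * W i u else 0)" for i u
  define H' where "H' i u = (if u \<in> U then (\<lambda>v. (\<eta> \<circ> \<psi>) u * fderiv (W i) u v + fderiv (\<eta> \<circ> \<psi>) u v * W i u) else (\<lambda>v. 0))" for i u
  have H0: "H i u = 0" if "u \<notin> ?L" for i u using that z0 by (auto simp: H_def)
  have dL: "(H i has_derivative (\<lambda>v. 0)) (at u)" if "u \<notin> ?L" for i u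
    by (rule has_derivative_transform_within_open[OF has_derivative_const oL]) (use that H0 in auto)
  have dH: "(H i has_derivative H' i u) (at u)" for i u
  proof (cases "u \<in> U")
    case True
    have "((\<lambda>u. (\<eta> \<circ> \<psi>) u * W i u) has_derivative H' i u) (at u)"
      using has_derivative_mult[OF Ck_on_has_derivative[OF \<eta>c True] Ck_on_has_derivative[OF W True]] True
      by (simp only: H'_def if_True)
    then show ?thesis
      by (rule has_derivative_transform_within_open[OF _ D(1) True]) (simp add: H_def)
  next
    case False
    then show ?thesis using dL[of u i] L(2) by (auto simp: H'_def)
  qed
  have H'0: "H' i u = (\<lambda>v. 0)" if "u \<notin> ?L" for i u
    using has_derivative_unique[OF dH dL[OF that]] .
  have cU: "continuous_on U (\<lambda>u. H' i u v)" for i v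
  proof -
    have "continuous_on U (\<lambda>u. (\<eta> \<circ> \<psi>) u * fderiv (W i) u v + fderiv (\<eta> \<circ> \<psi>) u v * W i u)"
      using W[of i] \<eta>c
      by (intro continuous_on_add continuous_on_mult Ck_on_imp_continuous_on[OF W[of i]] Ck_on_imp_continuous_on[OF \<eta>c]) simp_all
    then show ?thesis by (rule continuous_on_eq) (simp add: H'_def)
  qed
  have cH: "continuous_on UNIV (\<lambda>u. H' i u v)" for i v
  proof (rule continuous_at_imp_continuous_on, rule ballI)
    fix u
    show "isCont (\<lambda>u. H' i u v) u"
    proof (cases "u \<in> U")
      case True
      then show ?thesis using cU D(1) continuous_on_eq_continuous_at by blast
    next
      case False
      have "continuous_on (- ?L) (\<lambda>u. H' i u v)"
        by (rule continuous_on_eq[OF continuous_on_const[of _ 0]]) (simp add: H'0)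
      moreover have "u \<in> - ?L" using False L(2) by blast
      ultimately show ?thesis using oL continuous_on_eq_continuous_at by blast
    qed
  qed
  have i0: "(LINT u|lborel. H' i u (axis i 1)) = 0" for i
    by (rule integral_directional_derivative_zero[OF dH cH L(1)]) (rule H0)
  have int: "integrable lborel (\<lambda>u. H' i u v)" for i v
    by (rule compact_support_integrable[OF L(1)]) (use continuous_on_subset[OF cH] H'0 in auto)
  define A where "A u = indicator U u * (vol \<psi> u * (grd \<eta> (\<psi> u) \<bullet> grd f (\<psi> u)))" for u
  define B where "B u = indicator U u * (vol \<psi> u * (\<eta> (\<psi> u) * laplace_local \<psi> f u))" for u
  have sum: "(\<Sum>i\<in>UNIV. H' i u (axis i 1)) = A u + B u" for u
  proof (cases "u \<in> U")
    case True
    have "(\<Sum>i\<in>UNIV. H' i u (axis i 1)) = (\<Sum>i\<in>UNIV. \<eta> (\<psi> u) * partial i (W i) u) + (\<Sum>i\<in>UNIV. partial i (\<eta> \<circ> \<psi>) u * W i u)"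
      using True by (simp add: H'_def partial_def sum.distrib)
    also have "(\<Sum>i\<in>UNIV. partial i (\<eta> \<circ> \<psi>) u * W i u) = A u"
      using True unfolding A_def
      by (simp add: grad_inner_chart[OF c True Ck_manifold_differentiable[OF \<eta> c True] Ck_manifold_differentiable[OF f1 c True]]
          W_def sum_distrib_left mult_ac)
    also have "(\<Sum>i\<in>UNIV. \<eta> (\<psi> u) * partial i (W i) u) = B u"
    proof -
      have "laplace_local \<psi> f u = 1 / vol \<psi> u * (\<Sum>i\<in>UNIV. partial i (W i) u)"
        unfolding laplace_local_def W_def[abs_def] ..
      then show ?thesis using True volume_density_pos[OF c True]
        by (simp add: B_def sum_distrib_left)
    qed
    finally show ?thesis by simp
  next
    case False
    then show ?thesis by (simp add: H'_def A_def B_def)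
  qed
  have sumint: "integrable lborel (\<lambda>u. \<Sum>i\<in>UNIV. H' i u (axis i 1))" using int by auto
  have Bint: "integrable lborel B"
  proof (rule compact_support_integrable[OF L(1)])
    have "continuous_on U (\<lambda>u. vol \<psi> u * ((\<eta> \<circ> \<psi>) u * laplace_local \<psi> f u))"
      using Ck_on_imp_continuous_on[OF Ck_on_volume_density[OF c]] Ck_on_imp_continuous_on[OF \<eta>c] continuous_laplace_local[OF c f]
      by (intro continuous_on_mult)
    then have "continuous_on ?L (\<lambda>u. vol \<psi> u * ((\<eta> \<circ> \<psi>) u * laplace_local \<psi> f u))"
      using L(2) continuous_on_subset by blast
    then show "continuous_on ?L B"
      by (rule continuous_on_eq) (use L(2) in \<open>auto simp: B_def\<close>)
    show "B u = 0" if "u \<notin> ?L" for u using z0[of u] that by (cases "u \<in> U") (auto simp: B_def)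
  qed
  have "A = (\<lambda>u. (\<Sum>i\<in>UNIV. H' i u (axis i 1)) - B u)" using sum by (simp add: fun_eq_iff)
  then have Aint: "integrable lborel A" using sumint Bint by simp
  have "0 = (\<Sum>i\<in>UNIV. \<integral>u. H' i u (axis i 1) \<partial>lborel)" using i0 by simp
  also have "\<dots> = (LINT u|lborel. (\<Sum>i\<in>UNIV. H' i u (axis i 1)))"
    using int by (intro Bochner_Integration.integral_sum[symmetric])
  also have "\<dots> = (LINT u|lborel. A u) + (LINT u|lborel. B u)" unfolding sum using Aint Bint by simp
  also have "(LINT u|lborel. A u) = (LINT x|V. grd \<eta> x \<bullet> grd f x)"
    unfolding A_def
  proof (rule chart_integral[OF c, symmetric])
    show "(\<lambda>x. grd \<eta> x \<bullet> grd f x) \<in> borel_measurable V"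
      using continuous_measurable_V[OF continuous_grad_inner[OF \<eta> f1]] .
    show "grd \<eta> x \<bullet> grd f x = 0" if "x \<in> M" "x \<notin> \<psi> ` U" for x
    proof -
      have "grd \<eta> x = 0"
        by (rule grad_zero_outside[OF compact_imp_closed[OF K(1)]]) (use z that K(2) in auto)
      then show ?thesis by simp
    qed
  qed
  finally show ?thesis unfolding B_def by simp
qed

lemma continuous_laplace_inv:
  assumes c: "chart U \<psi>" and f: "Ck_manifold 2 f"
  shows "continuous_on (\<psi> ` U) (\<lambda>y. laplace_local \<psi> f (inv_into U \<psi> y))"
  using local_paramD(6)[OF c]
  by (intro continuous_on_compose2[OF continuous_laplace_local[OF c f] local_paramD(7)[OF c]]) simp

text \<open>Moves Green's formula from the chart domain to \<open>V\<close>. The right-hand side no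
  longer mentions the chart, so the expressions from two charts can be tested against the same
  function.\<close>

lemma laplace_weak:
  assumes c: "chart U \<psi>" and f: "Ck_manifold 2 f" and \<eta>: "Ck_manifold (Suc 0) \<eta>"
    and K: "compact K" "K \<subseteq> \<psi> ` U" and z: "\<And>y. y \<in> M \<Longrightarrow> y \<notin> K \<Longrightarrow> \<eta> y = 0"
  shows "integrable V (\<lambda>y. indicator K y * (\<eta> y * laplace_local \<psi> f (inv_into U \<psi> y)))"
    "(LINT y|V. indicator K y * (\<eta> y * laplace_local \<psi> f (inv_into U \<psi> y)))
     = - (LINT x|V. grd \<eta> x \<bullet> grd f x)"
proof -
  interpret finite_measure V by (rule finite_measure_V)
  note D = local_paramD[OF c]
  have KM: "K \<subseteq> M" using K D(5) by blast
  have "continuous_on K (\<lambda>y. laplace_local \<psi> f (inv_into U \<psi> y))"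
    using continuous_laplace_inv[OF c f] K(2) continuous_on_subset by blast
  moreover have "continuous_on K \<eta>" using Ck_manifold_continuous[OF \<eta>] KM continuous_on_subset by blast
  ultimately have co: "continuous_on K (\<lambda>y. \<eta> y * laplace_local \<psi> f (inv_into U \<psi> y))" by (rule continuous_on_mult[rotated])
  have "(\<lambda>y. indicator K y *\<^sub>R (\<eta> y * laplace_local \<psi> f (inv_into U \<psi> y))) \<in> borel_measurable borel"
    using K(1) by (intro borel_measurable_continuous_on_indicator co) (simp add: borel_closed compact_imp_closed)
  then have m: "(\<lambda>y. indicator K y * (\<eta> y * laplace_local \<psi> f (inv_into U \<psi> y))) \<in> borel_measurable V"
    by (intro borel_measurable_V) simp
  obtain B where B: "B \<ge> 0" "\<And>y. y \<in> K \<Longrightarrow> norm (\<eta> y * laplace_local \<psi> f (inv_into U \<psi> y)) \<le> B"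
    using compact_continuous_bound[OF K(1) co] by blast
  show "integrable V (\<lambda>y. indicator K y * (\<eta> y * laplace_local \<psi> f (inv_into U \<psi> y)))"
    using B by (intro integrable_const_bound[of _ B] m AE_I2) (auto split: split_indicator)
  have "(LINT y|V. indicator K y * (\<eta> y * laplace_local \<psi> f (inv_into U \<psi> y))) =
    (LINT u|lborel. indicator U u * (vol \<psi> u * (indicator K (\<psi> u) * (\<eta> (\<psi> u) * laplace_local \<psi> f (inv_into U \<psi> (\<psi> u))))))"
    by (rule chart_integral[OF c m]) (use K(2) in \<open>auto split: split_indicator\<close>)
  also have "\<dots> = (LINT u|lborel. indicator U u * (vol \<psi> u * (\<eta> (\<psi> u) * laplace_local \<psi> f u)))"
  proof (rule LINT_cong)
    fix u
    show "indicator U u * (vol \<psi> u * (indicator K (\<psi> u) * (\<eta> (\<psi> u) * laplace_local \<psi> f (inv_into U \<psi> (\<psi> u)))))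
      = indicator U u * (vol \<psi> u * (\<eta> (\<psi> u) * laplace_local \<psi> f u))"
    proof (cases "u \<in> U")
      case True
      then have "inv_into U \<psi> (\<psi> u) = u" using D(6) by simp
      then show ?thesis using True z[of "\<psi> u"] D(5) by (cases "\<psi> u \<in> K") auto
    qed simp
  qed
  finally show "(LINT y|V. indicator K y * (\<eta> y * laplace_local \<psi> f (inv_into U \<psi> y)))
     = - (LINT x|V. grd \<eta> x \<bullet> grd f x)"
    using green_chart[OF assms] by simp
qed

text \<open>Chart independence of the Laplacian: both chart expressions satisfy the same weak formulation,
  tested against bump functions.\<close>

lemma laplace_local_le:
  assumes c1: "chart U1 \<psi>1" "u1 \<in> U1" and c2: "chart U2 \<psi>2" "u2 \<in> U2"
    and eq: "\<psi>1 u1 = \<psi>2 u2" and f: "Ck_manifold 2 f"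
  shows "laplace_local \<psi>1 f u1 \<le> laplace_local \<psi>2 f u2"
proof (rule ccontr)
  assume neg: "\<not> ?thesis"
  define x where "x = \<psi>1 u1"
  define l1 where "l1 y = laplace_local \<psi>1 f (inv_into U1 \<psi>1 y)" for y
  define l2 where "l2 y = laplace_local \<psi>2 f (inv_into U2 \<psi>2 y)" for y
  note D1 = local_paramD[OF c1(1)] and D2 = local_paramD[OF c2(1)]
  have "l1 x = laplace_local \<psi>1 f u1" using c1(2) D1(6) by (simp add: l1_def x_def)
  moreover have "l2 x = laplace_local \<psi>2 f u2" unfolding x_def eq using c2(2) D2(6) by (simp add: l2_def)
  ultimately have gt: "l1 x - l2 x > 0" using neg by simp
  have xM: "x \<in> M" using c1(2) D1(5) by (auto simp: x_def)
  obtain \<delta>1 where \<delta>1: "\<delta>1 > 0" "cball x \<delta>1 \<inter> M \<subseteq> \<psi>1 ` U1" using chart_cball[OF c1] unfolding x_def by blast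
  obtain \<delta>2 where \<delta>2: "\<delta>2 > 0" "cball x \<delta>2 \<inter> M \<subseteq> \<psi>2 ` U2" using chart_cball[OF c2] unfolding x_def eq by blast
  have "continuous_on (\<psi>1 ` U1) l1" "continuous_on (\<psi>2 ` U2) l2"
    unfolding l1_def[abs_def] l2_def[abs_def] using continuous_laplace_inv[OF c1(1) f] continuous_laplace_inv[OF c2(1) f] by simp_all
  then have "continuous_on (cball x (min \<delta>1 \<delta>2) \<inter> M) (\<lambda>y. l1 y - l2 y)"
    using \<delta>1(2) \<delta>2(2) by (intro continuous_on_diff) (auto elim!: continuous_on_subset)
  moreover have "x \<in> cball x (min \<delta>1 \<delta>2) \<inter> M" using xM \<delta>1 \<delta>2 by simp
  ultimately obtain \<delta>3 where \<delta>3: "\<delta>3 > 0"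
    "\<And>y. y \<in> cball x (min \<delta>1 \<delta>2) \<inter> M \<Longrightarrow> dist y x < \<delta>3 \<Longrightarrow> dist (l1 y - l2 y) (l1 x - l2 x) < l1 x - l2 x"
    using gt unfolding continuous_on_iff by metis
  \<comment> \<open>The closed ball of this radius meets \<open>M\<close> inside both chart images,
    and there the difference of the two expressions stays positive; halving \<open>\<delta>3\<close>
    allows for the boundary of the ball.\<close>
  define \<delta> where "\<delta> = Min {\<delta>1, \<delta>2, \<delta>3 / 2}"
  have \<delta>: "\<delta> > 0" "\<delta> \<le> \<delta>1" "\<delta> \<le> \<delta>2" "\<delta> < \<delta>3" using \<delta>1 \<delta>2 \<delta>3 by (auto simp: \<delta>_def)
  define K where "K = cball x \<delta> \<inter> M"
  have K: "compact K" "K \<subseteq> \<psi>1 ` U1" "K \<subseteq> \<psi>2 ` U2"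
    using compact_M \<delta>1(2) \<delta>2(2) \<delta> by (auto simp: K_def compact_Int)
  have pos: "l1 y - l2 y > 0" if "y \<in> K" for y
    using \<delta>3(2)[of y] that \<delta> by (auto simp: K_def dist_commute dist_real_def)
  define \<eta> where "\<eta> = bump x \<delta>"
  have \<eta>: "Ck_manifold (Suc 0) \<eta>" unfolding \<eta>_def by (rule Ck_manifold_mono[OF Ck_manifold_bump]) simp
  have z: "\<eta> y = 0" if "y \<in> M" "y \<notin> K" for y
    using that bump_zero[of \<delta> x y] \<delta>(1) by (auto simp: K_def \<eta>_def)
  note w1 = laplace_weak[OF c1(1) f \<eta> K(1,2) z, folded l1_def]
  note w2 = laplace_weak[OF c2(1) f \<eta> K(1,3) z, folded l2_def]
  have i: "integrable V (\<lambda>y. indicator K y * (\<eta> y * l1 y) - indicator K y * (\<eta> y * l2 y))"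
    using w1(1) w2(1) by (rule Bochner_Integration.integrable_diff)
  have "(LINT y|V. indicator K y * (\<eta> y * l1 y) - indicator K y * (\<eta> y * l2 y)) = 0"
    using w1 w2 by simp
  moreover have "AE y in V. 0 \<le> indicator K y * (\<eta> y * l1 y) - indicator K y * (\<eta> y * l2 y)"
  proof (rule AE_I2)
    fix y
    have "0 \<le> \<eta> y * (l1 y - l2 y)" if "y \<in> K" using pos[OF that] bump_nonneg by (simp add: \<eta>_def)
    then show "0 \<le> indicator K y * (\<eta> y * l1 y) - indicator K y * (\<eta> y * l2 y)"
      by (auto split: split_indicator simp: algebra_simps)
  qed
  ultimately have ae: "AE y in V. indicator K y * (\<eta> y * l1 y) - indicator K y * (\<eta> y * l2 y) = 0"
    using integral_nonneg_eq_0_iff_AE[OF i] by simp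
  obtain y where y: "y \<in> M" "dist x y < \<delta>" "indicator K y * (\<eta> y * l1 y) - indicator K y * (\<eta> y * l2 y) = 0"
    using AE_V_dense[OF ae xM \<delta>(1)] .
  then have "y \<in> K" by (simp add: K_def)
  moreover have "\<eta> y > 0" unfolding \<eta>_def using y(2) by (rule bump_pos)
  ultimately show False using y(3) pos[of y] by simp
qed

text \<open>The inequality between two chart expressions, used in both directions, shows that the
  description of the Laplacian has exactly one solution.\<close>

lemma laplace_beltrami_chart:
  assumes c: "chart U \<psi>" "u \<in> U" and f: "Ck_manifold 2 f"
  shows "laplace_beltrami dT M f (\<psi> u) = laplace_local \<psi> f u"
  unfolding laplace_beltrami_def
proof (rule the_equality)
  show "\<forall>(U' :: (real ^ 'd) set) \<psi>' u'. chart U' \<psi>' \<and> u' \<in> U' \<and> \<psi>' u' = \<psi> u \<longrightarrow> laplace_local \<psi>' f u' = laplace_local \<psi> f u"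
  proof (intro allI impI)
    fix U' :: "(real ^ 'd) set" and \<psi>' u'
    assume "chart U' \<psi>' \<and> u' \<in> U' \<and> \<psi>' u' = \<psi> u"
    then have c': "chart U' \<psi>'" "u' \<in> U'" "\<psi>' u' = \<psi> u" by auto
    show "laplace_local \<psi>' f u' = laplace_local \<psi> f u"
      using laplace_local_le[OF c'(1,2) c c'(3) f] laplace_local_le[OF c c'(1,2) c'(3)[symmetric] f] by simp
  qed
  show "a = laplace_local \<psi> f u" if "\<forall>(U' :: (real ^ 'd) set) \<psi>' u'. chart U' \<psi>' \<and> u' \<in> U' \<and> \<psi>' u' = \<psi> u \<longrightarrow> laplace_local \<psi>' f u' = a" for a
    using that c by auto
qed

lemma continuous_laplace_beltrami: "Ck_manifold 2 f \<Longrightarrow> continuous_on M (laplace_beltrami dT M f)"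
proof (rule continuous_on_manifoldI)
  fix U \<psi> assume f: "Ck_manifold 2 f" and c: "chart U \<psi>"
  show "continuous_on U (\<lambda>u. laplace_beltrami dT M f (\<psi> u))"
    by (rule continuous_on_eq[OF continuous_laplace_local[OF c f]]) (simp add: laplace_beltrami_chart[OF c _ f])
qed

lemma green_supported:
  assumes c: "chart U \<psi>" and f: "Ck_manifold 2 f" and \<eta>: "Ck_manifold (Suc 0) \<eta>"
    and K: "compact K" "K \<subseteq> \<psi> ` U" and z: "\<And>y. y \<in> M \<Longrightarrow> y \<notin> K \<Longrightarrow> \<eta> y = 0"
  shows "(LINT x|V. \<eta> x * laplace_beltrami dT M f x) = - (LINT x|V. grd \<eta> x \<bullet> grd f x)"
proof -
  have "(LINT x|V. \<eta> x * laplace_beltrami dT M f x) =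
     (LINT u|lborel. indicator U u * (vol \<psi> u * (\<eta> (\<psi> u) * laplace_beltrami dT M f (\<psi> u))))"
    by (rule chart_integral[OF c])
      (use z K in \<open>auto intro!: continuous_measurable_V continuous_on_mult Ck_manifold_continuous[OF \<eta>] continuous_laplace_beltrami f\<close>)
  also have "\<dots> = (LINT u|lborel. indicator U u * (vol \<psi> u * (\<eta> (\<psi> u) * laplace_local \<psi> f u)))"
    by (rule LINT_cong) (auto split: split_indicator simp: laplace_beltrami_chart[OF c _ f])
  finally show ?thesis using green_chart[OF assms] by simp
qed

lemma grad_mult:
  assumes "Ck_manifold (Suc 0) f" "Ck_manifold (Suc 0) g" "x \<in> M"
  shows "grd (\<lambda>x. f x * g x) x = f x *\<^sub>R grd g x + g x *\<^sub>R grd f x"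
proof -
  obtain U and \<psi> u where c: "chart U \<psi>" "u \<in> U" "\<psi> u = x" using chart_exists[OF assms(3)] .
  note f = Ck_manifold_differentiable[OF assms(1) c(1,2)] and g = Ck_manifold_differentiable[OF assms(2) c(1,2)]
  note lin = local_param_deriv(2)[OF c(1,2)]
  have eq: "(\<lambda>x. f x * g x) \<circ> \<psi> = (\<lambda>u. (f \<circ> \<psi>) u * (g \<circ> \<psi>) u)" by auto
  have d: "((\<lambda>x. f x * g x) \<circ> \<psi> has_derivative (\<lambda>h. (f \<circ> \<psi>) u * fderiv (g \<circ> \<psi>) u h
       + fderiv (f \<circ> \<psi>) u h * (g \<circ> \<psi>) u)) (at u)"
    unfolding eq by (rule has_derivative_mult[OF f[unfolded frechet_derivative_works] g[unfolded frechet_derivative_works]])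
  obtain a where a: "grd f (\<psi> u) = fderiv \<psi> u a" using grad_chart(2)[OF c(1,2) f] by blast
  obtain b where b: "grd g (\<psi> u) = fderiv \<psi> u b" using grad_chart(2)[OF c(1,2) g] by blast
  have "grd (\<lambda>x. f x * g x) (\<psi> u) = f (\<psi> u) *\<^sub>R grd g (\<psi> u) + g (\<psi> u) *\<^sub>R grd f (\<psi> u)"
  proof (rule grad_eqI[OF c(1,2)])
    show "(\<lambda>x. f x * g x) \<circ> \<psi> differentiable at u" using d differentiableI by blast
    have "f (\<psi> u) *\<^sub>R grd g (\<psi> u) + g (\<psi> u) *\<^sub>R grd f (\<psi> u) = fderiv \<psi> u (f (\<psi> u) *\<^sub>R b + g (\<psi> u) *\<^sub>R a)"
      unfolding a b by (simp add: linear_add[OF lin] linear_scale[OF lin])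
    then show "f (\<psi> u) *\<^sub>R grd g (\<psi> u) + g (\<psi> u) *\<^sub>R grd f (\<psi> u) \<in> range (fderiv \<psi> u)"
      by (metis rangeI)
    show "(f (\<psi> u) *\<^sub>R grd g (\<psi> u) + g (\<psi> u) *\<^sub>R grd f (\<psi> u)) \<bullet> fderiv \<psi> u h
        = fderiv ((\<lambda>x. f x * g x) \<circ> \<psi>) u h" for h
      unfolding frechet_derivative_at[OF d, symmetric]
      by (simp add: inner_add_left grad_chart(3)[OF c(1,2) f] grad_chart(3)[OF c(1,2) g])
  qed
  then show ?thesis using c(3) by simp
qed

lemma grad_sum:
  assumes I: "finite I" and f: "\<And>i. i \<in> I \<Longrightarrow> Ck_manifold (Suc 0) (f i)" and x: "x \<in> M"
  shows "grd (\<lambda>x. \<Sum>i\<in>I. f i x) x = (\<Sum>i\<in>I. grd (f i) x)"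
proof -
  obtain U and \<psi> u where c: "chart U \<psi>" "u \<in> U" "\<psi> u = x" using chart_exists[OF x] .
  note f' = Ck_manifold_differentiable[OF f c(1,2)]
  note lin = local_param_deriv(2)[OF c(1,2)]
  have eq: "(\<lambda>x. \<Sum>i\<in>I. f i x) \<circ> \<psi> = (\<lambda>u. \<Sum>i\<in>I. (f i \<circ> \<psi>) u)" by auto
  have d: "((\<lambda>x. \<Sum>i\<in>I. f i x) \<circ> \<psi> has_derivative (\<lambda>h. \<Sum>i\<in>I. fderiv (f i \<circ> \<psi>) u h)) (at u)"
    unfolding eq by (rule has_derivative_sum) (rule f'[unfolded frechet_derivative_works])
  have "grd (\<lambda>x. \<Sum>i\<in>I. f i x) (\<psi> u) = (\<Sum>i\<in>I. grd (f i) (\<psi> u))"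
  proof (rule grad_eqI[OF c(1,2)])
    show "(\<lambda>x. \<Sum>i\<in>I. f i x) \<circ> \<psi> differentiable at u" using d differentiableI by blast
    have "subspace (range (fderiv \<psi> u))" using lin by (simp add: linear_subspace_image subspace_UNIV)
    then show "(\<Sum>i\<in>I. grd (f i) (\<psi> u)) \<in> range (fderiv \<psi> u)"
      using grad_chart(2)[OF c(1,2) f'] by (intro subspace_sum) auto
    show "(\<Sum>i\<in>I. grd (f i) (\<psi> u)) \<bullet> fderiv \<psi> u h
        = fderiv ((\<lambda>x. \<Sum>i\<in>I. f i x) \<circ> \<psi>) u h" for h
      unfolding frechet_derivative_at[OF d, symmetric] inner_sum_left
      by (intro sum.cong refl grad_chart(3)[OF c(1,2) f'])
  qed
  then show ?thesis using c(3) by simp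
qed

lemma grad_cong:
  assumes "\<And>y. y \<in> M \<Longrightarrow> f y = g y" "Ck_manifold (Suc 0) f" "x \<in> M"
  shows "grd g x = grd f x"
proof -
  obtain U and \<psi> u where c: "chart U \<psi>" "u \<in> U" "\<psi> u = x" using chart_exists[OF assms(3)] .
  note f = Ck_manifold_differentiable[OF assms(2) c(1,2)] and D = local_paramD[OF c(1)]
  have d: "((g \<circ> \<psi>) has_derivative fderiv (f \<circ> \<psi>) u) (at u)"
    using f[unfolded frechet_derivative_works]
    by (rule has_derivative_transform_within_open[OF _ D(1) c(2)]) (use assms(1) D(5) in auto)
  have "grd g (\<psi> u) = grd f (\<psi> u)"
    using d grad_chart(2,3)[OF c(1,2) f] frechet_derivative_at[OF d, symmetric]
    by (intro grad_eqI[OF c(1,2)]) (auto simp: differentiable_def)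
  then show ?thesis using c(3) by simp
qed

text \<open>Only the test function is cut into pieces supported in charts. The gradients of the
  pieces add up to that of \<eta>, so no derivative of a cutoff remains in the result.\<close>

lemma green:
  assumes f: "Ck_manifold 2 f" and \<eta>: "Ck_manifold (Suc 0) \<eta>"
  shows "(LINT x|V. \<eta> x * laplace_beltrami dT M f x) = - (LINT x|V. grd \<eta> x \<bullet> grd f x)"
proof -
  obtain X \<theta> K U \<psi> where P: "chart_partition X \<theta> K U \<psi>" by (rule partition_of_unity)
  note P = chart_partitionD[OF P]
  have f1: "Ck_manifold (Suc 0) f" using f by (rule Ck_manifold_mono) simp
  have \<theta>: "Ck_manifold (Suc 0) (\<theta> i)" if "i \<in> X" for i using P(2)[OF that] by (rule Ck_manifold_mono) simp
  have \<theta>\<eta>: "Ck_manifold (Suc 0) (\<lambda>x. \<theta> i x * \<eta> x)" if "i \<in> X" for i using \<theta>[OF that] \<eta> by (rule Ck_manifold_mult)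
  have e: "\<eta> x = (\<Sum>i\<in>X. \<theta> i x * \<eta> x)" if "x \<in> M" for x
    using P(7)[OF that] by (simp add: sum_distrib_right[symmetric])
  have "(LINT x|V. \<eta> x * laplace_beltrami dT M f x) = (LINT x|V. (\<Sum>i\<in>X. \<theta> i x * \<eta> x * laplace_beltrami dT M f x))"
    using e by (intro LINT_cong) (simp add: space_V sum_distrib_right[symmetric])
  also have "\<dots> = (\<Sum>i\<in>X. (LINT x|V. \<theta> i x * \<eta> x * laplace_beltrami dT M f x))"
    using \<theta>\<eta> by (intro Bochner_Integration.integral_sum continuous_integrable_V continuous_on_mult
        continuous_laplace_beltrami f) (auto intro: Ck_manifold_continuous \<theta> \<eta>)
  also have "\<dots> = (\<Sum>i\<in>X. - (LINT x|V. grd (\<lambda>x. \<theta> i x * \<eta> x) x \<bullet> grd f x))"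
  proof (rule sum.cong[OF refl])
    fix i assume i: "i \<in> X"
    show "(LINT x|V. \<theta> i x * \<eta> x * laplace_beltrami dT M f x) = - (LINT x|V. grd (\<lambda>x. \<theta> i x * \<eta> x) x \<bullet> grd f x)"
      by (rule green_supported[OF P(3)[OF i] f \<theta>\<eta>[OF i] P(4)[OF i] P(5)[OF i]]) (simp add: P(6)[OF i])
  qed
  also have "\<dots> = - (LINT x|V. (\<Sum>i\<in>X. grd (\<lambda>x. \<theta> i x * \<eta> x) x \<bullet> grd f x))"
    using \<theta>\<eta> f1 by (subst Bochner_Integration.integral_sum) (auto intro!: continuous_integrable_V continuous_grad_inner simp: sum_negf)
  also have "(LINT x|V. (\<Sum>i\<in>X. grd (\<lambda>x. \<theta> i x * \<eta> x) x \<bullet> grd f x)) =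
    (LINT x|V. grd \<eta> x \<bullet> grd f x)"
  proof (rule LINT_cong)
    fix x assume "x \<in> space V"
    then have x: "x \<in> M" by (simp add: space_V)
    have "grd \<eta> x = (\<Sum>i\<in>X. grd (\<lambda>x. \<theta> i x * \<eta> x) x)"
      using grad_sum[OF P(1) \<theta>\<eta> x] grad_cong[OF e \<eta> x] by simp
    then show "(\<Sum>i\<in>X. grd (\<lambda>x. \<theta> i x * \<eta> x) x \<bullet> grd f x) = grd \<eta> x \<bullet> grd f x"
      by (simp add: inner_sum_left)
  qed
  finally show ?thesis .
qed

text \<open>Green's formula for the test function \<phi> q: the term with the gradient of
  \<open>q\<close> produced by the product rule cancels the drift term of the weighted
  Laplacian.\<close>

lemma green_weighted:
  assumes f: "Ck_manifold 2 f" and \<phi>: "Ck_manifold (Suc 0) \<phi>" and q: "Ck_manifold (Suc 0) q" "\<And>x. x \<in> M \<Longrightarrow> q x > 0"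
  shows "weighted_inner V q \<phi> (weighted_laplacian dT M q f) = - (LINT x|V. q x * (grd \<phi> x \<bullet> grd f x))"
proof -
  have f1: "Ck_manifold (Suc 0) f" using f by (rule Ck_manifold_mono) simp
  note \<phi>q = Ck_manifold_mult[OF \<phi> q(1)]
  let ?g = "grd"
  have i1: "integrable V (\<lambda>x. (\<phi> x * q x) * laplace_beltrami dT M f x)"
    by (intro continuous_integrable_V continuous_on_mult Ck_manifold_continuous[OF \<phi>] Ck_manifold_continuous[OF q(1)] continuous_laplace_beltrami f)
  have i2: "integrable V (\<lambda>x. \<phi> x * (?g q x \<bullet> ?g f x))"
    by (intro continuous_integrable_V continuous_on_mult Ck_manifold_continuous[OF \<phi>] continuous_grad_inner q f1)
  have i3: "integrable V (\<lambda>x. q x * (?g \<phi> x \<bullet> ?g f x))"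
    by (intro continuous_integrable_V continuous_on_mult Ck_manifold_continuous[OF q(1)] continuous_grad_inner \<phi> f1)
  have "weighted_inner V q \<phi> (weighted_laplacian dT M q f) = (LINT x|V. (\<phi> x * q x) * laplace_beltrami dT M f x + \<phi> x * (?g q x \<bullet> ?g f x))"
    unfolding weighted_inner_def weighted_laplacian_def
  proof (rule LINT_cong)
    fix x assume "x \<in> space V"
    then have "q x > 0" using q(2) by (simp add: space_V)
    then show "\<phi> x * (laplace_beltrami dT M f x + 1 / q x * (?g q x \<bullet> ?g f x)) * q x = (\<phi> x * q x) * laplace_beltrami dT M f x + \<phi> x * (?g q x \<bullet> ?g f x)"
      by (simp add: field_simps)
  qed
  also have "\<dots> = - (LINT x|V. ?g (\<lambda>x. \<phi> x * q x) x \<bullet> ?g f x) + (LINT x|V. \<phi> x * (?g q x \<bullet> ?g f x))"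
    using i1 i2 green[OF f \<phi>q] by simp
  also have "(LINT x|V. ?g (\<lambda>x. \<phi> x * q x) x \<bullet> ?g f x) = (LINT x|V. \<phi> x * (?g q x \<bullet> ?g f x) + q x * (?g \<phi> x \<bullet> ?g f x))"
    by (rule LINT_cong) (simp add: grad_mult[OF \<phi> q(1)] space_V inner_add_left)
  also have "\<dots> = (LINT x|V. \<phi> x * (?g q x \<bullet> ?g f x)) + (LINT x|V. q x * (?g \<phi> x \<bullet> ?g f x))"
    using i2 i3 by simp
  finally show ?thesis by simp
qed

end

subsection \<open>The kernel\<close>

text \<open>Half of the exponent pays for the power: raise x \<le> exp x to the n-th power at x = c
  s / (2 n).\<close>

lemma power_exp_bound:
  fixes c :: real
  assumes "c > 0"
  shows "\<exists>C>0. \<forall>s\<ge>0. s ^ n * exp (- c * s) \<le> C * exp (- (c / 2) * s)"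
proof (cases "n = 0")
  case True
  then show ?thesis using assms by (intro exI[of _ 1]) (auto intro: mult_right_mono)
next
  case False
  define C where "C = (2 * real n / c) ^ n"
  have "s ^ n * exp (- c * s) \<le> C * exp (- (c / 2) * s)" if s: "s \<ge> 0" for s
  proof -
    let ?x = "c * s / (2 * real n)"
    have x0: "?x \<ge> 0" using s assms by simp
    have "?x \<le> exp ?x" using exp_ge_add_one_self[of ?x] by linarith
    then have "?x ^ n \<le> exp ?x ^ n" using x0 by (intro power_mono)
    also have "\<dots> = exp (c / 2 * s)" using False by (simp add: exp_of_nat_mult[symmetric])
    finally have "C * ?x ^ n \<le> C * exp (c / 2 * s)" using assms by (intro mult_left_mono) (simp_all add: C_def)
    moreover have "C * ?x ^ n = s ^ n" using assms False by (simp add: C_def power_mult_distrib[symmetric])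
    ultimately have "s ^ n * exp (- c * s) \<le> C * exp (c / 2 * s) * exp (- c * s)" by (intro mult_right_mono) auto
    also have "\<dots> = C * exp (- (c / 2) * s)" by (simp add: mult.assoc exp_add[symmetric])
    finally show ?thesis .
  qed
  moreover have "C > 0" using assms False by (simp add: C_def)
  ultimately show ?thesis by blast
qed

lemma powr_lipschitz:
  fixes Q1 Q2 s :: real
  assumes "Q1 > 0"
  shows "\<exists>C\<ge>0. (\<forall>Q\<in>{Q1..Q2}. \<bar>Q powr s\<bar> \<le> C) \<and> (\<forall>Q\<in>{Q1..Q2}. \<forall>Q'\<in>{Q1..Q2}. \<bar>Q powr s - Q' powr s\<bar> \<le> C * \<bar>Q - Q'\<bar>)"
proof -
  have "Ck_on (Suc 0) (\<lambda>Q::real. Q) {0<..}"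
    by (rule Ck_on_SucI[of _ _ "\<lambda>x v. v"]) auto
  then have C1: "Ck_on (Suc 0) (\<lambda>Q::real. Q powr s) {0<..}" by (intro Ck_on_powr) auto
  obtain C where C: "C \<ge> 0" "\<forall>a w. closed_segment a (a + w) \<subseteq> {Q1..Q2} \<longrightarrow> norm ((a + w) powr s - a powr s) \<le> C * norm w"
  proof -
    have "{Q1..Q2} \<subseteq> {0<..}" using assms by auto
    from C1_segment_bound[OF C1 compact_Icc this] show ?thesis using that by blast
  qed
  have l: "\<bar>Q powr s - Q' powr s\<bar> \<le> C * \<bar>Q - Q'\<bar>" if "Q \<in> {Q1..Q2}" "Q' \<in> {Q1..Q2}" for Q Q'
  proof -
    have "closed_segment Q' (Q' + (Q - Q')) \<subseteq> {Q1..Q2}" using that by (simp add: closed_segment_subset)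
    then have "norm ((Q' + (Q - Q')) powr s - Q' powr s) \<le> C * norm (Q - Q')" using C(2) by blast
    then show ?thesis by simp
  qed
  obtain B where B: "B \<ge> 0" "\<And>Q. Q \<in> {Q1..Q2} \<Longrightarrow> norm (Q powr s) \<le> B"
  proof (rule compact_continuous_bound[of "{Q1..Q2}" "\<lambda>Q. Q powr s"])
    show "continuous_on {Q1..Q2} (\<lambda>Q. Q powr s)"
      using assms by (intro continuous_on_powr continuous_on_id continuous_on_const) auto
  qed (use that in auto)
  show ?thesis
  proof (intro exI[of _ "B + C"] conjI ballI)
    show "\<bar>Q powr s\<bar> \<le> B + C" if "Q \<in> {Q1..Q2}" for Q using B(2)[OF that] C(1) by simp
    show "\<bar>Q powr s - Q' powr s\<bar> \<le> (B + C) * \<bar>Q - Q'\<bar>" if "Q \<in> {Q1..Q2}" "Q' \<in> {Q1..Q2}" for Q Q'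
      using l[OF that] B(1) by (simp add: distrib_right add_increasing)
  qed (use B C in auto)
qed

text \<open>The facts about an admissible kernel on which the estimates rest, with one rate and one
  constant: decay, and a Lipschitz bound that decays with the smaller argument. Positivity is asked
  at a positive argument, where it contributes to the second moment
  \<open>kernel_m2\<close>.\<close>

locale kernel =
  fixes k0 :: "real \<Rightarrow> real" and a A :: real
  assumes a_pos: "a > 0" and A_pos: "A > 0"
    and kernel_nonneg: "\<xi> \<ge> 0 \<Longrightarrow> k0 \<xi> \<ge> 0"
    and kernel_decay: "\<xi> \<ge> 0 \<Longrightarrow> k0 \<xi> \<le> A * exp (- a * \<xi>)"
    and kernel_lipschitz: "\<xi> \<ge> 0 \<Longrightarrow> \<zeta> \<ge> 0 \<Longrightarrow> \<bar>k0 \<xi> - k0 \<zeta>\<bar> \<le> A * \<bar>\<xi> - \<zeta>\<bar> * exp (- a * min \<xi> \<zeta>)"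
    and kernel_continuous: "continuous_on {0..} k0"
    and kernel_nonzero: "\<exists>\<xi>>0. k0 \<xi> > 0"

lemma admissible_kernelD:
  assumes "admissible_kernel k0"
  obtains a A where "kernel k0 a A"
proof -
  obtain a A where a: "a > 0" and AA: "\<forall>l\<le>4. A l > 0 \<and> (\<forall>\<xi>>0. \<bar>(deriv ^^ l) k0 \<xi>\<bar> \<le> A l * exp (- a * \<xi>))"
    using assms unfolding admissible_kernel_def by blast
  have A0: "A 0 > 0" "\<And>\<xi>. \<xi> > 0 \<Longrightarrow> \<bar>k0 \<xi>\<bar> \<le> A 0 * exp (- a * \<xi>)" using AA[rule_format, of 0] by auto
  have A1: "A 1 > 0" "\<And>\<xi>. \<xi> > 0 \<Longrightarrow> \<bar>deriv k0 \<xi>\<bar> \<le> A 1 * exp (- a * \<xi>)" using AA[rule_format, of 1] by auto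
  have cont: "continuous_on {0..} k0" and nn: "\<And>\<xi>. \<xi> \<ge> 0 \<Longrightarrow> k0 \<xi> \<ge> 0" and sup: "sup_norm_on {0..} k0 > 0"
    using assms by (auto simp: admissible_kernel_def)
  have "k0 differentiable_on {0<..}" using assms unfolding admissible_kernel_def by (metis funpow_0 zero_less_numeral)
  then have der: "(k0 has_real_derivative deriv k0 x) (at x)" if "x > 0" for x
    using that unfolding differentiable_on_def
    by (metis at_within_open greaterThan_iff open_greaterThan DERIV_deriv_iff_real_differentiable)
  have lip: "\<bar>k0 \<xi> - k0 \<zeta>\<bar> \<le> A 1 * \<bar>\<xi> - \<zeta>\<bar> * exp (- a * min \<xi> \<zeta>)" if lt: "0 \<le> \<xi>" "\<xi> < \<zeta>" for \<xi> \<zeta>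
  proof -
    have "continuous_on {\<xi>..\<zeta>} k0" using cont lt by (auto intro: continuous_on_subset)
    moreover have "(k0 has_derivative (\<lambda>h. deriv k0 x * h)) (at x)" if "\<xi> < x" "x < \<zeta>" for x
      using der[of x] that lt by (simp add: has_field_derivative_def)
    \<comment> \<open>The mean value theorem takes the derivative only in the open interval, so that
      \<xi> = 0 is covered by continuity there.\<close>
    ultimately obtain z where z: "\<xi> < z" "z < \<zeta>" "k0 \<zeta> - k0 \<xi> = deriv k0 z * (\<zeta> - \<xi>)"
      using mvt[of \<xi> \<zeta> k0 "\<lambda>x h. deriv k0 x * h"] lt by auto
    have "k0 \<xi> - k0 \<zeta> = deriv k0 z * (\<xi> - \<zeta>)" using z(3) by (simp add: algebra_simps)
    then have "\<bar>k0 \<xi> - k0 \<zeta>\<bar> = \<bar>deriv k0 z\<bar> * \<bar>\<xi> - \<zeta>\<bar>" by (simp add: abs_mult)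
    also have "\<dots> \<le> (A 1 * exp (- a * \<xi>)) * \<bar>\<xi> - \<zeta>\<bar>"
    proof (rule mult_right_mono)
      have "\<bar>deriv k0 z\<bar> \<le> A 1 * exp (- a * z)" using A1(2) z lt by simp
      also have "\<dots> \<le> A 1 * exp (- a * \<xi>)" using z a A1(1) by (intro mult_left_mono) auto
      finally show "\<bar>deriv k0 z\<bar> \<le> A 1 * exp (- a * \<xi>)" .
    qed simp
    finally show ?thesis using lt by (simp add: min_def mult_ac)
  qed
  define B where "B = Max {A 0, A 1, k0 0}"
  have B: "A 0 \<le> B" "A 1 \<le> B" "k0 0 \<le> B" by (auto simp: B_def)
  have "kernel k0 a B"
  proof
    show "a > 0" "B > 0" using a A0(1) B(1) by auto
    show "continuous_on {0..} k0" by fact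
    show "k0 \<xi> \<ge> 0" if "\<xi> \<ge> 0" for \<xi> using nn that .
    show "k0 \<xi> \<le> B * exp (- a * \<xi>)" if "\<xi> \<ge> 0" for \<xi>
    proof (cases "\<xi> = 0")
      case False
      then have "k0 \<xi> \<le> A 0 * exp (- a * \<xi>)" using A0(2)[of \<xi>] that by auto
      also have "\<dots> \<le> B * exp (- a * \<xi>)" using B(1) by (intro mult_right_mono) auto
      finally show ?thesis .
    qed (use B in simp)
    show "\<bar>k0 \<xi> - k0 \<zeta>\<bar> \<le> B * \<bar>\<xi> - \<zeta>\<bar> * exp (- a * min \<xi> \<zeta>)" if "\<xi> \<ge> 0" "\<zeta> \<ge> 0" for \<xi> \<zeta>
    proof -
      have "\<bar>k0 \<xi> - k0 \<zeta>\<bar> \<le> A 1 * \<bar>\<xi> - \<zeta>\<bar> * exp (- a * min \<xi> \<zeta>)"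
        using lip[of \<xi> \<zeta>] lip[of \<zeta> \<xi>] that by (cases \<xi> \<zeta> rule: linorder_cases) (auto simp: min.commute abs_minus_commute)
      also have "\<dots> \<le> B * \<bar>\<xi> - \<zeta>\<bar> * exp (- a * min \<xi> \<zeta>)" using B(2) by (intro mult_right_mono) auto
      finally show ?thesis .
    qed
    \<comment> \<open>A kernel that vanished at all positive arguments would vanish at 0 as well, by
      continuity, and would have sup norm 0.\<close>
    show "\<exists>\<xi>>0. k0 \<xi> > 0"
    proof (rule ccontr)
      assume "\<not> ?thesis"
      then have z: "k0 \<xi> = 0" if "\<xi> > 0" for \<xi> using nn[of \<xi>] that by force
      have "k0 0 = 0"
      proof (rule ccontr)
        assume "k0 0 \<noteq> 0"
        then have p: "k0 0 > 0" using nn[of 0] by simp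
        then obtain e where e: "e > 0" "\<And>x. x \<in> {0..} \<Longrightarrow> dist x 0 < e \<Longrightarrow> dist (k0 x) (k0 0) < k0 0"
          using cont unfolding continuous_on_iff by (metis atLeast_iff order_refl)
        then show False using e(2)[of "e / 2"] z[of "e / 2"] by (simp add: dist_real_def)
      qed
      then have z': "\<bar>k0 x\<bar> = 0" if "x \<in> {0..}" for x using z[of x] that by (cases "x = 0") auto
      have "(\<lambda>x. \<bar>k0 x\<bar>) ` {0..} = (\<lambda>x::real. 0) ` {0..}" by (rule image_cong[OF refl z'])
      also have "(\<lambda>x::real. 0::real) ` {0..} = {0}" by auto
      finally have "sup_norm_on {0..} k0 = 0" unfolding sup_norm_on_def by simp
      then show False using sup by simp
    qed
  qed
  then show ?thesis by (rule that)
qed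

context kernel
begin

text \<open>\<open>\<tau>\<close> is the squared distance over \<epsilon> and \<open>Q\<close> the
  product of the two bandwidths, so the two normalizing powers of the bandwidth merge into one. The
  \<open>max\<close> fixes the values at negative arguments, about which nothing is assumed of
  \<open>k0\<close>, and makes the function Borel on the whole plane.\<close>

definition kern :: "real \<Rightarrow> real \<Rightarrow> real \<Rightarrow> real" where
  "kern \<alpha> \<tau> Q = k0 (max 0 (\<tau> / Q)) * Q powr (- \<alpha>)"

lemma kernel_abs: "\<bar>k0 (max 0 \<xi>)\<bar> \<le> A * exp (- a * max 0 \<xi>)"
  using kernel_nonneg[of "max 0 \<xi>"] kernel_decay[of "max 0 \<xi>"] by simp

lemma kernel_measurable [measurable]: "(\<lambda>t. k0 (max 0 t)) \<in> borel_measurable borel"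
  by (intro borel_measurable_continuous_onI continuous_on_compose2[OF kernel_continuous] continuous_intros) auto

lemma kern_measurable [measurable]: "(\<lambda>z. kern \<alpha> (fst z) (snd z)) \<in> borel_measurable borel"
proof -
  have 1: "(\<lambda>z::real \<times> real. fst z) \<in> borel_measurable borel" "(\<lambda>z::real \<times> real. snd z) \<in> borel_measurable borel"
    by (auto intro!: borel_measurable_continuous_onI continuous_intros)
  have "(\<lambda>z::real \<times> real. fst z / snd z) \<in> borel_measurable borel" using 1 by (rule borel_measurable_divide)
  from measurable_compose[OF this kernel_measurable] 1(2) show ?thesis unfolding kern_def
    by measurable
qed

lemma measurable_kern:
  assumes "f \<in> borel_measurable N" "g \<in> borel_measurable N"
  shows "(\<lambda>x. kern \<alpha> (f x) (g x)) \<in> borel_measurable N"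
  using measurable_compose[OF borel_measurable_Pair[OF assms] kern_measurable[of \<alpha>]] by simp

lemma kern_nonneg: "kern \<alpha> \<tau> Q \<ge> 0"
  using kernel_nonneg by (simp add: kern_def)

definition kern_bound :: "real \<Rightarrow> real \<Rightarrow> real \<Rightarrow> real \<Rightarrow> real \<Rightarrow> bool" where
  "kern_bound \<alpha> Q1 Q2 C c \<longleftrightarrow> C > 0 \<and> c > 0 \<and> (\<forall>\<tau>\<ge>0. \<forall>Q\<in>{Q1..Q2}. \<bar>kern \<alpha> \<tau> Q\<bar> \<le> C * exp (- c * \<tau>)) \<and>
    (\<forall>\<tau>\<ge>0. \<forall>\<tau>'\<ge>0. \<forall>Q\<in>{Q1..Q2}. \<forall>Q'\<in>{Q1..Q2}.
       \<bar>kern \<alpha> \<tau> Q - kern \<alpha> \<tau>' Q'\<bar> \<le> C * (\<bar>\<tau> - \<tau>'\<bar> + \<bar>Q - Q'\<bar>) * exp (- c * min \<tau> \<tau>'))"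

lemma kern_boundD:
  assumes "kern_bound \<alpha> Q1 Q2 C c"
  shows "C > 0" "c > 0" "\<And>\<tau> Q. \<tau> \<ge> 0 \<Longrightarrow> Q \<in> {Q1..Q2} \<Longrightarrow> \<bar>kern \<alpha> \<tau> Q\<bar> \<le> C * exp (- c * \<tau>)"
    "\<And>\<tau> \<tau>' Q Q'. \<tau> \<ge> 0 \<Longrightarrow> \<tau>' \<ge> 0 \<Longrightarrow> Q \<in> {Q1..Q2} \<Longrightarrow> Q' \<in> {Q1..Q2} \<Longrightarrow>
       \<bar>kern \<alpha> \<tau> Q - kern \<alpha> \<tau>' Q'\<bar> \<le> C * (\<bar>\<tau> - \<tau>'\<bar> + \<bar>Q - Q'\<bar>) * exp (- c * min \<tau> \<tau>')"
  using assms unfolding kern_bound_def by blast+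

text \<open>With \<open>Q\<close> bounded above, dividing by it leaves at least the rate a / Q2.
  Varying \<open>Q\<close> brings down a factor \<tau>, which is absorbed by halving that
  rate.\<close>

lemma kern_bounds:
  assumes Q: "Q1 > 0"
  shows "\<exists>C c. kern_bound \<alpha> Q1 Q2 C c"
proof (cases "Q1 \<le> Q2")
  case False
  then have e: "{Q1..Q2} = {}" by simp
  show ?thesis unfolding kern_bound_def e by (intro exI[of _ 1]) auto
next
  case True
  then have Q2: "Q2 > 0" using Q by simp
  obtain P where P: "P \<ge> 0" "\<And>Q. Q \<in> {Q1..Q2} \<Longrightarrow> \<bar>Q powr (- \<alpha>)\<bar> \<le> P"
    "\<And>Q Q'. Q \<in> {Q1..Q2} \<Longrightarrow> Q' \<in> {Q1..Q2} \<Longrightarrow> \<bar>Q powr (- \<alpha>) - Q' powr (- \<alpha>)\<bar> \<le> P * \<bar>Q - Q'\<bar>"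
    using powr_lipschitz[OF Q, of Q2 "- \<alpha>"] by blast
  define b where "b = a / Q2"
  have b: "b > 0" using a_pos Q2 by (simp add: b_def)
  obtain E where E: "E > 0" "\<And>s. s \<ge> 0 \<Longrightarrow> s ^ 1 * exp (- b * s) \<le> E * exp (- (b / 2) * s)"
    using power_exp_bound[OF b, of 1] by blast
  define c where "c = b / 2"
  have c: "c > 0" "c \<le> b" using b by (auto simp: c_def)
  \<comment> \<open>A * P serves for the decay and for the variation of the power of
    \<open>Q\<close>, the second summand for the variation of \<open>k0\<close>; the final 1 secures
    positivity.\<close>
  define C where "C = A * P + A * P * (1 / Q1 + E / Q1\<^sup>2) + 1"
  have decay: "\<bar>k0 (max 0 (\<tau> / Q))\<bar> \<le> A * exp (- b * \<tau>)" if "\<tau> \<ge> 0" "Q \<in> {Q1..Q2}" for \<tau> Q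
  proof -
    have "Q > 0" using that Q by simp
    then have "b * \<tau> \<le> a * (\<tau> / Q)" using that a_pos by (simp add: b_def frac_le mult_nonneg_nonneg)
    then have "exp (- a * max 0 (\<tau> / Q)) \<le> exp (- b * \<tau>)" using that \<open>Q > 0\<close> by (simp add: max_def)
    then have "A * exp (- a * max 0 (\<tau> / Q)) \<le> A * exp (- b * \<tau>)" using A_pos by (intro mult_left_mono) auto
    then show ?thesis using kernel_abs order_trans by blast
  qed
  have eb: "exp (- b * \<tau>) \<le> exp (- c * \<tau>)" if "\<tau> \<ge> 0" for \<tau> using c that by (simp add: mult_right_mono)
  have b1: "\<bar>kern \<alpha> \<tau> Q\<bar> \<le> C * exp (- c * \<tau>)" if "\<tau> \<ge> 0" "Q \<in> {Q1..Q2}" for \<tau> Q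
  proof -
    have "\<bar>kern \<alpha> \<tau> Q\<bar> \<le> (A * exp (- b * \<tau>)) * P"
      unfolding kern_def abs_mult using decay[OF that] P(2)[OF that(2)] A_pos by (intro mult_mono) auto
    also have "\<dots> \<le> (A * exp (- c * \<tau>)) * P" using eb[OF that(1)] A_pos P(1) by (intro mult_right_mono mult_left_mono) auto
    also have "\<dots> = (A * P) * exp (- c * \<tau>)" by simp
    also have "\<dots> \<le> C * exp (- c * \<tau>)"
      unfolding C_def using A_pos P(1) Q E(1) by (intro mult_right_mono) auto
    finally show ?thesis .
  qed
  have b2: "\<bar>kern \<alpha> \<tau> Q - kern \<alpha> \<tau>' Q'\<bar> \<le> C * (\<bar>\<tau> - \<tau>'\<bar> + \<bar>Q - Q'\<bar>) * exp (- c * min \<tau> \<tau>')"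
    if t: "0 \<le> \<tau>'" "\<tau>' \<le> \<tau>" and QQ: "Q \<in> {Q1..Q2}" "Q' \<in> {Q1..Q2}" for \<tau> \<tau>' Q Q'
  proof -
    have Qp: "Q > 0" "Q' > 0" "Q1 \<le> Q" "Q1 \<le> Q'" "Q \<le> Q2" "Q' \<le> Q2" using QQ Q by auto
    let ?x = "\<tau> / Q" and ?y = "\<tau>' / Q'"
    have xy: "?x \<ge> 0" "?y \<ge> 0" using t Qp by auto
    have "\<tau>' / Q2 \<le> ?x" using t Qp by (intro frac_le) auto
    moreover have "\<tau>' / Q2 \<le> ?y" using t Qp by (intro frac_le) auto
    ultimately have "a * (\<tau>' / Q2) \<le> a * min ?x ?y" using a_pos by (intro mult_left_mono) auto
    then have "b * \<tau>' \<le> a * min ?x ?y" by (simp add: b_def)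
    then have em: "exp (- a * min ?x ?y) \<le> exp (- b * \<tau>')" by simp
    let ?d = "\<bar>\<tau> - \<tau>'\<bar> + \<bar>Q - Q'\<bar>" and ?F = "1 / Q1 + E / Q1\<^sup>2"
    have "?x - ?y = (\<tau> - \<tau>') / Q + \<tau>' * (Q' - Q) / (Q * Q')" using Qp by (simp add: field_simps)
    then have "\<bar>?x - ?y\<bar> \<le> \<bar>\<tau> - \<tau>'\<bar> / Q + \<tau>' * \<bar>Q - Q'\<bar> / (Q * Q')"
      using abs_triangle_ineq[of "(\<tau> - \<tau>') / Q" "\<tau>' * (Q' - Q) / (Q * Q')"] t Qp by (simp add: abs_mult abs_minus_commute)
    also have "\<dots> \<le> ?d / Q1 + \<tau>' * ?d / Q1\<^sup>2"
      using t Qp Q by (intro add_mono frac_le mult_left_mono) (auto simp: power2_eq_square intro: mult_mono)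
    also have "\<dots> = (1 / Q1 + \<tau>' / Q1\<^sup>2) * ?d" by (simp add: distrib_right)
    finally have dxy: "\<bar>?x - ?y\<bar> \<le> (1 / Q1 + \<tau>' / Q1\<^sup>2) * ?d" .
    have "(1 / Q1 + \<tau>' / Q1\<^sup>2) * exp (- b * \<tau>') = 1 / Q1 * exp (- b * \<tau>') + \<tau>' ^ 1 * exp (- b * \<tau>') / Q1\<^sup>2" by (simp add: distrib_right)
    also have "\<dots> \<le> 1 / Q1 * exp (- c * \<tau>') + E * exp (- c * \<tau>') / Q1\<^sup>2"
      using E(2)[OF t(1)] eb[OF t(1)] Q unfolding c_def[symmetric] by (intro add_mono divide_right_mono mult_left_mono) auto
    also have "\<dots> = ?F * exp (- c * \<tau>')" by (simp add: distrib_right)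
    finally have F: "(1 / Q1 + \<tau>' / Q1\<^sup>2) * exp (- b * \<tau>') \<le> ?F * exp (- c * \<tau>')" .
    have "\<bar>k0 ?x - k0 ?y\<bar> \<le> A * \<bar>?x - ?y\<bar> * exp (- a * min ?x ?y)" using kernel_lipschitz xy by blast
    also have "\<dots> \<le> A * ((1 / Q1 + \<tau>' / Q1\<^sup>2) * ?d) * exp (- b * \<tau>')"
      using dxy em A_pos t Q by (intro mult_mono mult_left_mono) auto
    also have "\<dots> = A * ?d * ((1 / Q1 + \<tau>' / Q1\<^sup>2) * exp (- b * \<tau>'))" by (simp only: mult_ac)
    also have "\<dots> \<le> A * ?d * (?F * exp (- c * \<tau>'))" using F A_pos by (intro mult_left_mono) auto
    finally have k: "\<bar>k0 ?x - k0 ?y\<bar> \<le> A * ?F * ?d * exp (- c * \<tau>')" by (simp only: mult_ac)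
    have m: "max 0 ?x = ?x" "max 0 ?y = ?y" using xy by auto
    have "kern \<alpha> \<tau> Q - kern \<alpha> \<tau>' Q' = (k0 ?x - k0 ?y) * Q powr (- \<alpha>) + k0 ?y * (Q powr (- \<alpha>) - Q' powr (- \<alpha>))"
      by (simp add: kern_def m algebra_simps)
    also have "\<bar>\<dots>\<bar> \<le> \<bar>k0 ?x - k0 ?y\<bar> * \<bar>Q powr (- \<alpha>)\<bar> + \<bar>k0 ?y\<bar> * \<bar>Q powr (- \<alpha>) - Q' powr (- \<alpha>)\<bar>"
      by (metis abs_mult abs_triangle_ineq)
    also have "\<dots> \<le> (A * ?F * ?d * exp (- c * \<tau>')) * P + (A * exp (- b * \<tau>')) * (P * \<bar>Q - Q'\<bar>)"
      using k P QQ decay[OF t(1) QQ(2)] A_pos Q E(1) unfolding m by (intro add_mono mult_mono) auto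
    also have "\<dots> \<le> (A * ?F * ?d * exp (- c * \<tau>')) * P + (A * exp (- c * \<tau>')) * (P * ?d)"
      using eb[OF t(1)] A_pos P(1) by (intro add_mono order_refl mult_mono mult_left_mono) auto
    also have "\<dots> = (C - 1) * ?d * exp (- c * \<tau>')"
      by (simp add: C_def algebra_simps)
    also have "\<dots> \<le> C * ?d * exp (- c * \<tau>')" by (intro mult_right_mono) auto
    finally show ?thesis using t by (simp add: min_absorb2)
  qed
  have b3: "\<bar>kern \<alpha> \<tau> Q - kern \<alpha> \<tau>' Q'\<bar> \<le> C * (\<bar>\<tau> - \<tau>'\<bar> + \<bar>Q - Q'\<bar>) * exp (- c * min \<tau> \<tau>')"
    if "\<tau> \<ge> 0" "\<tau>' \<ge> 0" "Q \<in> {Q1..Q2}" "Q' \<in> {Q1..Q2}" for \<tau> \<tau>' Q Q'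
    using b2[of \<tau>' \<tau> Q Q'] b2[of \<tau> \<tau>' Q' Q] that
    by (cases "\<tau>' \<le> \<tau>") (simp_all add: min.commute abs_minus_commute)
  have Cpos: "C > 0" unfolding C_def using A_pos P(1) Q E(1) by (intro add_nonneg_pos add_nonneg_nonneg mult_nonneg_nonneg) auto
  show ?thesis unfolding kern_bound_def
    by (rule exI[of _ C], rule exI[of _ c], intro conjI allI impI ballI Cpos c(1)) (rule b1 b3; assumption)+
qed

lemma second_moment_integrable:
  "integrable lborel (\<lambda>z :: real ^ 'd. (norm z)\<^sup>2 * k0 (max 0 ((norm z)\<^sup>2)))"
proof (rule integrableI_bounded)
  show "(\<lambda>z :: real ^ 'd. (norm z)\<^sup>2 * k0 (max 0 ((norm z)\<^sup>2))) \<in> borel_measurable lborel" by measurable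
  obtain E where E: "E > 0" "\<And>s. s \<ge> 0 \<Longrightarrow> s ^ 1 * exp (- a * s) \<le> E * exp (- (a / 2) * s)"
    using power_exp_bound[OF a_pos, of 1] by blast
  obtain C where C: "C > 0"
    "\<And>\<beta>. \<beta> > 0 \<Longrightarrow> (\<integral>\<^sup>+u. ennreal (gauss \<beta> u) \<partial>(lborel :: (real ^ 'd) measure)) \<le> ennreal (C * \<beta> powr (- real CARD('d) / 2))"
    using nn_integral_gaussian by blast
  have "(\<integral>\<^sup>+z. ennreal (norm ((norm z)\<^sup>2 * k0 (max 0 ((norm z)\<^sup>2)))) \<partial>(lborel :: (real ^ 'd) measure))
      \<le> (\<integral>\<^sup>+z. ennreal (A * E) * ennreal (gauss (a / 2) z) \<partial>(lborel :: (real ^ 'd) measure))"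
  proof (rule nn_integral_mono)
    fix z :: "real ^ 'd"
    have "norm ((norm z)\<^sup>2 * k0 (max 0 ((norm z)\<^sup>2))) \<le> (norm z)\<^sup>2 * (A * gauss a z)"
      using kernel_abs[of "(norm z)\<^sup>2"] by (simp add: abs_mult mult_left_mono)
    also have "\<dots> = A * (((norm z)\<^sup>2) ^ 1 * gauss a z)" by simp
    also have "\<dots> \<le> A * (E * gauss (a / 2) z)" using A_pos by (intro mult_left_mono E(2)) auto
    finally show "ennreal (norm ((norm z)\<^sup>2 * k0 (max 0 ((norm z)\<^sup>2)))) \<le> ennreal (A * E) * ennreal (gauss (a / 2) z)"
      using A_pos E(1) by (simp add: ennreal_mult[symmetric] ennreal_leI mult.assoc)
  qed
  also have "\<dots> = ennreal (A * E) * (\<integral>\<^sup>+z. ennreal (gauss (a / 2) z) \<partial>(lborel :: (real ^ 'd) measure))"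
    by (rule nn_integral_cmult) simp
  also have "\<dots> \<le> ennreal (A * E) * ennreal (C * (a / 2) powr (- real CARD('d) / 2))"
    using a_pos by (intro mult_left_mono C(2)) auto
  also have "\<dots> < \<infinity>" by (simp add: ennreal_mult_less_top)
  finally show "(\<integral>\<^sup>+z. ennreal (norm ((norm z)\<^sup>2 * k0 (max 0 ((norm z)\<^sup>2)))) \<partial>(lborel :: (real ^ 'd) measure)) < \<infinity>" .
qed

lemma kernel_m2_eq: "kernel_m2 (T :: 'd::finite itself) k0 =
    1 / real CARD('d) * (LINT z|(lborel :: (real ^ 'd) measure). (norm z)\<^sup>2 * k0 (max 0 ((norm z)\<^sup>2)))"
  by (simp add: kernel_m2_def)

text \<open>Continuity spreads the positive value at \<xi> to a ball around a vector of squared norm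
  \<xi>, and balls have positive Lebesgue measure.\<close>

lemma kernel_m2_pos: "kernel_m2 (T :: 'd::finite itself) k0 > 0"
proof -
  let ?g = "\<lambda>z :: real ^ 'd. (norm z)\<^sup>2 * k0 (max 0 ((norm z)\<^sup>2))"
  have nn: "?g z \<ge> 0" for z using kernel_nonneg by simp
  have c: "continuous_on UNIV ?g"
    by (intro continuous_intros continuous_on_compose2[OF kernel_continuous]) auto
  have "(LINT z|lborel. ?g z) \<noteq> 0"
  proof
    assume "(LINT z|lborel. ?g z) = 0"
    then have ae: "AE z in lborel. ?g z = 0"
      using integral_nonneg_eq_0_iff_AE[OF second_moment_integrable] nn by auto
    obtain \<xi> where \<xi>: "\<xi> > 0" "k0 \<xi> > 0" using kernel_nonzero by blast
    define z :: "real ^ 'd" where "z = sqrt \<xi> *\<^sub>R axis undefined 1"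
    have "(norm z)\<^sup>2 = \<xi>" using \<xi> by (simp add: z_def)
    then have "?g z > 0" using \<xi> by simp
    then obtain e where e: "e > 0" "\<And>y. dist y z < e \<Longrightarrow> dist (?g y) (?g z) < ?g z"
      using c unfolding continuous_on_iff by (metis UNIV_I)
    have "AE y in lborel. y \<notin> ball z e"
      using ae
    proof eventually_elim
      case (elim y)
      then show ?case using e(2)[of y] by (auto simp: dist_commute dist_real_def)
    qed
    then have "emeasure lborel (ball z e) = 0" by (rule AE_iff_measurable[THEN iffD1, rotated 2]) auto
    then show False using content_ball_pos[OF e(1), of z] by (simp add: measure_def)
  qed
  moreover have "(LINT z|lborel. ?g z) \<ge> 0" using nn by simp
  ultimately show ?thesis by (simp add: kernel_m2_eq)
qed

end

section \<open>Products and increments taken symmetrically about a midpoint\<close>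

lemma Ck_symmetric_product:
  fixes g :: "'a::euclidean_space \<Rightarrow> real"
  assumes "Ck_on 2 g U" "compact K" "K \<subseteq> U"
  shows "\<exists>C\<ge>0. \<forall>m w. closed_segment (m - w) (m + w) \<subseteq> K \<longrightarrow> \<bar>g (m + w) * g (m - w) - (g m)\<^sup>2\<bar> \<le> C * (norm w)\<^sup>2"
proof -
  have g1: "Ck_on (Suc 0) g U" using assms(1) by (rule Ck_on_mono) simp
  obtain C1 where C1: "C1 \<ge> 0" "\<And>a w. closed_segment a (a + w) \<subseteq> K \<Longrightarrow> norm (g (a + w) - g a) \<le> C1 * norm w"
    using C1_segment_bound[OF g1 assms(2,3)] by blast
  obtain C2 where C2: "C2 \<ge> 0" "\<And>m w. closed_segment (m - w) (m + w) \<subseteq> K \<Longrightarrow> norm (g (m + w) + g (m - w) - 2 *\<^sub>R g m) \<le> C2 * norm w ^ 2"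
    using C2_symmetric_bound[OF assms] by blast
  have "continuous_on K g" using Ck_on_imp_continuous_on[OF g1] assms(3) continuous_on_subset by blast
  then obtain B where B: "B \<ge> 0" "\<And>x. x \<in> K \<Longrightarrow> norm (g x) \<le> B" using compact_continuous_bound[OF assms(2)] by blast
  show ?thesis
  proof (intro exI[of _ "B * C2 + C1 * C1"] conjI allI impI)
    fix m w :: 'a assume s: "closed_segment (m - w) (m + w) \<subseteq> K"
    have 1: "closed_segment m (m + w) \<subseteq> K" "closed_segment m (m + (-w)) \<subseteq> K"
      using closed_segment_symmetric_subset[OF s, of 0 1] closed_segment_symmetric_subset[OF s, of 0 "-1"] by auto
    have m: "m \<in> K" using 1 by auto
    \<comment> \<open>The first-order terms cancel: what remains is a second symmetric difference
      and a product of two first-order increments, both quadratic in w.\<close>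
    have "g (m + w) * g (m - w) - (g m)\<^sup>2 = g m * (g (m + w) + g (m - w) - 2 *\<^sub>R g m) + (g (m + w) - g m) * (g (m + -w) - g m)"
      by (simp add: algebra_simps power2_eq_square)
    also have "\<bar>\<dots>\<bar> \<le> \<bar>g m\<bar> * \<bar>g (m + w) + g (m - w) - 2 *\<^sub>R g m\<bar> + \<bar>g (m + w) - g m\<bar> * \<bar>g (m + -w) - g m\<bar>"
      by (metis abs_mult abs_triangle_ineq)
    also have "\<dots> \<le> B * (C2 * norm w ^ 2) + (C1 * norm w) * (C1 * norm (-w))"
      using B(2)[OF m] C2(2)[OF s] C1(2)[OF 1(1)] C1(2)[OF 1(2)] B(1) C1(1) by (intro add_mono mult_mono) auto
    also have "\<dots> = (B * C2 + C1 * C1) * (norm w)\<^sup>2" by (simp add: power2_eq_square algebra_simps)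
    finally show "\<bar>g (m + w) * g (m - w) - (g m)\<^sup>2\<bar> \<le> (B * C2 + C1 * C1) * (norm w)\<^sup>2" .
  qed (use B C1 C2 in auto)
qed

text \<open>Needed for bandwidth and weight, which are powers of positive C^2 functions. The product
  of the two values stays in a compact interval of positive numbers, where the power is Lipschitz,
  so it inherits the quadratic error of the product.\<close>

lemma Ck_symmetric_product_powr:
  fixes g :: "'a::euclidean_space \<Rightarrow> real"
  assumes "Ck_on 2 g U" "compact K" "K \<subseteq> U" and pos: "\<And>x. x \<in> U \<Longrightarrow> g x > 0"
  shows "\<exists>C\<ge>0. \<forall>m w. closed_segment (m - w) (m + w) \<subseteq> K \<longrightarrow>
     \<bar>g (m + w) powr s * g (m - w) powr s - (g m powr s)\<^sup>2\<bar> \<le> C * (norm w)\<^sup>2"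
proof (cases "K = {}")
  case True
  then show ?thesis by (intro exI[of _ 0]) auto
next
  case False
  obtain C where C: "C \<ge> 0" "\<And>m w. closed_segment (m - w) (m + w) \<subseteq> K \<Longrightarrow> \<bar>g (m + w) * g (m - w) - (g m)\<^sup>2\<bar> \<le> C * (norm w)\<^sup>2"
    using Ck_symmetric_product[OF assms(1-3)] by blast
  have cont: "continuous_on K g" using Ck_on_imp_continuous_on[OF assms(1)] assms(3) continuous_on_subset by blast
  obtain x0 where x0: "x0 \<in> K" "\<And>x. x \<in> K \<Longrightarrow> g x0 \<le> g x" using continuous_attains_inf[OF assms(2) False cont] by blast
  obtain x1 where x1: "x1 \<in> K" "\<And>x. x \<in> K \<Longrightarrow> g x \<le> g x1" using continuous_attains_sup[OF assms(2) False cont] by blast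
  have p0: "g x0 > 0" "g x1 > 0" using pos x0 x1 assms(3) by auto
  then have Q1: "g x0 * g x0 > 0" by simp
  obtain P where P: "P \<ge> 0"
    "\<And>Q Q'. Q \<in> {g x0 * g x0..g x1 * g x1} \<Longrightarrow> Q' \<in> {g x0 * g x0..g x1 * g x1} \<Longrightarrow> \<bar>Q powr s - Q' powr s\<bar> \<le> P * \<bar>Q - Q'\<bar>"
    using powr_lipschitz[OF Q1, of "g x1 * g x1" s] by blast
  show ?thesis
  proof (intro exI[of _ "P * C"] conjI allI impI)
    fix m w :: 'a assume s: "closed_segment (m - w) (m + w) \<subseteq> K"
    have "closed_segment (m + 0 *\<^sub>R w) (m + 0 *\<^sub>R w) \<subseteq> K" using closed_segment_symmetric_subset[OF s, of 0 0] by simp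
    then have K: "m \<in> K" "m + w \<in> K" "m - w \<in> K" using s by auto
    have r: "g a * g b \<in> {g x0 * g x0..g x1 * g x1}" if "a \<in> K" "b \<in> K" for a b
      using x0(2)[OF that(1)] x0(2)[OF that(2)] x1(2)[OF that(1)] x1(2)[OF that(2)] p0 by (auto intro!: mult_mono)
    have pp: "g a > 0" if "a \<in> K" for a using that pos assms(3) by blast
    have "\<bar>g (m + w) powr s * g (m - w) powr s - (g m powr s)\<^sup>2\<bar> = \<bar>(g (m + w) * g (m - w)) powr s - (g m * g m) powr s\<bar>"
      using pp[OF K(1)] pp[OF K(2)] pp[OF K(3)] by (simp add: powr_mult power2_eq_square)
    also have "\<dots> \<le> P * \<bar>g (m + w) * g (m - w) - g m * g m\<bar>" using r K by (intro P(2)) auto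
    also have "\<dots> \<le> P * (C * (norm w)\<^sup>2)" using C(2)[OF s] P(1) by (intro mult_left_mono) (auto simp: power2_eq_square)
    finally show "\<bar>g (m + w) powr s * g (m - w) powr s - (g m powr s)\<^sup>2\<bar> \<le> P * C * (norm w)\<^sup>2" by (simp add: mult.assoc)
  qed (use P C in auto)
qed

lemma abs_mult_le: "\<bar>x\<bar> \<le> a \<Longrightarrow> \<bar>y\<bar> \<le> b \<Longrightarrow> \<bar>x * y\<bar> \<le> a * (b :: real)"
  by (simp add: abs_mult mult_mono')

lemma abs_mult_diff_le:
  fixes x x0 y y0 :: real
  assumes "\<bar>x - x0\<bar> \<le> dx" "\<bar>y\<bar> \<le> b" "\<bar>x0\<bar> \<le> a" "\<bar>y - y0\<bar> \<le> dy"
  shows "\<bar>x * y - x0 * y0\<bar> \<le> dx * b + a * dy"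
proof -
  have "x * y - x0 * y0 = (x - x0) * y + x0 * (y - y0)" by (simp add: algebra_simps)
  then have "\<bar>x * y - x0 * y0\<bar> \<le> \<bar>x - x0\<bar> * \<bar>y\<bar> + \<bar>x0\<bar> * \<bar>y - y0\<bar>" by (metis abs_mult abs_triangle_ineq)
  also have "\<dots> \<le> dx * b + a * dy" using assms by (intro add_mono mult_mono) auto
  finally show ?thesis .
qed

text \<open>Telescoping in the shape of the integrand: kernel x, increments y and z, weight
  w.\<close>

lemma abs_mult4_diff_le:
  fixes x x0 y y0 z z0 w w0 :: real
  assumes "\<bar>x - x0\<bar> \<le> dx" "\<bar>x\<bar> \<le> a" "\<bar>x0\<bar> \<le> a" "\<bar>y - y0\<bar> \<le> dy" "\<bar>y\<bar> \<le> b" "\<bar>y0\<bar> \<le> b"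
    "\<bar>z - z0\<bar> \<le> dz" "\<bar>z\<bar> \<le> c" "\<bar>z0\<bar> \<le> c" "\<bar>w - w0\<bar> \<le> dw" "\<bar>w\<bar> \<le> d" "\<bar>w0\<bar> \<le> d"
  shows "\<bar>x * (y * z) * w - x0 * (y0 * z0) * w0\<bar> \<le> (dx * (b * c) + a * (dy * c + b * dz)) * d + (a * (b * c)) * dw"
proof (intro abs_mult_diff_le)
  have ab: "0 \<le> a" "0 \<le> b" using assms(3,6) by linarith+
  have bc: "\<bar>y0 * z0\<bar> \<le> b * c" unfolding abs_mult by (rule mult_mono[OF assms(6,9) ab(2) abs_ge_zero])
  show "\<bar>y * z\<bar> \<le> b * c" unfolding abs_mult by (rule mult_mono[OF assms(5,8) ab(2) abs_ge_zero])
  show "\<bar>x0 * (y0 * z0)\<bar> \<le> a * (b * c)"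
    unfolding abs_mult[of x0] by (rule mult_mono[OF assms(3) bc ab(1) abs_ge_zero])
qed (rule assms)+

abbreviation lo :: "'a::real_vector \<Rightarrow> 'a \<Rightarrow> 'a" where "lo m w \<equiv> m - (1/2) *\<^sub>R w"
abbreviation hi :: "'a::real_vector \<Rightarrow> 'a \<Rightarrow> 'a" where "hi m w \<equiv> m + (1/2) *\<^sub>R w"
abbreviation seg :: "'a::real_vector \<Rightarrow> 'a \<Rightarrow> 'a set" where "seg m w \<equiv> closed_segment (lo m w) (hi m w)"

text \<open>Smooth functions evaluated symmetrically about a midpoint: the increment is odd, so that its
  error is cubic.\<close>

definition increment_bound :: "'a set \<Rightarrow> ('a::euclidean_space \<Rightarrow> 'b::real_normed_vector) \<Rightarrow> real \<Rightarrow> bool" where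
  "increment_bound S g C \<longleftrightarrow> C \<ge> 0 \<and> (\<forall>m\<in>S. \<forall>w. norm (fderiv g m w) \<le> C * norm w) \<and>
    (\<forall>m w. seg m w \<subseteq> S \<longrightarrow> norm (g (hi m w) - g (lo m w) - fderiv g m w) \<le> C * norm w ^ 3 \<and>
      norm (g (hi m w) - g (lo m w)) \<le> C * norm w)"

lemma increment_boundD:
  assumes "increment_bound S g C"
  shows "C \<ge> 0" "\<And>m w. m \<in> S \<Longrightarrow> norm (fderiv g m w) \<le> C * norm w"
    "\<And>m w. seg m w \<subseteq> S \<Longrightarrow> norm (g (hi m w) - g (lo m w) - fderiv g m w) \<le> C * norm w ^ 3"
    "\<And>m w. seg m w \<subseteq> S \<Longrightarrow> norm (g (hi m w) - g (lo m w)) \<le> C * norm w"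
  using assms unfolding increment_bound_def by blast+

lemma Ck_increment:
  fixes g :: "'a::euclidean_space \<Rightarrow> 'b::real_normed_vector"
  assumes g: "Ck_on 3 g U" and S: "compact S" "S \<subseteq> U"
  shows "\<exists>C. increment_bound S g C"
proof -
  have g1: "Ck_on (Suc 0) g U" using g by (rule Ck_on_mono) simp
  obtain C1 where C1: "C1 \<ge> 0" "\<And>a w. closed_segment a (a + w) \<subseteq> S \<Longrightarrow> norm (g (a + w) - g a) \<le> C1 * norm w"
    using C1_segment_bound[OF g1 S] by blast
  obtain C3 where C3: "C3 \<ge> 0" "\<And>m w. closed_segment (m - w) (m + w) \<subseteq> S \<Longrightarrow>
       norm (g (m + w) - g (m - w) - 2 *\<^sub>R fderiv g m w) \<le> C3 * norm w ^ 3"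
    using C3_symmetric_bound[OF g S] by blast
  have "continuous_on S (\<lambda>x. \<Sum>b\<in>Basis. norm (fderiv g x b))"
    using g1 S(2) by (intro continuous_intros) (auto intro: continuous_on_subset)
  then obtain D where D: "D \<ge> 0" "\<And>x. x \<in> S \<Longrightarrow> norm (\<Sum>b\<in>Basis. norm (fderiv g x b)) \<le> D"
    using compact_continuous_bound[OF S(1)] by blast
  have D': "norm (fderiv g m w) \<le> D * norm w" if m: "m \<in> S" for m w
  proof -
    have bl: "bounded_linear (fderiv g m)" using Ck_on_bounded_linear[OF g1] m S(2) by blast
    have "norm (fderiv g m w) \<le> onorm (fderiv g m) * norm w" by (rule onorm[OF bl])
    also have "\<dots> \<le> D * norm w"
      using onorm_le_sum_Basis[OF bl] D(2)[OF m] by (intro mult_right_mono) auto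
    finally show ?thesis .
  qed
  show ?thesis unfolding increment_bound_def
  proof (intro exI[of _ "C1 + C3 + D"] conjI allI impI ballI)
    show "norm (fderiv g m w) \<le> (C1 + C3 + D) * norm w" if "m \<in> S" for m w
      using D'[OF that, of w] C1(1) C3(1) by (simp add: algebra_simps add_increasing)
    fix m w :: 'a assume s: "seg m w \<subseteq> S"
    have "closed_segment (m + 0 *\<^sub>R w) (m + 0 *\<^sub>R w) \<subseteq> S" using closed_segment_symmetric_subset[OF s, of 0 0] by simp
    then have "m \<in> U" using S(2) by auto
    then have "2 *\<^sub>R fderiv g m ((1/2) *\<^sub>R w) = fderiv g m w"
      using Ck_on_bounded_linear[OF g1] by (simp add: linear_scale bounded_linear.linear)
    then have "norm (g (hi m w) - g (lo m w) - fderiv g m w) \<le> C3 * norm ((1/2) *\<^sub>R w) ^ 3"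
      using C3(2)[OF s] by simp
    also have "\<dots> \<le> C3 * norm w ^ 3" using C3(1) by (intro mult_left_mono power_mono) auto
    also have "\<dots> \<le> (C1 + C3 + D) * norm w ^ 3" using C1(1) D(1) by (intro mult_right_mono) auto
    finally show "norm (g (hi m w) - g (lo m w) - fderiv g m w) \<le> (C1 + C3 + D) * norm w ^ 3" .
    have e: "lo m w + w = hi m w" by (simp add: algebra_simps flip: scaleR_add_left)
    have "norm (g (hi m w) - g (lo m w)) \<le> C1 * norm w"
      using C1(2)[of "lo m w" w] s unfolding e by blast
    also have "\<dots> \<le> (C1 + C3 + D) * norm w" using C3(1) D(1) by (intro mult_right_mono) auto
    finally show "norm (g (hi m w) - g (lo m w)) \<le> (C1 + C3 + D) * norm w" .
  qed (use C1 C3 D in auto)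
qed

section \<open>Midpoint coordinates and Gaussian error integrals\<close>

lemma lborel_pair_bounded_integrable:
  fixes G :: "'a::euclidean_space \<times> 'b::euclidean_space \<Rightarrow> real"
  assumes m: "G \<in> borel_measurable lborel2" and b: "\<And>u v. \<bar>G (u, v)\<bar> \<le> B"
    and z: "\<And>u v. u \<notin> cball 0 R \<or> v \<notin> cball 0 R' \<Longrightarrow> G (u, v) = 0"
  shows "integrable lborel2 G"
proof (rule integrableI_bounded_set[where A="cball 0 R \<times> cball 0 R'" and B=B])
  have "emeasure lborel2 (cball (0::'a) R \<times> cball (0::'b) R') = emeasure lborel (cball (0::'a) R) * emeasure lborel (cball (0::'b) R')"
    by (intro lborel.emeasure_pair_measure_Times) auto
  also have "\<dots> < \<infinity>"
    using emeasure_bounded_finite[OF bounded_cball, of "0::'a" R] emeasure_bounded_finite[OF bounded_cball, of "0::'b" R']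
    by (simp add: ennreal_mult_less_top)
  finally show "emeasure lborel2 (cball (0::'a) R \<times> cball (0::'b) R') < \<infinity>" .
  show "AE x in lborel \<Otimes>\<^sub>M lborel. x \<in> cball 0 R \<times> cball 0 R' \<longrightarrow> norm (G x) \<le> B"
    using b by (intro AE_I2) auto
  show "AE x in lborel \<Otimes>\<^sub>M lborel. x \<notin> cball 0 R \<times> cball 0 R' \<longrightarrow> G x = 0"
  proof (intro AE_I2 impI)
    fix x :: "'a \<times> 'b" assume "x \<notin> cball 0 R \<times> cball 0 R'"
    then show "G x = 0" using z[of "fst x" "snd x"] by (cases x) auto
  qed
qed (use m in auto)

text \<open>Two shears, each a translation in one variable: (u, v) becomes (u, v - u), and then u
  becomes the midpoint. No Jacobian appears, so Fubini and translation invariance suffice;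
  boundedness and bounded support keep each intermediate integrand integrable.\<close>

lemma midpoint_substitution:
  fixes G :: "'a::euclidean_space \<times> 'a \<Rightarrow> real"
  assumes m: "G \<in> borel_measurable lborel2" and b: "\<And>u v. \<bar>G (u, v)\<bar> \<le> B"
    and z: "\<And>u v. u \<notin> cball 0 R \<or> v \<notin> cball 0 R \<Longrightarrow> G (u, v) = 0"
  shows "integrable lborel2 (\<lambda>(m, w). G (lo m w, hi m w))"
    "(LINT z|lborel2. G z) = (LINT (m, w)|lborel2. G (lo m w, hi m w))"
proof -
  have mb: "G \<in> borel_measurable (borel \<Otimes>\<^sub>M borel)" using m by (simp cong: measurable_cong_sets)
  have c1: "(\<lambda>(u, w). G (u, u + w)) \<in> borel_measurable lborel2"
    using mb by measurable
  have c2: "(\<lambda>(m, w). G (lo m w, hi m w)) \<in> borel_measurable lborel2"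
    using mb by measurable
  have bd: "norm w \<le> 2 * R" if "u \<in> cball 0 R" "u + w \<in> cball 0 R" for u w :: 'a
  proof -
    have "norm w \<le> norm (u + w) + norm u" using norm_triangle_ineq4[of "u + w" u] by simp
    then show ?thesis using that by simp
  qed
  have i0: "integrable lborel2 G" using lborel_pair_bounded_integrable[OF m b z] by blast
  have i1: "integrable lborel2 (\<lambda>(u, w). G (u, u + w))"
  proof (rule lborel_pair_bounded_integrable[OF c1, of B R "2 * R"])
    show "(case (u, w) of (u, w) \<Rightarrow> G (u, u + w)) = 0" if "u \<notin> cball 0 R \<or> w \<notin> cball 0 (2 * R)" for u w
      using that bd[of u w] z[of u "u + w"] by auto
  qed (use b in auto)
  show i2: "integrable lborel2 (\<lambda>(m, w). G (lo m w, hi m w))"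
  proof (rule lborel_pair_bounded_integrable[OF c2, of B R "2 * R"])
    fix m w :: 'a assume mw: "m \<notin> cball 0 R \<or> w \<notin> cball 0 (2 * R)"
    show "(case (m, w) of (m, w) \<Rightarrow> G (lo m w, hi m w)) = 0"
    proof (rule ccontr)
      assume "\<not> ?thesis"
      then have uv: "lo m w \<in> cball 0 R" "hi m w \<in> cball 0 R" using z by fastforce+
      have e: "lo m w + w = hi m w" by (simp add: algebra_simps flip: scaleR_add_left)
      have "norm w \<le> 2 * R" using bd[of "lo m w" w] uv unfolding e by blast
      moreover have "m \<in> cball 0 R"
      proof -
        have "(1/2) *\<^sub>R (lo m w) + (1/2) *\<^sub>R (hi m w) \<in> cball 0 R"
          using convex_cball uv by (intro convexD) auto
        moreover have "(1/2) *\<^sub>R (lo m w) + (1/2) *\<^sub>R (hi m w) = m"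
          by (simp add: algebra_simps flip: scaleR_add_left)
        ultimately show ?thesis by simp
      qed
      ultimately show False using mw by simp
    qed
  qed (use b in auto)
  have Gb: "(\<lambda>v. G (u, v)) \<in> borel_measurable borel" for u using mb by measurable
  have Gb2: "(\<lambda>u. G (u, u + w)) \<in> borel_measurable borel" for w using mb by measurable
  have "(LINT z|lborel2. G z) = (LINT u|lborel. (LINT v|lborel. G (u, v)))"
    using lborel_pair.integral_fst'[OF i0] by simp
  also have "\<dots> = (LINT u|lborel. (LINT w|lborel. G (u, w + u)))"
    by (simp only: integral_lborel_translate[OF Gb])
  also have "\<dots> = (LINT w|lborel. (LINT u|lborel. G (u, u + w)))"
    using lborel_pair.Fubini_integral[OF i1] by (simp add: add.commute)
  also have "\<dots> = (LINT w|lborel. (LINT m|lborel. G (m + (- (1/2)) *\<^sub>R w, (m + (- (1/2)) *\<^sub>R w) + w)))"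
    by (simp only: integral_lborel_translate[OF Gb2])
  also have "\<dots> = (LINT w|lborel. (LINT m|lborel. G (lo m w, hi m w)))"
  proof -
    have e1: "m + (- (1/2)) *\<^sub>R w = lo m w" for m w :: 'a by simp
    have e2: "lo m w + w = hi m w" for m w :: 'a
      by (simp add: algebra_simps flip: scaleR_add_left)
    show ?thesis unfolding e1 e2 ..
  qed
  also have "\<dots> = (LINT (m, w)|lborel2. G (lo m w, hi m w))"
    by (rule lborel_pair.integral_snd[OF i2])
  finally show "(LINT z|lborel2. G z) = (LINT (m, w)|lborel2. G (lo m w, hi m w))" .
qed

text \<open>Compares a double integral with an iterated one. The model \<open>h\<close> is treated
  section by section and its inner integral \<open>I\<close> is supplied, because for a fixed base
  point the model integral is computed exactly on the tangent space. The constant is independent of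
  the integrands and of the width.\<close>

definition iterated_gaussian :: "'d::finite itself \<Rightarrow> real \<Rightarrow> real \<Rightarrow> bool" where
  "iterated_gaussian _ R C \<longleftrightarrow> C > 0 \<and> (\<forall>B\<ge>0. \<forall>b>0. \<forall>(g :: real ^ 'd \<Rightarrow> real ^ 'd \<Rightarrow> real) h I. integrable lborel2 (case_prod g) \<longrightarrow>
     (\<forall>m. h m \<in> borel_measurable lborel) \<longrightarrow> (\<forall>m. (LINT w|lborel. h m w) = I m) \<longrightarrow> integrable lborel I \<longrightarrow>
     (\<forall>m w. \<bar>g m w - h m w\<bar> \<le> B * (indicator (cball 0 R) m * gauss b w)) \<longrightarrow>
     \<bar>(LINT z|lborel2. case_prod g z) - (LINT m|lborel. I m)\<bar> \<le> B * (C * b powr (- real CARD('d) / 2)))"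

lemma iterated_gaussianD:
  fixes g h :: "real ^ 'd::finite \<Rightarrow> real ^ 'd \<Rightarrow> real"
  assumes "iterated_gaussian TYPE('d) R C"
  shows "C > 0"
    "B \<ge> 0 \<Longrightarrow> b > 0 \<Longrightarrow> integrable lborel2 (case_prod g) \<Longrightarrow> (\<And>m. h m \<in> borel_measurable lborel) \<Longrightarrow>
     (\<And>m. (LINT w|lborel. h m w) = I m) \<Longrightarrow> integrable lborel I \<Longrightarrow>
     (\<And>m w. \<bar>g m w - h m w\<bar> \<le> B * (indicator (cball 0 R) m * gauss b w)) \<Longrightarrow>
     \<bar>(LINT z|lborel2. case_prod g z) - (LINT m|lborel. I m)\<bar> \<le> B * (C * b powr (- real CARD('d) / 2))"
proof -
  note a = assms[unfolded iterated_gaussian_def]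
  show "C > 0" using a by (rule conjunct1)
  show "B \<ge> 0 \<Longrightarrow> b > 0 \<Longrightarrow> integrable lborel2 (case_prod g) \<Longrightarrow> (\<And>m. h m \<in> borel_measurable lborel) \<Longrightarrow>
     (\<And>m. (LINT w|lborel. h m w) = I m) \<Longrightarrow> integrable lborel I \<Longrightarrow>
     (\<And>m w. \<bar>g m w - h m w\<bar> \<le> B * (indicator (cball 0 R) m * gauss b w)) \<Longrightarrow>
     \<bar>(LINT z|lborel2. case_prod g z) - (LINT m|lborel. I m)\<bar> \<le> B * (C * b powr (- real CARD('d) / 2))"
    by (rule a[THEN conjunct2, rule_format])
qed

lemma iterated_gaussian_exists: "\<exists>C. iterated_gaussian TYPE('d::finite) R C"
proof -
  obtain G where G: "G > 0"
    "\<And>\<beta>. \<beta> > 0 \<Longrightarrow> (\<integral>\<^sup>+u. ennreal (gauss \<beta> u) \<partial>(lborel :: (real ^ 'd) measure)) \<le>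
       ennreal (G * \<beta> powr (- real CARD('d) / 2))" using nn_integral_gaussian by blast
  let ?V = "measure lborel (cball (0 :: real ^ 'd) R)"
  show ?thesis unfolding iterated_gaussian_def
  proof (intro exI[of _ "G * (?V + 1)"] conjI allI impI)
    show "G * (?V + 1) > 0" using G by (simp add: add_nonneg_pos)
    fix B b :: real and g h :: "real ^ 'd \<Rightarrow> real ^ 'd \<Rightarrow> real" and I
    assume B: "B \<ge> 0" and b: "b > 0" and g: "integrable lborel2 (case_prod g)" and h: "\<forall>m. h m \<in> borel_measurable lborel"
      and hI: "\<forall>m. (LINT w|lborel. h m w) = I m" and I: "integrable lborel I"
      and e: "\<forall>m w. \<bar>g m w - h m w\<bar> \<le> B * (indicator (cball 0 R) m * gauss b w)"
    let ?X = "G * b powr (- real CARD('d) / 2)" and ?e = "\<lambda>w :: real ^ 'd. gauss b w"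
    have i: "integrable lborel ?e"
      using le_less_trans[OF G(2)[OF b]] by (intro integrableI_bounded) auto
    have "ennreal (LINT w|lborel. ?e w) \<le> ennreal ?X" using G(2)[OF b] nn_integral_eq_integral[OF i] by simp
    then have X: "(LINT w|lborel. ?e w) \<le> ?X" using G(1) by (simp add: ennreal_le_iff)
    have "AE m in lborel. integrable lborel (g m)" using lborel_pair.AE_integrable_fst'[OF g] by simp
    then have le: "AE m in lborel. \<bar>(LINT w|lborel. g m w) - I m\<bar> \<le> B * ?X * indicator (cball 0 R) m"
    proof eventually_elim
      case (elim m)
      have d: "integrable lborel (\<lambda>w. g m w - h m w)"
        by (rule Bochner_Integration.integrable_bound[OF integrable_mult_right[OF i, of "B * indicator (cball 0 R) m"]])
          (use e h elim B in \<open>auto simp: mult.assoc intro!: borel_measurable_diff\<close>)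
      \<comment> \<open>Integrability of \<open>h m\<close> is inherited from \<open>g m\<close>,
        since their difference is dominated by a Gaussian.\<close>
      have hm: "h m = (\<lambda>w. g m w - (g m w - h m w))" by auto
      have "integrable lborel (h m)" by (subst hm) (intro Bochner_Integration.integrable_diff elim d)
      then have "\<bar>(LINT w|lborel. g m w) - I m\<bar> = \<bar>LINT w|lborel. g m w - h m w\<bar>" using hI elim by simp
      also have "\<dots> \<le> (LINT w|lborel. \<bar>g m w - h m w\<bar>)" using integral_norm_bound[of lborel "\<lambda>w. g m w - h m w"] by simp
      also have "\<dots> \<le> (LINT w|lborel. B * indicator (cball 0 R) m * ?e w)"
        using e d i by (intro integral_mono integrable_abs integrable_mult_right) (auto simp: mult.assoc)
      also have "\<dots> \<le> B * indicator (cball 0 R) m * ?X" using X B by (simp add: mult_left_mono)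
      finally show ?case by (simp only: mult_ac)
    qed
    have ig: "integrable lborel (\<lambda>m. LINT w|lborel. g m w)" using lborel_pair.integrable_fst'[OF g] by simp
    have "(LINT z|lborel2. case_prod g z) = (LINT m|lborel. (LINT w|lborel. g m w))" using lborel_pair.integral_fst'[OF g] by simp
    then have "\<bar>(LINT z|lborel2. case_prod g z) - (LINT m|lborel. I m)\<bar> = \<bar>LINT m|lborel. (LINT w|lborel. g m w) - I m\<bar>"
      using ig I by simp
    also have "\<dots> \<le> (LINT m|lborel. \<bar>(LINT w|lborel. g m w) - I m\<bar>)" using integral_norm_bound[of lborel "\<lambda>m. (LINT w|lborel. g m w) - I m"] by simp
    also have "\<dots> \<le> (LINT m|lborel. B * ?X * indicator (cball (0 :: real ^ 'd) R) m)"
      using le ig I emeasure_bounded_finite[OF bounded_cball, of "0 :: real ^ 'd" R]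
      by (intro integral_mono_AE integrable_abs integrable_mult_right Bochner_Integration.integrable_diff)
        (auto simp: integrable_indicator_iff)
    also have "\<dots> = B * ?X * ?V" by simp
    also have "\<dots> \<le> B * ?X * (?V + 1)" using B G(1) by (intro mult_left_mono) auto
    finally show "\<bar>(LINT z|lborel2. case_prod g z) - (LINT m|lborel. I m)\<bar> \<le> B * (G * (?V + 1) * b powr (- real CARD('d) / 2))" by (simp add: mult_ac)
  qed
qed

section \<open>Double integrals over the manifold\<close>

context manifold
begin

lemma pair_V: "pair_sigma_finite V V" "finite_measure VV"
proof -
  interpret finite_measure V by (rule finite_measure_V)
  show 1: "pair_sigma_finite V V" by standard
  show "finite_measure VV" by (intro finite_measure_pair_measure finite_measure_V)
qed

lemma pair_V_bounded_integrable:
  fixes F :: "(real ^ 'D) \<times> (real ^ 'D) \<Rightarrow> real"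
  assumes "F \<in> borel_measurable VV" "\<And>x y. x \<in> M \<Longrightarrow> y \<in> M \<Longrightarrow> \<bar>F (x, y)\<bar> \<le> B"
  shows "integrable VV F"
proof -
  interpret P: finite_measure "V \<Otimes>\<^sub>M V" by (rule pair_V)
  show ?thesis
    by (rule P.integrable_const_bound[of _ B]) (use assms in \<open>auto intro!: AE_I2 simp: space_pair_measure space_V\<close>)
qed

lemma pair_V_gaussian_bound:
  "\<exists>C>0. \<forall>F. \<forall>B\<ge>0. \<forall>b>0. F \<in> borel_measurable VV \<longrightarrow>
     (\<forall>x\<in>M. \<forall>y\<in>M. \<bar>F (x, y)\<bar> \<le> B * gauss b (x - y)) \<longrightarrow>
     \<bar>\<integral>z. F z \<partial>VV\<bar> \<le> B * (C * b powr (- real CARD('d) / 2))"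
proof -
  interpret V: finite_measure V by (rule finite_measure_V)
  obtain G where GC: "gaussian_const G" by (rule gaussian_constE)
  note G = gaussian_constD[OF GC]
  let ?V = "measure V M"
  have V: "emeasure V M = ennreal ?V" using V.emeasure_eq_measure by blast
  show ?thesis
  proof (intro exI[of _ "G * (?V + 1)"] conjI allI impI)
    show "G * (?V + 1) > 0" using G by (simp add: add_nonneg_pos)
    fix F :: "(real ^ 'D) \<times> (real ^ 'D) \<Rightarrow> real" and B b :: real
    assume B: "B \<ge> 0" and b: "b > 0" and m: "F \<in> borel_measurable VV"
      and e: "\<forall>x\<in>M. \<forall>y\<in>M. \<bar>F (x, y)\<bar> \<le> B * gauss b (x - y)"
    let ?X = "G * b powr (- real CARD('d) / 2)"
    have [measurable]: "(\<lambda>x. x) \<in> borel_measurable V" by (rule id_measurable_V)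
    have "(\<integral>\<^sup>+z. ennreal (norm (F z)) \<partial>VV) = (\<integral>\<^sup>+x. (\<integral>\<^sup>+y. ennreal (norm (F (x, y))) \<partial>V) \<partial>V)"
      by (rule V.nn_integral_fst[symmetric]) (rule measurable_compose[OF m], measurable)
    also have "\<dots> \<le> (\<integral>\<^sup>+x. ennreal B * ennreal ?X \<partial>V)"
    proof (rule nn_integral_mono)
      fix x assume "x \<in> space V"
      then have x: "x \<in> M" by (simp add: space_V)
      have "(\<integral>\<^sup>+y. ennreal (norm (F (x, y))) \<partial>V) \<le> (\<integral>\<^sup>+y. ennreal B * ennreal (gauss b (y - x)) \<partial>V)"
      proof (rule nn_integral_mono)
        fix y assume "y \<in> space V"
        then have "\<bar>F (x, y)\<bar> \<le> B * gauss b (y - x)"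
          using e x norm_minus_commute[of y x] by (simp add: space_V)
        then show "ennreal (norm (F (x, y))) \<le> ennreal B * ennreal (gauss b (y - x))"
          using B by (simp add: ennreal_mult[symmetric] ennreal_leI)
      qed
      also have "\<dots> = ennreal B * (\<integral>\<^sup>+y. ennreal (gauss b (y - x)) \<partial>V)"
        by (rule nn_integral_cmult) measurable
      also have "\<dots> \<le> ennreal B * ennreal ?X" using b by (intro mult_left_mono G(2)) auto
      finally show "(\<integral>\<^sup>+y. ennreal (norm (F (x, y))) \<partial>V) \<le> ennreal B * ennreal ?X" .
    qed
    also have "\<dots> = ennreal B * ennreal ?X * ennreal ?V" by (simp add: V space_V)
    also have "\<dots> = ennreal (B * ?X * ?V)" using B G(1) by (simp add: ennreal_mult)
    finally have le: "(\<integral>\<^sup>+z. ennreal (norm (F z)) \<partial>VV) \<le> ennreal (B * ?X * ?V)" .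
    have i: "integrable VV F"
    proof (rule pair_V_bounded_integrable[OF m, of B])
      fix x y assume "x \<in> M" "y \<in> M"
      then have "\<bar>F (x, y)\<bar> \<le> B * gauss b (x - y)" using e by blast
      also have "\<dots> \<le> B" using B b by (intro mult_left_le) auto
      finally show "\<bar>F (x, y)\<bar> \<le> B" .
    qed
    have "ennreal (norm (LINT z|VV. F z)) \<le> ennreal (B * ?X * ?V)"
      using integral_norm_bound_ennreal[OF i] le by (rule order_trans)
    then have "\<bar>\<integral>z. F z \<partial>VV\<bar> \<le> B * ?X * ?V" using B G(1) by (simp add: ennreal_le_iff)
    also have "\<dots> \<le> B * ?X * (?V + 1)" using B G(1) by (intro mult_left_mono) auto
    finally show "\<bar>\<integral>z. F z \<partial>VV\<bar> \<le> B * (G * (?V + 1) * b powr (- real CARD('d) / 2))" by (simp add: mult_ac)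
  qed
qed

lemma chart_pair_integral:
  fixes F :: "(real ^ 'D) \<times> (real ^ 'D) \<Rightarrow> real"
  assumes c: "chart U \<psi>" and S: "compact S" "S \<subseteq> U"
    and m: "F \<in> borel_measurable VV" and b: "\<And>x y. x \<in> M \<Longrightarrow> y \<in> M \<Longrightarrow> \<bar>F (x, y)\<bar> \<le> B"
    and z: "\<And>x y. x \<in> M \<Longrightarrow> y \<in> M \<Longrightarrow> x \<notin> \<psi> ` S \<or> y \<notin> \<psi> ` S \<Longrightarrow> F (x, y) = 0"
  defines "G \<equiv> \<lambda>(u, v). indicator S u * (indicator S v * (vol \<psi> u * (vol \<psi> v * F (\<psi> u, \<psi> v))))"
  shows "G \<in> borel_measurable lborel2" "(LINT z|VV. F z) = (LINT z|lborel2. G z)"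
    "\<exists>B'. \<forall>u v. \<bar>G (u, v)\<bar> \<le> B'"
proof -
  interpret P: pair_sigma_finite V V by (rule pair_V)
  note D = local_paramD[OF c]
  have Sb: "S \<in> sets borel" using S(1) by (simp add: borel_closed compact_imp_closed)
  have Gm: "G \<in> borel_measurable lborel2"
  proof (cases "S = {}")
    case True
    then have "G = (\<lambda>_. 0)" by (auto simp: G_def fun_eq_iff)
    then show ?thesis by simp
  next
    case False
    then obtain s0 where s0: "s0 \<in> S" by blast
    \<comment> \<open>Off \<open>S\<close> nothing is known about the values or the measurability of
      the chart, so it is made constant there; \<open>vS\<close> vanishes at those points and
      removes them from the integrand.\<close>
    define \<psi>S where "\<psi>S u = (if u \<in> S then \<psi> u else \<psi> s0)" for u
    define vS where "vS u = (if u \<in> S then vol \<psi> u else 0)" for u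
    have "continuous_on S \<psi>" using Ck_on_imp_continuous_on[OF D(2)] S(2) continuous_on_subset by blast
    then have \<psi>b: "\<psi>S \<in> borel_measurable borel" unfolding \<psi>S_def[abs_def]
      by (intro borel_measurable_continuous_on_if Sb continuous_on_const)
    have p: "\<psi>S \<in> measurable lborel V"
      unfolding measurable_cong_sets[OF refl sets_V] 
    proof (rule measurable_restrict_space2)
      have "\<psi> u \<in> M" if "u \<in> S" for u using that D(5) S(2) by blast
      then show "\<psi>S \<in> space lborel \<rightarrow> M" using s0 by (simp add: \<psi>S_def)
    qed (use \<psi>b in simp)
    have "continuous_on S (vol \<psi>)" using Ck_on_imp_continuous_on[OF Ck_on_volume_density[OF c]] S(2) continuous_on_subset by blast
    then have "vS \<in> borel_measurable borel" unfolding vS_def[abs_def]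
      by (intro borel_measurable_continuous_on_if Sb continuous_on_const)
    then have v[measurable]: "vS \<in> borel_measurable lborel" by simp
    have pp[measurable]: "(\<lambda>z. (\<psi>S (fst z), \<psi>S (snd z))) \<in> measurable lborel2 VV"
      using p by measurable
    have [measurable]: "(\<lambda>z. F (\<psi>S (fst z), \<psi>S (snd z))) \<in> borel_measurable lborel2"
      using measurable_compose[OF pp m] .
    have "G = (\<lambda>z. vS (fst z) * (vS (snd z) * F (\<psi>S (fst z), \<psi>S (snd z))))"
      by (auto simp: G_def fun_eq_iff vS_def \<psi>S_def)
    then show ?thesis by simp
  qed
  then show "G \<in> borel_measurable lborel2" .
  have "continuous_on S (vol \<psi>)" using Ck_on_imp_continuous_on[OF Ck_on_volume_density[OF c]] S(2) continuous_on_subset by blast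
  then obtain W where W: "W \<ge> 0" "\<And>u. u \<in> S \<Longrightarrow> norm (vol \<psi> u) \<le> W" using compact_continuous_bound[OF S(1)] by blast
  have Gb: "\<bar>G (u, v)\<bar> \<le> W * (W * \<bar>B\<bar>)" for u v
  proof (cases "u \<in> S \<and> v \<in> S")
    case True
    then have xy: "\<psi> u \<in> M" "\<psi> v \<in> M" using S(2) D(5) by auto
    have "\<bar>G (u, v)\<bar> = \<bar>vol \<psi> u\<bar> * (\<bar>vol \<psi> v\<bar> * \<bar>F (\<psi> u, \<psi> v)\<bar>)" using True by (simp add: G_def abs_mult)
    also have "\<dots> \<le> W * (W * \<bar>B\<bar>)" using W True b[OF xy] by (intro mult_mono) auto
    finally show ?thesis .
  qed (use W in \<open>auto simp: G_def\<close>)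
  then show "\<exists>B'. \<forall>u v. \<bar>G (u, v)\<bar> \<le> B'" by blast
  obtain R where "S \<subseteq> ball 0 R" using S(1) compact_imp_bounded bounded_subset_ballD by blast
  then have R: "S \<subseteq> cball 0 R" using ball_subset_cball by blast
  have Gi: "integrable lborel2 G"
    by (rule lborel_pair_bounded_integrable[OF Gm Gb, of R R]) (use R in \<open>auto simp: G_def split: split_indicator\<close>)
  have Fi: "integrable VV F" using pair_V_bounded_integrable[OF m b] .
  have inner: "(LINT y|V. F (x, y)) = (LINT v|lborel. indicator S v * (vol \<psi> v * F (x, \<psi> v)))" if x: "x \<in> M" for x
  proof -
    have "(LINT y|V. F (x, y)) = (LINT v|lborel. indicator U v * (vol \<psi> v * F (x, \<psi> v)))"
    proof (rule chart_integral[OF c])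
      show "(\<lambda>y. F (x, y)) \<in> borel_measurable V" by (rule measurable_Pair2[OF m]) (simp add: x space_V)
      show "F (x, y) = 0" if "y \<in> M" "y \<notin> \<psi> ` U" for y using z[OF x that(1)] that(2) S(2) by blast
    qed
    also have "\<dots> = (LINT v|lborel. indicator S v * (vol \<psi> v * F (x, \<psi> v)))"
    proof (rule LINT_cong)
      fix v
      have "F (x, \<psi> v) = 0" if "v \<in> U" "v \<notin> S"
        using z[OF x, of "\<psi> v"] that D(5,6) S(2) by (auto dest: inj_onD)
      then show "indicator U v * (vol \<psi> v * F (x, \<psi> v)) = indicator S v * (vol \<psi> v * F (x, \<psi> v))"
        using S(2) by (auto split: split_indicator)
    qed
    finally show ?thesis .
  qed
  have "(LINT z|VV. F z) = (LINT x|V. (LINT y|V. F (x, y)))" using P.integral_fst'[OF Fi] by simp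
  also have "\<dots> = (LINT u|lborel. indicator U u * (vol \<psi> u * (LINT y|V. F (\<psi> u, y))))"
  proof (rule chart_integral[OF c])
    show "(\<lambda>x. \<integral>y. F (x, y) \<partial>V) \<in> borel_measurable V" using P.integrable_fst'[OF Fi] by (rule borel_measurable_integrable)
    show "(LINT y|V. F (x, y)) = 0" if "x \<in> M" "x \<notin> \<psi> ` U" for x
    proof -
      have "(LINT y|V. F (x, y)) = (LINT y|V. 0)"
        using z[OF that(1)] that(2) S(2) by (intro LINT_cong) (auto simp: space_V)
      then show ?thesis by simp
    qed
  qed
  also have "\<dots> = (LINT u|lborel. (LINT v|lborel. G (u, v)))"
  proof (rule LINT_cong)
    fix u
    show "indicator U u * (vol \<psi> u * (LINT y|V. F (\<psi> u, y))) = (LINT v|lborel. G (u, v))"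
    proof (cases "u \<in> U")
      case True
      then have uM: "\<psi> u \<in> M" using D(5) by blast
      show ?thesis
      proof (cases "u \<in> S")
        case True
        then show ?thesis using \<open>u \<in> U\<close> by (simp add: inner[OF uM] G_def mult_ac flip: integral_mult_right_zero)
      next
        case False
        then have "\<psi> u \<notin> \<psi> ` S" using \<open>u \<in> U\<close> D(6) S(2) by (auto dest: inj_onD)
        then have "(LINT y|V. F (\<psi> u, y)) = (LINT y|V. 0)"
          using z[OF uM] by (intro LINT_cong) (auto simp: space_V)
        then show ?thesis using False by (simp add: G_def)
      qed
    next
      case False
      then have "u \<notin> S" using S(2) by blast
      then show ?thesis using False by (simp add: G_def)
    qed
  qed
  also have "\<dots> = (LINT z|lborel2. G z)" using lborel_pair.integral_fst'[OF Gi] by simp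
  finally show "(LINT z|VV. F z) = (LINT z|lborel2. G z)" .
qed

end

text \<open>The scaling rule of all error estimates: under a Gaussian of width sqrt \<epsilon> every
  factor t^2 is worth a factor \<epsilon>, at the price of half the exponential rate.\<close>

definition exp_absorbs :: "nat \<Rightarrow> real \<Rightarrow> real \<Rightarrow> bool" where
  "exp_absorbs n c C \<longleftrightarrow> C > 0 \<and>
     (\<forall>\<epsilon>>0. \<forall>t. t ^ (2 * n) * exp (- c * (t\<^sup>2 / \<epsilon>)) \<le> C * \<epsilon> ^ n * exp (- (c / 2) * (t\<^sup>2 / \<epsilon>)))"

lemma exp_absorbsD:
  "exp_absorbs n c C \<Longrightarrow> C > 0"
  "exp_absorbs n c C \<Longrightarrow> \<epsilon> > 0 \<Longrightarrow> t ^ (2 * n) * exp (- c * (t\<^sup>2 / \<epsilon>)) \<le> C * \<epsilon> ^ n * exp (- (c / 2) * (t\<^sup>2 / \<epsilon>))"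
  unfolding exp_absorbs_def by blast+

lemma exp_absorbsE:
  fixes c :: real
  assumes "c > 0"
  obtains C where "exp_absorbs n c C"
proof -
  obtain C where C: "C > 0" "\<And>s. s \<ge> 0 \<Longrightarrow> s ^ n * exp (- c * s) \<le> C * exp (- (c / 2) * s)"
    using power_exp_bound[OF assms] by blast
  have "t ^ (2 * n) * exp (- c * (t\<^sup>2 / \<epsilon>)) \<le> C * \<epsilon> ^ n * exp (- (c / 2) * (t\<^sup>2 / \<epsilon>))" if \<epsilon>: "\<epsilon> > 0" for \<epsilon> t
  proof -
    have "t ^ (2 * n) * exp (- c * (t\<^sup>2 / \<epsilon>)) = \<epsilon> ^ n * ((t\<^sup>2 / \<epsilon>) ^ n * exp (- c * (t\<^sup>2 / \<epsilon>)))"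
      using \<epsilon> by (simp add: power_divide power_mult)
    also have "\<dots> \<le> \<epsilon> ^ n * (C * exp (- (c / 2) * (t\<^sup>2 / \<epsilon>)))" using \<epsilon> by (intro mult_left_mono C(2)) auto
    finally show ?thesis by (simp only: mult_ac)
  qed
  then show ?thesis using C(1) that unfolding exp_absorbs_def by blast
qed

text \<open>By homogeneity it suffices to minimize over the compact product of \<open>S\<close> with
  the unit sphere, where injectivity makes the minimum positive.\<close>

lemma chart_deriv_lower_bound:
  fixes U :: "(real ^ 'd::finite) set"
  assumes c: "local_param M U \<psi>" and S: "compact S" "S \<subseteq> U"
  obtains c where "c > 0" "\<And>m w. m \<in> S \<Longrightarrow> c * norm w \<le> norm (fderiv \<psi> m w)"
proof (cases "S = {}")
  case True
  then show ?thesis using that[of 1] by simp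
next
  case False
  let ?D = "\<lambda>m. fderiv \<psi> m"
  let ?g = "\<lambda>z. norm (\<Sum>b\<in>Basis. (snd z \<bullet> b) *\<^sub>R ?D (fst z) b)"
  have g: "?g (m, w) = norm (?D m w)" if "m \<in> S" for m w
  proof -
    have l: "linear (?D m)" using local_param_deriv(2)[OF c] that S(2) by blast
    have "?D m w = ?D m (\<Sum>b\<in>Basis. (w \<bullet> b) *\<^sub>R b)" by (simp add: euclidean_representation)
    also have "\<dots> = (\<Sum>b\<in>Basis. (w \<bullet> b) *\<^sub>R ?D m b)" by (simp only: linear_sum[OF l] linear_scale[OF l])
    finally show ?thesis by simp
  qed
  have "continuous_on S (\<lambda>m. ?D m b)" for b
  proof -
    have "Ck_on (Suc 0) \<psi> U" using local_paramD(2)[OF c] .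
    then have "continuous_on U (\<lambda>m. ?D m b)" by simp
    then show ?thesis using S(2) continuous_on_subset by blast
  qed
  then have "continuous_on (S \<times> sphere 0 1) (\<lambda>z. ?D (fst z) b)" for b
    by (intro continuous_on_compose2[of S "\<lambda>m. ?D m b" _ fst] continuous_intros) auto
  then have ct: "continuous_on (S \<times> sphere 0 1) ?g" by (intro continuous_intros)
  have cp: "compact (S \<times> sphere (0 :: real ^ 'd) 1)" using S(1) by (intro compact_Times) auto
  have "S \<times> sphere (0 :: real ^ 'd) 1 \<noteq> {}" using False by simp
  from continuous_attains_inf[OF cp this ct] obtain z0 where z0: "z0 \<in> S \<times> sphere 0 1" "\<And>z. z \<in> S \<times> sphere 0 1 \<Longrightarrow> ?g z0 \<le> ?g z" by blast
  obtain m0 w0 where mw: "z0 = (m0, w0)" by (cases z0)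
  have m0: "m0 \<in> S" "norm w0 = 1" using z0(1) mw by auto
  have "?g z0 > 0"
  proof -
    have l: "linear (?D m0)" "inj (?D m0)" using local_param_deriv(2,3)[OF c] m0 S(2) by blast+
    have "w0 \<noteq> 0" using m0(2) by auto
    then have "?D m0 w0 \<noteq> 0" using l linear_injective_0 by blast
    then show ?thesis using g[OF m0(1), of w0] mw by simp
  qed
  moreover have "?g z0 * norm w \<le> norm (?D m w)" if m: "m \<in> S" for m w
  proof (cases "w = 0")
    case False
    have l: "linear (?D m)" using local_param_deriv(2)[OF c] m S(2) by blast
    have "?g z0 \<le> ?g (m, (1 / norm w) *\<^sub>R w)" using m False by (intro z0(2)) auto
    also have "\<dots> = norm (?D m ((1 / norm w) *\<^sub>R w))" by (rule g[OF m])
    also have "\<dots> = norm (?D m w) / norm w" by (simp add: linear_scale[OF l])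
    finally show ?thesis using False by (simp add: field_simps)
  qed simp
  ultimately show ?thesis using that by blast
qed

subsection \<open>The Dirichlet form\<close>

locale weighted_manifold = manifold dT M V + kernel k0 a A
  for dT :: "'d::finite itself" and M :: "(real ^ 'D::finite) set" and V k0 a A +
  fixes p :: "real ^ 'D \<Rightarrow> real"
  assumes p_Ck: "Ck_manifold k p" and p_pos: "x \<in> M \<Longrightarrow> p x > 0"
begin

abbreviation \<rho>\<^sub>0 :: "real ^ 'D \<Rightarrow> real" where "\<rho>\<^sub>0 \<equiv> rho_bar dT p"

definition form where
  "form \<alpha> \<epsilon> \<rho> \<phi> f z = kern \<alpha> ((norm (fst z - snd z))\<^sup>2 / \<epsilon>) (\<rho> (fst z) * \<rho> (snd z)) *
     ((\<phi> (fst z) - \<phi> (snd z)) * (f (fst z) - f (snd z))) * (p (fst z) * p (snd z))"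

abbreviation m2 :: real where "m2 \<equiv> kernel_m2 dT k0"

abbreviation dirichlet where
  "dirichlet \<alpha> \<phi> f \<equiv> (LINT x|V. p_alpha dT \<alpha> p x * (grd \<phi> x \<bullet> grd f x))"

abbreviation Form where
  "Form \<alpha> \<epsilon> \<rho> \<phi> f \<equiv> (LINT z|VV. form \<alpha> \<epsilon> \<rho> \<phi> f z)"

lemma form_measurable:
  assumes "\<rho> \<in> borel_measurable V" "\<phi> \<in> borel_measurable V" "f \<in> borel_measurable V"
  shows "form \<alpha> \<epsilon> \<rho> \<phi> f \<in> borel_measurable VV"
proof -
  note [measurable] = assms id_measurable_V continuous_measurable_V[OF Ck_manifold_continuous[OF p_Ck]]
  have "(\<lambda>z. kern \<alpha> ((norm (fst z - snd z))\<^sup>2 / \<epsilon>) (\<rho> (fst z) * \<rho> (snd z))) \<in> borel_measurable VV"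
    by (rule measurable_kern) measurable
  then show ?thesis unfolding form_def[abs_def] by measurable
qed

lemma p_continuous: "continuous_on M p"
  by (rule Ck_manifold_continuous[OF p_Ck])

lemma rho0_continuous: "continuous_on M \<rho>\<^sub>0"
  unfolding rho_bar_def using p_pos p_continuous
  by (intro continuous_on_powr continuous_on_const) force+

lemma rho0_pos: "x \<in> M \<Longrightarrow> \<rho>\<^sub>0 x > 0"
  using p_pos[of x] by (auto simp: rho_bar_def)

lemma continuous_bounds_M:
  fixes g :: "real ^ 'D \<Rightarrow> real"
  assumes "continuous_on M g" "\<And>x. x \<in> M \<Longrightarrow> g x > 0"
  obtains l u where "0 < l" "0 < u" "\<And>x. x \<in> M \<Longrightarrow> l \<le> g x" "\<And>x. x \<in> M \<Longrightarrow> g x \<le> u"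
proof (cases "M = {}")
  case True
  then show ?thesis using that[of 1 1] by simp
next
  case False
  obtain x0 where x0: "x0 \<in> M" "\<And>x. x \<in> M \<Longrightarrow> g x0 \<le> g x" using continuous_attains_inf[OF compact_M False assms(1)] by blast
  obtain x1 where x1: "x1 \<in> M" "\<And>x. x \<in> M \<Longrightarrow> g x \<le> g x1" using continuous_attains_sup[OF compact_M False assms(1)] by blast
  show ?thesis using that[of "g x0" "g x1"] x0 x1 assms(2) by blast
qed

text \<open>The model integral is exact. One factor \<open>vol\<close> is consumed by the change to
  Euclidean measure on the tangent space, the other remains for the integral over the base point.
  The exponents 2 \<alpha> / d from the normalization, 2 from the two densities and -1 - 2/d from
  the scaling of the kernel add up to the exponent of \<open>p_alpha\<close>.\<close>

lemma tangent_kernel_integral: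
  assumes c: "chart U \<psi>" "m \<in> U" and \<epsilon>: "\<epsilon> > 0"
    and \<phi>: "Ck_manifold (Suc 0) \<phi>" and f: "Ck_manifold (Suc 0) f"
  shows "(LINT w|lborel. kern \<alpha> ((norm (fderiv \<psi> m w))\<^sup>2 / \<epsilon>) ((\<rho>\<^sub>0 (\<psi> m))\<^sup>2) *
      (fderiv (\<phi> \<circ> \<psi>) m w * fderiv (f \<circ> \<psi>) m w) * (p (\<psi> m) * vol \<psi> m)\<^sup>2)
    = vol \<psi> m * (m2 * \<epsilon> powr (real CARD('d) / 2 + 1) * (p_alpha dT \<alpha> p (\<psi> m) * (grd \<phi> (\<psi> m) \<bullet> grd f (\<psi> m))))"
proof -
  let ?A = "fderiv \<psi> m" and ?x = "\<psi> m"
  let ?R = "sqrt \<epsilon> * \<rho>\<^sub>0 ?x"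
  have x: "?x \<in> M" using c local_paramD(5) by blast
  have R: "?R > 0" using \<epsilon> rho0_pos[OF x] by simp
  note d\<phi> = Ck_manifold_differentiable[OF \<phi> c] and df = Ck_manifold_differentiable[OF f c]
  let ?c = "((\<rho>\<^sub>0 ?x)\<^sup>2) powr (- \<alpha>) * (p ?x * vol \<psi> m)\<^sup>2"
  let ?v = "grd \<phi> ?x" and ?w = "grd f ?x"
  let ?q = "\<lambda>w. k0 (max 0 ((norm (?A w))\<^sup>2 / ?R\<^sup>2)) * ((?v \<bullet> ?A w) * (?w \<bullet> ?A w))"
  have "(LINT w|lborel. kern \<alpha> ((norm (?A w))\<^sup>2 / \<epsilon>) ((\<rho>\<^sub>0 ?x)\<^sup>2) *
      (fderiv (\<phi> \<circ> \<psi>) m w * fderiv (f \<circ> \<psi>) m w) * (p ?x * vol \<psi> m)\<^sup>2)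
    = (LINT w|lborel. ?c * ?q w)"
  proof (rule LINT_cong)
    fix w
    have e: "(norm (?A w))\<^sup>2 / \<epsilon> / (\<rho>\<^sub>0 ?x)\<^sup>2 = (norm (?A w))\<^sup>2 / ?R\<^sup>2" using \<epsilon> by (simp add: power_mult_distrib)
    show "kern \<alpha> ((norm (?A w))\<^sup>2 / \<epsilon>) ((\<rho>\<^sub>0 ?x)\<^sup>2) *
      (fderiv (\<phi> \<circ> \<psi>) m w * fderiv (f \<circ> \<psi>) m w) * (p ?x * vol \<psi> m)\<^sup>2
      = ?c * ?q w"
      unfolding kern_def e grad_chart(3)[OF c d\<phi>] grad_chart(3)[OF c df] by (simp only: mult_ac)
  qed
  also have "\<dots> = ?c * (LINT w|lborel. ?q w)"
    by (rule integral_mult_right_zero)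
  also have "\<dots> = (((\<rho>\<^sub>0 ?x)\<^sup>2) powr (- \<alpha>) * (p ?x)\<^sup>2 * vol \<psi> m) * (vol \<psi> m * (LINT w|lborel. ?q w))"
    by (simp add: power_mult_distrib power2_eq_square mult_ac)
  also have "vol \<psi> m * (LINT w|lborel. ?q w) =
      m2 * ?R ^ (CARD('d) + 2) * (?v \<bullet> ?w)"
    unfolding volume_density_def metric_matrix_eq_gram kernel_m2_eq
    by (rule tangent_second_moment[OF local_param_deriv(2,3)[OF c] kernel_measurable second_moment_integrable
      grad_chart(2)[OF c d\<phi>] grad_chart(2)[OF c df] R])
  also have "(((\<rho>\<^sub>0 ?x)\<^sup>2) powr (- \<alpha>) * (p ?x)\<^sup>2 * vol \<psi> m) * (m2 * ?R ^ (CARD('d) + 2) * (?v \<bullet> ?w))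
    = vol \<psi> m * (m2 * ((\<rho>\<^sub>0 ?x)\<^sup>2 powr (- \<alpha>) * (p ?x)\<^sup>2 * ?R ^ (CARD('d) + 2)) * (?v \<bullet> ?w))"
    by (simp only: mult_ac)
  also have "(\<rho>\<^sub>0 ?x)\<^sup>2 powr (- \<alpha>) * (p ?x)\<^sup>2 * ?R ^ (CARD('d) + 2) = \<epsilon> powr (real CARD('d) / 2 + 1) * p_alpha dT \<alpha> p ?x"
  proof -
    let ?d = "real CARD('d)"
    have P: "p ?x > 0" using p_pos[OF x] .
    have r2: "(\<rho>\<^sub>0 ?x)\<^sup>2 = p ?x powr (- 2 / ?d)"
      by (simp add: rho_bar_def power2_eq_square powr_add[symmetric])
    have a1: "(\<rho>\<^sub>0 ?x)\<^sup>2 powr (- \<alpha>) = p ?x powr (2 * \<alpha> / ?d)" unfolding r2 by (simp add: powr_powr)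
    have a2: "(p ?x)\<^sup>2 = p ?x powr 2" using P by (simp add: powr_numeral)
    have "sqrt \<epsilon> = \<epsilon> powr (1 / 2)" using \<epsilon> by (simp add: powr_half_sqrt)
    then have "sqrt \<epsilon> ^ (CARD('d) + 2) = \<epsilon> powr (real (CARD('d) + 2) * (1 / 2))"
      using \<epsilon> by (simp only: powr_realpow[symmetric] powr_powr powr_gt_zero mult.commute)
    also have "real (CARD('d) + 2) * (1 / 2) = ?d / 2 + 1" by simp
    finally have a3: "sqrt \<epsilon> ^ (CARD('d) + 2) = \<epsilon> powr (?d / 2 + 1)" .
    have "\<rho>\<^sub>0 ?x ^ (CARD('d) + 2) = p ?x powr ((- 1 / ?d) * real (CARD('d) + 2))"
      unfolding rho_bar_def using P by (simp only: powr_realpow[symmetric] powr_powr powr_gt_zero)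
    also have "(- 1 / ?d) * real (CARD('d) + 2) = - 1 - 2 / ?d" by (simp add: field_simps)
    finally have a4: "\<rho>\<^sub>0 ?x ^ (CARD('d) + 2) = p ?x powr (- 1 - 2 / ?d)" .
    have "(\<rho>\<^sub>0 ?x)\<^sup>2 powr (- \<alpha>) * (p ?x)\<^sup>2 * ?R ^ (CARD('d) + 2) = \<epsilon> powr (?d / 2 + 1) * (p ?x powr (2 * \<alpha> / ?d) * p ?x powr 2 * p ?x powr (- 1 - 2 / ?d))"
      unfolding power_mult_distrib a1 a2 a3 a4 by (simp only: mult_ac)
    also have "p ?x powr (2 * \<alpha> / ?d) * p ?x powr 2 * p ?x powr (- 1 - 2 / ?d) = p ?x powr (2 * \<alpha> / ?d + 2 + (- 1 - 2 / ?d))"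
      by (simp only: powr_add)
    also have "2 * \<alpha> / ?d + 2 + (- 1 - 2 / ?d) = 1 + 2 * (\<alpha> - 1) / ?d" by (simp add: field_simps)
    finally show ?thesis by (simp add: p_alpha_def)
  qed
  finally show ?thesis by (simp only: mult_ac)
qed

text \<open>Only \<phi> is localized, so pairs with a single point in \<open>K\<close> must be
  handled as well: the chart is used on a thickened set \<open>S\<close>, and pairs that leave it
  stay a fixed distance apart. In midpoint coordinates the integrand is compared with its model on
  the tangent space at the midpoint. Every error is \<epsilon>^2 times a Gaussian, hence of order
  \<epsilon>^(d/2 + 2) after integration.\<close>

lemma chart_dirichlet_limit:
  assumes c: "chart U \<psi>" and \<phi>: "Ck_manifold 3 \<phi>" and f: "Ck_manifold 3 f"
    and K: "compact K" "K \<subseteq> \<psi> ` U" and z: "\<And>y. y \<in> M \<Longrightarrow> y \<notin> K \<Longrightarrow> \<phi> y = 0"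
  shows "\<exists>C\<ge>0. \<forall>\<epsilon>>0. \<bar>(Form \<alpha> \<epsilon> \<rho>\<^sub>0 \<phi> f) -
      m2 * \<epsilon> powr (real CARD('d) / 2 + 1) * (dirichlet \<alpha> \<phi> f)\<bar>
    \<le> C * \<epsilon> powr (real CARD('d) / 2 + 2)"
proof -
  let ?d = "real CARD('d)"
  note D = local_paramD[OF c] and L = inv_chart_compact[OF c K]
  define L where "L = inv_into U \<psi> ` K"
  have Lc: "compact L" "L \<subseteq> U" "\<psi> ` L = K" "\<And>u. u \<in> U \<Longrightarrow> \<psi> u \<in> K \<longleftrightarrow> u \<in> L" unfolding L_def using L by auto
  have \<phi>1: "Ck_manifold (Suc 0) \<phi>" using \<phi> by (rule Ck_manifold_mono) simp
  have f1: "Ck_manifold (Suc 0) f" using f by (rule Ck_manifold_mono) simp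
  obtain \<delta> where \<delta>: "\<delta> > 0" "(\<Union>u\<in>L. cball u \<delta>) \<subseteq> U"
    using compact_subset_open_imp_cball_epsilon_subset[OF Lc(1) D(1) Lc(2)] by blast
  \<comment> \<open>A compact neighbourhood, inside the chart domain, of the preimage of
    \<open>K\<close>; as a sum of compact sets it is compact at once.\<close>
  define S where "S = {u + v | u v. u \<in> L \<and> v \<in> cball 0 \<delta>}"
  have S1: "compact S" unfolding S_def by (rule compact_sums[OF Lc(1) compact_cball])
  have LS: "cball u \<delta> \<subseteq> S" if "u \<in> L" for u
  proof
    fix v assume "v \<in> cball u \<delta>"
    then have "v = u + (v - u)" "v - u \<in> cball 0 \<delta>" by (auto simp: dist_norm norm_minus_commute)
    then show "v \<in> S" unfolding S_def using that by blast
  qed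
  have S2: "S \<subseteq> U"
  proof
    fix v assume "v \<in> S"
    then obtain u w where "u \<in> L" "w \<in> cball 0 \<delta>" "v = u + w" by (auto simp: S_def)
    then have "v \<in> cball u \<delta>" by (simp add: dist_norm)
    then show "v \<in> U" using \<delta>(2) \<open>u \<in> L\<close> by blast
  qed
  have LsubS: "L \<subseteq> S" using LS \<delta>(1) by force
  have SM: "\<psi> u \<in> M" if "u \<in> S" for u using that S2 D(5) by blast
  obtain R where "S \<subseteq> ball 0 R" using S1 compact_imp_bounded bounded_subset_ballD by blast
  then have R: "S \<subseteq> cball 0 R" using ball_subset_cball by blast
  have \<phi>0: "\<phi> (\<psi> u) = 0" if "u \<in> U" "u \<notin> L" for u using z[of "\<psi> u"] that Lc(4) D(5) by blast
  have D\<phi>0: "fderiv (\<phi> \<circ> \<psi>) u w = 0" if "u \<in> U" "u \<notin> L" for u w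
  proof -
    have "grd \<phi> (\<psi> u) = 0"
      by (rule grad_zero_outside[OF compact_imp_closed[OF K(1)]]) (use z that Lc(4) D(5) in auto)
    then show ?thesis using grad_chart(3)[OF c that(1) Ck_manifold_differentiable[OF \<phi>1 c that(1)], of w] by simp
  qed

  obtain cl where cl: "cl > 0" "\<And>u v. u \<in> S \<Longrightarrow> v \<in> S \<Longrightarrow> cl * norm (u - v) \<le> norm (\<psi> u - \<psi> v)"
    using chart_compact_lower_bound[OF c S1 S2] by blast
  obtain cd where cd: "cd > 0" "\<And>m w. m \<in> S \<Longrightarrow> cd * norm w \<le> norm (fderiv \<psi> m w)"
    using chart_deriv_lower_bound[OF c S1 S2] by blast
  obtain C\<psi> where "increment_bound S \<psi> C\<psi>" using Ck_increment[OF D(2) S1 S2] by blast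
  note C\<psi> = increment_boundD[OF this]
  have c3: "Ck_on 3 (\<phi> \<circ> \<psi>) U" "Ck_on 3 (f \<circ> \<psi>) U" using \<phi> f c by (auto simp: Ck_manifold_def)
  obtain C\<phi> where "increment_bound S (\<phi> \<circ> \<psi>) C\<phi>" using Ck_increment[OF c3(1) S1 S2] by blast
  note C\<phi> = increment_boundD[OF this]
  obtain Cf where "increment_bound S (f \<circ> \<psi>) Cf" using Ck_increment[OF c3(2) S1 S2] by blast
  note Cf = increment_boundD[OF this]

  \<comment> \<open>The density of the sampling measure in the coordinates of the chart.\<close>
  define zz where "zz u = p (\<psi> u) * vol \<psi> u" for u
  have pU: "p (\<psi> u) > 0" if "u \<in> U" for u using p_pos that D(5) by blast
  have pC: "Ck_on 2 (\<lambda>u. p (\<psi> u)) U" using p_Ck c by (rule Ck_manifoldD)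
  have zz_powr: "((p (\<psi> u))\<^sup>2 * det (metric_matrix \<psi> u)) powr (1/2) = zz u" if "u \<in> U" for u
    using pU[OF that] det_metric_pos[OF c that] by (simp add: zz_def volume_density_def powr_half_sqrt real_sqrt_mult)
  \<comment> \<open>Viewing the weight as the square root of p^2 det g puts the C^2 condition on the
    radicand and leaves the root to the Lipschitz bound for powers.\<close>
  have gC: "Ck_on 2 (\<lambda>u. (p (\<psi> u))\<^sup>2 * det (metric_matrix \<psi> u)) U"
    by (intro Ck_on_mult Ck_on_power Ck_on_det_metric[OF c] pC D(1))
  obtain Cz where Cz: "Cz \<ge> 0" "\<And>m w. seg m w \<subseteq> S \<Longrightarrow>
     \<bar>zz (lo m w) * zz (hi m w) - (zz m)\<^sup>2\<bar> \<le> Cz * (norm w)\<^sup>2"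
  proof -
    have "(p (\<psi> u))\<^sup>2 * det (metric_matrix \<psi> u) > 0" if "u \<in> U" for u using pU[OF that] det_metric_pos[OF c that] by simp
    from Ck_symmetric_product_powr[OF gC S1 S2 this, of "1/2"]
    obtain C where C: "C \<ge> 0" "\<And>m h. closed_segment (m - h) (m + h) \<subseteq> S \<Longrightarrow>
      \<bar>((p (\<psi> (m + h)))\<^sup>2 * det (metric_matrix \<psi> (m + h))) powr (1/2) * ((p (\<psi> (m - h)))\<^sup>2 * det (metric_matrix \<psi> (m - h))) powr (1/2)
       - (((p (\<psi> m))\<^sup>2 * det (metric_matrix \<psi> m)) powr (1/2))\<^sup>2\<bar> \<le> C * (norm h)\<^sup>2" by blast
    show ?thesis
    proof (rule that[OF C(1)])
      fix m w assume s: "seg m w \<subseteq> S"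
      have "closed_segment (m + 0 *\<^sub>R w) (m + 0 *\<^sub>R w) \<subseteq> S" using closed_segment_symmetric_subset[OF s, of 0 0] by simp
      then have u: "m \<in> U" "lo m w \<in> U" "hi m w \<in> U" using s S2 by auto
      have "\<bar>zz (lo m w) * zz (hi m w) - (zz m)\<^sup>2\<bar> \<le> C * (norm ((1/2) *\<^sub>R w))\<^sup>2"
        using C(2)[OF s] unfolding zz_powr[OF u(1)] zz_powr[OF u(2)] zz_powr[OF u(3)] by (simp only: mult.commute)
      also have "\<dots> \<le> C * (norm w)\<^sup>2" using C(1) by (intro mult_left_mono power_mono) auto
      finally show "\<bar>zz (lo m w) * zz (hi m w) - (zz m)\<^sup>2\<bar> \<le> C * (norm w)\<^sup>2" .
    qed
  qed
  obtain Cr where Cr: "Cr \<ge> 0" "\<And>m w. seg m w \<subseteq> S \<Longrightarrow>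
     \<bar>\<rho>\<^sub>0 (\<psi> (lo m w)) * \<rho>\<^sub>0 (\<psi> (hi m w)) - (\<rho>\<^sub>0 (\<psi> m))\<^sup>2\<bar> \<le> Cr * (norm w)\<^sup>2"
  proof -
    from Ck_symmetric_product_powr[OF pC S1 S2 pU, of "- 1 / ?d"]
    obtain C where C: "C \<ge> 0" "\<And>m h. closed_segment (m - h) (m + h) \<subseteq> S \<Longrightarrow>
      \<bar>\<rho>\<^sub>0 (\<psi> (m + h)) * \<rho>\<^sub>0 (\<psi> (m - h)) - (\<rho>\<^sub>0 (\<psi> m))\<^sup>2\<bar> \<le> C * (norm h)\<^sup>2" unfolding rho_bar_def by blast
    show ?thesis
    proof (rule that[OF C(1)])
      fix m w assume s: "seg m w \<subseteq> S"
      have "\<bar>\<rho>\<^sub>0 (\<psi> (lo m w)) * \<rho>\<^sub>0 (\<psi> (hi m w)) - (\<rho>\<^sub>0 (\<psi> m))\<^sup>2\<bar> \<le> C * (norm ((1/2) *\<^sub>R w))\<^sup>2"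
        using C(2)[OF s] by (simp only: mult.commute)
      also have "\<dots> \<le> C * (norm w)\<^sup>2" using C(1) by (intro mult_left_mono power_mono) auto
      finally show "\<bar>\<rho>\<^sub>0 (\<psi> (lo m w)) * \<rho>\<^sub>0 (\<psi> (hi m w)) - (\<rho>\<^sub>0 (\<psi> m))\<^sup>2\<bar> \<le> C * (norm w)\<^sup>2" .
    qed
  qed
  have zzc: "continuous_on S zz"
  proof -
    have "continuous_on U zz" unfolding zz_def[abs_def]
      using Ck_on_imp_continuous_on[OF pC] Ck_on_imp_continuous_on[OF Ck_on_volume_density[OF c]] by (rule continuous_on_mult)
    then show ?thesis using S2 continuous_on_subset by blast
  qed
  obtain Bz where Bz: "Bz \<ge> 0" "\<And>u. u \<in> S \<Longrightarrow> \<bar>zz u\<bar> \<le> Bz" using compact_continuous_bound[OF S1 zzc] by auto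
  obtain r1 r2 where r: "0 < r1" "0 < r2" "\<And>x. x \<in> M \<Longrightarrow> r1 \<le> \<rho>\<^sub>0 x" "\<And>x. x \<in> M \<Longrightarrow> \<rho>\<^sub>0 x \<le> r2"
    using continuous_bounds_M[OF rho0_continuous rho0_pos] by blast
  have rr: "\<rho>\<^sub>0 x * \<rho>\<^sub>0 y \<in> {r1 * r1..r2 * r2}" if "x \<in> M" "y \<in> M" for x y
    using r(1,2) r(3,4)[OF that(1)] r(3,4)[OF that(2)] by (auto intro!: mult_mono)
  have Q1: "r1 * r1 > 0" using r by simp
  \<comment> \<open>Serves to insert a power of a distance over a fixed length when that quotient is
    at least 1.\<close>
  have grow: "a \<le> a * b" if "0 \<le> a" "1 \<le> b" for a b :: real using mult_left_mono[OF that(2,1)] by simp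
  obtain Ck ck where "kern_bound \<alpha> (r1 * r1) (r2 * r2) Ck ck" using kern_bounds[OF Q1] by blast
  note Ck = kern_boundD[OF this]
  obtain B\<phi> where "bounded_by \<phi> B\<phi>" by (rule bounded_byI[OF Ck_manifold_continuous[OF \<phi>]])
  note B\<phi> = bounded_byD[OF this]
  obtain Bf where "bounded_by f Bf" by (rule bounded_byI[OF Ck_manifold_continuous[OF f]])
  note Bf = bounded_byD[OF this]
  obtain Bp where "bounded_by p Bp" by (rule bounded_byI[OF p_continuous])
  note Bp = bounded_byD[OF this]
let ?BB = "(2 * B\<phi>) * (2 * Bf)"

  \<comment> \<open>A common lower constant for true and linearized distances, so that the kernel
    and the model kernel decay at the same rate \<open>cc\<close>.\<close>
  define cm where "cm = min cl cd"
  have cm: "cm > 0" "cm \<le> cl" "cm \<le> cd" using cl cd by (auto simp: cm_def)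
  define cc where "cc = ck * cm\<^sup>2"
  have cc: "cc > 0" using Ck cm by (simp add: cc_def)
  let ?DD = "\<lambda>m w. fderiv (\<phi> \<circ> \<psi>) m w * fderiv (f \<circ> \<psi>) m w"
  let ?km = "\<lambda>\<epsilon> m w. kern \<alpha> ((norm (fderiv \<psi> m w))\<^sup>2 / \<epsilon>) ((\<rho>\<^sub>0 (\<psi> m))\<^sup>2)"
  obtain E2 where "exp_absorbs 2 cc E2" by (rule exp_absorbsE[OF cc])
  note E2 = exp_absorbsD[OF this]
  obtain E3 where "exp_absorbs 3 cc E3" by (rule exp_absorbsE[OF cc])
  note E3 = exp_absorbsD[OF this]
  obtain Ek where "exp_absorbs 2 ck Ek" by (rule exp_absorbsE[OF Ck(2)])
  note Ek = exp_absorbsD[OF this]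

  \<comment> \<open>The image of the open thickening is relatively open and contains
    \<open>K\<close>, so the rest of \<open>M\<close> is a closed set disjoint from the compact
    \<open>K\<close> and has positive distance from it.\<close>
  obtain \<eta> where \<eta>: "\<eta> > 0" "\<And>x y. x \<in> K \<Longrightarrow> y \<in> M \<Longrightarrow> y \<notin> \<psi> ` S \<Longrightarrow> \<eta> \<le> norm (x - y)"
  proof -
    define W where "W = (\<Union>u\<in>L. ball u \<delta>)"
    have W: "W \<subseteq> S" "open W" "L \<subseteq> W" unfolding W_def using LS \<delta>(1) ball_subset_cball by (blast, blast, force)
    obtain \<theta> where h: "homeomorphism U (\<psi> ` U) \<psi> \<theta>" using c by (auto simp: local_param_def)
    have "openin (top_of_set U) W" using W S2 by (intro open_subset) auto
    then have "openin (top_of_set (\<psi> ` U)) (\<psi> ` W)" by (rule homeomorphism_imp_open_map[OF h])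
    then have "openin (top_of_set M) (\<psi> ` W)" using D(4) openin_trans by blast
    then obtain T where T: "open T" "\<psi> ` W = M \<inter> T" using openin_open by blast
    have cl: "closed (M - T)" using compact_M T(1) compact_imp_closed by blast
    have "K \<inter> (M - T) = {}"
    proof -
      have "K \<subseteq> \<psi> ` W" using Lc(3) W(3) by blast
      then show ?thesis using T(2) by blast
    qed
    from separate_compact_closed[OF K(1) cl this]
    obtain \<eta> where \<eta>: "\<eta> > 0" "\<And>x y. x \<in> K \<Longrightarrow> y \<in> M - T \<Longrightarrow> \<eta> \<le> dist x y" by blast
    have "\<eta> \<le> norm (x - y)" if "x \<in> K" "y \<in> M" "y \<notin> \<psi> ` S" for x y
    proof -
      have "y \<notin> \<psi> ` W" using that(3) W(1) by blast
      then have "y \<in> M - T" using that(2) T(2) by blast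
      then show ?thesis using \<eta>(2)[OF that(1)] by (simp add: dist_norm)
    qed
    then show ?thesis using that \<eta>(1) by blast
  qed

  \<comment> \<open>\<open>N1\<close> is for displacements whose segment lies in \<open>S\<close>,
    \<open>N2\<close> and \<open>N3\<close> are for the integrand and for the model at displacements
    of length at least \<delta>, \<open>N4\<close> is for pairs that leave the image of
    \<open>S\<close>.\<close>
  define N1 where "N1 = Ck * C\<phi> * Cf * (2 * C\<psi>\<^sup>2 * Bz\<^sup>2 * E3 + (Cr * Bz\<^sup>2 + 2 * Bz\<^sup>2 + Cz) * E2)"
  define N2 where "N2 = Ck * ?BB * Bz\<^sup>2 / \<delta> ^ 4 * E2"
  define N3 where "N3 = Ck * (C\<phi> * Cf) * Bz\<^sup>2 / \<delta>\<^sup>2 * E2"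
  define N where "N = N1 + N2 + N3"
  have N0: "N1 \<ge> 0" "N2 \<ge> 0" "N3 \<ge> 0"
    unfolding N1_def N2_def N3_def using Ck(1) C\<phi>(1) Cf(1) E2(1) E3(1) Cr(1) Cz(1) B\<phi>(1) Bf(1) by simp_all
  define N4 where "N4 = Ck * ?BB * Bp\<^sup>2 / \<eta> ^ 4 * Ek"
  have N4: "N4 \<ge> 0" unfolding N4_def using Ck(1) B\<phi>(1) Bf(1) Ek(1) by simp

  \<comment> \<open>The model: \<open>fst z\<close> is the midpoint and \<open>snd z\<close> the
    displacement; distances and increments are linearized at the midpoint, bandwidths and weights
    are frozen there.\<close>
  define P0 where "P0 \<epsilon> z = indicator S (fst z) * (kern \<alpha> ((norm (fderiv \<psi> (fst z) (snd z)))\<^sup>2 / \<epsilon>) ((\<rho>\<^sub>0 (\<psi> (fst z)))\<^sup>2) *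
      (fderiv (\<phi> \<circ> \<psi>) (fst z) (snd z) * fderiv (f \<circ> \<psi>) (fst z) (snd z)) * (zz (fst z))\<^sup>2)" for \<epsilon> z
  define P where "P \<epsilon> u v = kern \<alpha> ((norm (\<psi> u - \<psi> v))\<^sup>2 / \<epsilon>) (\<rho>\<^sub>0 (\<psi> u) * \<rho>\<^sub>0 (\<psi> v)) *
      ((\<phi> (\<psi> u) - \<phi> (\<psi> v)) * (f (\<psi> u) - f (\<psi> v))) * (zz u * zz v)" for \<epsilon> u v
  define G where "G \<epsilon> z = indicator S (fst z) * (indicator S (snd z) * P \<epsilon> (fst z) (snd z))" for \<epsilon> z

  have exp_cc: "exp (- ck * \<tau>) \<le> exp (- cc * (t\<^sup>2 / \<epsilon>))" if "\<epsilon> > 0" "b = cl \<or> b = cd" "t \<ge> 0" "(b * t)\<^sup>2 / \<epsilon> \<le> \<tau>" for \<epsilon> \<tau> t b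
  proof -
    have "(cm * t)\<^sup>2 \<le> (b * t)\<^sup>2" using that cm by (intro power_mono mult_right_mono) auto
    then have "(cm * t)\<^sup>2 / \<epsilon> \<le> \<tau>" using that by (meson divide_right_mono less_imp_le order_trans)
    then have "ck * ((cm * t)\<^sup>2 / \<epsilon>) \<le> ck * \<tau>" using Ck(2) by (intro mult_left_mono) auto
    then show ?thesis by (simp add: cc_def power_mult_distrib mult.assoc)
  qed
  have kuv: "\<bar>kern \<alpha> ((norm (\<psi> u - \<psi> v))\<^sup>2 / \<epsilon>) (\<rho>\<^sub>0 (\<psi> u) * \<rho>\<^sub>0 (\<psi> v))\<bar> \<le> Ck * exp (- cc * ((norm (v - u))\<^sup>2 / \<epsilon>))"
    if "\<epsilon> > 0" "u \<in> S" "v \<in> S" for \<epsilon> u v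
  proof -
    have "(cl * norm (v - u))\<^sup>2 \<le> (norm (\<psi> u - \<psi> v))\<^sup>2" using cl(2)[OF that(2,3)] cl(1) by (intro power_mono) (auto simp: norm_minus_commute)
    then have "exp (- ck * ((norm (\<psi> u - \<psi> v))\<^sup>2 / \<epsilon>)) \<le> exp (- cc * ((norm (v - u))\<^sup>2 / \<epsilon>))"
      using that(1) by (intro exp_cc[of _ cl]) (auto intro: divide_right_mono)
    then have "Ck * exp (- ck * ((norm (\<psi> u - \<psi> v))\<^sup>2 / \<epsilon>)) \<le> Ck * exp (- cc * ((norm (v - u))\<^sup>2 / \<epsilon>))"
      using Ck(1) by (intro mult_left_mono) auto
    then show ?thesis using Ck(3)[OF _ rr[OF SM[OF that(2)] SM[OF that(3)]], of "(norm (\<psi> u - \<psi> v))\<^sup>2 / \<epsilon>"] that(1) by simp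
  qed
  have km: "\<bar>?km \<epsilon> m w\<bar> \<le> Ck * exp (- cc * ((norm w)\<^sup>2 / \<epsilon>))"
    "exp (- ck * ((norm (fderiv \<psi> m w))\<^sup>2 / \<epsilon>)) \<le> exp (- cc * ((norm w)\<^sup>2 / \<epsilon>))"
    if "\<epsilon> > 0" "m \<in> S" for \<epsilon> m w
  proof -
    have "(cd * norm w)\<^sup>2 \<le> (norm (fderiv \<psi> m w))\<^sup>2" using cd(2)[OF that(2)] cd(1) by (intro power_mono) auto
    then show e: "exp (- ck * ((norm (fderiv \<psi> m w))\<^sup>2 / \<epsilon>)) \<le> exp (- cc * ((norm w)\<^sup>2 / \<epsilon>))"
      using that(1) by (intro exp_cc[of _ cd]) (auto intro: divide_right_mono)
    then have "Ck * exp (- ck * ((norm (fderiv \<psi> m w))\<^sup>2 / \<epsilon>)) \<le> Ck * exp (- cc * ((norm w)\<^sup>2 / \<epsilon>))"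
      using Ck(1) by (intro mult_left_mono) auto
    then show "\<bar>?km \<epsilon> m w\<bar> \<le> Ck * exp (- cc * ((norm w)\<^sup>2 / \<epsilon>))"
      using Ck(3)[of "(norm (fderiv \<psi> m w))\<^sup>2 / \<epsilon>" "(\<rho>\<^sub>0 (\<psi> m))\<^sup>2"] rr[OF SM[OF that(2)] SM[OF that(2)]] that(1)
      by (simp add: power2_eq_square)
  qed
  \<comment> \<open>Under the Gaussian both t^4 and t^6 / \<epsilon> are worth \<epsilon>^2, and the
    comparison produces no other orders.\<close>
  have scale2: "t ^ 4 * exp (- cc * (t\<^sup>2 / \<epsilon>)) \<le> \<epsilon>\<^sup>2 * (E2 * exp (- (cc / 2) * (t\<^sup>2 / \<epsilon>)))" if "\<epsilon> > 0" for t \<epsilon> :: real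
    using E2(2)[OF that, of t] by (simp add: mult_ac)
  have scale3: "t ^ 6 / \<epsilon> * exp (- cc * (t\<^sup>2 / \<epsilon>)) \<le> \<epsilon>\<^sup>2 * (E3 * exp (- (cc / 2) * (t\<^sup>2 / \<epsilon>)))" if "\<epsilon> > 0" for t \<epsilon> :: real
    using divide_right_mono[OF E3(2)[OF that, of t], of \<epsilon>] that by (simp add: power3_eq_cube power2_eq_square mult_ac)

  \<comment> \<open>Orders in t = |w|: the kernel changes by t^4 / \<epsilon> + t^2, each increment
    by t^3, the weight by t^2. An increment is itself of order t, so every error term is of order
    t^6 / \<epsilon> or t^4.\<close>
  have near: "\<bar>P \<epsilon> (lo m w) (hi m w) - ?km \<epsilon> m w *
      ?DD m w * (zz m)\<^sup>2\<bar> \<le> N1 * (\<epsilon>\<^sup>2 * exp (- (cc / 2) * ((norm w)\<^sup>2 / \<epsilon>)))"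
    if \<epsilon>: "\<epsilon> > 0" and s: "seg m w \<subseteq> S" for \<epsilon> m w
  proof -
    let ?u = "lo m w" and ?v = "hi m w"
    let ?t = "norm w"
    have "closed_segment (m + 0 *\<^sub>R w) (m + 0 *\<^sub>R w) \<subseteq> S" using closed_segment_symmetric_subset[OF s, of 0 0] by simp
    then have S: "m \<in> S" "?u \<in> S" "?v \<in> S" using s by auto
    have uvw: "?v - ?u = w" by (simp add: algebra_simps flip: scaleR_add_left)
    define a where "a = \<psi> ?v - \<psi> ?u"
    define b where "b = fderiv \<psi> m w"
    define \<tau> where "\<tau> = (norm (\<psi> ?u - \<psi> ?v))\<^sup>2 / \<epsilon>"
    define \<tau>0 where "\<tau>0 = (norm b)\<^sup>2 / \<epsilon>"
    define e where "e = exp (- cc * (?t\<^sup>2 / \<epsilon>))"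
    have \<tau>pos: "\<tau> \<ge> 0" "\<tau>0 \<ge> 0" using \<epsilon> by (auto simp: \<tau>_def \<tau>0_def)
    have ab: "norm (a - b) \<le> C\<psi> * ?t ^ 3" "norm a \<le> C\<psi> * ?t" "norm b \<le> C\<psi> * ?t"
      using C\<psi>(3)[OF s] C\<psi>(4)[OF s] C\<psi>(2)[OF S(1)] by (auto simp: a_def b_def)
    \<comment> \<open>Thanks to the midpoint the chord \<open>a\<close> and its linearization
      \<open>b\<close>, both O(t), differ by O(t^3), so their squared lengths differ by
      O(t^4).\<close>
    have "\<bar>(norm a)\<^sup>2 - (norm b)\<^sup>2\<bar> = \<bar>norm a - norm b\<bar> * (norm a + norm b)"
      unfolding power2_eq_square square_diff_square_factored by (simp add: abs_mult mult.commute)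
    also have "\<dots> \<le> (C\<psi> * ?t ^ 3) * (C\<psi> * ?t + C\<psi> * ?t)"
      using ab norm_triangle_ineq3[of a b] C\<psi>(1) by (intro mult_mono add_mono) auto
    also have "\<dots> = 2 * C\<psi>\<^sup>2 * ?t ^ 4" by (simp add: power2_eq_square power3_eq_cube power4_eq_xxxx algebra_simps)
    finally have "\<bar>(norm a)\<^sup>2 - (norm b)\<^sup>2\<bar> / \<epsilon> \<le> 2 * C\<psi>\<^sup>2 * ?t ^ 4 / \<epsilon>" using \<epsilon> by (intro divide_right_mono) auto
    moreover have "\<bar>\<tau> - \<tau>0\<bar> = \<bar>(norm a)\<^sup>2 - (norm b)\<^sup>2\<bar> / \<epsilon>"
      using \<epsilon> by (simp add: \<tau>_def \<tau>0_def a_def norm_minus_commute diff_divide_distrib[symmetric])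
    ultimately have d\<tau>: "\<bar>\<tau> - \<tau>0\<bar> \<le> 2 * C\<psi>\<^sup>2 * ?t ^ 4 / \<epsilon>" by simp
    have Q: "\<rho>\<^sub>0 (\<psi> ?u) * \<rho>\<^sub>0 (\<psi> ?v) \<in> {r1 * r1..r2 * r2}" "(\<rho>\<^sub>0 (\<psi> m))\<^sup>2 \<in> {r1 * r1..r2 * r2}"
      using rr[OF SM[OF S(2)] SM[OF S(3)]] rr[OF SM[OF S(1)] SM[OF S(1)]] by (auto simp: power2_eq_square)
    have "(cl * ?t)\<^sup>2 \<le> (norm (\<psi> ?u - \<psi> ?v))\<^sup>2"
      using cl(2)[OF S(3,2)] cl(1) unfolding uvw by (intro power_mono) (auto simp: norm_minus_commute)
    then have "exp (- ck * \<tau>) \<le> e" unfolding e_def \<tau>_def using \<epsilon> by (intro exp_cc[of _ cl]) (auto intro: divide_right_mono)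
    moreover have "exp (- ck * \<tau>0) \<le> e" unfolding e_def \<tau>0_def b_def using km(2)[OF \<epsilon> S(1)] .
    ultimately have emin: "exp (- ck * min \<tau> \<tau>0) \<le> e" by (simp add: min_def)
    have dk: "\<bar>kern \<alpha> \<tau> (\<rho>\<^sub>0 (\<psi> ?u) * \<rho>\<^sub>0 (\<psi> ?v)) - kern \<alpha> \<tau>0 ((\<rho>\<^sub>0 (\<psi> m))\<^sup>2)\<bar> \<le> Ck * (2 * C\<psi>\<^sup>2 * ?t ^ 4 / \<epsilon> + Cr * ?t\<^sup>2) * e"
    proof -
      have "\<bar>kern \<alpha> \<tau> (\<rho>\<^sub>0 (\<psi> ?u) * \<rho>\<^sub>0 (\<psi> ?v)) - kern \<alpha> \<tau>0 ((\<rho>\<^sub>0 (\<psi> m))\<^sup>2)\<bar>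
        \<le> Ck * (\<bar>\<tau> - \<tau>0\<bar> + \<bar>\<rho>\<^sub>0 (\<psi> ?u) * \<rho>\<^sub>0 (\<psi> ?v) - (\<rho>\<^sub>0 (\<psi> m))\<^sup>2\<bar>) * exp (- ck * min \<tau> \<tau>0)"
        by (rule Ck(4)[OF \<tau>pos Q])
      also have "\<dots> \<le> Ck * (2 * C\<psi>\<^sup>2 * ?t ^ 4 / \<epsilon> + Cr * ?t\<^sup>2) * e"
        using d\<tau> Cr(2)[OF s] Ck(1) emin by (intro mult_mono mult_left_mono add_mono) auto
      finally show ?thesis .
    qed
    have k1: "\<bar>kern \<alpha> \<tau> (\<rho>\<^sub>0 (\<psi> ?u) * \<rho>\<^sub>0 (\<psi> ?v))\<bar> \<le> Ck * e"
      using kuv[OF \<epsilon> S(2,3)] unfolding uvw \<tau>_def e_def .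
    have k2: "\<bar>kern \<alpha> \<tau>0 ((\<rho>\<^sub>0 (\<psi> m))\<^sup>2)\<bar> \<le> Ck * e" unfolding \<tau>0_def b_def e_def by (rule km(1)[OF \<epsilon> S(1)])
    have z1: "\<bar>zz ?u * zz ?v\<bar> \<le> Bz\<^sup>2" "\<bar>(zz m)\<^sup>2\<bar> \<le> Bz\<^sup>2"
      unfolding power2_eq_square abs_mult using Bz S by (intro mult_mono; simp)+
    let ?X0 = "fderiv (\<phi> \<circ> \<psi>) m w" and ?Y0 = "fderiv (f \<circ> \<psi>) m w"
    have X: "\<bar>\<phi> (\<psi> ?v) - \<phi> (\<psi> ?u) - ?X0\<bar> \<le> C\<phi> * ?t ^ 3" "\<bar>\<phi> (\<psi> ?v) - \<phi> (\<psi> ?u)\<bar> \<le> C\<phi> * ?t" "\<bar>?X0\<bar> \<le> C\<phi> * ?t"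
      and Y: "\<bar>f (\<psi> ?v) - f (\<psi> ?u) - ?Y0\<bar> \<le> Cf * ?t ^ 3" "\<bar>f (\<psi> ?v) - f (\<psi> ?u)\<bar> \<le> Cf * ?t" "\<bar>?Y0\<bar> \<le> Cf * ?t"
      using C\<phi>(2)[OF S(1)] C\<phi>(3,4)[OF s] Cf(2)[OF S(1)] Cf(3,4)[OF s] by simp_all
    have Pe: "P \<epsilon> ?u ?v = kern \<alpha> \<tau> (\<rho>\<^sub>0 (\<psi> ?u) * \<rho>\<^sub>0 (\<psi> ?v)) * ((\<phi> (\<psi> ?v) - \<phi> (\<psi> ?u)) * (f (\<psi> ?v) - f (\<psi> ?u))) * (zz ?u * zz ?v)"
      unfolding P_def \<tau>_def[symmetric] by (simp add: algebra_simps)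
    have "\<bar>P \<epsilon> ?u ?v - kern \<alpha> \<tau>0 ((\<rho>\<^sub>0 (\<psi> m))\<^sup>2) * (?X0 * ?Y0) * (zz m)\<^sup>2\<bar> \<le>
      (Ck * (2 * C\<psi>\<^sup>2 * ?t ^ 4 / \<epsilon> + Cr * ?t\<^sup>2) * e * ((C\<phi> * ?t) * (Cf * ?t)) + Ck * e * (C\<phi> * ?t ^ 3 * (Cf * ?t) + C\<phi> * ?t * (Cf * ?t ^ 3))) * Bz\<^sup>2
      + (Ck * e * ((C\<phi> * ?t) * (Cf * ?t))) * (Cz * ?t\<^sup>2)"
      unfolding Pe
      by (rule abs_mult4_diff_le[OF dk k1 k2 X Y Cz(2)[OF s] z1])
    also have "\<dots> = Ck * C\<phi> * Cf * (2 * C\<psi>\<^sup>2 * Bz\<^sup>2 * (?t ^ 6 / \<epsilon> * e) + (Cr * Bz\<^sup>2 + 2 * Bz\<^sup>2 + Cz) * (?t ^ 4 * e))"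
      by (simp add: power2_eq_square power3_eq_cube eval_nat_numeral algebra_simps)
    also have "\<dots> \<le> Ck * C\<phi> * Cf * (2 * C\<psi>\<^sup>2 * Bz\<^sup>2 * (\<epsilon>\<^sup>2 * (E3 * exp (- (cc / 2) * (?t\<^sup>2 / \<epsilon>)))) + (Cr * Bz\<^sup>2 + 2 * Bz\<^sup>2 + Cz) * (\<epsilon>\<^sup>2 * (E2 * exp (- (cc / 2) * (?t\<^sup>2 / \<epsilon>)))))"
      unfolding e_def using scale2[OF \<epsilon>, of ?t] scale3[OF \<epsilon>, of ?t] Ck(1) C\<phi>(1) Cf(1) Cr(1) Cz(1)
      by (intro mult_left_mono add_mono) auto
    also have "\<dots> = N1 * (\<epsilon>\<^sup>2 * exp (- (cc / 2) * (?t\<^sup>2 / \<epsilon>)))" by (simp add: N1_def algebra_simps)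
    finally show ?thesis by (simp add: \<tau>0_def b_def)
  qed

  \<comment> \<open>If the midpoint or an end point lies in \<open>L\<close>, a short segment stays
    in \<open>S\<close>. Conversely, when it does not, \<phi> vanishes at those end points that lie
    in \<open>S\<close>, and its derivative at the midpoint if that lies in \<open>S\<close>;
    integrand and model are then both zero.\<close>
  have seg: "seg m w \<subseteq> S"
    if "norm w < \<delta>" "q \<in> L" "q = m \<or> q = lo m w \<or> q = hi m w" for m w q
  proof -
    have uvw: "hi m w - (lo m w) = w" by (simp add: algebra_simps flip: scaleR_add_left)
    have "lo m w \<in> cball q \<delta> \<and> hi m w \<in> cball q \<delta>"
      using that(3)
    proof (elim disjE)
      assume q: "q = lo m w"
      have "dist q (hi m w) = norm w" unfolding q dist_norm norm_minus_commute[of "lo m w"] uvw ..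
      then show ?thesis using that(1) \<delta>(1) q by simp
    next
      assume q: "q = hi m w"
      have "dist q (lo m w) = norm w" unfolding q dist_norm uvw ..
      then show ?thesis using that(1) \<delta>(1) q by simp
    qed (use that(1) \<delta>(1) in \<open>auto simp: dist_norm\<close>)
    then have "seg m w \<subseteq> cball q \<delta>" by (intro closed_segment_subset) auto
    then show ?thesis using LS[OF that(2)] by blast
  qed

  have bound: "\<bar>G \<epsilon> (lo m w, hi m w) - P0 \<epsilon> (m, w)\<bar> \<le> (N * \<epsilon>\<^sup>2) * (indicator (cball 0 R) m * gauss (cc / 2 / \<epsilon>) w)"
    if \<epsilon>: "\<epsilon> > 0" for \<epsilon> m w
  proof -
    let ?u = "lo m w" and ?v = "hi m w" and ?t = "norm w"
    have uvw: "?v - ?u = w" by (simp add: algebra_simps flip: scaleR_add_left)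
    define X where "X = \<epsilon>\<^sup>2 * exp (- (cc / 2) * (?t\<^sup>2 / \<epsilon>))"
    have X0: "X \<ge> 0" by (simp add: X_def)
    have rhs: "(N * \<epsilon>\<^sup>2) * (indicator (cball 0 R) m * gauss (cc / 2 / \<epsilon>) w) = N * X * indicator (cball 0 R) m"
      by (simp add: X_def mult_ac)
    have uvS: "m \<in> cball 0 R" if "?u \<in> S" "?v \<in> S"
    proof -
      have "(1/2) *\<^sub>R ?u + (1/2) *\<^sub>R ?v \<in> cball 0 R" using that R by (intro convexD[OF convex_cball]) auto
      moreover have "(1/2) *\<^sub>R ?u + (1/2) *\<^sub>R ?v = m" by (simp add: algebra_simps flip: scaleR_add_left)
      ultimately show ?thesis by simp
    qed
    show ?thesis
    proof (cases "?t < \<delta>")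
      case True
      show ?thesis
      proof (cases "closed_segment ?u ?v \<subseteq> S")
        case s: True
        have "closed_segment (m + 0 *\<^sub>R w) (m + 0 *\<^sub>R w) \<subseteq> S" using closed_segment_symmetric_subset[OF s, of 0 0] by simp
        then have S: "m \<in> S" "?u \<in> S" "?v \<in> S" using s by auto
        have "\<bar>G \<epsilon> (?u, ?v) - P0 \<epsilon> (m, w)\<bar> \<le> N1 * X" using near[OF \<epsilon> s] S by (simp add: G_def P0_def X_def)
        also have "\<dots> \<le> N * X" using N0 X0 by (intro mult_right_mono) (auto simp: N_def)
        finally show ?thesis unfolding rhs using S R by auto
      next
        case False
        then have nL: "m \<notin> L" "?u \<notin> L" "?v \<notin> L" using seg[OF True, of _ m] by blast+
        have "\<phi> (\<psi> ?u) = 0" if "?u \<in> S" using \<phi>0[of ?u] nL S2 that by blast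
        moreover have "\<phi> (\<psi> ?v) = 0" if "?v \<in> S" using \<phi>0[of ?v] nL S2 that by blast
        ultimately have "G \<epsilon> (?u, ?v) = 0" by (simp add: G_def P_def indicator_def)
        moreover have "P0 \<epsilon> (m, w) = 0" using D\<phi>0[of m w] nL S2 by (auto simp: P0_def indicator_def)
        ultimately show ?thesis unfolding rhs using N0 X0 by (simp add: N_def)
      qed
    next
      case False
      then have t: "\<delta> \<le> ?t" by simp
      \<comment> \<open>For long displacements the order t^4 is produced artificially: the integrand
        receives the factor t^4 / \<delta>^4, whereas the model already carries t^2 from its linear
        increments and needs only t^2 / \<delta>^2.\<close>
      have tp: "1 \<le> ?t ^ 4 / \<delta> ^ 4" "1 \<le> ?t\<^sup>2 / \<delta>\<^sup>2" using t \<delta>(1) by (auto intro!: power_mono)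
      have s2: "?t ^ 4 * exp (- cc * (?t\<^sup>2 / \<epsilon>)) \<le> E2 * X" using scale2[OF \<epsilon>, of ?t] by (simp add: X_def mult_ac)
      have "\<bar>G \<epsilon> (?u, ?v)\<bar> \<le> N2 * X * indicator (cball 0 R) m"
      proof (cases "?u \<in> S \<and> ?v \<in> S")
        case True
        have "\<bar>(\<phi> (\<psi> ?u) - \<phi> (\<psi> ?v)) * (f (\<psi> ?u) - f (\<psi> ?v))\<bar> \<le> (2 * B\<phi>) * (2 * Bf)"
          unfolding abs_mult using B\<phi>(2)[OF SM, of ?u] B\<phi>(2)[OF SM, of ?v] Bf(2)[OF SM, of ?u] Bf(2)[OF SM, of ?v] True B\<phi>(1) Bf(1)
          by (intro mult_mono) (auto intro: order_trans[OF abs_triangle_ineq4])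
        moreover have "\<bar>zz ?u * zz ?v\<bar> \<le> Bz\<^sup>2" unfolding power2_eq_square abs_mult using Bz True by (auto intro!: mult_mono)
        ultimately have "\<bar>P \<epsilon> ?u ?v\<bar> \<le> (Ck * exp (- cc * (?t\<^sup>2 / \<epsilon>))) * ?BB * Bz\<^sup>2"
          unfolding P_def abs_mult[of _ "zz ?u * zz ?v"] abs_mult[of "kern _ _ _"]
          using kuv[OF \<epsilon>, of ?u ?v] True Ck(1) B\<phi>(1) Bf(1) unfolding uvw by (intro mult_mono) auto
        also have "\<dots> \<le> (Ck * exp (- cc * (?t\<^sup>2 / \<epsilon>))) * ?BB * Bz\<^sup>2 * (?t ^ 4 / \<delta> ^ 4)"
          by (rule grow[OF _ tp(1)]) (use Ck(1) B\<phi>(1) Bf(1) in simp)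
        also have "\<dots> = Ck * ?BB * Bz\<^sup>2 / \<delta> ^ 4 * (?t ^ 4 * exp (- cc * (?t\<^sup>2 / \<epsilon>)))" by (simp add: mult_ac)
        also have "\<dots> \<le> Ck * ?BB * Bz\<^sup>2 / \<delta> ^ 4 * (E2 * X)"
          using s2 Ck(1) B\<phi>(1) Bf(1) by (intro mult_left_mono) auto
        also have "\<dots> = N2 * X" by (simp add: N2_def)
        finally show ?thesis using True uvS by (simp add: G_def)
      next
        case False
        then have "G \<epsilon> (?u, ?v) = 0" by (auto simp: G_def indicator_def)
        then show ?thesis using N0 X0 by simp
      qed
      moreover have "\<bar>P0 \<epsilon> (m, w)\<bar> \<le> N3 * X * indicator (cball 0 R) m"
      proof (cases "m \<in> S")
        case True
        have "\<bar>?DD m w\<bar> \<le> (C\<phi> * ?t) * (Cf * ?t)"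
          using C\<phi>(2)[OF True, of w] Cf(2)[OF True, of w] by (intro abs_mult_le) simp_all
        moreover have "\<bar>(zz m)\<^sup>2\<bar> \<le> Bz\<^sup>2" unfolding power2_eq_square abs_mult using Bz True by (intro mult_mono; simp)
        ultimately have "\<bar>P0 \<epsilon> (m, w)\<bar> \<le> (Ck * exp (- cc * (?t\<^sup>2 / \<epsilon>))) * ((C\<phi> * ?t) * (Cf * ?t)) * Bz\<^sup>2"
          using True km(1)[OF \<epsilon> True, of w] Ck(1) C\<phi>(1) Cf(1)
          unfolding P0_def abs_mult[of _ "(zz _)\<^sup>2"] abs_mult[of "kern _ _ _"] abs_mult[of "indicator _ _"]
          by (auto intro!: mult_mono)
        also have "\<dots> \<le> (Ck * exp (- cc * (?t\<^sup>2 / \<epsilon>))) * ((C\<phi> * ?t) * (Cf * ?t)) * Bz\<^sup>2 * (?t\<^sup>2 / \<delta>\<^sup>2)"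
          by (rule grow[OF _ tp(2)]) (use Ck(1) C\<phi>(1) Cf(1) in simp)
        also have "\<dots> = Ck * (C\<phi> * Cf) * Bz\<^sup>2 / \<delta>\<^sup>2 * (?t ^ 4 * exp (- cc * (?t\<^sup>2 / \<epsilon>)))"
          by (simp add: power2_eq_square power4_eq_xxxx mult_ac)
        also have "\<dots> \<le> Ck * (C\<phi> * Cf) * Bz\<^sup>2 / \<delta>\<^sup>2 * (E2 * X)"
          using s2 Ck(1) C\<phi>(1) Cf(1) by (intro mult_left_mono) auto
        also have "\<dots> = N3 * X" by (simp add: N3_def)
        finally show ?thesis using True R by (auto simp: indicator_def)
      next
        case False
        then show ?thesis using N0 X0 by (simp add: P0_def)
      qed
      ultimately have "\<bar>G \<epsilon> (?u, ?v) - P0 \<epsilon> (m, w)\<bar> \<le> (N2 + N3) * X * indicator (cball 0 R) m"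
        by (simp add: distrib_right)
      also have "\<dots> \<le> N * X * indicator (cball 0 R) m"
        using N0 X0 by (intro mult_right_mono) (auto simp: N_def)
      finally show ?thesis unfolding rhs .
    qed
  qed

  obtain CL where "iterated_gaussian TYPE('d) R CL" using iterated_gaussian_exists by blast
  note CL = iterated_gaussianD[OF this]
  obtain CV where CV: "CV > 0" "\<And>F B b. B \<ge> 0 \<Longrightarrow> b > 0 \<Longrightarrow> F \<in> borel_measurable VV \<Longrightarrow>
     (\<forall>x\<in>M. \<forall>y\<in>M. \<bar>F (x, y)\<bar> \<le> B * gauss b (x - y)) \<Longrightarrow>
     \<bar>\<integral>z. F z \<partial>VV\<bar> \<le> B * (CV * b powr (- ?d / 2))"
    using pair_V_gaussian_bound by blast
  define C where "C = N * CL * (cc / 2) powr (- ?d / 2) + N4 * CV * (ck / 2) powr (- ?d / 2)"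
  have powr_eps: "\<epsilon>\<^sup>2 * (b / \<epsilon>) powr (- ?d / 2) = b powr (- ?d / 2) * \<epsilon> powr (?d / 2 + 2)" if "\<epsilon> > 0" "b > 0" for b \<epsilon>
  proof -
    have "(b / \<epsilon>) powr (- ?d / 2) = b powr (- ?d / 2) * \<epsilon> powr (?d / 2)"
      using that by (simp add: powr_divide powr_minus_divide)
    moreover have "\<epsilon> powr (?d / 2 + 2) = \<epsilon> powr (?d / 2) * \<epsilon>\<^sup>2" using that by (simp add: powr_add powr_numeral)
    ultimately show ?thesis by simp
  qed
  show ?thesis
  proof (intro exI[of _ C] conjI allI impI)
    show "C \<ge> 0" unfolding C_def N_def using N0 N4 CL(1) CV(1) by simp
    fix \<epsilon> :: real assume \<epsilon>: "\<epsilon> > 0"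
    define F where "F = form \<alpha> \<epsilon> \<rho>\<^sub>0 \<phi> f"
    have Fm: "F \<in> borel_measurable VV" unfolding F_def
      by (intro form_measurable continuous_measurable_V rho0_continuous Ck_manifold_continuous[OF \<phi>] Ck_manifold_continuous[OF f])
    have Fb: "\<bar>F (x, y)\<bar> \<le> Ck * exp (- ck * ((norm (x - y))\<^sup>2 / \<epsilon>)) * ?BB * Bp\<^sup>2" if xy: "x \<in> M" "y \<in> M" for x y
    proof -
      have "\<bar>(\<phi> x - \<phi> y) * (f x - f y)\<bar> \<le> (2 * B\<phi>) * (2 * Bf)"
        unfolding abs_mult using B\<phi>(2)[OF xy(1)] B\<phi>(2)[OF xy(2)] Bf(2)[OF xy(1)] Bf(2)[OF xy(2)] B\<phi>(1) Bf(1)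
        by (intro mult_mono) (auto intro: order_trans[OF abs_triangle_ineq4])
      moreover have "\<bar>p x * p y\<bar> \<le> Bp\<^sup>2" unfolding power2_eq_square abs_mult using Bp xy by (auto intro!: mult_mono)
      moreover have "\<bar>kern \<alpha> ((norm (x - y))\<^sup>2 / \<epsilon>) (\<rho>\<^sub>0 x * \<rho>\<^sub>0 y)\<bar> \<le> Ck * exp (- ck * ((norm (x - y))\<^sup>2 / \<epsilon>))"
        using rr[OF xy] \<epsilon> by (intro Ck(3)) auto
      ultimately show ?thesis
        unfolding F_def form_def fst_conv snd_conv abs_mult[of _ "p x * p y"] abs_mult[of "kern _ _ _"]
        using Ck(1) B\<phi>(1) Bf(1) by (intro mult_mono) auto
    qed
    have Fb': "\<bar>F (x, y)\<bar> \<le> Ck * ?BB * Bp\<^sup>2" if xy: "x \<in> M" "y \<in> M" for x y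
    proof -
      have "Ck * exp (- ck * ((norm (x - y))\<^sup>2 / \<epsilon>)) \<le> Ck" using Ck(1,2) \<epsilon> by (intro mult_left_le) auto
      then have "Ck * exp (- ck * ((norm (x - y))\<^sup>2 / \<epsilon>)) * ?BB * Bp\<^sup>2 \<le> Ck * ?BB * Bp\<^sup>2"
        using B\<phi>(1) Bf(1) by (intro mult_right_mono) auto
      then show ?thesis using Fb[OF xy] by linarith
    qed
    have SV[measurable]: "\<psi> ` S \<in> sets V"
    proof -
      have "continuous_on S \<psi>" using Ck_on_imp_continuous_on[OF D(2)] S2 continuous_on_subset by blast
      then have "compact (\<psi> ` S)" using S1 compact_continuous_image by blast
      then show ?thesis using SM by (auto simp: in_sets_V borel_closed compact_imp_closed)
    qed
    \<comment> \<open>\<open>F1\<close> keeps the pairs with both points in the image of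
      \<open>S\<close>. Where the remainder \<open>F2\<close> is nonzero, one point lies in
      \<open>K\<close> and the distance is at least \<eta>, so it is exponentially small.\<close>
    define F1 where "F1 z = indicator (\<psi> ` S) (fst z) * (indicator (\<psi> ` S) (snd z) * F z)" for z
    define F2 where "F2 z = F z - F1 z" for z
    have F1m: "F1 \<in> borel_measurable VV" unfolding F1_def[abs_def] using Fm by measurable
    have F2m: "F2 \<in> borel_measurable VV" unfolding F2_def[abs_def] using Fm F1m by measurable
    have F1b: "\<bar>F1 (x, y)\<bar> \<le> Ck * ?BB * Bp\<^sup>2" if "x \<in> M" "y \<in> M" for x y
      using Fb'[OF that] Ck(1) B\<phi>(1) Bf(1) by (auto simp: F1_def indicator_def)
    have F2b: "\<bar>F2 (x, y)\<bar> \<le> (N4 * \<epsilon>\<^sup>2) * gauss (ck / 2 / \<epsilon>) (x - y)" if xy: "x \<in> M" "y \<in> M" for x y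
    proof (cases "F2 (x, y) = 0")
      case True
      then show ?thesis using N4 by simp
    next
      case False
      let ?t = "norm (x - y)"
      have notS: "\<not> (x \<in> \<psi> ` S \<and> y \<in> \<psi> ` S)" and F0: "F (x, y) \<noteq> 0"
        using False by (auto simp: F2_def F1_def)
      have "x \<in> K \<or> y \<in> K"
      proof (rule ccontr)
        assume "\<not> (x \<in> K \<or> y \<in> K)"
        then have "\<phi> x = 0" "\<phi> y = 0" using z xy by blast+
        then show False using F0 by (simp add: F_def form_def)
      qed
      moreover have "K \<subseteq> \<psi> ` S" using Lc(3) LsubS by blast
      ultimately have t: "\<eta> \<le> ?t" using notS \<eta>(2)[of x y] \<eta>(2)[of y x] xy by (auto simp: norm_minus_commute)
      then have tp: "1 \<le> ?t ^ 4 / \<eta> ^ 4" using \<eta>(1) by (auto intro!: power_mono)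
      have s2: "?t ^ 4 * exp (- ck * (?t\<^sup>2 / \<epsilon>)) \<le> \<epsilon>\<^sup>2 * (Ek * exp (- (ck / 2) * (?t\<^sup>2 / \<epsilon>)))"
        using Ek(2)[OF \<epsilon>, of ?t] by (simp add: mult_ac)
      have "\<bar>F2 (x, y)\<bar> \<le> \<bar>F (x, y)\<bar>" by (auto simp: F2_def F1_def indicator_def)
      also have "\<dots> \<le> Ck * exp (- ck * (?t\<^sup>2 / \<epsilon>)) * ?BB * Bp\<^sup>2" by (rule Fb[OF xy])
      also have "\<dots> \<le> Ck * exp (- ck * (?t\<^sup>2 / \<epsilon>)) * ?BB * Bp\<^sup>2 * (?t ^ 4 / \<eta> ^ 4)"
        by (rule grow[OF _ tp]) (use Ck(1) B\<phi>(1) Bf(1) in simp)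
      also have "\<dots> = Ck * ?BB * Bp\<^sup>2 / \<eta> ^ 4 * (?t ^ 4 * exp (- ck * (?t\<^sup>2 / \<epsilon>)))" by (simp add: mult_ac)
      also have "\<dots> \<le> Ck * ?BB * Bp\<^sup>2 / \<eta> ^ 4 * (\<epsilon>\<^sup>2 * (Ek * exp (- (ck / 2) * (?t\<^sup>2 / \<epsilon>))))"
        using s2 Ck(1) B\<phi>(1) Bf(1) by (intro mult_left_mono) auto
      also have "\<dots> = (N4 * \<epsilon>\<^sup>2) * gauss (ck / 2 / \<epsilon>) (x - y)" by (simp add: N4_def mult_ac)
      finally show ?thesis .
    qed
    have iF: "integrable VV F" "integrable VV F1"
      using pair_V_bounded_integrable[OF Fm Fb'] pair_V_bounded_integrable[OF F1m F1b] by auto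
    have far: "\<bar>(LINT z|VV. F z) - (LINT z|VV. F1 z)\<bar> \<le> (N4 * \<epsilon>\<^sup>2) * (CV * (ck / 2 / \<epsilon>) powr (- ?d / 2))"
    proof -
      have "(LINT z|VV. F z) - (LINT z|VV. F1 z) = (LINT z|VV. F2 z)"
        unfolding F2_def using iF by simp
      then show ?thesis using CV(2)[OF _ _ F2m, of "N4 * \<epsilon>\<^sup>2" "ck / 2 / \<epsilon>"] F2b N4 Ck(2) \<epsilon> by simp
    qed
    have F1z: "F1 (x, y) = 0" if "x \<notin> \<psi> ` S \<or> y \<notin> \<psi> ` S" for x y using that by (auto simp: F1_def)
    have Geq: "G \<epsilon> = (\<lambda>(u, v). indicator S u * (indicator S v * (vol \<psi> u * (vol \<psi> v * F1 (\<psi> u, \<psi> v)))))"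
      by (auto simp: fun_eq_iff G_def P_def F1_def F_def form_def zz_def indicator_def)
    have CPI: "G \<epsilon> \<in> borel_measurable lborel2" "(LINT z|VV. F1 z) = (LINT z|lborel2. G \<epsilon> z)"
      "\<exists>B'. \<forall>u v. \<bar>G \<epsilon> (u, v)\<bar> \<le> B'"
      unfolding Geq using chart_pair_integral[OF c S1 S2 F1m F1b F1z] by blast+
    obtain BG where BG: "\<And>u v. \<bar>G \<epsilon> (u, v)\<bar> \<le> BG" using CPI(3) by blast
    have Gz: "G \<epsilon> (u, v) = 0" if "u \<notin> cball 0 R \<or> v \<notin> cball 0 R" for u v using that R by (auto simp: G_def indicator_def)
    have mid: "integrable lborel2 (\<lambda>(m, w). G \<epsilon> (lo m w, hi m w))"
      "(LINT z|lborel2. G \<epsilon> z) = (LINT (m, w)|lborel2. G \<epsilon> (lo m w, hi m w))"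
      using Gz by (intro midpoint_substitution[OF CPI(1) BG, of R]; simp)+
    define H where "H x = m2 * \<epsilon> powr (?d / 2 + 1) * (p_alpha dT \<alpha> p x * (grd \<phi> x \<bullet> grd f x))" for x
    let ?I = "\<lambda>m. indicator U m * (vol \<psi> m * H (\<psi> m))"
    have pac: "continuous_on M (\<lambda>x. p_alpha dT \<alpha> p x)"
      unfolding p_alpha_def using p_pos p_continuous by (intro continuous_on_powr continuous_on_const) force+
    have Hc: "continuous_on M H" unfolding H_def[abs_def]
      by (intro continuous_on_mult continuous_on_const pac continuous_grad_inner \<phi>1 f1)
    have Hz: "H (\<psi> m) = 0" if "m \<in> U" "m \<notin> L" for m
    proof -
      have "grd \<phi> (\<psi> m) = 0"
        by (rule grad_zero_outside[OF compact_imp_closed[OF K(1)]]) (use z that Lc(4) D(5) in auto)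
      then show ?thesis by (simp add: H_def)
    qed
    \<comment> \<open>Measurability in the displacement only: for a fixed midpoint the model is a
      kernel of a linear map times two linear forms.\<close>
    have P0m: "(\<lambda>w. P0 \<epsilon> (m, w)) \<in> borel_measurable lborel" for m
    proof (cases "m \<in> S")
      case True
      have bl: "bounded_linear (fderiv \<psi> m)" "bounded_linear (fderiv (\<phi> \<circ> \<psi>) m)" "bounded_linear (fderiv (f \<circ> \<psi>) m)"
        using True S2 by (auto intro!: Ck_on_bounded_linear[OF Ck_on_mono[OF c3(1), of "Suc 0"]] Ck_on_bounded_linear[OF Ck_on_mono[OF c3(2), of "Suc 0"]]
          Ck_on_bounded_linear[OF D(2)[of "Suc 0"]])
      note [measurable] = bl[THEN linear_continuous_on, THEN borel_measurable_continuous_onI]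
      have [measurable]: "(\<lambda>w. ?km \<epsilon> m w) \<in> borel_measurable borel"
        by (rule measurable_kern) measurable
      show ?thesis unfolding P0_def by simp
    qed (simp add: P0_def)
    have P0I: "(LINT w|lborel. P0 \<epsilon> (m, w)) = ?I m" for m
    proof (cases "m \<in> S")
      case True
      then have mU: "m \<in> U" using S2 by blast
      then show ?thesis using True tangent_kernel_integral[OF c mU \<epsilon> \<phi>1 f1, of \<alpha>] by (simp add: P0_def H_def zz_def)
    next
      case False
      then show ?thesis using Hz[of m] LsubS by (auto simp: P0_def indicator_def)
    qed
    have Ii: "integrable lborel ?I"
    proof (rule compact_support_integrable[OF S1])
      have "continuous_on S (\<lambda>m. vol \<psi> m * H (\<psi> m))"
        using S2 SM Ck_on_imp_continuous_on[OF D(2)] Ck_on_imp_continuous_on[OF Ck_on_volume_density[OF c]]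
        by (intro continuous_on_mult continuous_on_compose2[OF Hc]) (auto intro: continuous_on_subset)
      then show "continuous_on S ?I" by (rule continuous_on_eq) (use S2 in \<open>auto simp: indicator_def\<close>)
      show "?I m = 0" if "m \<notin> S" for m using Hz[of m] that LsubS by (auto simp: indicator_def)
    qed
    have near': "\<bar>(LINT z|VV. F1 z) - (LINT m|lborel. ?I m)\<bar> \<le> (N * \<epsilon>\<^sup>2) * (CL * (cc / 2 / \<epsilon>) powr (- ?d / 2))"
      unfolding CPI(2) mid(2)
      using bound[OF \<epsilon>] N0 cc \<epsilon> by (intro CL(2)[OF _ _ mid(1) P0m P0I Ii]) (auto simp: N_def)
    have "(LINT m|lborel. ?I m) = (LINT x|V. H x)"
    proof (rule chart_integral[OF c continuous_measurable_V[OF Hc], symmetric])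
      show "H x = 0" if "x \<in> M" "x \<notin> \<psi> ` U" for x
      proof -
        have "grd \<phi> x = 0"
          by (rule grad_zero_outside[OF compact_imp_closed[OF K(1)]]) (use z that K(2) in auto)
        then show ?thesis by (simp add: H_def)
      qed
    qed
    also have "\<dots> = m2 * \<epsilon> powr (?d / 2 + 1) * (dirichlet \<alpha> \<phi> f)"
      unfolding H_def by (rule integral_mult_right_zero)
    finally have P0int: "(LINT m|lborel. ?I m) = m2 * \<epsilon> powr (?d / 2 + 1) * (dirichlet \<alpha> \<phi> f)" .
    have "\<bar>(LINT z|VV. F z) - (LINT m|lborel. ?I m)\<bar> \<le> (N4 * \<epsilon>\<^sup>2) * (CV * (ck / 2 / \<epsilon>) powr (- ?d / 2)) + (N * \<epsilon>\<^sup>2) * (CL * (cc / 2 / \<epsilon>) powr (- ?d / 2))"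
      using far near' by linarith
    also have "\<dots> = N4 * CV * (\<epsilon>\<^sup>2 * (ck / 2 / \<epsilon>) powr (- ?d / 2)) + N * CL * (\<epsilon>\<^sup>2 * (cc / 2 / \<epsilon>) powr (- ?d / 2))" by (simp only: mult_ac)
    also have "\<dots> = C * \<epsilon> powr (?d / 2 + 2)"
      using powr_eps[OF \<epsilon>, of "ck / 2"] powr_eps[OF \<epsilon>, of "cc / 2"] Ck(2) cc by (simp add: C_def algebra_simps)
    finally show "\<bar>(Form \<alpha> \<epsilon> \<rho>\<^sub>0 \<phi> f) -
      m2 * \<epsilon> powr (real CARD('d) / 2 + 1) * (dirichlet \<alpha> \<phi> f)\<bar> \<le> C * \<epsilon> powr (real CARD('d) / 2 + 2)"
      unfolding P0int F_def .
  qed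
qed

end

section \<open>Perturbation of the bandwidth and globalization of the limit\<close>

lemma powr_divide_neg:
  fixes c \<epsilon> s :: real
  assumes "c > 0" "\<epsilon> > 0"
  shows "(c / \<epsilon>) powr (- s / 2) = c powr (- s / 2) * \<epsilon> powr (s / 2)"
  using assms by (simp add: powr_divide powr_minus_divide)

lemma exp_mult_divide:
  fixes b t \<epsilon> :: real
  shows "exp (- b * (t / \<epsilon>)) = exp (- (b / \<epsilon>) * t)"
  by simp

context weighted_manifold
begin

text \<open>The tolerance 1 / 10 keeps \<rho> between 9 / 10 and 11 / 10 of
  \<open>\<rho>\<^sub>0\<close>, so that the products of bandwidths range over one compact interval
  of positive numbers.\<close>

definition close_bandwidth :: "real \<Rightarrow> (real ^ 'D \<Rightarrow> real) \<Rightarrow> bool" where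
  "close_bandwidth \<delta> \<rho> \<longleftrightarrow> 0 \<le> \<delta> \<and> \<delta> \<le> 1 / 10 \<and> \<rho> \<in> borel_measurable V \<and> (\<forall>x\<in>M. \<bar>\<rho> x - \<rho>\<^sub>0 x\<bar> \<le> \<delta> * \<rho>\<^sub>0 x)"

lemma close_bandwidthD:
  assumes "close_bandwidth \<delta> \<rho>"
  shows "0 \<le> \<delta>" "\<delta> \<le> 1 / 10" "\<rho> \<in> borel_measurable V" "\<And>x. x \<in> M \<Longrightarrow> \<bar>\<rho> x - \<rho>\<^sub>0 x\<bar> \<le> \<delta> * \<rho>\<^sub>0 x"
    "\<And>x. x \<in> M \<Longrightarrow> 9 / 10 * \<rho>\<^sub>0 x \<le> \<rho> x" "\<And>x. x \<in> M \<Longrightarrow> \<rho> x \<le> 11 / 10 * \<rho>\<^sub>0 x" "\<And>x. x \<in> M \<Longrightarrow> \<rho> x > 0"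
proof -
  show *: "0 \<le> \<delta>" "\<delta> \<le> 1 / 10" "\<rho> \<in> borel_measurable V" "\<And>x. x \<in> M \<Longrightarrow> \<bar>\<rho> x - \<rho>\<^sub>0 x\<bar> \<le> \<delta> * \<rho>\<^sub>0 x"
    using assms by (auto simp: close_bandwidth_def)
  have **: "\<bar>\<rho> x - \<rho>\<^sub>0 x\<bar> \<le> 1 / 10 * \<rho>\<^sub>0 x" if "x \<in> M" for x
    using *(4)[OF that] mult_right_mono[OF *(2), of "\<rho>\<^sub>0 x"] rho0_pos[OF that] by linarith
  show "9 / 10 * \<rho>\<^sub>0 x \<le> \<rho> x" "\<rho> x \<le> 11 / 10 * \<rho>\<^sub>0 x" "\<rho> x > 0" if "x \<in> M" for x
    using **[OF that] rho0_pos[OF that] by linarith+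
qed

lemma close_bandwidth_rho0: "close_bandwidth 0 \<rho>\<^sub>0"
  using continuous_measurable_V[OF rho0_continuous] by (simp add: close_bandwidth_def)

text \<open>The constants precede \<delta> and \<rho>, because the bandwidth may change with
  N.\<close>

definition kern_constants :: "real \<Rightarrow> real \<Rightarrow> real \<Rightarrow> bool" where
  "kern_constants \<alpha> C c \<longleftrightarrow> C > 0 \<and> c > 0 \<and> (\<forall>\<delta> \<rho>. close_bandwidth \<delta> \<rho> \<longrightarrow> (\<forall>x\<in>M. \<forall>y\<in>M. \<forall>\<tau>\<ge>0.
     \<bar>kern \<alpha> \<tau> (\<rho> x * \<rho> y)\<bar> \<le> C * exp (- c * \<tau>) \<and>
     \<bar>kern \<alpha> \<tau> (\<rho> x * \<rho> y) - kern \<alpha> \<tau> (\<rho>\<^sub>0 x * \<rho>\<^sub>0 y)\<bar> \<le> C * \<delta> * exp (- c * \<tau>)))"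

lemma kern_constantsD:
  assumes "kern_constants \<alpha> C c"
  shows "C > 0" "c > 0"
    "\<And>\<delta> \<rho> x y \<tau>. close_bandwidth \<delta> \<rho> \<Longrightarrow> x \<in> M \<Longrightarrow> y \<in> M \<Longrightarrow> \<tau> \<ge> 0 \<Longrightarrow>
       \<bar>kern \<alpha> \<tau> (\<rho> x * \<rho> y)\<bar> \<le> C * exp (- c * \<tau>)"
    "\<And>\<delta> \<rho> x y \<tau>. close_bandwidth \<delta> \<rho> \<Longrightarrow> x \<in> M \<Longrightarrow> y \<in> M \<Longrightarrow> \<tau> \<ge> 0 \<Longrightarrow>
       \<bar>kern \<alpha> \<tau> (\<rho> x * \<rho> y) - kern \<alpha> \<tau> (\<rho>\<^sub>0 x * \<rho>\<^sub>0 y)\<bar> \<le> C * \<delta> * exp (- c * \<tau>)"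
  using assms unfolding kern_constants_def by blast+

lemma kern_constants_exist: obtains C c where "kern_constants \<alpha> C c"
proof -
  obtain r1 r2 where r: "0 < r1" "0 < r2" "\<And>x. x \<in> M \<Longrightarrow> r1 \<le> \<rho>\<^sub>0 x" "\<And>x. x \<in> M \<Longrightarrow> \<rho>\<^sub>0 x \<le> r2"
    using continuous_bounds_M[OF rho0_continuous rho0_pos] by blast
  define s1 where "s1 = 9 / 10 * r1"
  define s2 where "s2 = 11 / 10 * r2"
  have s: "0 < s1" "0 < s2" using r by (auto simp: s1_def s2_def)
  have Q1: "s1 * s1 > 0" using s by simp
  obtain C c where "kern_bound \<alpha> (s1 * s1) (s2 * s2) C c" using kern_bounds[OF Q1] by blast
  note C = kern_boundD(1,2)[OF this] and K = kern_boundD(3,4)[OF this]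
  \<comment> \<open>21 / 10 = 11 / 10 + 1 comes from the difference of the two products of
    bandwidths: one term has a factor of at most 11 / 10 r2, the other a factor of at most
    r2.\<close>
  let ?C = "C + C * (21 / 10 * r2 * r2)"
  have main: "\<bar>kern \<alpha> \<tau> (\<rho> x * \<rho> y)\<bar> \<le> ?C * exp (- c * \<tau>)"
     "\<bar>kern \<alpha> \<tau> (\<rho> x * \<rho> y) - kern \<alpha> \<tau> (\<rho>\<^sub>0 x * \<rho>\<^sub>0 y)\<bar> \<le> ?C * \<delta> * exp (- c * \<tau>)"
    if b: "close_bandwidth \<delta> \<rho>" and xy: "x \<in> M" "y \<in> M" and \<tau>: "\<tau> \<ge> 0" for \<delta> \<rho> x y \<tau>
  proof -
    note D = close_bandwidthD[OF b]
    have R: "s1 \<le> \<rho> z" "\<rho> z \<le> s2" "s1 \<le> \<rho>\<^sub>0 z" "\<rho>\<^sub>0 z \<le> s2" "\<bar>\<rho> z - \<rho>\<^sub>0 z\<bar> \<le> \<delta> * r2" if "z \<in> M" for z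
    proof -
      show "s1 \<le> \<rho> z" "\<rho> z \<le> s2" "s1 \<le> \<rho>\<^sub>0 z" "\<rho>\<^sub>0 z \<le> s2"
        using r(1,2) r(3,4)[OF that] D(5,6)[OF that] by (auto simp: s1_def s2_def)
      show "\<bar>\<rho> z - \<rho>\<^sub>0 z\<bar> \<le> \<delta> * r2" using D(4)[OF that] mult_left_mono[OF r(4)[OF that] D(1)] by linarith
    qed
    have Q: "\<rho> x * \<rho> y \<in> {s1 * s1..s2 * s2}" "\<rho>\<^sub>0 x * \<rho>\<^sub>0 y \<in> {s1 * s1..s2 * s2}"
      using R(1-4)[OF xy(1)] R(1-4)[OF xy(2)] s by (auto intro!: mult_mono)
    have "0 \<le> C * (21 / 10 * r2 * r2) * exp (- c * \<tau>)" using C r by simp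
    then show "\<bar>kern \<alpha> \<tau> (\<rho> x * \<rho> y)\<bar> \<le> ?C * exp (- c * \<tau>)"
      using K(1)[OF \<tau> Q(1)] unfolding distrib_right by linarith
    have "\<bar>\<rho> x * \<rho> y - \<rho>\<^sub>0 x * \<rho>\<^sub>0 y\<bar> \<le> (\<delta> * r2) * s2 + r2 * (\<delta> * r2)"
      using R[OF xy(1)] R[OF xy(2)] r s rho0_pos[OF xy(1)] r(4)[OF xy(1)] by (intro abs_mult_diff_le) auto
    also have "\<dots> = 21 / 10 * r2 * r2 * \<delta>" by (simp add: s2_def algebra_simps)
    finally have "C * \<bar>\<rho> x * \<rho> y - \<rho>\<^sub>0 x * \<rho>\<^sub>0 y\<bar> \<le> C * (21 / 10 * r2 * r2 * \<delta>)" using C by (intro mult_left_mono) auto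
    also have "\<dots> \<le> ?C * \<delta>" using C D(1) by (simp add: algebra_simps)
    finally have "C * \<bar>\<rho> x * \<rho> y - \<rho>\<^sub>0 x * \<rho>\<^sub>0 y\<bar> * exp (- c * \<tau>) \<le> ?C * \<delta> * exp (- c * \<tau>)"
      by (intro mult_right_mono) auto
    then show "\<bar>kern \<alpha> \<tau> (\<rho> x * \<rho> y) - kern \<alpha> \<tau> (\<rho>\<^sub>0 x * \<rho>\<^sub>0 y)\<bar> \<le> ?C * \<delta> * exp (- c * \<tau>)"
      using K(2)[OF \<tau> \<tau> Q] unfolding min.idem diff_self abs_zero add_0_left by linarith
  qed
  have "C + C * (21 / 10 * r2 * r2) > 0" using C r by (simp add: add_pos_nonneg)
  then have "kern_constants \<alpha> ?C c"
    unfolding kern_constants_def using C(2) by (intro conjI allI impI ballI main)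
  then show ?thesis by (rule that)
qed

lemma form_integrable:
  assumes b: "close_bandwidth \<delta> \<rho>" and \<epsilon>: "\<epsilon> > 0" and \<phi>: "continuous_on M \<phi>" and f: "continuous_on M f"
  shows "integrable VV (form \<alpha> \<epsilon> \<rho> \<phi> f)"
proof -
  obtain C c where "kern_constants \<alpha> C c" by (rule kern_constants_exist)
  note KC = kern_constantsD[OF this]
  note C = KC(1,2) and K = KC(3)
  obtain B\<phi> where "bounded_by \<phi> B\<phi>" by (rule bounded_byI[OF \<phi>])
  note B\<phi> = bounded_byD[OF this]
  obtain Bf where "bounded_by f Bf" by (rule bounded_byI[OF f])
  note Bf = bounded_byD[OF this]
  obtain Bp where "bounded_by p Bp" by (rule bounded_byI[OF p_continuous])
  note Bp = bounded_byD[OF this]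
  show ?thesis
  proof (rule pair_V_bounded_integrable)
    show "form \<alpha> \<epsilon> \<rho> \<phi> f \<in> borel_measurable VV"
      using close_bandwidthD(3)[OF b] continuous_measurable_V[OF \<phi>] continuous_measurable_V[OF f] by (rule form_measurable)
    fix x y assume xy: "x \<in> M" "y \<in> M"
    have "\<bar>kern \<alpha> ((norm (x - y))\<^sup>2 / \<epsilon>) (\<rho> x * \<rho> y)\<bar> \<le> C * exp (- c * ((norm (x - y))\<^sup>2 / \<epsilon>))" using \<epsilon> by (intro K[OF b] xy) simp
    also have "\<dots> \<le> C * 1" using C \<epsilon> by (intro mult_left_mono) auto
    finally have k: "\<bar>kern \<alpha> ((norm (x - y))\<^sup>2 / \<epsilon>) (\<rho> x * \<rho> y)\<bar> \<le> C" by simp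
    have "\<bar>\<phi> x - \<phi> y\<bar> \<le> 2 * B\<phi>" "\<bar>f x - f y\<bar> \<le> 2 * Bf"
      using B\<phi>(2)[OF xy(1)] B\<phi>(2)[OF xy(2)] Bf(2)[OF xy(1)] Bf(2)[OF xy(2)] by linarith+
    then show "\<bar>form \<alpha> \<epsilon> \<rho> \<phi> f (x, y)\<bar> \<le> C * ((2 * B\<phi>) * (2 * Bf)) * (Bp * Bp)"
      unfolding form_def fst_conv snd_conv by (intro abs_mult_le k Bp(2) xy)
  qed
qed

text \<open>The form is linear in \<phi>, so a partition of unity acting on \<phi> alone reduces it
  to single charts; as \<open>f\<close> is left whole, no cross terms between charts arise.\<close>

lemma dirichlet_limit:
  assumes \<phi>: "Ck_manifold 3 \<phi>" and f: "Ck_manifold 3 f"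
  shows "\<exists>C\<ge>0. \<forall>\<epsilon>>0. \<bar>(Form \<alpha> \<epsilon> \<rho>\<^sub>0 \<phi> f) -
      m2 * \<epsilon> powr (real CARD('d) / 2 + 1) * (dirichlet \<alpha> \<phi> f)\<bar>
    \<le> C * \<epsilon> powr (real CARD('d) / 2 + 2)"
proof -
  obtain X \<eta> K U \<psi> where "chart_partition X \<eta> K U \<psi>" by (rule partition_of_unity)
  note P = chart_partitionD[OF this]
  let ?\<phi> = "\<lambda>i x. \<eta> i x * \<phi> x"
  have \<phi>i: "Ck_manifold 3 (?\<phi> i)" if "i \<in> X" for i by (rule Ck_manifold_mult[OF P(2)[OF that] \<phi>])
  have \<phi>i1: "Ck_manifold (Suc 0) (?\<phi> i)" if "i \<in> X" for i using \<phi>i[OF that] by (rule Ck_manifold_mono) simp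
  have f1: "Ck_manifold (Suc 0) f" using f by (rule Ck_manifold_mono) simp
  let ?I = "\<lambda>g. \<integral>x. p_alpha dT \<alpha> p x * (grd g x \<bullet> grd f x) \<partial>V"
  let ?F = "\<lambda>\<epsilon> g. \<integral>z. form \<alpha> \<epsilon> \<rho>\<^sub>0 g f z \<partial>VV"
  let ?m = "\<lambda>\<epsilon>. m2 * \<epsilon> powr (real CARD('d) / 2 + 1)"
  define Q where "Q i C \<longleftrightarrow> C \<ge> 0 \<and> (\<forall>\<epsilon>>0. \<bar>?F \<epsilon> (?\<phi> i) - ?m \<epsilon> * ?I (?\<phi> i)\<bar> \<le> C * \<epsilon> powr (real CARD('d) / 2 + 2))" for i C
  have "\<forall>i\<in>X. \<exists>C. Q i C"
  proof
    fix i assume i: "i \<in> X"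
    have "\<exists>C\<ge>0. \<forall>\<epsilon>>0. \<bar>?F \<epsilon> (?\<phi> i) - ?m \<epsilon> * ?I (?\<phi> i)\<bar> \<le> C * \<epsilon> powr (real CARD('d) / 2 + 2)"
      by (rule chart_dirichlet_limit[OF P(3)[OF i] \<phi>i[OF i] f P(4)[OF i] P(5)[OF i]]) (simp add: P(6)[OF i])
    then show "\<exists>C. Q i C" unfolding Q_def .
  qed
  then obtain C where "\<And>i. i \<in> X \<Longrightarrow> Q i (C i)" by metis
  then have C: "\<And>i. i \<in> X \<Longrightarrow> C i \<ge> 0" "\<And>i \<epsilon>. i \<in> X \<Longrightarrow> \<epsilon> > 0 \<Longrightarrow> \<bar>?F \<epsilon> (?\<phi> i) - ?m \<epsilon> * ?I (?\<phi> i)\<bar> \<le> C i * \<epsilon> powr (real CARD('d) / 2 + 2)"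
    unfolding Q_def by blast+
  have \<phi>s: "\<phi> x = (\<Sum>i\<in>X. ?\<phi> i x)" if "x \<in> M" for x
    using P(7)[OF that] by (simp add: sum_distrib_right[symmetric])
  have F: "?F \<epsilon> \<phi> = (\<Sum>i\<in>X. ?F \<epsilon> (?\<phi> i))" if \<epsilon>: "\<epsilon> > 0" for \<epsilon>
  proof -
    have "?F \<epsilon> \<phi> = (LINT z|VV. (\<Sum>i\<in>X. form \<alpha> \<epsilon> \<rho>\<^sub>0 (?\<phi> i) f z))"
    proof (rule LINT_cong)
      fix z assume "z \<in> space VV"
      then have "fst z \<in> M" "snd z \<in> M" by (auto simp: space_pair_measure space_V)
      note s = \<phi>s[OF this(1)] \<phi>s[OF this(2)]
      have "\<phi> (fst z) - \<phi> (snd z) = (\<Sum>i\<in>X. ?\<phi> i (fst z) - ?\<phi> i (snd z))" by (simp only: sum_subtractf s[symmetric])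
      then show "form \<alpha> \<epsilon> \<rho>\<^sub>0 \<phi> f z = (\<Sum>i\<in>X. form \<alpha> \<epsilon> \<rho>\<^sub>0 (?\<phi> i) f z)"
        unfolding form_def by (simp only: sum_distrib_left sum_distrib_right)
    qed
    also have "\<dots> = (\<Sum>i\<in>X. ?F \<epsilon> (?\<phi> i))"
      by (rule Bochner_Integration.integral_sum)
        (rule form_integrable[OF close_bandwidth_rho0 \<epsilon> Ck_manifold_continuous[OF \<phi>i] Ck_manifold_continuous[OF f]])
    finally show ?thesis .
  qed
  have pac: "continuous_on M (\<lambda>x. p_alpha dT \<alpha> p x)"
    unfolding p_alpha_def using p_pos p_continuous by (intro continuous_on_powr continuous_on_const) force+
  have I: "?I \<phi> = (\<Sum>i\<in>X. ?I (?\<phi> i))"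
  proof -
    have "?I \<phi> = (LINT x|V. (\<Sum>i\<in>X. p_alpha dT \<alpha> p x * (grd (?\<phi> i) x \<bullet> grd f x)))"
    proof (rule LINT_cong)
      fix x assume "x \<in> space V"
      then have x: "x \<in> M" by (simp add: space_V)
      have "grd \<phi> x = grd (\<lambda>x. \<Sum>i\<in>X. ?\<phi> i x) x" using \<phi>s Ck_manifold_sum[of X "Suc 0" ?\<phi>] \<phi>i1 x by (intro grad_cong) auto
      also have "\<dots> = (\<Sum>i\<in>X. grd (?\<phi> i) x)" by (rule grad_sum[OF P(1) \<phi>i1 x])
      finally show "p_alpha dT \<alpha> p x * (grd \<phi> x \<bullet> grd f x) = (\<Sum>i\<in>X. p_alpha dT \<alpha> p x * (grd (?\<phi> i) x \<bullet> grd f x))"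
        by (simp only: inner_sum_left sum_distrib_left)
    qed
    also have "\<dots> = (\<Sum>i\<in>X. ?I (?\<phi> i))"
      by (rule Bochner_Integration.integral_sum) (intro continuous_integrable_V continuous_on_mult pac continuous_grad_inner \<phi>i1 f1)
    finally show ?thesis .
  qed
  show ?thesis
  proof (intro exI[of _ "sum C X"] conjI allI impI)
    show "0 \<le> sum C X" using C(1) by (rule sum_nonneg)
    fix \<epsilon> :: real assume \<epsilon>: "\<epsilon> > 0"
    have "\<bar>?F \<epsilon> \<phi> - ?m \<epsilon> * ?I \<phi>\<bar> = \<bar>\<Sum>i\<in>X. ?F \<epsilon> (?\<phi> i) - ?m \<epsilon> * ?I (?\<phi> i)\<bar>"
      unfolding F[OF \<epsilon>] I sum_distrib_left sum_subtractf ..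
    also have "\<dots> \<le> (\<Sum>i\<in>X. \<bar>?F \<epsilon> (?\<phi> i) - ?m \<epsilon> * ?I (?\<phi> i)\<bar>)" by (rule sum_abs)
    also have "\<dots> \<le> (\<Sum>i\<in>X. C i * \<epsilon> powr (real CARD('d) / 2 + 2))" using C(2) \<epsilon> by (intro sum_mono) auto
    also have "\<dots> = sum C X * \<epsilon> powr (real CARD('d) / 2 + 2)" by (simp only: sum_distrib_right)
    finally show "\<bar>?F \<epsilon> \<phi> - ?m \<epsilon> * ?I \<phi>\<bar> \<le> sum C X * \<epsilon> powr (real CARD('d) / 2 + 2)" .
  qed
qed

text \<open>The kernel changes by O(\<delta>), the two Lipschitz increments contribute |x - y|^2,
  which is worth \<epsilon>, and the Gaussian mass is of order \<epsilon>^(d/2).\<close>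

lemma dirichlet_bandwidth:
  assumes \<phi>: "Ck_manifold (Suc 0) \<phi>" and f: "Ck_manifold (Suc 0) f"
  shows "\<exists>C\<ge>0. \<forall>\<epsilon>>0. \<forall>\<delta> \<rho>. close_bandwidth \<delta> \<rho> \<longrightarrow>
    \<bar>(Form \<alpha> \<epsilon> \<rho> \<phi> f) - (Form \<alpha> \<epsilon> \<rho>\<^sub>0 \<phi> f)\<bar> \<le> C * \<delta> * \<epsilon> powr (real CARD('d) / 2 + 1)"
proof -
  obtain C c where "kern_constants \<alpha> C c" by (rule kern_constants_exist)
  note KC = kern_constantsD[OF this]
  note C = KC(1,2) and K = KC(4)
  obtain L\<phi> where L\<phi>: "L\<phi> \<ge> 0" "\<And>x y. x \<in> M \<Longrightarrow> y \<in> M \<Longrightarrow> \<bar>\<phi> x - \<phi> y\<bar> \<le> L\<phi> * norm (x - y)" using Ck_manifold_lipschitz[OF \<phi>] by blast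
  obtain Lf where Lf: "Lf \<ge> 0" "\<And>x y. x \<in> M \<Longrightarrow> y \<in> M \<Longrightarrow> \<bar>f x - f y\<bar> \<le> Lf * norm (x - y)" using Ck_manifold_lipschitz[OF f] by blast
  obtain Bp where "bounded_by p Bp" by (rule bounded_byI[OF p_continuous])
  note Bp = bounded_byD[OF this]
  obtain E where "exp_absorbs 1 c E" by (rule exp_absorbsE[OF C(2)])
  note E = exp_absorbsD[OF this]
  obtain CV where CV: "CV > 0" "\<And>F B b. B \<ge> 0 \<Longrightarrow> b > 0 \<Longrightarrow> F \<in> borel_measurable VV \<Longrightarrow>
     (\<forall>x\<in>M. \<forall>y\<in>M. \<bar>F (x, y)\<bar> \<le> B * gauss b (x - y)) \<Longrightarrow>
     \<bar>\<integral>z. F z \<partial>VV\<bar> \<le> B * (CV * b powr (- real CARD('d) / 2))"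
    using pair_V_gaussian_bound by blast
  define B where "B = C * (L\<phi> * Lf) * (Bp * Bp) * E"
  have B: "B \<ge> 0" unfolding B_def using C L\<phi>(1) Lf(1) E(1) Bp(1) by simp
  show ?thesis
  proof (intro exI[of _ "B * (CV * (c / 2) powr (- real CARD('d) / 2))"] conjI allI impI)
    show "0 \<le> B * (CV * (c / 2) powr (- real CARD('d) / 2))" using B CV(1) by simp
    fix \<epsilon> \<delta> :: real and \<rho> assume \<epsilon>: "\<epsilon> > 0" and b: "close_bandwidth \<delta> \<rho>"
    note D = close_bandwidthD[OF b]
    let ?F = "form \<alpha> \<epsilon> \<rho> \<phi> f" and ?H = "form \<alpha> \<epsilon> \<rho>\<^sub>0 \<phi> f"
    note i = form_integrable[OF b \<epsilon> Ck_manifold_continuous[OF \<phi>] Ck_manifold_continuous[OF f], of \<alpha>]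
      form_integrable[OF close_bandwidth_rho0 \<epsilon> Ck_manifold_continuous[OF \<phi>] Ck_manifold_continuous[OF f], of \<alpha>]
    have "\<bar>?F (x, y) - ?H (x, y)\<bar> \<le> (B * \<delta> * \<epsilon>) * gauss (c / 2 / \<epsilon>) (x - y)" if xy: "x \<in> M" "y \<in> M" for x y
    proof -
      let ?t = "norm (x - y)"
      let ?\<tau> = "?t\<^sup>2 / \<epsilon>"
      have \<tau>: "?\<tau> \<ge> 0" using \<epsilon> by simp
      have e: "?F (x, y) - ?H (x, y) = (kern \<alpha> ?\<tau> (\<rho> x * \<rho> y) - kern \<alpha> ?\<tau> (\<rho>\<^sub>0 x * \<rho>\<^sub>0 y)) * ((\<phi> x - \<phi> y) * (f x - f y)) * (p x * p y)"
        unfolding form_def fst_conv snd_conv left_diff_distrib[symmetric] ..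
      have "\<bar>?F (x, y) - ?H (x, y)\<bar> \<le> (C * \<delta> * exp (- c * ?\<tau>)) * ((L\<phi> * ?t) * (Lf * ?t)) * (Bp * Bp)"
        unfolding e by (intro abs_mult_le K[OF b xy \<tau>] L\<phi>(2)[OF xy] Lf(2)[OF xy] Bp(2) xy)
      also have "\<dots> = (C * (L\<phi> * Lf) * (Bp * Bp)) * \<delta> * (?t ^ (2 * 1) * exp (- c * ?\<tau>))" by (simp add: power2_eq_square mult_ac)
      also have "\<dots> \<le> (C * (L\<phi> * Lf) * (Bp * Bp)) * \<delta> * (E * \<epsilon> ^ 1 * exp (- (c / 2) * ?\<tau>))"
        using C L\<phi>(1) Lf(1) Bp(1) D(1) by (intro mult_left_mono E(2) \<epsilon>) auto
      also have "\<dots> = (B * \<delta> * \<epsilon>) * exp (- (c / 2 / \<epsilon>) * ?t\<^sup>2)" unfolding exp_mult_divide by (simp add: B_def mult_ac)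
      finally show ?thesis .
    qed
    then have "\<bar>\<integral>z. ?F z - ?H z \<partial>VV\<bar> \<le> (B * \<delta> * \<epsilon>) * (CV * (c / 2 / \<epsilon>) powr (- real CARD('d) / 2))"
      using B D(1) \<epsilon> C i by (intro CV(2)) (auto intro!: borel_measurable_diff borel_measurable_integrable)
    also have "\<dots> = B * (CV * (c / 2) powr (- real CARD('d) / 2)) * \<delta> * \<epsilon> powr (real CARD('d) / 2 + 1)"
    proof -
      have "\<epsilon> powr (real CARD('d) / 2 + 1) = \<epsilon> * \<epsilon> powr (real CARD('d) / 2)" using \<epsilon> by (simp add: powr_add)
      moreover have "(c / 2 / \<epsilon>) powr (- real CARD('d) / 2) = (c / 2) powr (- real CARD('d) / 2) * \<epsilon> powr (real CARD('d) / 2)"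
        using C \<epsilon> by (intro powr_divide_neg) auto
      ultimately show ?thesis by (simp only: mult_ac)
    qed
    finally show "\<bar>(LINT z|VV. ?F z) - (LINT z|VV. ?H z)\<bar> \<le> B * (CV * (c / 2) powr (- real CARD('d) / 2)) * \<delta> * \<epsilon> powr (real CARD('d) / 2 + 1)"
      by (simp only: Bochner_Integration.integral_diff[OF i])
  qed
qed

lemma dirichlet_bandwidth_limit:
  assumes \<phi>: "Ck_manifold 3 \<phi>" and f: "Ck_manifold 3 f"
  shows "\<exists>C\<ge>0. \<forall>\<epsilon>>0. \<forall>\<delta> \<rho>. close_bandwidth \<delta> \<rho> \<longrightarrow>
    \<bar>\<epsilon> powr (- real CARD('d) / 2 - 1) * (Form \<alpha> \<epsilon> \<rho> \<phi> f) -
      m2 * (dirichlet \<alpha> \<phi> f)\<bar> \<le> C * (\<epsilon> + \<delta>)"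
proof -
  let ?d = "real CARD('d)"
  let ?I = "m2 * (dirichlet \<alpha> \<phi> f)"
  have f1: "Ck_manifold (Suc 0) f" using f by (rule Ck_manifold_mono) simp
  have \<phi>1: "Ck_manifold (Suc 0) \<phi>" using \<phi> by (rule Ck_manifold_mono) simp
  obtain C1 where C1: "C1 \<ge> 0" "\<And>\<epsilon>. \<epsilon> > 0 \<Longrightarrow> \<bar>(Form \<alpha> \<epsilon> \<rho>\<^sub>0 \<phi> f) -
      m2 * \<epsilon> powr (?d / 2 + 1) * (dirichlet \<alpha> \<phi> f)\<bar> \<le> C1 * \<epsilon> powr (?d / 2 + 2)"
    using dirichlet_limit[OF \<phi> f, of \<alpha>] by blast
  obtain C2 where C2: "C2 \<ge> 0" "\<And>\<epsilon> \<delta> \<rho>. \<epsilon> > 0 \<Longrightarrow> close_bandwidth \<delta> \<rho> \<Longrightarrow>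
    \<bar>(Form \<alpha> \<epsilon> \<rho> \<phi> f) - (Form \<alpha> \<epsilon> \<rho>\<^sub>0 \<phi> f)\<bar> \<le> C2 * \<delta> * \<epsilon> powr (?d / 2 + 1)"
    using dirichlet_bandwidth[OF \<phi>1 f1, of \<alpha>] by blast
  show ?thesis
  proof (intro exI[of _ "C1 + C2"] conjI allI impI)
    show "0 \<le> C1 + C2" using C1 C2 by simp
    fix \<epsilon> \<delta> :: real and \<rho> assume \<epsilon>: "\<epsilon> > 0" and b: "close_bandwidth \<delta> \<rho>"
    let ?e = "\<epsilon> powr (- ?d / 2 - 1)" and ?h = "\<epsilon> powr (?d / 2 + 1)"
    let ?F = "\<integral>z. form \<alpha> \<epsilon> \<rho> \<phi> f z \<partial>VV"
    have "?e = \<epsilon> powr (- (?d / 2 + 1))" by simp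
    then have e1: "?e * ?h = 1" using \<epsilon> by (simp only: powr_minus) simp
    have h2: "\<epsilon> powr (?d / 2 + 2) = \<epsilon> * ?h" using \<epsilon> powr_add[of \<epsilon> 1 "?d / 2 + 1"] by (simp add: add.commute)
    have "\<bar>?F - ?h * ?I\<bar> \<le> C1 * (\<epsilon> * ?h) + C2 * \<delta> * ?h"
      using C1(2)[OF \<epsilon>] C2(2)[OF \<epsilon> b] unfolding h2 by (simp only: mult_ac)
    also have "\<dots> = (C1 * \<epsilon> + C2 * \<delta>) * ?h" by (simp only: ring_distribs mult_ac)
    finally have "?e * \<bar>?F - ?h * ?I\<bar> \<le> ?e * ((C1 * \<epsilon> + C2 * \<delta>) * ?h)" by (intro mult_left_mono) auto
    also have "\<dots> = (C1 * \<epsilon> + C2 * \<delta>) * (?e * ?h)" by (simp only: mult_ac)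
    also have "\<dots> \<le> (C1 + C2) * (\<epsilon> + \<delta>)" unfolding e1 using C1(1) C2(1) \<epsilon> close_bandwidthD(1)[OF b] by (simp add: algebra_simps)
    finally have "?e * \<bar>?F - ?h * ?I\<bar> \<le> (C1 + C2) * (\<epsilon> + \<delta>)" .
    moreover have "?e * \<bar>?F - ?h * ?I\<bar> = \<bar>?e * ?F - (?e * ?h) * ?I\<bar>"
      unfolding mult.assoc right_diff_distrib[symmetric] by (simp add: abs_mult)
    ultimately show "\<bar>?e * ?F - ?I\<bar> \<le> (C1 + C2) * (\<epsilon> + \<delta>)" unfolding e1 by simp
  qed
qed

end

section \<open>Sections of double integrals and a weighted Cauchy-Schwarz inequality\<close>

context manifold
begin

lemma bounded_section_integrable:
  fixes F :: "(real ^ 'D) \<times> (real ^ 'D) \<Rightarrow> real"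
  assumes m: "F \<in> borel_measurable VV" and b: "\<And>x y. x \<in> M \<Longrightarrow> y \<in> M \<Longrightarrow> \<bar>F (x, y)\<bar> \<le> B" and y: "y \<in> M"
  shows "integrable V (\<lambda>x. F (x, y))"
proof -
  interpret V: finite_measure V by (rule finite_measure_V)
  have "(\<lambda>x. (x, y)) \<in> measurable V VV" using y by (intro measurable_Pair2') (simp add: space_V)
  from measurable_compose[OF this m] have "(\<lambda>x. F (x, y)) \<in> borel_measurable V" .
  then show ?thesis by (rule V.integrable_const_bound[of _ B, rotated]) (use b y in \<open>auto simp: space_V\<close>)
qed

lemma section_integral_measurable:
  fixes F :: "(real ^ 'D) \<times> (real ^ 'D) \<Rightarrow> real"
  assumes "F \<in> borel_measurable VV"
  shows "(\<lambda>y. \<integral>x. F (x, y) \<partial>V) \<in> borel_measurable V"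
proof -
  interpret V: finite_measure V by (rule finite_measure_V)
  have "(\<lambda>(y, x). F (x, y)) \<in> borel_measurable VV" using measurable_pair_swap[OF assms] .
  then show ?thesis by (rule V.borel_measurable_lebesgue_integral)
qed

lemma gaussian_integral_le:
  fixes g :: "real ^ 'D \<Rightarrow> real"
  assumes G: "G \<ge> 0" "(\<integral>\<^sup>+x. ennreal (gauss b (x - y)) \<partial>V) \<le> ennreal (G * b powr (- real CARD('d) / 2))"
  shows "integrable V (\<lambda>x. gauss b (x - y))" "(LINT x|V. gauss b (x - y)) \<le> G * b powr (- real CARD('d) / 2)"
proof -
  show i: "integrable V (\<lambda>x. gauss b (x - y))"
    by (rule continuous_integrable_V) (intro continuous_intros)
  have "ennreal (LINT x|V. gauss b (x - y)) \<le> ennreal (G * b powr (- real CARD('d) / 2))"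
    using G(2) nn_integral_eq_integral[OF i] by simp
  then show "(LINT x|V. gauss b (x - y)) \<le> G * b powr (- real CARD('d) / 2)"
    by (rule ennreal_le_iff[THEN iffD1, rotated]) (use G(1) in simp)
qed

end

text \<open>The integral of w (s u - r v)^2 is a nonnegative quadratic form in (s, r); its value at
  s = B, r = I is B (A B - I^2).\<close>

lemma weighted_Cauchy_Schwarz:
  fixes w u v :: "'a \<Rightarrow> real"
  assumes w: "\<And>x. x \<in> space N \<Longrightarrow> w x \<ge> 0"
    and i: "integrable N (\<lambda>x. w x * (u x)\<^sup>2)" "integrable N (\<lambda>x. w x * u x * v x)" "integrable N (\<lambda>x. w x * (v x)\<^sup>2)"
  shows "(LINT x|N. w x * u x * v x)\<^sup>2 \<le> (LINT x|N. w x * (u x)\<^sup>2) * (LINT x|N. w x * (v x)\<^sup>2)"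
proof -
  let ?A = "\<integral>x. w x * (u x)\<^sup>2 \<partial>N" and ?I = "\<integral>x. w x * u x * v x \<partial>N" and ?B = "\<integral>x. w x * (v x)\<^sup>2 \<partial>N"
  have q: "0 \<le> s\<^sup>2 * ?A - 2 * s * r * ?I + r\<^sup>2 * ?B" for s r
  proof -
    have "0 \<le> (LINT x|N. w x * (s * u x - r * v x)\<^sup>2)" using w by (intro integral_nonneg_AE AE_I2) auto
    also have "\<dots> = (LINT x|N. s\<^sup>2 * (w x * (u x)\<^sup>2) - (2 * s * r) * (w x * u x * v x) + r\<^sup>2 * (w x * (v x)\<^sup>2))"
      by (intro LINT_cong) (simp add: power2_eq_square algebra_simps)
    also have "\<dots> = s\<^sup>2 * ?A - 2 * s * r * ?I + r\<^sup>2 * ?B" using i by simp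
    finally show ?thesis .
  qed
  have A: "?A \<ge> 0" "?B \<ge> 0" using w by (auto intro!: integral_nonneg_AE AE_I2)
  show ?thesis
  proof (cases "?B = 0")
    case True
    show ?thesis
    proof (cases "?I = 0")
      case False
      \<comment> \<open>If \<open>?B\<close> is 0, the form at s = 1 is affine in r, and this r
        would give it the value -1.\<close>
      from q[of 1 "(?A + 1) / (2 * ?I)"] have "0 \<le> ?A - (?A + 1)" using False unfolding True by simp
      then show ?thesis by simp
    qed (simp add: True)
  next
    case False
    from q[of ?B ?I] have "0 \<le> ?B * (?A * ?B - ?I\<^sup>2)" by (simp add: power2_eq_square algebra_simps)
    then show ?thesis using A(2) False by (simp add: zero_le_mult_iff)
  qed
qed

section \<open>The weak form as a sample average; its mean, bound and variance\<close>

context weighted_manifold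
begin

definition kern_pair where
  "kern_pair \<alpha> \<epsilon> \<rho> z = kern \<alpha> ((norm (fst z - snd z))\<^sup>2 / \<epsilon>) (\<rho> (fst z) * \<rho> (snd z))"

lemma kern_pair_measurable:
  assumes "\<rho> \<in> borel_measurable V"
  shows "kern_pair \<alpha> \<epsilon> \<rho> \<in> borel_measurable VV"
proof -
  note [measurable] = assms id_measurable_V
  show ?thesis unfolding kern_pair_def[abs_def] by (rule measurable_kern) measurable
qed

lemma kern_pair_nonneg: "kern_pair \<alpha> \<epsilon> \<rho> z \<ge> 0"
  by (simp add: kern_pair_def kern_nonneg)

lemma kern_pair_commute: "kern_pair \<alpha> \<epsilon> \<rho> (x, y) = kern_pair \<alpha> \<epsilon> \<rho> (y, x)"
  by (simp add: kern_pair_def norm_minus_commute mult.commute)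

lemma kern_pair_decay:
  assumes K: "kern_constants \<alpha> C c" and b: "close_bandwidth \<delta> \<rho>" and \<epsilon>: "\<epsilon> > 0" and xy: "x \<in> M" "y \<in> M"
  shows "\<bar>kern_pair \<alpha> \<epsilon> \<rho> (x, y)\<bar> \<le> C * exp (- c * ((norm (x - y))\<^sup>2 / \<epsilon>))" "\<bar>kern_pair \<alpha> \<epsilon> \<rho> (x, y)\<bar> \<le> C"
proof -
  note K = kern_constantsD[OF K]
  show *: "\<bar>kern_pair \<alpha> \<epsilon> \<rho> (x, y)\<bar> \<le> C * exp (- c * ((norm (x - y))\<^sup>2 / \<epsilon>))"
    unfolding kern_pair_def fst_conv snd_conv using \<epsilon> by (intro K(3)[OF b xy]) simp
  have "C * exp (- c * ((norm (x - y))\<^sup>2 / \<epsilon>)) \<le> C * 1" using K(1,2) \<epsilon> by (intro mult_left_mono) auto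
  with * show "\<bar>kern_pair \<alpha> \<epsilon> \<rho> (x, y)\<bar> \<le> C" by linarith
qed

text \<open>By Fubini, the weak form of the graph Laplacian of a sample \<open>X\<close> is the average of \<open>summand\<close>
  over the points of \<open>X\<close>.\<close>

definition pairing where
  "pairing \<alpha> \<epsilon> \<rho> \<phi> f z = p (fst z) * \<phi> (fst z) * (kern_pair \<alpha> \<epsilon> \<rho> z * (f (snd z) - f (fst z)))"

definition summand where
  "summand \<alpha> \<epsilon> \<rho> \<phi> f y = 2 * \<epsilon> powr (- real CARD('d) / 2 - 1) / m2 * (LINT x|V. pairing \<alpha> \<epsilon> \<rho> \<phi> f (x, y))"

lemma pairing_measurable:
  assumes "close_bandwidth \<delta> \<rho>" "continuous_on M \<phi>" "continuous_on M f"
  shows "pairing \<alpha> \<epsilon> \<rho> \<phi> f \<in> borel_measurable VV"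
proof -
  note [measurable] = kern_pair_measurable[OF close_bandwidthD(3)[OF assms(1)]] continuous_measurable_V[OF assms(2)]
    continuous_measurable_V[OF assms(3)] continuous_measurable_V[OF p_continuous]
  show ?thesis unfolding pairing_def[abs_def] by measurable
qed

lemma summand_measurable:
  assumes "close_bandwidth \<delta> \<rho>" "continuous_on M \<phi>" "continuous_on M f"
  shows "summand \<alpha> \<epsilon> \<rho> \<phi> f \<in> borel_measurable V"
  unfolding summand_def[abs_def]
  by (intro borel_measurable_times borel_measurable_const section_integral_measurable pairing_measurable[OF assms])

lemma pairing_bounded:
  assumes b: "close_bandwidth \<delta> \<rho>" and \<epsilon>: "\<epsilon> > 0" and \<phi>: "continuous_on M \<phi>" and f: "continuous_on M f"
  obtains B where "\<And>x y. x \<in> M \<Longrightarrow> y \<in> M \<Longrightarrow> \<bar>pairing \<alpha> \<epsilon> \<rho> \<phi> f (x, y)\<bar> \<le> B"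
proof -
  obtain C c where K: "kern_constants \<alpha> C c" by (rule kern_constants_exist)
  obtain B\<phi> where "bounded_by \<phi> B\<phi>" by (rule bounded_byI[OF \<phi>])
  note B\<phi> = bounded_byD[OF this]
  obtain Bf where "bounded_by f Bf" by (rule bounded_byI[OF f])
  note Bf = bounded_byD[OF this]
  obtain Bp where "bounded_by p Bp" by (rule bounded_byI[OF p_continuous])
  note Bp = bounded_byD[OF this]
  have "\<bar>pairing \<alpha> \<epsilon> \<rho> \<phi> f (x, y)\<bar> \<le> Bp * B\<phi> * (C * (2 * Bf))" if xy: "x \<in> M" "y \<in> M" for x y
  proof -
    have "\<bar>f y - f x\<bar> \<le> 2 * Bf" using Bf(2)[OF xy(1)] Bf(2)[OF xy(2)] by linarith
    then show ?thesis unfolding pairing_def fst_conv snd_conv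
      by (intro abs_mult_le kern_pair_decay(2)[OF K b \<epsilon> xy] Bp(2) B\<phi>(2) xy)
  qed
  then show ?thesis by (rule that)
qed

abbreviation weak_form where
  "weak_form \<alpha> \<epsilon> \<rho> \<phi> f N X \<equiv> weighted_inner V p \<phi> (graph_laplacian_un dT k0 \<alpha> \<epsilon> \<rho> N X f)"

lemma weighted_inner_graph_laplacian:
  assumes b: "close_bandwidth \<delta> \<rho>" and \<epsilon>: "\<epsilon> > 0" and \<phi>: "continuous_on M \<phi>" and f: "continuous_on M f"
    and X: "\<And>j. j < N \<Longrightarrow> X j \<in> M"
  shows "weak_form \<alpha> \<epsilon> \<rho> \<phi> f N X = 1 / real N * (\<Sum>j<N. summand \<alpha> \<epsilon> \<rho> \<phi> f (X j))"
proof -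
  let ?c = "2 * \<epsilon> powr (- real CARD('d) / 2 - 1) / m2"
  note D = close_bandwidthD[OF b]
  obtain B where B: "\<And>x y. x \<in> M \<Longrightarrow> y \<in> M \<Longrightarrow> \<bar>pairing \<alpha> \<epsilon> \<rho> \<phi> f (x, y)\<bar> \<le> B"
    using pairing_bounded[OF b \<epsilon> \<phi> f] by blast
  have i: "integrable V (\<lambda>x. pairing \<alpha> \<epsilon> \<rho> \<phi> f (x, X j))" if "j < N" for j
    using pairing_measurable[OF b \<phi> f] B X[OF that] by (rule bounded_section_integrable)
  have "weak_form \<alpha> \<epsilon> \<rho> \<phi> f N X =
    (LINT x|V. ?c * (1 / real N) * (\<Sum>j<N. pairing \<alpha> \<epsilon> \<rho> \<phi> f (x, X j)))"
    unfolding weighted_inner_def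
  proof (rule LINT_cong)
    fix x assume "x \<in> space V"
    then have x: "x \<in> M" by (simp add: space_V)
    have "1 / \<rho> x powr \<alpha> * (k0 ((norm (x - X j))\<^sup>2 / (\<epsilon> * \<rho> x * \<rho> (X j))) * ((f (X j) - f x) / \<rho> (X j) powr \<alpha>))
      = kern_pair \<alpha> \<epsilon> \<rho> (x, X j) * (f (X j) - f x)" if j: "j < N" for j
    proof -
      \<comment> \<open>Positive bandwidths make the \<open>max\<close> inside \<open>kern\<close>
        inactive and let the two powers of the bandwidth merge into one.\<close>
      have "(norm (x - X j))\<^sup>2 / (\<epsilon> * \<rho> x * \<rho> (X j)) \<ge> 0" using \<epsilon> D(7)[OF x] D(7)[OF X[OF j]] by simp
      then have m: "max 0 ((norm (x - X j))\<^sup>2 / \<epsilon> / (\<rho> x * \<rho> (X j))) = (norm (x - X j))\<^sup>2 / (\<epsilon> * \<rho> x * \<rho> (X j))"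
        by (simp add: mult.assoc)
      have "(\<rho> x * \<rho> (X j)) powr (- \<alpha>) = 1 / \<rho> x powr \<alpha> * (1 / \<rho> (X j) powr \<alpha>)"
        using D(7)[OF x] D(7)[OF X[OF j]] by (simp add: powr_minus_divide powr_mult)
      then show ?thesis unfolding kern_pair_def kern_def fst_conv snd_conv m by simp
    qed
    then have s: "1 / \<rho> x powr \<alpha> * (\<Sum>j<N. k0 ((norm (x - X j))\<^sup>2 / (\<epsilon> * \<rho> x * \<rho> (X j))) * ((f (X j) - f x) / \<rho> (X j) powr \<alpha>))
      = (\<Sum>j<N. kern_pair \<alpha> \<epsilon> \<rho> (x, X j) * (f (X j) - f x))"
      unfolding sum_distrib_left by (intro sum.cong refl) simp
    have "graph_laplacian_un dT k0 \<alpha> \<epsilon> \<rho> N X f x = ?c * (1 / real N) * (\<Sum>j<N. kern_pair \<alpha> \<epsilon> \<rho> (x, X j) * (f (X j) - f x))"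
      unfolding graph_laplacian_un_def s[symmetric] by (simp only: mult_ac)
    moreover have "(\<Sum>j<N. pairing \<alpha> \<epsilon> \<rho> \<phi> f (x, X j)) = p x * \<phi> x * (\<Sum>j<N. kern_pair \<alpha> \<epsilon> \<rho> (x, X j) * (f (X j) - f x))"
      unfolding pairing_def fst_conv snd_conv sum_distrib_left ..
    ultimately show "\<phi> x * graph_laplacian_un dT k0 \<alpha> \<epsilon> \<rho> N X f x * p x = ?c * (1 / real N) * (\<Sum>j<N. pairing \<alpha> \<epsilon> \<rho> \<phi> f (x, X j))"
      by (simp only: mult_ac)
  qed
  also have "\<dots> = ?c * (1 / real N) * (\<Sum>j<N. \<integral>x. pairing \<alpha> \<epsilon> \<rho> \<phi> f (x, X j) \<partial>V)"
    using i by simp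
  also have "\<dots> = 1 / real N * (\<Sum>j<N. summand \<alpha> \<epsilon> \<rho> \<phi> f (X j))"
    unfolding summand_def sum_distrib_left[symmetric] by (simp only: mult_ac)
  finally show ?thesis .
qed

lemma summand_expectation:
  assumes b: "close_bandwidth \<delta> \<rho>" and \<epsilon>: "\<epsilon> > 0" and \<phi>: "continuous_on M \<phi>" and f: "continuous_on M f"
  shows "(LINT y|V. p y * summand \<alpha> \<epsilon> \<rho> \<phi> f y) =
    - (\<epsilon> powr (- real CARD('d) / 2 - 1) * (Form \<alpha> \<epsilon> \<rho> \<phi> f)) / m2"
proof -
  interpret V: finite_measure V by (rule finite_measure_V)
  interpret VV: pair_sigma_finite V V by (rule pair_V)
  let ?P = "pairing \<alpha> \<epsilon> \<rho> \<phi> f"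
  let ?Q = "\<lambda>z. p (snd z) * ?P z"
  let ?c = "2 * \<epsilon> powr (- real CARD('d) / 2 - 1) / m2"
  obtain B where B: "\<And>x y. x \<in> M \<Longrightarrow> y \<in> M \<Longrightarrow> \<bar>?P (x, y)\<bar> \<le> B" using pairing_bounded[OF b \<epsilon> \<phi> f] by blast
  obtain Bp where "bounded_by p Bp" by (rule bounded_byI[OF p_continuous])
  note Bp = bounded_byD[OF this]
  have i: "integrable VV ?Q"
  proof (rule pair_V_bounded_integrable)
    note [measurable] = pairing_measurable[OF b \<phi> f] continuous_measurable_V[OF p_continuous]
    show "?Q \<in> borel_measurable VV" by measurable
    show "\<bar>?Q (x, y)\<bar> \<le> Bp * B" if "x \<in> M" "y \<in> M" for x y
      unfolding snd_conv by (intro abs_mult_le Bp(2) B that)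
  qed
  have s: "(LINT z|VV. ?Q (snd z, fst z)) = (LINT z|VV. ?Q z)"
    "integrable VV (\<lambda>z. ?Q (snd z, fst z))"
    using VV.integral_product_swap[of ?Q] VV.integrable_product_swap[OF i] i by (simp_all add: case_prod_unfold)
  have "(LINT y|V. p y * summand \<alpha> \<epsilon> \<rho> \<phi> f y) = (LINT y|V. ?c * (LINT x|V. ?Q (x, y)))"
    by (intro LINT_cong) (simp add: summand_def)
  also have "\<dots> = ?c * (LINT y|V. (LINT x|V. ?Q (x, y)))" by (rule integral_mult_right_zero)
  also have "(LINT y|V. (LINT x|V. ?Q (x, y))) = (LINT z|VV. ?Q z)"
    using VV.integral_snd[of "\<lambda>x y. ?Q (x, y)"] i by (simp add: case_prod_unfold)
  \<comment> \<open>Averaging with the swapped integrand produces the product of the two increments;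
    the 1 / 2 cancels the 2 in the normalization of the graph Laplacian.\<close>
  also have "(LINT z|VV. ?Q z) = 1 / 2 * (LINT z|VV. ?Q z + ?Q (snd z, fst z))"
    using Bochner_Integration.integral_add[OF i s(2)] s(1) by simp
  also have "(\<lambda>z. ?Q z + ?Q (snd z, fst z)) = (\<lambda>z. - form \<alpha> \<epsilon> \<rho> \<phi> f z)"
  proof
    fix z :: "(real ^ 'D) \<times> (real ^ 'D)"
    obtain x y where z: "z = (x, y)" by (cases z)
    have "?Q (x, y) + ?Q (y, x) = - (kern_pair \<alpha> \<epsilon> \<rho> (x, y) * ((\<phi> x - \<phi> y) * (f x - f y)) * (p x * p y))"
      unfolding pairing_def fst_conv snd_conv kern_pair_commute[of \<alpha> \<epsilon> \<rho> y x] by (simp add: algebra_simps)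
    then show "?Q z + ?Q (snd z, fst z) = - form \<alpha> \<epsilon> \<rho> \<phi> f z" unfolding z form_def kern_pair_def by simp
  qed
  finally show ?thesis by simp
qed

text \<open>The prefactor \<epsilon>^(-d/2 - 1) meets a Gaussian mass of order \<epsilon>^(d/2),
  which leaves B / \<epsilon>.\<close>

lemma summand_gaussian_bound:
  assumes b: "close_bandwidth \<delta> \<rho>" and \<epsilon>: "\<epsilon> > 0" and \<phi>: "continuous_on M \<phi>" and f: "continuous_on M f" and y: "y \<in> M"
    and GC: "gaussian_const G"
    and B: "B \<ge> 0" and \<beta>: "\<beta> > 0"
    and bd: "\<And>x. x \<in> M \<Longrightarrow> \<bar>pairing \<alpha> \<epsilon> \<rho> \<phi> f (x, y)\<bar> \<le> B * gauss (\<beta> / \<epsilon>) (x - y)"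
  shows "\<bar>summand \<alpha> \<epsilon> \<rho> \<phi> f y\<bar> \<le> 2 / m2 * (G * \<beta> powr (- real CARD('d) / 2)) * (B / \<epsilon>)"
proof -
  note G = gaussian_constD[OF GC]
  have m: "m2 > 0" by (rule kernel_m2_pos)
  let ?P = "\<lambda>x. pairing \<alpha> \<epsilon> \<rho> \<phi> f (x, y)"
  have c2: "\<beta> / \<epsilon> > 0" using \<beta> \<epsilon> by simp
  note g = gaussian_integral_le[OF less_imp_le[OF G(1)] G(2)[OF c2, of y]]
  obtain B' where B': "\<And>x y. x \<in> M \<Longrightarrow> y \<in> M \<Longrightarrow> \<bar>pairing \<alpha> \<epsilon> \<rho> \<phi> f (x, y)\<bar> \<le> B'"
    using pairing_bounded[OF b \<epsilon> \<phi> f] by blast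
  have i: "integrable V ?P" using pairing_measurable[OF b \<phi> f] B' y by (rule bounded_section_integrable)
  have "\<bar>\<integral>x. ?P x \<partial>V\<bar> \<le> (LINT x|V. \<bar>?P x\<bar>)" using integral_norm_bound[of V ?P] by simp
  also have "\<dots> \<le> (LINT x|V. B * gauss (\<beta> / \<epsilon>) (x - y))"
    using bd by (intro integral_mono integrable_abs i integrable_mult_right g(1)) (simp add: space_V)
  also have "\<dots> = B * (LINT x|V. gauss (\<beta> / \<epsilon>) (x - y))" by (rule integral_mult_right_zero)
  also have "\<dots> \<le> B * (G * (\<beta> / \<epsilon>) powr (- real CARD('d) / 2))" using B by (intro mult_left_mono g(2)) auto
  also have "(\<beta> / \<epsilon>) powr (- real CARD('d) / 2) = \<beta> powr (- real CARD('d) / 2) * \<epsilon> powr (real CARD('d) / 2)"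
    using \<beta> \<epsilon> by (rule powr_divide_neg)
  finally have I: "\<bar>\<integral>x. ?P x \<partial>V\<bar> \<le> B * (G * (\<beta> powr (- real CARD('d) / 2) * \<epsilon> powr (real CARD('d) / 2)))" .
  have pw: "\<epsilon> powr (- real CARD('d) / 2 - 1) * \<epsilon> powr (real CARD('d) / 2) = 1 / \<epsilon>"
    unfolding powr_add[symmetric] using \<epsilon> by (simp add: powr_minus_divide)
  have "\<bar>summand \<alpha> \<epsilon> \<rho> \<phi> f y\<bar> = 2 * \<epsilon> powr (- real CARD('d) / 2 - 1) / m2 * \<bar>\<integral>x. ?P x \<partial>V\<bar>"
    using m by (simp add: summand_def abs_mult)
  also have "\<dots> \<le> 2 * \<epsilon> powr (- real CARD('d) / 2 - 1) / m2 * (B * (G * (\<beta> powr (- real CARD('d) / 2) * \<epsilon> powr (real CARD('d) / 2))))"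
    using m by (intro mult_left_mono I) auto
  also have "\<dots> = 2 / m2 * (G * \<beta> powr (- real CARD('d) / 2)) * (B * (\<epsilon> powr (- real CARD('d) / 2 - 1) * \<epsilon> powr (real CARD('d) / 2)))"
    by (simp add: mult_ac)
  finally show ?thesis unfolding pw by simp
qed

text \<open>A crude bound whose constant may depend on \<open>p\<close>, \<open>f\<close> and
  \<phi>: it enters only the side condition of Bernstein's inequality and leaves no trace in the
  rate.\<close>

lemma summand_bound:
  assumes \<phi>: "continuous_on M \<phi>" and f: "continuous_on M f"
  shows "\<exists>L\<ge>0. \<forall>\<epsilon>>0. \<forall>\<delta> \<rho>. close_bandwidth \<delta> \<rho> \<longrightarrow> (\<forall>y\<in>M. \<bar>summand \<alpha> \<epsilon> \<rho> \<phi> f y\<bar> \<le> L / \<epsilon>)"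
proof -
  obtain C c where K: "kern_constants \<alpha> C c" by (rule kern_constants_exist)
  note C = kern_constantsD(1,2)[OF K]
  obtain B\<phi> where "bounded_by \<phi> B\<phi>" by (rule bounded_byI[OF \<phi>])
  note B\<phi> = bounded_byD[OF this]
  obtain Bf where "bounded_by f Bf" by (rule bounded_byI[OF f])
  note Bf = bounded_byD[OF this]
  obtain Bp where "bounded_by p Bp" by (rule bounded_byI[OF p_continuous])
  note Bp = bounded_byD[OF this]
  obtain G where GC: "gaussian_const G" by (rule gaussian_constE)
  note G = gaussian_constD[OF GC]
  let ?B = "Bp * B\<phi> * (C * (2 * Bf))" and ?K = "2 / m2 * (G * c powr (- real CARD('d) / 2))"
  have B: "?B \<ge> 0" using Bp(1) B\<phi>(1) C Bf(1) by simp
  show ?thesis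
  proof (intro exI[of _ "?K * ?B"] conjI allI impI ballI)
    show "0 \<le> ?K * ?B" by (rule mult_nonneg_nonneg[OF _ B]) (use kernel_m2_pos[of dT] G(1) in auto)
    fix \<epsilon> \<delta> :: real and \<rho> y assume \<epsilon>: "\<epsilon> > 0" and b: "close_bandwidth \<delta> \<rho>" and y: "y \<in> M"
    have bd: "\<bar>pairing \<alpha> \<epsilon> \<rho> \<phi> f (x, y)\<bar> \<le> ?B * gauss (c / \<epsilon>) (x - y)" if x: "x \<in> M" for x
    proof -
      have "\<bar>f y - f x\<bar> \<le> 2 * Bf" using Bf(2)[OF x] Bf(2)[OF y] by linarith
      then have "\<bar>pairing \<alpha> \<epsilon> \<rho> \<phi> f (x, y)\<bar> \<le> Bp * B\<phi> * ((C * exp (- c * ((norm (x - y))\<^sup>2 / \<epsilon>))) * (2 * Bf))"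
        unfolding pairing_def fst_conv snd_conv by (intro abs_mult_le kern_pair_decay(1)[OF K b \<epsilon> x y] Bp(2) B\<phi>(2) x)
      then show ?thesis unfolding exp_mult_divide by (simp only: mult_ac)
    qed
    show "\<bar>summand \<alpha> \<epsilon> \<rho> \<phi> f y\<bar> \<le> ?K * ?B / \<epsilon>"
      using summand_gaussian_bound[OF b \<epsilon> \<phi> f y GC B C(2) bd] by simp
  qed
qed

text \<open>Only pairs at distance at least \<eta> contribute. There the factor |x - y|^4 / \<eta>^4
  can be inserted; it is worth \<epsilon>^2, of which one power is spent on the 1 / \<epsilon> of
  the normalization.\<close>

lemma summand_locally_constant:
  assumes \<phi>: "continuous_on M \<phi>" and f: "continuous_on M f" and \<eta>: "\<eta> > 0"
    and fc: "\<And>x y. x \<in> M \<Longrightarrow> y \<in> M \<Longrightarrow> dist x y < \<eta> \<Longrightarrow> f x = f y"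
  shows "\<exists>L\<ge>0. \<forall>\<epsilon>>0. \<forall>\<delta> \<rho>. close_bandwidth \<delta> \<rho> \<longrightarrow> (\<forall>y\<in>M. \<bar>summand \<alpha> \<epsilon> \<rho> \<phi> f y\<bar> \<le> L * \<epsilon>)"
proof -
  obtain C c where K: "kern_constants \<alpha> C c" by (rule kern_constants_exist)
  note C = kern_constantsD(1,2)[OF K]
  obtain B\<phi> where "bounded_by \<phi> B\<phi>" by (rule bounded_byI[OF \<phi>])
  note B\<phi> = bounded_byD[OF this]
  obtain Bf where "bounded_by f Bf" by (rule bounded_byI[OF f])
  note Bf = bounded_byD[OF this]
  obtain Bp where "bounded_by p Bp" by (rule bounded_byI[OF p_continuous])
  note Bp = bounded_byD[OF this]
  obtain E where "exp_absorbs 2 c E" by (rule exp_absorbsE[OF C(2)])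
  note E = exp_absorbsD[OF this]
  obtain G where GC: "gaussian_const G" by (rule gaussian_constE)
  note G = gaussian_constD[OF GC]
  define B where "B = Bp * B\<phi> * (C * (2 * Bf / \<eta> ^ 4)) * E"
  have B: "B \<ge> 0" unfolding B_def using Bp(1) B\<phi>(1) C Bf(1) E(1) by simp
  show ?thesis
  proof (intro exI[of _ "2 / m2 * (G * (c / 2) powr (- real CARD('d) / 2)) * B"] conjI allI impI ballI)
    show "0 \<le> 2 / m2 * (G * (c / 2) powr (- real CARD('d) / 2)) * B" using kernel_m2_pos[of dT] B G(1) by simp
    fix \<epsilon> \<delta> :: real and \<rho> y assume \<epsilon>: "\<epsilon> > 0" and b: "close_bandwidth \<delta> \<rho>" and y: "y \<in> M"
    have bd: "\<bar>pairing \<alpha> \<epsilon> \<rho> \<phi> f (x, y)\<bar> \<le> (B * \<epsilon>\<^sup>2) * gauss (c / 2 / \<epsilon>) (x - y)" if x: "x \<in> M" for x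
    proof -
      let ?t = "norm (x - y)"
      let ?e = "exp (- c * (?t\<^sup>2 / \<epsilon>))" and ?e' = "exp (- (c / 2) * (?t\<^sup>2 / \<epsilon>))"
      have fb: "\<bar>f y - f x\<bar> \<le> 2 * Bf / \<eta> ^ 4 * ?t ^ (2 * 2)"
      proof (cases "?t < \<eta>")
        case True
        then have "f x = f y" using x y by (intro fc) (simp_all add: dist_norm)
        then show ?thesis using Bf(1) \<eta> by simp
      next
        case False
        then have "\<eta> ^ 4 \<le> ?t ^ 4" using \<eta> by (intro power_mono) auto
        then have "2 * Bf * 1 \<le> 2 * Bf * (?t ^ 4 / \<eta> ^ 4)" using Bf(1) \<eta> by (intro mult_left_mono) auto
        moreover have "\<bar>f y - f x\<bar> \<le> 2 * Bf" using Bf(2)[OF x] Bf(2)[OF y] by linarith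
        ultimately show ?thesis by simp
      qed
      have "\<bar>pairing \<alpha> \<epsilon> \<rho> \<phi> f (x, y)\<bar> \<le> Bp * B\<phi> * ((C * ?e) * (2 * Bf / \<eta> ^ 4 * ?t ^ (2 * 2)))"
        unfolding pairing_def fst_conv snd_conv by (intro abs_mult_le kern_pair_decay(1)[OF K b \<epsilon> x y] Bp(2) B\<phi>(2) x fb)
      also have "\<dots> = Bp * B\<phi> * (C * (2 * Bf / \<eta> ^ 4)) * (?t ^ (2 * 2) * ?e)" by (simp only: mult_ac)
      also have "\<dots> \<le> Bp * B\<phi> * (C * (2 * Bf / \<eta> ^ 4)) * (E * \<epsilon> ^ 2 * ?e')"
        using Bp(1) B\<phi>(1) C Bf(1) \<eta> by (intro mult_left_mono E(2) \<epsilon>) simp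
      also have "\<dots> = (B * \<epsilon>\<^sup>2) * exp (- (c / 2 / \<epsilon>) * ?t\<^sup>2)" unfolding exp_mult_divide B_def by (simp only: mult_ac)
      finally show ?thesis .
    qed
    have "B * \<epsilon>\<^sup>2 / \<epsilon> = B * \<epsilon>" using \<epsilon> by (simp add: power2_eq_square)
    then show "\<bar>summand \<alpha> \<epsilon> \<rho> \<phi> f y\<bar> \<le> 2 / m2 * (G * (c / 2) powr (- real CARD('d) / 2)) * B * \<epsilon>"
      using summand_gaussian_bound[OF b \<epsilon> \<phi> f y GC, of "B * \<epsilon>\<^sup>2" "c / 2", OF _ _ bd] B C(2) \<epsilon>
      by (simp add: mult.assoc)
  qed
qed

text \<open>The bound on the mass of the kernel is uniform in \<open>p\<close>: the bandwidth \<open>p powr (- 1 / d)\<close>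
  compensates the density.\<close>

lemma kernel_mass:
  assumes GC: "gaussian_const G"
  shows "\<exists>\<epsilon>0>0. \<forall>\<epsilon>. 0 < \<epsilon> \<and> \<epsilon> < \<epsilon>0 \<longrightarrow> (\<forall>\<delta> \<rho>. close_bandwidth \<delta> \<rho> \<longrightarrow> (\<forall>y\<in>M.
    (LINT x|V. p x * kern_pair 0 \<epsilon> \<rho> (x, y)) \<le> (2 * A * G * (a / 3) powr (- real CARD('d) / 2) + 1) * \<epsilon> powr (real CARD('d) / 2)))"
proof -
  note G = gaussian_constD[OF GC]
  let ?d = "real CARD('d)"
  obtain C c where K: "kern_constants 0 C c" by (rule kern_constants_exist)
  note C = kern_constantsD(1,2)[OF K]
  obtain Bp where "bounded_by p Bp" by (rule bounded_byI[OF p_continuous])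
  note Bp = bounded_byD[OF this]
  obtain E where "exp_absorbs 1 c E" by (rule exp_absorbsE[OF C(2)])
  note E = exp_absorbsD[OF this]
  obtain Lp where Lp: "Lp \<ge> 0" "\<And>x y. x \<in> M \<Longrightarrow> y \<in> M \<Longrightarrow> \<bar>p x - p y\<bar> \<le> Lp * norm (x - y)" using Ck_manifold_lipschitz[OF p_Ck] by blast
  obtain l u where l: "0 < l" "0 < u" "\<And>x. x \<in> M \<Longrightarrow> l \<le> p x" "\<And>x. x \<in> M \<Longrightarrow> p x \<le> u"
    using continuous_bounds_M[OF p_continuous p_pos] by blast
  \<comment> \<open>Within this distance \<open>p\<close> changes by at most l / 2, half of its
    lower bound, and hence by a factor of at most 2 in either direction.\<close>
  define \<eta> where "\<eta> = l / (2 * (Lp + 1))"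
  have \<eta>: "\<eta> > 0" using l Lp(1) by (simp add: \<eta>_def)
  have near: "p x \<le> 2 * p y" "p y / 2 \<le> p x" if "x \<in> M" "y \<in> M" "norm (x - y) < \<eta>" for x y
  proof -
    have "Lp * norm (x - y) \<le> (Lp + 1) * \<eta>" using Lp(1) that(3) by (intro mult_mono) auto
    also have "\<dots> = l / 2" using Lp(1) by (simp add: \<eta>_def field_simps)
    finally have "\<bar>p x - p y\<bar> \<le> l / 2" using Lp(2)[OF that(1,2)] by linarith
    then show "p x \<le> 2 * p y" "p y / 2 \<le> p x" using l(3)[OF that(2)] by linarith+
  qed
  define H where "H = Bp * (C / \<eta>\<^sup>2) * E"
  have H: "H \<ge> 0" unfolding H_def using Bp(1) C E(1) by simp
  define Q where "Q = H * (G * (c / 2) powr (- ?d / 2))"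
  have Q: "Q \<ge> 0" unfolding Q_def using H G(1) by simp
  have bd: "p x * kern_pair 0 \<epsilon> \<rho> (x, y) \<le> 2 * p y * A * gauss (a / (3 * (\<rho>\<^sub>0 y)\<^sup>2) / \<epsilon>) (x - y) + H * \<epsilon> * gauss (c / 2 / \<epsilon>) (x - y)"
    if \<epsilon>: "\<epsilon> > 0" and b: "close_bandwidth \<delta> \<rho>" and x: "x \<in> M" and y: "y \<in> M" for \<epsilon> \<delta> \<rho> x y
  proof (cases "norm (x - y) < \<eta>")
    case True
    note D = close_bandwidthD[OF b]
    let ?\<tau> = "(norm (x - y))\<^sup>2 / \<epsilon>"
    have "\<rho>\<^sub>0 x \<le> (p y / 2) powr (- 1 / ?d)"
      unfolding rho_bar_def using near(2)[OF x y True] p_pos[OF y] by (intro powr_mono2') auto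
    also have "\<dots> = 2 powr (1 / ?d) * \<rho>\<^sub>0 y"
      using p_pos[OF y] by (simp add: rho_bar_def powr_divide powr_minus_divide)
    also have "\<dots> \<le> 2 powr 1 * \<rho>\<^sub>0 y" using rho0_pos[OF y] by (intro mult_right_mono powr_mono) auto
    finally have r: "\<rho>\<^sub>0 x \<le> 2 * \<rho>\<^sub>0 y" by simp
    have pos: "\<rho> x * \<rho> y > 0" using D(7)[OF x] D(7)[OF y] by simp
    \<comment> \<open>The product 2 * 11/10 * 11/10 = 2.42 is rounded up to 3; this is the origin of
      a / 3.\<close>
    have "\<rho> x * \<rho> y \<le> (11 / 10 * (2 * \<rho>\<^sub>0 y)) * (11 / 10 * \<rho>\<^sub>0 y)"
      using D(6)[OF x] D(6)[OF y] D(7)[OF x] D(7)[OF y] r rho0_pos[OF y] by (intro mult_mono) auto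
    also have "\<dots> \<le> 3 * (\<rho>\<^sub>0 y)\<^sup>2" by (simp add: power2_eq_square)
    finally have le: "\<rho> x * \<rho> y \<le> 3 * (\<rho>\<^sub>0 y)\<^sup>2" .
    have \<tau>: "?\<tau> / (\<rho> x * \<rho> y) \<ge> 0" using pos \<epsilon> by simp
    have "kern_pair 0 \<epsilon> \<rho> (x, y) = k0 (?\<tau> / (\<rho> x * \<rho> y))"
      unfolding kern_pair_def kern_def fst_conv snd_conv using \<tau> D(7)[OF x] D(7)[OF y] by (simp add: max_absorb2)
    also have "\<dots> \<le> A * exp (- a * (?\<tau> / (\<rho> x * \<rho> y)))" using \<tau> by (rule kernel_decay)
    also have "\<dots> \<le> A * exp (- a * (?\<tau> / (3 * (\<rho>\<^sub>0 y)\<^sup>2)))"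
    proof -
      have "?\<tau> / (3 * (\<rho>\<^sub>0 y)\<^sup>2) \<le> ?\<tau> / (\<rho> x * \<rho> y)"
        using le pos rho0_pos[OF y] \<epsilon> by (intro divide_left_mono) auto
      then have "- a * (?\<tau> / (\<rho> x * \<rho> y)) \<le> - a * (?\<tau> / (3 * (\<rho>\<^sub>0 y)\<^sup>2))" using a_pos by (intro mult_left_mono_neg) auto
      then show ?thesis using A_pos by (intro mult_left_mono) auto
    qed
    also have "- a * (?\<tau> / (3 * (\<rho>\<^sub>0 y)\<^sup>2)) = - (a / (3 * (\<rho>\<^sub>0 y)\<^sup>2) / \<epsilon>) * (norm (x - y))\<^sup>2" by simp
    finally have k: "kern_pair 0 \<epsilon> \<rho> (x, y) \<le> A * gauss (a / (3 * (\<rho>\<^sub>0 y)\<^sup>2) / \<epsilon>) (x - y)" .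
    have "p x * kern_pair 0 \<epsilon> \<rho> (x, y) \<le> 2 * p y * (A * gauss (a / (3 * (\<rho>\<^sub>0 y)\<^sup>2) / \<epsilon>) (x - y))"
      using near(1)[OF x y True] k p_pos[OF x] p_pos[OF y] kern_pair_nonneg by (intro mult_mono) auto
    moreover have "0 \<le> H * \<epsilon> * gauss (c / 2 / \<epsilon>) (x - y)" using H \<epsilon> by simp
    ultimately show ?thesis unfolding mult.assoc by linarith
  next
    case False
    let ?t = "norm (x - y)"
    have "\<eta>\<^sup>2 \<le> ?t\<^sup>2" using False \<eta> by (intro power_mono) auto
    then have "1 \<le> ?t\<^sup>2 / \<eta>\<^sup>2" using \<eta> by simp
    then have g: "1 * (C * exp (- c * (?t\<^sup>2 / \<epsilon>))) \<le> ?t\<^sup>2 / \<eta>\<^sup>2 * (C * exp (- c * (?t\<^sup>2 / \<epsilon>)))" using C by (intro mult_right_mono) auto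
    have "kern_pair 0 \<epsilon> \<rho> (x, y) \<le> C * exp (- c * (?t\<^sup>2 / \<epsilon>))" using kern_pair_decay(1)[OF K b \<epsilon> x y] by linarith
    also have "\<dots> \<le> C / \<eta>\<^sup>2 * (?t ^ (2 * 1) * exp (- c * (?t\<^sup>2 / \<epsilon>)))" using g by (simp add: mult_ac)
    also have "\<dots> \<le> C / \<eta>\<^sup>2 * (E * \<epsilon> ^ 1 * exp (- (c / 2) * (?t\<^sup>2 / \<epsilon>)))" using C by (intro mult_left_mono E(2) \<epsilon>) simp
    finally have k: "kern_pair 0 \<epsilon> \<rho> (x, y) \<le> C / \<eta>\<^sup>2 * (E * \<epsilon> ^ 1 * exp (- (c / 2) * (?t\<^sup>2 / \<epsilon>)))" .
    have "p x * kern_pair 0 \<epsilon> \<rho> (x, y) \<le> Bp * (C / \<eta>\<^sup>2 * (E * \<epsilon> ^ 1 * exp (- (c / 2) * (?t\<^sup>2 / \<epsilon>))))"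
      using Bp(1) Bp(2)[OF x] k kern_pair_nonneg by (intro mult_mono) auto
    also have "\<dots> = H * \<epsilon> * exp (- (c / 2 / \<epsilon>) * ?t\<^sup>2)" unfolding exp_mult_divide H_def by (simp add: mult_ac)
    finally show ?thesis using p_pos[OF y] A_pos by (simp add: add_increasing)
  qed
  show ?thesis
  \<comment> \<open>The part away from \<open>y\<close> contributes Q \<epsilon>, at most 1 for
    these \<epsilon>. Thus what still depends on \<open>p\<close> is moved into the range of
    \<epsilon>.\<close>
  proof (intro exI[of _ "1 / (Q + 1)"] conjI allI impI ballI)
    show "0 < 1 / (Q + 1)" using Q by simp
    fix \<epsilon> \<delta> :: real and \<rho> y assume e: "0 < \<epsilon> \<and> \<epsilon> < 1 / (Q + 1)" and b: "close_bandwidth \<delta> \<rho>" and y: "y \<in> M"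
    then have \<epsilon>: "\<epsilon> > 0" and "\<epsilon> * (Q + 1) < 1" using Q by (auto simp: pos_less_divide_eq)
    then have Qe: "Q * \<epsilon> \<le> 1" by (simp add: algebra_simps)
    let ?b1 = "a / (3 * (\<rho>\<^sub>0 y)\<^sup>2)" and ?b2 = "c / 2"
    have b1: "?b1 > 0" using a_pos rho0_pos[OF y] by simp
    have b2: "?b2 > 0" using C by simp
    let ?g = "\<lambda>b x. gauss (b / \<epsilon>) (x - y)"
    have g: "integrable V (?g b)" "(LINT x|V. ?g b x) \<le> G * (b powr (- ?d / 2) * \<epsilon> powr (?d / 2))" if "b > 0" for b
    proof -
      have "b / \<epsilon> > 0" using that \<epsilon> by simp
      from gaussian_integral_le[OF less_imp_le[OF G(1)] G(2)[OF this, of y]]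
      show "integrable V (?g b)" "(LINT x|V. ?g b x) \<le> G * (b powr (- ?d / 2) * \<epsilon> powr (?d / 2))"
        unfolding powr_divide_neg[OF that \<epsilon>] .
    qed
    have iK: "integrable V (\<lambda>x. p x * kern_pair 0 \<epsilon> \<rho> (x, y))"
    proof -
      note [measurable] = kern_pair_measurable[OF close_bandwidthD(3)[OF b]] continuous_measurable_V[OF p_continuous]
      have "(\<lambda>z. p (fst z) * kern_pair 0 \<epsilon> \<rho> z) \<in> borel_measurable VV" by measurable
      moreover have "\<bar>p (fst (x, y)) * kern_pair 0 \<epsilon> \<rho> (x, y)\<bar> \<le> Bp * C" if "x \<in> M" "y \<in> M" for x y
        unfolding fst_conv by (intro abs_mult_le Bp(2) kern_pair_decay(2)[OF K b \<epsilon>] that)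
      ultimately show ?thesis using bounded_section_integrable[of "\<lambda>z. p (fst z) * kern_pair 0 \<epsilon> \<rho> z" "Bp * C" y] y by simp
    qed
    have "(LINT x|V. p x * kern_pair 0 \<epsilon> \<rho> (x, y)) \<le> (LINT x|V. 2 * p y * A * ?g ?b1 x + H * \<epsilon> * ?g ?b2 x)"
      using bd[OF \<epsilon> b _ y] b1 b2
      by (intro integral_mono iK Bochner_Integration.integrable_add integrable_mult_right g) (simp_all add: space_V)
    also have "\<dots> = 2 * p y * A * (LINT x|V. ?g ?b1 x) + H * \<epsilon> * (LINT x|V. ?g ?b2 x)"
      using g(1)[OF b1] g(1)[OF b2] by simp
    also have "\<dots> \<le> 2 * p y * A * (G * (?b1 powr (- ?d / 2) * \<epsilon> powr (?d / 2))) + H * \<epsilon> * (G * (?b2 powr (- ?d / 2) * \<epsilon> powr (?d / 2)))"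
      using p_pos[OF y] A_pos H \<epsilon> by (intro add_mono mult_left_mono g(2) b1 b2) auto
    \<comment> \<open>The width of the Gaussian at \<open>y\<close> contributes the d-th power of
      \<open>\<rho>\<^sub>0 y\<close>, which is 1 / p y and cancels the factor p y in front.\<close>
    also have "?b1 powr (- ?d / 2) = (a / 3) powr (- ?d / 2) * (1 / p y)"
    proof -
      have "?b1 powr (- ?d / 2) = (a / 3 / (\<rho>\<^sub>0 y)\<^sup>2) powr (- ?d / 2)" by simp
      also have "\<dots> = (a / 3) powr (- ?d / 2) * ((\<rho>\<^sub>0 y)\<^sup>2) powr (?d / 2)"
        using a_pos rho0_pos[OF y] by (intro powr_divide_neg) auto
      also have "((\<rho>\<^sub>0 y)\<^sup>2) powr (?d / 2) = 1 / p y"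
      proof -
        have "(\<rho>\<^sub>0 y)\<^sup>2 = p y powr (- 2 / ?d)" by (simp add: rho_bar_def power2_eq_square powr_add[symmetric])
        then have "((\<rho>\<^sub>0 y)\<^sup>2) powr (?d / 2) = p y powr (- 1)" by (simp only: powr_powr) simp
        then show ?thesis using p_pos[OF y] by (simp add: powr_minus_divide)
      qed
      finally show ?thesis .
    qed
    also have "2 * p y * A * (G * ((a / 3) powr (- ?d / 2) * (1 / p y) * \<epsilon> powr (?d / 2))) + H * \<epsilon> * (G * (?b2 powr (- ?d / 2) * \<epsilon> powr (?d / 2)))
      = (2 * A * G * (a / 3) powr (- ?d / 2) + Q * \<epsilon>) * \<epsilon> powr (?d / 2)"
      using p_pos[OF y] by (simp add: Q_def algebra_simps)
    also have "\<dots> \<le> (2 * A * G * (a / 3) powr (- ?d / 2) + 1) * \<epsilon> powr (?d / 2)" using Qe by (intro mult_right_mono add_left_mono) auto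
    finally show "(LINT x|V. p x * kern_pair 0 \<epsilon> \<rho> (x, y)) \<le> (2 * A * G * (a / 3) powr (- ?d / 2) + 1) * \<epsilon> powr (?d / 2)" .
  qed
qed

text \<open>The factor (\<rho> x \<rho> y)^-\<alpha> is grouped with the increment of
  \<open>f\<close>. The weight is then the kernel with exponent 0, the one whose mass is bounded
  uniformly in \<open>p\<close>, and squaring the increment turns the exponent into 2
  \<alpha>.\<close>

lemma summand_second_moment:
  assumes b: "close_bandwidth \<delta> \<rho>" and \<epsilon>: "\<epsilon> > 0" and \<phi>: "continuous_on M \<phi>" and f: "continuous_on M f"
    and D: "D \<ge> 0" "\<And>y. y \<in> M \<Longrightarrow> (LINT x|V. p x * kern_pair 0 \<epsilon> \<rho> (x, y)) \<le> D * \<epsilon> powr (real CARD('d) / 2)"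
    and \<Phi>: "\<And>x. x \<in> M \<Longrightarrow> \<bar>\<phi> x\<bar> \<le> \<Phi>"
  shows "(LINT y|V. p y * (summand \<alpha> \<epsilon> \<rho> \<phi> f y)\<^sup>2) \<le>
    4 * D / (m2)\<^sup>2 * \<Phi>\<^sup>2 / \<epsilon> * (\<epsilon> powr (- real CARD('d) / 2 - 1) * (Form (2 * \<alpha>) \<epsilon> \<rho> f f))"
proof -
  let ?d = "real CARD('d)"
  let ?Z = "\<Phi>\<^sup>2 * (D * \<epsilon> powr (?d / 2))"
  interpret V: finite_measure V by (rule finite_measure_V)
  interpret VV: pair_sigma_finite V V by (rule pair_V)
  obtain C0 c0 where K0: "kern_constants 0 C0 c0" by (rule kern_constants_exist)
  obtain C2 c2 where K2: "kern_constants (2 * \<alpha>) C2 c2" by (rule kern_constants_exist)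
  obtain Bf where "bounded_by f Bf" by (rule bounded_byI[OF f])
  note Bf = bounded_byD[OF this]
  obtain Bp where "bounded_by p Bp" by (rule bounded_byI[OF p_continuous])
  note Bp = bounded_byD[OF this]
  obtain BP where BP: "\<And>x y. x \<in> M \<Longrightarrow> y \<in> M \<Longrightarrow> \<bar>pairing \<alpha> \<epsilon> \<rho> \<phi> f (x, y)\<bar> \<le> BP" using pairing_bounded[OF b \<epsilon> \<phi> f] by blast
  note [measurable] = kern_pair_measurable[OF close_bandwidthD(3)[OF b]] continuous_measurable_V[OF p_continuous]
    continuous_measurable_V[OF f] continuous_measurable_V[OF \<phi>]
  let ?W = "\<lambda>z. p (fst z) * kern_pair 0 \<epsilon> \<rho> z"
  let ?U = "\<lambda>z. p (fst z) * kern_pair 0 \<epsilon> \<rho> z * (\<phi> (fst z))\<^sup>2"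
  let ?R = "\<lambda>z. p (fst z) * kern_pair (2 * \<alpha>) \<epsilon> \<rho> z * (f (snd z) - f (fst z))\<^sup>2"
  have fb: "\<bar>(f y - f x)\<^sup>2\<bar> \<le> (2 * Bf) * (2 * Bf)" if "x \<in> M" "y \<in> M" for x y
  proof -
    have "\<bar>f y - f x\<bar> \<le> 2 * Bf" using Bf(2)[OF that(1)] Bf(2)[OF that(2)] by linarith
    then show ?thesis unfolding power2_eq_square by (intro abs_mult_le)
  qed
  have m: "?W \<in> borel_measurable VV" "?U \<in> borel_measurable VV" "?R \<in> borel_measurable VV" by measurable
  have Wb: "\<bar>?W (x, y)\<bar> \<le> Bp * C0" if "x \<in> M" "y \<in> M" for x y
    unfolding fst_conv by (intro abs_mult_le Bp(2) kern_pair_decay(2)[OF K0 b \<epsilon>] that)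
  have Ub: "\<bar>?U (x, y)\<bar> \<le> Bp * C0 * (\<Phi> * \<Phi>)" if "x \<in> M" "y \<in> M" for x y
    unfolding fst_conv power2_eq_square by (intro abs_mult_le Bp(2) \<Phi> kern_pair_decay(2)[OF K0 b \<epsilon>] that)
  have Rb: "\<bar>?R (x, y)\<bar> \<le> Bp * C2 * ((2 * Bf) * (2 * Bf))" if "x \<in> M" "y \<in> M" for x y
    unfolding fst_conv snd_conv by (intro abs_mult_le Bp(2) fb kern_pair_decay(2)[OF K2 b \<epsilon>] that)
  let ?r = "\<lambda>y. \<integral>x. ?R (x, y) \<partial>V"
  have sq: "(LINT x|V. pairing \<alpha> \<epsilon> \<rho> \<phi> f (x, y))\<^sup>2 \<le> ?Z * ?r y" if y: "y \<in> M" for y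
  proof -
    let ?w = "\<lambda>x. ?W (x, y)"
    let ?v = "\<lambda>x. (\<rho> x * \<rho> y) powr (- \<alpha>) * (f y - f x)"
    note iU = bounded_section_integrable[OF m(2) Ub y] and iR = bounded_section_integrable[OF m(3) Rb y]
      and iP = bounded_section_integrable[OF pairing_measurable[OF b \<phi> f] BP y] and iW = bounded_section_integrable[OF m(1) Wb y]
    have eP: "pairing \<alpha> \<epsilon> \<rho> \<phi> f (x, y) = ?w x * \<phi> x * ?v x" for x
      by (simp add: pairing_def kern_pair_def kern_def)
    have eU: "?U (x, y) = ?w x * (\<phi> x)\<^sup>2" for x by simp
    have eR: "?R (x, y) = ?w x * (?v x)\<^sup>2" for x
    proof -
      have "(\<rho> x * \<rho> y) powr (- (2 * \<alpha>)) = ((\<rho> x * \<rho> y) powr (- \<alpha>))\<^sup>2"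
        by (simp add: power2_eq_square powr_add[symmetric])
      then show ?thesis by (simp add: kern_pair_def kern_def power_mult_distrib)
    qed
    have w0: "?w x \<ge> 0" if "x \<in> space V" for x
      unfolding fst_conv using p_pos[of x] that kern_pair_nonneg by (intro mult_nonneg_nonneg) (auto simp: space_V less_imp_le)
    have "(LINT x|V. ?w x * \<phi> x * ?v x)\<^sup>2 \<le> (LINT x|V. ?w x * (\<phi> x)\<^sup>2) * (LINT x|V. ?w x * (?v x)\<^sup>2)"
      by (rule weighted_Cauchy_Schwarz[OF w0]) (use iU iP iR in \<open>simp_all only: eU eP eR\<close>)
    also have "\<dots> \<le> ?Z * (LINT x|V. ?w x * (?v x)\<^sup>2)"
    proof (rule mult_right_mono)
      have "(LINT x|V. ?w x * (\<phi> x)\<^sup>2) \<le> (LINT x|V. \<Phi>\<^sup>2 * ?w x)"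
      proof (intro integral_mono)
        show "integrable V (\<lambda>x. ?w x * (\<phi> x)\<^sup>2)" using iU unfolding eU .
        show "integrable V (\<lambda>x. \<Phi>\<^sup>2 * ?w x)" using iW by (rule integrable_mult_right)
        fix x assume x: "x \<in> space V"
        then have "(\<phi> x)\<^sup>2 \<le> \<Phi>\<^sup>2" using \<Phi>[of x] by (simp add: space_V abs_le_square_iff[symmetric])
        then show "?w x * (\<phi> x)\<^sup>2 \<le> \<Phi>\<^sup>2 * ?w x" using w0[OF x] by (subst mult.commute) (rule mult_right_mono)
      qed
      also have "\<dots> = \<Phi>\<^sup>2 * (LINT x|V. ?w x)" by (rule integral_mult_right_zero)
      also have "\<dots> \<le> \<Phi>\<^sup>2 * (D * \<epsilon> powr (?d / 2))" using D(2)[OF y] by (intro mult_left_mono) auto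
      finally show "(LINT x|V. ?w x * (\<phi> x)\<^sup>2) \<le> \<Phi>\<^sup>2 * (D * \<epsilon> powr (?d / 2))" .
      show "0 \<le> (LINT x|V. ?w x * (?v x)\<^sup>2)" using w0 by (intro integral_nonneg_AE AE_I2) simp
    qed
    finally show ?thesis unfolding eP eR .
  qed
  let ?c = "2 * \<epsilon> powr (- ?d / 2 - 1) / m2"
  have iPR: "integrable VV (\<lambda>z. p (snd z) * ?R z)"
  proof (rule pair_V_bounded_integrable)
    show "(\<lambda>z. p (snd z) * ?R z) \<in> borel_measurable VV" using m(3) by measurable
    show "\<bar>p (snd (x, y)) * ?R (x, y)\<bar> \<le> Bp * (Bp * C2 * ((2 * Bf) * (2 * Bf)))" if "x \<in> M" "y \<in> M" for x y
      using abs_mult_le[OF Bp(2)[OF that(2)] Rb[OF that]] by simp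
  qed
  have eI: "(LINT y|V. p y * ?r y) = (Form (2 * \<alpha>) \<epsilon> \<rho> f f)"
  proof -
    have "(LINT y|V. p y * ?r y) = (LINT y|V. (LINT x|V. p (snd (x, y)) * ?R (x, y)))" by simp
    also have "\<dots> = (LINT z|VV. p (snd z) * ?R z)"
      using VV.integral_snd[of "\<lambda>x y. p (snd (x, y)) * ?R (x, y)"] iPR by (simp add: case_prod_unfold)
    also have "(\<lambda>z. p (snd z) * ?R z) = form (2 * \<alpha>) \<epsilon> \<rho> f f"
    proof
      fix z
      have "(f (snd z) - f (fst z))\<^sup>2 = (f (fst z) - f (snd z)) * (f (fst z) - f (snd z))" by (simp add: power2_eq_square algebra_simps)
      then show "p (snd z) * ?R z = form (2 * \<alpha>) \<epsilon> \<rho> f f z" unfolding form_def kern_pair_def by (simp only: mult_ac)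
    qed
    finally show ?thesis .
  qed
  have r0: "?r y \<ge> 0" if "y \<in> M" for y
    unfolding fst_conv snd_conv using p_pos kern_pair_nonneg
    by (intro integral_nonneg_AE AE_I2 mult_nonneg_nonneg) (auto simp: space_V less_imp_le)
  have irp: "integrable V (\<lambda>y. p y * ?r y)"
  proof -
    have "integrable V (\<lambda>y. \<integral>x. p (snd (x, y)) * ?R (x, y) \<partial>V)"
      using VV.integrable_snd[of "\<lambda>x y. p (snd (x, y)) * ?R (x, y)"] iPR by (simp add: case_prod_unfold)
    then show ?thesis by simp
  qed
  have le: "p y * (summand \<alpha> \<epsilon> \<rho> \<phi> f y)\<^sup>2 \<le> ?c\<^sup>2 * ?Z * (p y * ?r y)" if y: "y \<in> M" for y
  proof -
    have "(summand \<alpha> \<epsilon> \<rho> \<phi> f y)\<^sup>2 = ?c\<^sup>2 * (LINT x|V. pairing \<alpha> \<epsilon> \<rho> \<phi> f (x, y))\<^sup>2" unfolding summand_def power_mult_distrib ..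
    also have "\<dots> \<le> ?c\<^sup>2 * (?Z * ?r y)" by (intro mult_left_mono sq y) simp
    finally have "p y * (summand \<alpha> \<epsilon> \<rho> \<phi> f y)\<^sup>2 \<le> p y * (?c\<^sup>2 * (?Z * ?r y))"
      using p_pos[OF y] by (intro mult_left_mono) auto
    then show ?thesis by (simp only: mult_ac)
  qed
  have "(LINT y|V. p y * (summand \<alpha> \<epsilon> \<rho> \<phi> f y)\<^sup>2) \<le> (LINT y|V. ?c\<^sup>2 * ?Z * (p y * ?r y))"
    using le irp p_pos by (intro Bochner_Integration.integral_mono_AE' AE_I2 integrable_mult_right) (auto simp: space_V less_imp_le intro!: mult_nonneg_nonneg r0[simplified] D(1))
  also have "\<dots> = ?c\<^sup>2 * ?Z * (LINT y|V. p y * ?r y)" by (rule integral_mult_right_zero)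
  also have "\<dots> = ?c\<^sup>2 * ?Z * (Form (2 * \<alpha>) \<epsilon> \<rho> f f)" unfolding eI ..
  also have "?c\<^sup>2 * ?Z = 4 * D / (m2)\<^sup>2 * \<Phi>\<^sup>2 / \<epsilon> * \<epsilon> powr (- ?d / 2 - 1)"
  proof -
    have "\<epsilon> powr (- ?d / 2 - 1) * \<epsilon> powr (?d / 2) = 1 / \<epsilon>"
      unfolding powr_add[symmetric] using \<epsilon> by (simp add: powr_minus_divide)
    then have "(\<epsilon> powr (- ?d / 2 - 1))\<^sup>2 * \<epsilon> powr (?d / 2) = \<epsilon> powr (- ?d / 2 - 1) * (1 / \<epsilon>)"
      unfolding power2_eq_square by (simp only: mult.assoc)
    then have "4 * D / (m2)\<^sup>2 * \<Phi>\<^sup>2 * ((\<epsilon> powr (- ?d / 2 - 1))\<^sup>2 * \<epsilon> powr (?d / 2)) = 4 * D / (m2)\<^sup>2 * \<Phi>\<^sup>2 * (\<epsilon> powr (- ?d / 2 - 1) * (1 / \<epsilon>))" by simp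
    then show ?thesis by (simp add: power_mult_distrib power_divide mult_ac)
  qed
  finally show ?thesis by (simp only: mult.assoc)
qed

end

subsection \<open>Concentration\<close>

text \<open>For negative z the bound follows from exp (- z) \<ge> 1 - z together with (1 + z + z^2)
  (1 - z) = 1 - z^3 \<ge> 1.\<close>

lemma exp_le_quadratic:
  fixes z :: real
  assumes "z \<le> 1"
  shows "exp z \<le> 1 + z + z\<^sup>2"
proof (cases "z \<ge> 0")
  case False
  have "1 - z \<le> exp (- z)" using exp_ge_add_one_self[of "- z"] by simp
  then have "exp z \<le> 1 / (1 - z)" using False by (simp add: exp_minus field_simps)
  moreover have "1 \<le> (1 + z + z\<^sup>2) * (1 - z)"
  proof -
    have "(1 + z + z\<^sup>2) * (1 - z) = 1 - z ^ 3" by (simp add: algebra_simps power2_eq_square power3_eq_cube)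
    moreover have "z ^ 3 \<le> 0" using False by (simp add: power_le_zero_eq)
    ultimately show ?thesis by simp
  qed
  then have "1 / (1 - z) \<le> 1 + z + z\<^sup>2" using False by (simp add: pos_divide_le_eq)
  ultimately show ?thesis by simp
qed (use assms exp_bound in auto)

context prob_space
begin

text \<open>Chernoff's method: l * L \<le> 1 admits the quadratic bound on the exponential, the
  linear term has mean zero, and independence turns the expectation of the product into a
  power.\<close>

lemma iid_exponential_tail:
  fixes Y :: "'a \<Rightarrow> real"
  assumes Y: "Y \<in> borel_measurable M" "\<And>x. x \<in> space M \<Longrightarrow> \<bar>Y x\<bar> \<le> L" and E: "(LINT x|M. Y x) = 0"
    and v: "(LINT x|M. (Y x)\<^sup>2) \<le> v" and l: "l \<ge> 0" "l * L \<le> 1"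
  shows "measure (Pi\<^sub>M {..<N} (\<lambda>_. M)) {X \<in> space (Pi\<^sub>M {..<N} (\<lambda>_. M)). real N * t \<le> (\<Sum>j<N. Y (X j))}
    \<le> exp (real N * (l\<^sup>2 * v - l * t))"
proof -
  let ?P = "Pi\<^sub>M {..<N} (\<lambda>_. M)"
  interpret P: product_sigma_finite "\<lambda>_. M" ..
  note [measurable] = Y(1)
  have iY: "integrable M Y" using Y by (intro integrable_const_bound[of _ L] AE_I2) auto
  have iY2: "integrable M (\<lambda>x. (Y x)\<^sup>2)"
  proof (intro integrable_const_bound[of _ "L\<^sup>2"] AE_I2)
    fix x assume "x \<in> space M"
    then have "\<bar>Y x\<bar>\<^sup>2 \<le> L\<^sup>2" using Y(2) by (intro power_mono) auto
    then show "norm ((Y x)\<^sup>2) \<le> L\<^sup>2" by simp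
  qed measurable
  have lY: "l * Y x \<le> 1" if "x \<in> space M" for x
  proof -
    have "l * Y x \<le> l * L" using Y(2)[OF that] l(1) by (intro mult_left_mono) auto
    then show ?thesis using l(2) by simp
  qed
  have ie: "integrable M (\<lambda>x. exp (l * Y x))"
    using lY by (intro integrable_const_bound[of _ "exp 1"] AE_I2) auto
  have "(LINT x|M. exp (l * Y x)) \<le> (LINT x|M. 1 + l * Y x + l\<^sup>2 * (Y x)\<^sup>2)"
    using ie iY iY2 exp_le_quadratic[OF lY] by (intro integral_mono) (auto simp: power_mult_distrib)
  also have "\<dots> = 1 + l\<^sup>2 * (LINT x|M. (Y x)\<^sup>2)" using iY iY2 E by (simp add: prob_space)
  also have "\<dots> \<le> 1 + l\<^sup>2 * v" using v by (intro add_left_mono mult_left_mono) auto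
  also have "\<dots> \<le> exp (l\<^sup>2 * v)" by (rule exp_ge_add_one_self)
  finally have mgf: "(LINT x|M. exp (l * Y x)) \<le> exp (l\<^sup>2 * v)" .
  let ?u = "\<lambda>X. \<Prod>j<N. exp (l * Y (X j))"
  have iu: "integrable ?P ?u" using ie by (intro P.product_integrable_prod) auto
  have "(\<integral>X. ?u X \<partial>?P) = (\<Prod>j<N. \<integral>x. exp (l * Y x) \<partial>M)"
    using ie by (intro P.product_integral_prod) auto
  then have eu: "(\<integral>X. ?u X \<partial>?P) = (LINT x|M. exp (l * Y x)) ^ N" by simp
  have u: "?u X = exp (l * (\<Sum>j<N. Y (X j)))" for X by (simp add: exp_sum sum_distrib_left)
  have "measure ?P {X \<in> space ?P. real N * t \<le> (\<Sum>j<N. Y (X j))} \<le> measure ?P {X \<in> space ?P. exp (l * (real N * t)) \<le> ?u X}"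
  proof (rule finite_measure.finite_measure_mono)
    show "finite_measure ?P" using prob_space_PiM[of "{..<N}" "\<lambda>_. M"] prob_space_axioms by (simp add: prob_space.finite_measure)
    show "{X \<in> space ?P. real N * t \<le> (\<Sum>j<N. Y (X j))} \<subseteq> {X \<in> space ?P. exp (l * (real N * t)) \<le> ?u X}"
      unfolding u using l(1) by (auto intro: mult_left_mono)
    show "{X \<in> space ?P. exp (l * (real N * t)) \<le> ?u X} \<in> sets ?P" by measurable
  qed
  also have "\<dots> \<le> (\<integral>X. ?u X \<partial>?P) / exp (l * (real N * t))"
    by (rule integral_Markov_inequality_measure[OF iu sets.empty_sets]) (auto intro!: prod_nonneg)
  also have "\<dots> \<le> exp (l\<^sup>2 * v) ^ N / exp (l * (real N * t))"
    unfolding eu using mgf by (intro divide_right_mono) (auto intro!: power_mono integral_nonneg_AE)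
  also have "\<dots> = exp (real N * (l\<^sup>2 * v - l * t))"
    by (simp add: exp_of_nat_mult[symmetric] exp_diff[symmetric] algebra_simps)
  finally show ?thesis .
qed

text \<open>The condition t * L \<le> v confines the deviation to the range where the tail is
  Gaussian with variance proxy \<open>v\<close>. The two tails are handled together through a sign
  s, whence the factor 2.\<close>

lemma bernstein_inequality:
  fixes Y :: "'a \<Rightarrow> real"
  assumes Y: "Y \<in> borel_measurable M" "\<And>x. x \<in> space M \<Longrightarrow> \<bar>Y x\<bar> \<le> L"
    and v: "(LINT x|M. (Y x)\<^sup>2) \<le> v" "v > 0" and t: "t \<ge> 0" "t * L \<le> v" and N: "N > 0"
  shows "measure (Pi\<^sub>M {..<N} (\<lambda>_. M)) {X \<in> space (Pi\<^sub>M {..<N} (\<lambda>_. M)).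
      \<bar>1 / real N * (\<Sum>j<N. Y (X j)) - (LINT x|M. Y x)\<bar> \<le> t} \<ge> 1 - 2 * exp (- (real N * t\<^sup>2 / (4 * v)))"
proof -
  let ?P = "Pi\<^sub>M {..<N} (\<lambda>_. M)"
  let ?E = "\<integral>x. Y x \<partial>M"
  interpret P: prob_space ?P using prob_space_PiM[of "{..<N}" "\<lambda>_. M"] prob_space_axioms by simp
  note [measurable] = Y(1)
  have iY: "integrable M Y" using Y by (intro integrable_const_bound[of _ L] AE_I2) auto
  have iY2: "integrable M (\<lambda>x. (Y x)\<^sup>2)"
  proof (intro integrable_const_bound[of _ "L\<^sup>2"] AE_I2)
    fix x assume "x \<in> space M"
    then have "\<bar>Y x\<bar>\<^sup>2 \<le> L\<^sup>2" using Y(2) by (intro power_mono) auto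
    then show "norm ((Y x)\<^sup>2) \<le> L\<^sup>2" by simp
  qed measurable
  have EL: "\<bar>?E\<bar> \<le> L"
  proof -
    have "\<bar>?E\<bar> \<le> (LINT x|M. \<bar>Y x\<bar>)" using integral_norm_bound[of M Y] by simp
    also have "\<dots> \<le> (LINT x|M. L)" using iY Y(2) by (intro integral_mono) auto
    finally show ?thesis by (simp add: prob_space)
  qed
  \<comment> \<open>The minimizer of l^2 v - l t, with minimum - t^2 / (4 v). It is admissible
    because the centred variable is bounded by 2 L, so the condition on l is t L \<le> v.\<close>
  let ?l = "t / (2 * v)"
  have l: "?l \<ge> 0" "?l * (2 * L) \<le> 1" using t v(2) by (auto simp: field_simps)
  have ex: "real N * (?l\<^sup>2 * v - ?l * t) = - (real N * t\<^sup>2 / (4 * v))"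
    using v(2) by (simp add: field_simps power2_eq_square)
  have tail: "measure ?P {X \<in> space ?P. real N * t \<le> (\<Sum>j<N. s * (Y (X j) - ?E))} \<le> exp (- (real N * t\<^sup>2 / (4 * v)))" if s: "\<bar>s\<bar> = 1" for s
    unfolding ex[symmetric]
  proof (rule iid_exponential_tail[OF _ _ _ _ l])
    show "(\<lambda>x. s * (Y x - ?E)) \<in> borel_measurable M" by measurable
    show "\<bar>s * (Y x - ?E)\<bar> \<le> 2 * L" if "x \<in> space M" for x
      using Y(2)[OF that] EL s by (simp add: abs_mult)
    show "(LINT x|M. s * (Y x - ?E)) = 0" using iY by (simp add: prob_space)
    have s2: "s\<^sup>2 = 1" using s by (metis power2_abs power_one)
    have "(LINT x|M. (s * (Y x - ?E))\<^sup>2) = (LINT x|M. (Y x)\<^sup>2 - 2 * ?E * Y x + ?E\<^sup>2)"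
      unfolding power_mult_distrib s2 by (intro LINT_cong) (simp add: power2_eq_square algebra_simps)
    also have "\<dots> = (LINT x|M. (Y x)\<^sup>2) - 2 * ?E * ?E + ?E\<^sup>2" using iY iY2 by (simp add: prob_space)
    also have "\<dots> \<le> v" using v(1) zero_le_square[of ?E] by (simp add: power2_eq_square del: zero_le_square)
    finally show "(LINT x|M. (s * (Y x - ?E))\<^sup>2) \<le> v" .
  qed
  let ?A = "\<lambda>s. {X \<in> space ?P. real N * t \<le> (\<Sum>j<N. s * (Y (X j) - ?E))}"
  let ?B = "{X \<in> space ?P. \<bar>1 / real N * (\<Sum>j<N. Y (X j)) - ?E\<bar> \<le> t}"
  have Am: "?A s \<in> sets ?P" for s by measurable
  have Bm: "?B \<in> sets ?P" by measurable
  have "space ?P - ?B \<subseteq> ?A 1 \<union> ?A (- 1)"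
  proof
    fix X assume X: "X \<in> space ?P - ?B"
    have e: "(\<Sum>j<N. Y (X j) - ?E) = real N * (1 / real N * (\<Sum>j<N. Y (X j)) - ?E)"
      using N by (simp add: sum_subtractf right_diff_distrib)
    from X have "t < \<bar>1 / real N * (\<Sum>j<N. Y (X j)) - ?E\<bar>" by auto
    then have "real N * t \<le> real N * \<bar>1 / real N * (\<Sum>j<N. Y (X j)) - ?E\<bar>" by (intro mult_left_mono) auto
    also have "\<dots> = \<bar>\<Sum>j<N. Y (X j) - ?E\<bar>" unfolding e by (simp add: abs_mult)
    finally have "real N * t \<le> (\<Sum>j<N. Y (X j) - ?E) \<or> real N * t \<le> - (\<Sum>j<N. Y (X j) - ?E)" by linarith
    then show "X \<in> ?A 1 \<union> ?A (- 1)" using X unfolding sum_negf[symmetric] by auto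
  qed
  then have "P.prob (space ?P - ?B) \<le> P.prob (?A 1 \<union> ?A (- 1))" using Am by (intro P.finite_measure_mono) auto
  also have "\<dots> \<le> P.prob (?A 1) + P.prob (?A (- 1))" using Am by (intro measure_Un_le) auto
  also have "\<dots> \<le> 2 * exp (- (real N * t\<^sup>2 / (4 * v)))" using tail[of 1] tail[of "- 1"] by simp
  finally show ?thesis using P.prob_compl[OF Bm] by simp
qed

end

section \<open>Regularity of the nearest-neighbour bandwidth; the sampling density as a probability
  measure\<close>

lemma knn_radius_lipschitz:
  fixes Y :: "nat \<Rightarrow> 'a::real_normed_vector"
  assumes k: "k \<le> Ny"
  shows "\<bar>knn_radius k Ny Y x - knn_radius k Ny Y z\<bar> \<le> norm (x - z)"
proof -
  define S where "S x = {r. r > 0 \<and> (\<Sum>j<Ny. of_bool (norm (Y j - x) < r) :: nat) \<ge> k}" for x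
  \<comment> \<open>As k \<le> Ny, a radius that reaches all the points qualifies, so the infimum is
    over a non-empty set.\<close>
  have ne: "S x \<noteq> {}" for x
  proof -
    let ?r = "1 + (\<Sum>j<Ny. norm (Y j - x))"
    have "norm (Y j - x) < ?r" if "j < Ny" for j
      using member_le_sum[of j "{..<Ny}" "\<lambda>j. norm (Y j - x)"] that by simp
    then have "(\<Sum>j<Ny. of_bool (norm (Y j - x) < ?r) :: nat) = (\<Sum>j<Ny. 1)" by (intro sum.cong refl) simp
    moreover have "?r > 0" by (simp add: add_pos_nonneg sum_nonneg)
    ultimately have "?r \<in> S x" using k by (simp add: S_def)
    then show ?thesis by blast
  qed
  have bd: "bdd_below (S x)" for x by (rule bdd_belowI[of _ 0]) (simp add: S_def)
  have le: "Inf (S z) \<le> Inf (S x) + norm (x - z)" for x z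
  proof -
    have "Inf (S z) - norm (x - z) \<le> Inf (S x)"
    proof (rule cInf_greatest[OF ne])
      fix r assume r: "r \<in> S x"
      \<comment> \<open>Moving the centre by x - z and enlarging the radius by its norm keeps every
        counted point.\<close>
      have "norm (Y j - z) < r + norm (x - z)" if "norm (Y j - x) < r" for j
        using norm_triangle_ineq[of "Y j - x" "x - z"] that by simp
      then have "(\<Sum>j<Ny. of_bool (norm (Y j - x) < r) :: nat) \<le> (\<Sum>j<Ny. of_bool (norm (Y j - z) < r + norm (x - z)))"
        by (intro sum_mono) auto
      then have "r + norm (x - z) \<in> S z" using r by (auto simp: S_def add_pos_nonneg)
      then show "Inf (S z) - norm (x - z) \<le> r" using cInf_lower[OF _ bd] by force
    qed
    then show ?thesis by simp
  qed
  have e: "knn_radius k Ny Y w = Inf (S w)" for w by (simp add: knn_radius_def S_def)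
  show ?thesis unfolding e using le[of z x] le[of x z] by (simp add: norm_minus_commute abs_le_iff)
qed

lemma knn_bandwidth_continuous:
  fixes Y :: "nat \<Rightarrow> 'a::real_normed_vector"
  assumes "k \<le> Ny"
  shows "continuous_on S (knn_bandwidth T k Ny Y)"
proof -
  have "1-lipschitz_on S (knn_radius k Ny Y)"
    using knn_radius_lipschitz[OF assms] by (intro lipschitz_onI) (auto simp: dist_norm)
  then have "continuous_on S (knn_radius k Ny Y)" by (rule lipschitz_on_continuous_on)
  then show ?thesis unfolding knn_bandwidth_def[abs_def] by (intro continuous_on_mult continuous_on_const)
qed

context weighted_manifold
begin

text \<open>A real supremum controls the single values only for a bounded family; continuity on the
  compact \<open>M\<close> provides the bound, and it makes the bandwidth measurable as
  well.\<close>

lemma close_bandwidthI: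
  assumes \<rho>: "continuous_on M \<rho>" and M: "M \<noteq> {}"
    and s: "(SUP x\<in>M. \<bar>\<rho> x - \<rho>\<^sub>0 x\<bar> / \<bar>\<rho>\<^sub>0 x\<bar>) < \<delta>" and \<delta>: "\<delta> < 0.1"
  shows "close_bandwidth \<delta> \<rho>"
proof -
  let ?g = "\<lambda>x. \<bar>\<rho> x - \<rho>\<^sub>0 x\<bar> / \<bar>\<rho>\<^sub>0 x\<bar>"
  have "continuous_on M ?g"
    using rho0_pos by (intro continuous_intros \<rho> rho0_continuous) force
  then obtain B where "\<And>x. x \<in> M \<Longrightarrow> norm (?g x) \<le> B" using compact_continuous_bound[OF compact_M] by blast
  then have bd: "bdd_above (?g ` M)" by (intro bdd_aboveI2[of _ _ B]) (metis abs_le_D1 real_norm_def)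
  have g: "?g x \<le> \<delta>" if "x \<in> M" for x using cSUP_upper[OF that bd] s by linarith
  have "\<delta> \<ge> 0"
  proof -
    obtain x where "x \<in> M" using M by blast
    moreover have "?g x \<ge> 0" by simp
    ultimately show ?thesis using g[of x] by linarith
  qed
  moreover have "\<bar>\<rho> x - \<rho>\<^sub>0 x\<bar> \<le> \<delta> * \<rho>\<^sub>0 x" if "x \<in> M" for x
    using g[OF that] rho0_pos[OF that] by (simp add: pos_divide_le_eq)
  ultimately show ?thesis using \<delta> continuous_measurable_V[OF \<rho>] by (simp add: close_bandwidth_def)
qed

lemma prob_space_density:
  assumes "(LINT x|V. p x) = 1"
  shows "prob_space (density V (\<lambda>x. ennreal (p x)))"
proof
  have i: "integrable V p" by (rule continuous_integrable_V[OF p_continuous])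
  have "emeasure (density V (\<lambda>x. ennreal (p x))) (space V) = (\<integral>\<^sup>+x. ennreal (p x) * indicator (space V) x \<partial>V)"
    using i by (intro emeasure_density) auto
  also have "\<dots> = (\<integral>\<^sup>+x. ennreal (p x) \<partial>V)" by (intro nn_integral_cong) simp
  also have "\<dots> = ennreal (LINT x|V. p x)" using i p_pos by (intro nn_integral_eq_integral AE_I2) (auto simp: space_V less_imp_le)
  finally show "emeasure (density V (\<lambda>x. ennreal (p x))) (space (density V (\<lambda>x. ennreal (p x)))) = 1" by (simp add: assms)
qed

lemma integral_density_p:
  fixes g :: "real ^ 'D \<Rightarrow> real"
  assumes "g \<in> borel_measurable V"
  shows "(LINT x|(density V (\<lambda>x. ennreal (p x))). g x) = (LINT x|V. p x * g x)"
proof -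
  have "AE x in V. 0 \<le> p x" using p_pos by (intro AE_I2) (simp add: space_V less_imp_le)
  from integral_density[OF assms continuous_measurable_V[OF p_continuous] this]
  show ?thesis by simp
qed

end

section \<open>Bias and fluctuation combined\<close>

context weighted_manifold
begin

lemma p_alpha_pos: "x \<in> M \<Longrightarrow> p_alpha dT \<alpha> p x > 0"
  using p_pos[of x] by (auto simp: p_alpha_def)

lemma p_alpha_Ck: "Ck_manifold (Suc 0) (p_alpha dT \<alpha> p)"
  unfolding p_alpha_def[abs_def] by (rule Ck_manifold_powr[OF p_Ck p_pos])

lemma sup_norm_on_M:
  assumes "continuous_on M g"
  shows "x \<in> M \<Longrightarrow> \<bar>g x\<bar> \<le> sup_norm_on M g"
proof -
  obtain B where "\<And>x. x \<in> M \<Longrightarrow> norm (g x) \<le> B" using compact_continuous_bound[OF compact_M assms] by blast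
  then have "bdd_above ((\<lambda>x. \<bar>g x\<bar>) ` M)" by (intro bdd_aboveI2[of _ _ B]) simp
  then show "x \<in> M \<Longrightarrow> \<bar>g x\<bar> \<le> sup_norm_on M g" unfolding sup_norm_on_def by (rule cSUP_upper[rotated])
qed

text \<open>The average concentrates about its expectation with radius \<open>t\<close>; an
  arbitrary target \<open>J\<close> is reached by adding the bias to the radius.\<close>

lemma sample_concentration:
  assumes p1: "(LINT x|V. p x) = 1" and b: "close_bandwidth \<delta> \<rho>" and \<epsilon>: "\<epsilon> > 0"
    and \<phi>: "continuous_on M \<phi>" and f: "continuous_on M f"
    and L: "\<And>y. y \<in> M \<Longrightarrow> \<bar>summand \<alpha> \<epsilon> \<rho> \<phi> f y\<bar> \<le> L"
    and v: "(LINT y|V. p y * (summand \<alpha> \<epsilon> \<rho> \<phi> f y)\<^sup>2) \<le> v" "v > 0" and t: "t \<ge> 0" "t * L \<le> v" and N: "N > 0"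
    and r: "\<bar>(LINT y|V. p y * summand \<alpha> \<epsilon> \<rho> \<phi> f y) - J\<bar> + t \<le> r"
  shows "measure (iid_sample V p N) {X \<in> space (iid_sample V p N).
      \<bar>weak_form \<alpha> \<epsilon> \<rho> \<phi> f N X - J\<bar> \<le> r} \<ge> 1 - 2 * exp (- (real N * t\<^sup>2 / (4 * v)))"
proof -
  let ?D = "density V (\<lambda>x. ennreal (p x))" and ?Y = "summand \<alpha> \<epsilon> \<rho> \<phi> f"
  let ?P = "Pi\<^sub>M {..<N} (\<lambda>_. ?D)"
  interpret D: prob_space ?D by (rule prob_space_density[OF p1])
  interpret P: prob_space ?P using prob_space_PiM[of "{..<N}" "\<lambda>_. ?D"] D.prob_space_axioms by simp
  have YV: "?Y \<in> borel_measurable V" by (rule summand_measurable[OF b \<phi> f])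
  then have Y: "?Y \<in> borel_measurable ?D" by simp
  note [measurable] = Y
  have XM: "X j \<in> M" if "X \<in> space ?P" "j < N" for X j using that by (auto simp: space_PiM space_V)
  have W: "weak_form \<alpha> \<epsilon> \<rho> \<phi> f N X = 1 / real N * (\<Sum>j<N. ?Y (X j))" if "X \<in> space ?P" for X
    using XM[OF that] by (rule weighted_inner_graph_laplacian[OF b \<epsilon> \<phi> f])
  have "1 - 2 * exp (- (real N * t\<^sup>2 / (4 * v))) \<le> measure ?P {X \<in> space ?P. \<bar>1 / real N * (\<Sum>j<N. ?Y (X j)) - (\<integral>x. ?Y x \<partial>?D)\<bar> \<le> t}"
  proof (rule D.bernstein_inequality[OF Y _ _ v(2) t N])
    show "\<bar>?Y x\<bar> \<le> L" if "x \<in> space ?D" for x using L that by (simp add: space_V)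
    have "(\<lambda>x. (?Y x)\<^sup>2) \<in> borel_measurable V" using YV by measurable
    from integral_density_p[OF this] show "(\<integral>x. (?Y x)\<^sup>2 \<partial>?D) \<le> v" using v(1) by simp
  qed
  also have "\<dots> \<le> measure ?P {X \<in> space ?P. \<bar>1 / real N * (\<Sum>j<N. ?Y (X j)) - J\<bar> \<le> r}"
  proof (rule P.finite_measure_mono)
    have "(\<integral>x. ?Y x \<partial>?D) = (LINT y|V. p y * ?Y y)" by (rule integral_density_p[OF YV])
    then show "{X \<in> space ?P. \<bar>1 / real N * (\<Sum>j<N. ?Y (X j)) - (\<integral>x. ?Y x \<partial>?D)\<bar> \<le> t} \<subseteq> {X \<in> space ?P. \<bar>1 / real N * (\<Sum>j<N. ?Y (X j)) - J\<bar> \<le> r}"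
      using r by auto
    show "{X \<in> space ?P. \<bar>1 / real N * (\<Sum>j<N. ?Y (X j)) - J\<bar> \<le> r} \<in> sets ?P" by measurable
  qed
  also have "{X \<in> space ?P. \<bar>1 / real N * (\<Sum>j<N. ?Y (X j)) - J\<bar> \<le> r} =
      {X \<in> space ?P. \<bar>weak_form \<alpha> \<epsilon> \<rho> \<phi> f N X - J\<bar> \<le> r}"
    using W by auto
  finally show ?thesis unfolding iid_sample_def .
qed

text \<open>A property of all samples has probability 1, and strictness comes from N^-10 > 0. Here N
  > 0 matters, since \<open>0 powr (- 10)\<close> is 0.\<close>

lemma sample_deterministic:
  assumes p1: "(LINT x|V. p x) = 1" and N: "N > 0"
    and r: "\<And>X. (\<And>j. j < N \<Longrightarrow> X j \<in> M) \<Longrightarrow> Q X"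
  shows "measure (iid_sample V p N) {X \<in> space (iid_sample V p N). Q X} > 1 - 2 * real N powr (- 10)"
proof -
  let ?D = "density V (\<lambda>x. ennreal (p x))"
  let ?P = "Pi\<^sub>M {..<N} (\<lambda>_. ?D)"
  interpret D: prob_space ?D by (rule prob_space_density[OF p1])
  interpret P: prob_space ?P using prob_space_PiM[of "{..<N}" "\<lambda>_. ?D"] D.prob_space_axioms by simp
  have "Q X" if "X \<in> space ?P" for X
    by (rule r) (use that in \<open>auto simp: space_PiM space_V\<close>)
  then have "{X \<in> space ?P. Q X} = space ?P" by auto
  then show ?thesis unfolding iid_sample_def using N by (simp add: P.prob_space)
qed

lemma p_alpha_double:
  assumes "x \<in> M"
  shows "p_alpha dT (2 * \<alpha>) p x = p_alpha dT \<alpha> p x * (p x powr (\<alpha> / real CARD('d)))\<^sup>2"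
proof -
  have "1 + 2 * (2 * \<alpha> - 1) / real CARD('d) = (1 + 2 * (\<alpha> - 1) / real CARD('d)) + (\<alpha> / real CARD('d) + \<alpha> / real CARD('d))"
    by (simp add: field_simps)
  then show ?thesis unfolding p_alpha_def power2_eq_square by (simp only: powr_add)
qed

definition energy where
  "energy \<alpha> f = (LINT x|V. p_alpha dT \<alpha> p x * (norm (grd f x))\<^sup>2)"

lemma energy_double_le:
  assumes f: "Ck_manifold (Suc 0) f"
  shows "(dirichlet (2 * \<alpha>) f f) \<le> (sup_norm_on M (\<lambda>x. p x powr (\<alpha> / real CARD('d))))\<^sup>2 * energy \<alpha> f"
proof -
  let ?\<Psi> = "sup_norm_on M (\<lambda>x. p x powr (\<alpha> / real CARD('d)))"
  have c: "continuous_on M (\<lambda>x. p x powr (\<alpha> / real CARD('d)))"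
    by (rule Ck_manifold_continuous[OF Ck_manifold_powr[OF p_Ck p_pos]])
  have i: "integrable V (\<lambda>x. p_alpha dT \<beta> p x * (grd f x \<bullet> grd f x))" for \<beta>
    by (intro continuous_integrable_V continuous_on_mult Ck_manifold_continuous[OF p_alpha_Ck] continuous_grad_inner f)
  have "(dirichlet (2 * \<alpha>) f f) \<le> (LINT x|V. ?\<Psi>\<^sup>2 * (p_alpha dT \<alpha> p x * (grd f x \<bullet> grd f x)))"
  proof (intro integral_mono i integrable_mult_right)
    fix x assume "x \<in> space V"
    then have x: "x \<in> M" by (simp add: space_V)
    have "(p x powr (\<alpha> / real CARD('d)))\<^sup>2 \<le> ?\<Psi>\<^sup>2" using sup_norm_on_M[OF c x] by (intro power_mono) auto
    then have "(p x powr (\<alpha> / real CARD('d)))\<^sup>2 * (p_alpha dT \<alpha> p x * (grd f x \<bullet> grd f x)) \<le> ?\<Psi>\<^sup>2 * (p_alpha dT \<alpha> p x * (grd f x \<bullet> grd f x))"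
      using p_alpha_pos[OF x, of \<alpha>] by (intro mult_right_mono) auto
    then show "p_alpha dT (2 * \<alpha>) p x * (grd f x \<bullet> grd f x) \<le> ?\<Psi>\<^sup>2 * (p_alpha dT \<alpha> p x * (grd f x \<bullet> grd f x))"
      unfolding p_alpha_double[OF x] by (simp only: mult_ac)
  qed
  then show ?thesis by (simp add: energy_def power2_norm_eq_inner)
qed

lemma energy_zero_grad:
  assumes f: "Ck_manifold (Suc 0) f" and z: "energy \<alpha> f = 0" and x: "x \<in> M"
  shows "grd f x = 0"
proof -
  have c: "continuous_on M (\<lambda>x. p_alpha dT \<alpha> p x * (grd f x \<bullet> grd f x))"
    by (intro continuous_on_mult Ck_manifold_continuous[OF p_alpha_Ck] continuous_grad_inner f)
  have nn: "p_alpha dT \<alpha> p x * (grd f x \<bullet> grd f x) \<ge> 0" if "x \<in> M" for x using p_alpha_pos[OF that, of \<alpha>] by simp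
  have z': "(LINT x|V. p_alpha dT \<alpha> p x * (grd f x \<bullet> grd f x)) = 0" using z by (simp add: energy_def power2_norm_eq_inner)
  show ?thesis using integral_zero_imp_zero[OF c nn z' x] p_alpha_pos[OF x, of \<alpha>] by simp
qed

abbreviation target where
  "target \<alpha> \<phi> f \<equiv> weighted_inner V (p_alpha dT \<alpha> p) \<phi> (weighted_laplacian dT M (p_alpha dT \<alpha> p) f)"

lemma target_eq:
  assumes "Ck_manifold 3 \<phi>" "Ck_manifold 3 f"
  shows "target \<alpha> \<phi> f = - (dirichlet \<alpha> \<phi> f)"
proof (rule green_weighted)
  show "Ck_manifold 2 f" using assms(2) by (rule Ck_manifold_mono) simp
  show "Ck_manifold (Suc 0) \<phi>" using assms(1) by (rule Ck_manifold_mono) simp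
qed (fact p_alpha_Ck, rule p_alpha_pos)

lemma expectation_limit:
  assumes \<phi>: "Ck_manifold 3 \<phi>" and f: "Ck_manifold 3 f"
  shows "\<exists>C\<ge>0. \<forall>\<epsilon>>0. \<forall>\<delta> \<rho>. close_bandwidth \<delta> \<rho> \<longrightarrow>
    \<bar>(LINT y|V. p y * summand \<alpha> \<epsilon> \<rho> \<phi> f y) - target \<alpha> \<phi> f\<bar> \<le> C * (\<epsilon> + \<delta>)"
proof -
  have m: "m2 > 0" by (rule kernel_m2_pos)
  let ?I = "\<integral>x. p_alpha dT \<alpha> p x * (grd \<phi> x \<bullet> grd f x) \<partial>V"
  obtain C where C: "C \<ge> 0" "\<And>\<epsilon> \<delta> \<rho>. \<epsilon> > 0 \<Longrightarrow> close_bandwidth \<delta> \<rho> \<Longrightarrow>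
    \<bar>\<epsilon> powr (- real CARD('d) / 2 - 1) * (Form \<alpha> \<epsilon> \<rho> \<phi> f) - m2 * ?I\<bar> \<le> C * (\<epsilon> + \<delta>)"
    using dirichlet_bandwidth_limit[OF \<phi> f, of \<alpha>] by blast
  show ?thesis
  proof (intro exI[of _ "C / m2"] conjI allI impI)
    show "0 \<le> C / m2" using C(1) m by simp
    fix \<epsilon> \<delta> :: real and \<rho> assume \<epsilon>: "\<epsilon> > 0" and b: "close_bandwidth \<delta> \<rho>"
    let ?F = "\<epsilon> powr (- real CARD('d) / 2 - 1) * (Form \<alpha> \<epsilon> \<rho> \<phi> f)"
    have "(LINT y|V. p y * summand \<alpha> \<epsilon> \<rho> \<phi> f y) - target \<alpha> \<phi> f = - ?F / m2 + ?I"
      unfolding summand_expectation[OF b \<epsilon> Ck_manifold_continuous[OF \<phi>] Ck_manifold_continuous[OF f]] target_eq[OF \<phi> f] by simp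
    also have "\<dots> = - ((?F - m2 * ?I) / m2)" using m by (simp add: diff_divide_distrib)
    finally have "\<bar>(LINT y|V. p y * summand \<alpha> \<epsilon> \<rho> \<phi> f y) - target \<alpha> \<phi> f\<bar> = \<bar>?F - m2 * ?I\<bar> / m2" using m by simp
    also have "\<dots> \<le> C * (\<epsilon> + \<delta>) / m2" using C(2)[OF \<epsilon> b] m by (intro divide_right_mono) auto
    finally show "\<bar>(LINT y|V. p y * summand \<alpha> \<epsilon> \<rho> \<phi> f y) - target \<alpha> \<phi> f\<bar> \<le> C / m2 * (\<epsilon> + \<delta>)" by simp
  qed
qed

text \<open>If \<phi> vanishes, both sides are zero. If the energy vanishes, the target is zero and
  \<open>f\<close> is locally constant, so a bound of order \<epsilon> holds for every sample and
  the deterministic error term suffices.\<close>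

lemma degenerate_bound:
  assumes \<phi>: "Ck_manifold 3 \<phi>" and f: "Ck_manifold 3 f" and z: "sup_norm_on M \<phi> = 0 \<or> energy \<alpha> f = 0"
  shows "\<exists>C\<ge>0. \<forall>\<epsilon>>0. \<forall>\<delta> \<rho> N X. close_bandwidth \<delta> \<rho> \<longrightarrow> (\<forall>j<N. X j \<in> M) \<longrightarrow>
    \<bar>weak_form \<alpha> \<epsilon> \<rho> \<phi> f N X - target \<alpha> \<phi> f\<bar> \<le> C * \<epsilon>"
proof (cases "energy \<alpha> f = 0")
  case True
  have f1: "Ck_manifold (Suc 0) f" using f by (rule Ck_manifold_mono) simp
  note \<phi>c = Ck_manifold_continuous[OF \<phi>] and fc = Ck_manifold_continuous[OF f]
  note g = energy_zero_grad[OF f1 True]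
  have "(dirichlet \<alpha> \<phi> f) = (LINT x|V. 0)"
    using g by (intro LINT_cong) (simp add: space_V)
  then have J: "target \<alpha> \<phi> f = 0" unfolding target_eq[OF \<phi> f] by simp
  obtain \<eta> where "\<eta> > 0" "\<And>x y. x \<in> M \<Longrightarrow> y \<in> M \<Longrightarrow> dist x y < \<eta> \<Longrightarrow> f x = f y"
    using grad_zero_locally_constant[OF f1 g] by blast
  from summand_locally_constant[OF \<phi>c fc this, of \<alpha>] obtain L where L: "L \<ge> 0"
    "\<And>\<epsilon> \<delta> \<rho> y. \<epsilon> > 0 \<Longrightarrow> close_bandwidth \<delta> \<rho> \<Longrightarrow> y \<in> M \<Longrightarrow> \<bar>summand \<alpha> \<epsilon> \<rho> \<phi> f y\<bar> \<le> L * \<epsilon>" by blast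
  show ?thesis
  proof (intro exI[of _ L] conjI allI impI L(1))
    fix \<epsilon> \<delta> :: real and \<rho> N and X :: "nat \<Rightarrow> real ^ 'D" assume \<epsilon>: "\<epsilon> > 0" and b: "close_bandwidth \<delta> \<rho>" and X: "\<forall>j<N. X j \<in> M"
    have "\<bar>weak_form \<alpha> \<epsilon> \<rho> \<phi> f N X\<bar> = 1 / real N * \<bar>\<Sum>j<N. summand \<alpha> \<epsilon> \<rho> \<phi> f (X j)\<bar>"
      using X by (subst weighted_inner_graph_laplacian[OF b \<epsilon> \<phi>c fc]) (simp_all add: abs_mult)
    also have "\<dots> \<le> 1 / real N * (\<Sum>j<N. L * \<epsilon>)"
      using X L(2)[OF \<epsilon> b] by (intro mult_left_mono order_trans[OF sum_abs] sum_mono) auto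
    also have "\<dots> \<le> L * \<epsilon>" using L(1) \<epsilon> by (cases "N = 0") auto
    finally show "\<bar>weak_form \<alpha> \<epsilon> \<rho> \<phi> f N X - target \<alpha> \<phi> f\<bar> \<le> L * \<epsilon>" unfolding J by simp
  qed
next
  case False
  have "\<phi> x = 0" if "x \<in> M" for x using sup_norm_on_M[OF Ck_manifold_continuous[OF \<phi>] that] z False by simp
  then have "weighted_inner V q \<phi> g = 0" for q g
  proof -
    have "weighted_inner V q \<phi> g = (LINT x|V. 0)" unfolding weighted_inner_def
      using \<open>\<And>x. x \<in> M \<Longrightarrow> \<phi> x = 0\<close> by (intro LINT_cong) (simp add: space_V)
    then show ?thesis by simp
  qed
  then show ?thesis by (intro exI[of _ 0]) simp
qed

text \<open>For small \<epsilon> and \<delta> the error C (\<epsilon> + \<delta>) is at most m2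
  \<Psi>^2 S, which is positive and already bounds the limit; this doubles 4 D to 8 D. The threshold
  depends on all the data, the factor 8 D / m2 only on the manifold and the kernel.\<close>

lemma second_moment_limit:
  assumes \<phi>: "Ck_manifold 3 \<phi>" and f: "Ck_manifold 3 f"
    and GC: "gaussian_const G"
    and D: "D = 2 * A * G * (a / 3) powr (- real CARD('d) / 2) + 1"
    and \<Psi>: "\<Psi> = sup_norm_on M (\<lambda>x. p x powr (\<alpha> / real CARD('d)))" "\<Psi> > 0" and S: "energy \<alpha> f > 0"
  shows "\<exists>\<eta>>0. \<forall>\<epsilon> \<delta> \<rho>. 0 < \<epsilon> \<longrightarrow> \<epsilon> < \<eta> \<longrightarrow> \<delta> < \<eta> \<longrightarrow> close_bandwidth \<delta> \<rho> \<longrightarrow>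
    (LINT y|V. p y * (summand \<alpha> \<epsilon> \<rho> \<phi> f y)\<^sup>2) \<le> 8 * D / m2 * (sup_norm_on M \<phi>)\<^sup>2 * \<Psi>\<^sup>2 * energy \<alpha> f / \<epsilon>"
proof -
  note G = gaussian_constD[OF GC]
  have m: "m2 > 0" by (rule kernel_m2_pos)
  have D0: "D \<ge> 0" unfolding D using A_pos G(1) by simp
  let ?I = "\<integral>x. p_alpha dT (2 * \<alpha>) p x * (grd f x \<bullet> grd f x) \<partial>V"
  let ?S = "energy \<alpha> f"
  have f1: "Ck_manifold (Suc 0) f" using f by (rule Ck_manifold_mono) simp
  note \<phi>c = Ck_manifold_continuous[OF \<phi>] and fc = Ck_manifold_continuous[OF f]
  obtain C where C: "C \<ge> 0" "\<And>\<epsilon> \<delta> \<rho>. \<epsilon> > 0 \<Longrightarrow> close_bandwidth \<delta> \<rho> \<Longrightarrow>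
    \<bar>\<epsilon> powr (- real CARD('d) / 2 - 1) * (Form (2 * \<alpha>) \<epsilon> \<rho> f f) - m2 * ?I\<bar> \<le> C * (\<epsilon> + \<delta>)"
    using dirichlet_bandwidth_limit[OF f f, of "2 * \<alpha>"] by blast
  obtain \<epsilon>0 where \<epsilon>0: "\<epsilon>0 > 0" "\<And>\<epsilon> \<delta> \<rho> y. 0 < \<epsilon> \<Longrightarrow> \<epsilon> < \<epsilon>0 \<Longrightarrow> close_bandwidth \<delta> \<rho> \<Longrightarrow> y \<in> M \<Longrightarrow>
    (LINT x|V. p x * kern_pair 0 \<epsilon> \<rho> (x, y)) \<le> D * \<epsilon> powr (real CARD('d) / 2)"
    using kernel_mass[OF GC] unfolding D by blast
  define \<eta> where "\<eta> = min \<epsilon>0 (m2 * \<Psi>\<^sup>2 * ?S / (2 * (C + 1)))"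
  have mS: "m2 * \<Psi>\<^sup>2 * ?S > 0" using m \<Psi>(2) S by simp
  have \<eta>: "\<eta> > 0" unfolding \<eta>_def using \<epsilon>0(1) mS C(1) by simp
  show ?thesis
  proof (intro exI[of _ \<eta>] conjI allI impI \<eta>)
    fix \<epsilon> \<delta> :: real and \<rho> assume \<epsilon>: "0 < \<epsilon>" "\<epsilon> < \<eta>" and \<delta>: "\<delta> < \<eta>" and b: "close_bandwidth \<delta> \<rho>"
    let ?F = "\<epsilon> powr (- real CARD('d) / 2 - 1) * (Form (2 * \<alpha>) \<epsilon> \<rho> f f)"
    have "\<epsilon> + \<delta> \<le> m2 * \<Psi>\<^sup>2 * ?S / (C + 1)" using \<epsilon>(2) \<delta> C(1) by (simp add: \<eta>_def field_simps)
    then have "(C + 1) * (\<epsilon> + \<delta>) \<le> m2 * \<Psi>\<^sup>2 * ?S" using C(1) by (simp add: pos_le_divide_eq mult.commute)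
    then have "C * (\<epsilon> + \<delta>) \<le> m2 * \<Psi>\<^sup>2 * ?S" using \<epsilon>(1) close_bandwidthD(1)[OF b] by (simp add: algebra_simps)
    moreover have "m2 * ?I \<le> m2 * (\<Psi>\<^sup>2 * ?S)" using energy_double_le[OF f1, of \<alpha>] m unfolding \<Psi>(1) by (intro mult_left_mono) auto
    ultimately have F: "?F \<le> 2 * (m2 * \<Psi>\<^sup>2 * ?S)" using C(2)[OF \<epsilon>(1) b] by simp
    have "\<epsilon> < \<epsilon>0" using \<epsilon>(2) by (simp add: \<eta>_def)
    then have "(LINT y|V. p y * (summand \<alpha> \<epsilon> \<rho> \<phi> f y)\<^sup>2) \<le> 4 * D / m2\<^sup>2 * (sup_norm_on M \<phi>)\<^sup>2 / \<epsilon> * ?F"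
      using \<epsilon>(1) b by (intro summand_second_moment[OF b \<epsilon>(1) \<phi>c fc D0 \<epsilon>0(2)] sup_norm_on_M[OF \<phi>c]) auto
    also have "\<dots> \<le> 4 * D / m2\<^sup>2 * (sup_norm_on M \<phi>)\<^sup>2 / \<epsilon> * (2 * (m2 * \<Psi>\<^sup>2 * ?S))"
      using F D0 \<epsilon>(1) by (intro mult_left_mono) auto
    also have "\<dots> = 8 * D / m2 * (sup_norm_on M \<phi>)\<^sup>2 * \<Psi>\<^sup>2 * ?S / \<epsilon>" using m \<epsilon>(1) by (simp add: field_simps power2_eq_square)
    finally show "(LINT y|V. p y * (summand \<alpha> \<epsilon> \<rho> \<phi> f y)\<^sup>2) \<le> 8 * D / m2 * (sup_norm_on M \<phi>)\<^sup>2 * \<Psi>\<^sup>2 * ?S / \<epsilon>"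
      .
  qed
qed

abbreviation pr where
  "pr \<alpha> \<phi> f N \<epsilon> \<rho> r \<equiv> measure (iid_sample V p N)
     {X \<in> space (iid_sample V p N). \<bar>weak_form \<alpha> \<epsilon> \<rho> \<phi> f N X - target \<alpha> \<phi> f\<bar> \<le> r}"

lemma laplacian_weak_consistency:
  assumes p1: "(LINT x|V. p x) = 1" and \<phi>: "Ck_manifold 3 \<phi>" and f: "Ck_manifold 3 f"
    and GC: "gaussian_const G"
    and D: "D = 2 * A * G * (a / 3) powr (- real CARD('d) / 2) + 1" and C2: "C2 = sqrt (352 * D / m2)"
  shows "\<exists>C1>0. \<forall>(\<epsilon> :: nat \<Rightarrow> real) \<delta> \<rho>. (\<forall>N. close_bandwidth (\<delta> N) (\<rho> N)) \<longrightarrow> (\<forall>N. \<epsilon> N > 0) \<longrightarrow> \<epsilon> \<longlonglongrightarrow> 0 \<longrightarrow>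
    filterlim (\<lambda>N. \<epsilon> N * real N / ln (real N)) at_top sequentially \<longrightarrow> \<delta> \<longlonglongrightarrow> 0 \<longrightarrow>
    (\<forall>\<^sub>F N in sequentially. pr \<alpha> \<phi> f N (\<epsilon> N) (\<rho> N) (C1 * (\<bar>\<epsilon> N\<bar> + \<bar>\<delta> N\<bar>) + C2 * (sup_norm_on M \<phi> * sup_norm_on M (\<lambda>x. p x powr (\<alpha> / real CARD('d))) *
           sqrt (ln (real N) / (real N * \<epsilon> N) * energy \<alpha> f))) > 1 - 2 * real N powr (- 10))"
proof -
  note G = gaussian_constD[OF GC]
  let ?\<Phi> = "sup_norm_on M \<phi>" and ?\<Psi> = "sup_norm_on M (\<lambda>x. p x powr (\<alpha> / real CARD('d)))" and ?S = "energy \<alpha> f"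
  have m: "m2 > 0" by (rule kernel_m2_pos)
  have D0: "D > 0" unfolding D using A_pos G(1) by (simp add: add_nonneg_pos)
  note \<phi>c = Ck_manifold_continuous[OF \<phi>] and fc = Ck_manifold_continuous[OF f]
  have \<psi>c: "continuous_on M (\<lambda>x. p x powr (\<alpha> / real CARD('d)))"
    by (rule Ck_manifold_continuous[OF Ck_manifold_powr[OF p_Ck p_pos]])
  \<comment> \<open>On an empty \<open>M\<close> the density would integrate to 0. A point of
    \<open>M\<close> is needed to see that the sup norms have the right sign.\<close>
  have "M \<noteq> {}" using p1 Bochner_Integration.integral_cong[of V V p "\<lambda>_. 0"] by (auto simp: space_V)
  then obtain x0 where x0: "x0 \<in> M" by blast
  have \<Phi>: "?\<Phi> \<ge> 0" using sup_norm_on_M[OF \<phi>c x0] by linarith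
  have \<Psi>: "?\<Psi> > 0" using sup_norm_on_M[OF \<psi>c x0] p_pos[OF x0] by (smt (verit) powr_gt_zero)
  have S: "?S \<ge> 0" unfolding energy_def using p_alpha_pos by (intro integral_nonneg_AE AE_I2) (simp add: space_V less_imp_le)
  show ?thesis
  proof (cases "?\<Phi> = 0 \<or> ?S = 0")
    case True
    obtain C where C: "C \<ge> 0" "\<And>\<epsilon> \<delta> \<rho> N X. \<epsilon> > 0 \<Longrightarrow> close_bandwidth \<delta> \<rho> \<Longrightarrow> (\<And>j. j < N \<Longrightarrow> X j \<in> M) \<Longrightarrow>
       \<bar>weak_form \<alpha> \<epsilon> \<rho> \<phi> f N X - target \<alpha> \<phi> f\<bar> \<le> C * \<epsilon>"
      using degenerate_bound[OF \<phi> f True] by blast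
    show ?thesis
    proof (intro exI[of _ "C + 1"] conjI allI impI)
      show "C + 1 > 0" using C(1) by simp
      fix \<epsilon> \<delta> :: "nat \<Rightarrow> real" and \<rho> assume b: "\<forall>N. close_bandwidth (\<delta> N) (\<rho> N)" and \<epsilon>: "\<forall>N. \<epsilon> N > 0"
      have z: "?\<Phi> * ?\<Psi> * sqrt (ln (real N) / (real N * \<epsilon> N) * ?S) = 0" for N using True by auto
      show "\<forall>\<^sub>F N in sequentially. pr \<alpha> \<phi> f N (\<epsilon> N) (\<rho> N) ((C + 1) * (\<bar>\<epsilon> N\<bar> + \<bar>\<delta> N\<bar>) + C2 * (?\<Phi> * ?\<Psi> * sqrt (ln (real N) / (real N * \<epsilon> N) * ?S))) > 1 - 2 * real N powr (- 10)"
        unfolding z using eventually_gt_at_top[of 0]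
      proof eventually_elim
        case (elim N)
        show ?case
        proof (rule sample_deterministic[OF p1 elim])
          fix X :: "nat \<Rightarrow> real ^ 'D" assume "\<And>j. j < N \<Longrightarrow> X j \<in> M"
          then have "\<bar>weak_form \<alpha> (\<epsilon> N) (\<rho> N) \<phi> f N X - target \<alpha> \<phi> f\<bar> \<le> C * \<epsilon> N"
            using b \<epsilon> by (intro C(2)) auto
          also have "\<dots> \<le> (C + 1) * (\<bar>\<epsilon> N\<bar> + \<bar>\<delta> N\<bar>)" using C(1) \<epsilon> by (intro mult_mono) (auto simp: less_imp_le)
          finally show "\<bar>weak_form \<alpha> (\<epsilon> N) (\<rho> N) \<phi> f N X - target \<alpha> \<phi> f\<bar> \<le> (C + 1) * (\<bar>\<epsilon> N\<bar> + \<bar>\<delta> N\<bar>) + C2 * 0" by simp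
        qed
      qed
    qed
  next
    case False
    then have \<Phi>0: "?\<Phi> > 0" and S0: "?S > 0" using \<Phi> S by auto
    obtain C where C: "C \<ge> 0" "\<And>\<epsilon> \<delta> \<rho>. \<epsilon> > 0 \<Longrightarrow> close_bandwidth \<delta> \<rho> \<Longrightarrow>
      \<bar>(LINT y|V. p y * summand \<alpha> \<epsilon> \<rho> \<phi> f y) - target \<alpha> \<phi> f\<bar> \<le> C * (\<epsilon> + \<delta>)"
      using expectation_limit[OF \<phi> f, of \<alpha>] by blast
    obtain L where L: "L \<ge> 0" "\<And>\<epsilon> \<delta> \<rho> y. \<epsilon> > 0 \<Longrightarrow> close_bandwidth \<delta> \<rho> \<Longrightarrow> y \<in> M \<Longrightarrow> \<bar>summand \<alpha> \<epsilon> \<rho> \<phi> f y\<bar> \<le> L / \<epsilon>"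
      using summand_bound[OF \<phi>c fc, of \<alpha>] by blast
    \<comment> \<open>The variance bound is w / \<epsilon>; its factor 8 becomes part of the
      constant in \<open>C2\<close>.\<close>
    define w where "w = 8 * D / m2 * ?\<Phi>\<^sup>2 * ?\<Psi>\<^sup>2 * ?S"
    have w: "w > 0" unfolding w_def using D0 m \<Phi>0 \<Psi> S0 by simp
    obtain \<eta> where \<eta>: "\<eta> > 0" "\<And>\<epsilon> \<delta> \<rho>. 0 < \<epsilon> \<Longrightarrow> \<epsilon> < \<eta> \<Longrightarrow> \<delta> < \<eta> \<Longrightarrow> close_bandwidth \<delta> \<rho> \<Longrightarrow>
      (LINT y|V. p y * (summand \<alpha> \<epsilon> \<rho> \<phi> f y)\<^sup>2) \<le> w / \<epsilon>"
      using second_moment_limit[OF \<phi> f GC D refl \<Psi> S0] unfolding w_def by blast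
    show ?thesis
    proof (intro exI[of _ "C + 1"] conjI allI impI)
      show "C + 1 > 0" using C(1) by simp
      fix \<epsilon> \<delta> :: "nat \<Rightarrow> real" and \<rho> assume b: "\<forall>N. close_bandwidth (\<delta> N) (\<rho> N)" and \<epsilon>: "\<forall>N. \<epsilon> N > 0" and \<epsilon>0: "\<epsilon> \<longlonglongrightarrow> 0"
        and lim: "filterlim (\<lambda>N. \<epsilon> N * real N / ln (real N)) at_top sequentially" and \<delta>0: "\<delta> \<longlonglongrightarrow> 0"
      define q where "q N = ln (real N) / (real N * \<epsilon> N)" for N
      define t where "t N = C2 * (?\<Phi> * ?\<Psi> * sqrt (q N * ?S))" for N
      \<comment> \<open>As \<epsilon> N outgrows log N, \<open>q\<close> and with it
        \<open>t\<close> tend to 0. Since the bounds on summand and variance both carry 1 /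
        \<epsilon>, this yields the side condition of Bernstein's inequality eventually.\<close>
      have "(\<lambda>N. inverse (\<epsilon> N * real N / ln (real N))) \<longlonglongrightarrow> 0" using lim by (rule tendsto_inverse_0_at_top)
      then have q0: "q \<longlonglongrightarrow> 0" by (simp add: q_def[abs_def] mult.commute)
      have "(\<lambda>N. t N * L) \<longlonglongrightarrow> C2 * (?\<Phi> * ?\<Psi> * sqrt (0 * ?S)) * L"
        unfolding t_def by (intro tendsto_intros q0)
      then have "\<forall>\<^sub>F N in sequentially. t N * L < w" using w by (intro order_tendstoD(2)) simp_all
      moreover have "\<forall>\<^sub>F N in sequentially. \<epsilon> N < \<eta>" using \<epsilon>0 \<eta>(1) by (rule order_tendstoD(2))
      moreover have "\<forall>\<^sub>F N in sequentially. \<delta> N < \<eta>" using \<delta>0 \<eta>(1) by (rule order_tendstoD(2))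
      moreover have "\<forall>\<^sub>F N in sequentially. (1 :: nat) < N" by (rule eventually_gt_at_top)
      ultimately show "\<forall>\<^sub>F N in sequentially. pr \<alpha> \<phi> f N (\<epsilon> N) (\<rho> N) ((C + 1) * (\<bar>\<epsilon> N\<bar> + \<bar>\<delta> N\<bar>) + C2 * (?\<Phi> * ?\<Psi> * sqrt (ln (real N) / (real N * \<epsilon> N) * ?S))) > 1 - 2 * real N powr (- 10)"
      proof eventually_elim
        case (elim N)
        then have e: "\<epsilon> N > 0" and b': "close_bandwidth (\<delta> N) (\<rho> N)" and N: "N > 0" "real N > 1" using \<epsilon> b by auto
        have qN: "q N \<ge> 0" using N e by (simp add: q_def)
        have C20: "C2 \<ge> 0" unfolding C2 using D0 m by simp
        have tN: "t N \<ge> 0" unfolding t_def using C20 \<Phi>0 \<Psi> S0 qN by simp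
        have tsq: "(t N)\<^sup>2 = 44 * w * q N"
        proof -
          have "C2\<^sup>2 = 352 * D / m2" unfolding C2 using D0 m by simp
          then have "(t N)\<^sup>2 = 352 * D / m2 * (?\<Phi>\<^sup>2 * ?\<Psi>\<^sup>2 * (q N * ?S))"
            unfolding t_def using qN S0 by (simp add: power_mult_distrib)
          then show ?thesis by (simp add: w_def)
        qed
        \<comment> \<open>\<open>C2\<close> is made for this: 352 = 44 * 8, where 8 belongs to
          \<open>w\<close>, and 44 / 4 = 11. The surplus of 11 over 10 turns the non-strict tail
          bound into a strict one for N > 1.\<close>
        have ex: "real N * (t N)\<^sup>2 / (4 * (w / \<epsilon> N)) = 11 * ln (real N)"
          unfolding tsq q_def using w e N by (simp add: field_simps)
        have "1 - 2 * real N powr (- 10) < 1 - 2 * exp (- (real N * (t N)\<^sup>2 / (4 * (w / \<epsilon> N))))"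
        proof -
          have "exp (- (real N * (t N)\<^sup>2 / (4 * (w / \<epsilon> N)))) = real N powr (- 11)" unfolding ex using N by (simp add: powr_def)
          also have "\<dots> < real N powr (- 10)" using N by (intro powr_less_mono) auto
          finally show ?thesis by simp
        qed
        also have "\<dots> \<le> pr \<alpha> \<phi> f N (\<epsilon> N) (\<rho> N) ((C + 1) * (\<bar>\<epsilon> N\<bar> + \<bar>\<delta> N\<bar>) + t N)"
        proof (rule sample_concentration[OF p1 b' e \<phi>c fc L(2)[OF e b'] \<eta>(2)[OF e _ _ b'] _ tN _ N(1)])
          show "\<epsilon> N < \<eta>" "\<delta> N < \<eta>" using elim by auto
          show "0 < w / \<epsilon> N" using w e by simp
          have "t N * (L / \<epsilon> N) = t N * L / \<epsilon> N" by simp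
          also have "\<dots> \<le> w / \<epsilon> N" using elim(1) e by (intro divide_right_mono) auto
          finally show "t N * (L / \<epsilon> N) \<le> w / \<epsilon> N" .
          show "\<bar>(LINT y|V. p y * summand \<alpha> (\<epsilon> N) (\<rho> N) \<phi> f y) - target \<alpha> \<phi> f\<bar> + t N \<le> (C + 1) * (\<bar>\<epsilon> N\<bar> + \<bar>\<delta> N\<bar>) + t N"
            using C(2)[OF e b'] e close_bandwidthD(1)[OF b'] by (simp add: distrib_right)
        qed
        finally show ?case unfolding t_def q_def .
      qed
    qed
  qed
qed

end

theorem theorem3p7:
  fixes M :: "(real ^ 'D::finite) set" and V :: "(real ^ 'D) measure" and k0 :: "real \<Rightarrow> real"
  assumes "compact M" and "embedded_submanifold TYPE('d::finite) M"
    and "riemannian_volume TYPE('d) M V"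
    and "admissible_kernel k0"
  shows "\<exists>C2>0. \<forall>(p :: real ^ 'D \<Rightarrow> real) (\<alpha> :: real) f \<phi>.
    smooth_density TYPE('d) M V p \<longrightarrow>
    smooth_fun_on_manifold TYPE('d) M f \<longrightarrow>
    smooth_fun_on_manifold TYPE('d) M \<phi> \<longrightarrow>
    (\<exists>C1>0. \<forall>(\<epsilon> :: nat \<Rightarrow> real) (\<epsilon>\<rho> :: nat \<Rightarrow> real)
        (k :: nat \<Rightarrow> nat) (Ny :: nat \<Rightarrow> nat) (Y :: nat \<Rightarrow> nat \<Rightarrow> real ^ 'D) (\<rho> :: nat \<Rightarrow> real ^ 'D \<Rightarrow> real).
      (\<forall>N. 1 \<le> k N \<and> k N \<le> Ny N) \<longrightarrow>
      (\<forall>N. \<rho> N = knn_bandwidth TYPE('d) (k N) (Ny N) (Y N)) \<longrightarrow>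
      (\<forall>N. (SUP x\<in>M. \<bar>\<rho> N x - rho_bar TYPE('d) p x\<bar> / \<bar>rho_bar TYPE('d) p x\<bar>) < \<epsilon>\<rho> N \<and> \<epsilon>\<rho> N < 0.1) \<longrightarrow>
      (\<forall>N. \<epsilon> N > 0) \<longrightarrow>
      \<epsilon> \<longlonglongrightarrow> 0 \<longrightarrow>
      filterlim (\<lambda>N. \<epsilon> N * real N / ln (real N)) at_top sequentially \<longrightarrow>
      \<epsilon>\<rho> \<longlonglongrightarrow> 0 \<longrightarrow>
      (\<forall>\<^sub>F N in sequentially.
         measure (iid_sample V p N)
           {X \<in> space (iid_sample V p N).
              \<bar>weighted_inner V p \<phi> (graph_laplacian_un TYPE('d) k0 \<alpha> (\<epsilon> N) (\<rho> N) N X f)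
               - weighted_inner V (p_alpha TYPE('d) \<alpha> p) \<phi>
                   (weighted_laplacian TYPE('d) M (p_alpha TYPE('d) \<alpha> p) f)\<bar>
              \<le> C1 * (\<bar>\<epsilon> N\<bar> + \<bar>\<epsilon>\<rho> N\<bar>)
                + C2 * (sup_norm_on M \<phi> * sup_norm_on M (\<lambda>x. p x powr (\<alpha> / real CARD('d))) *
                    sqrt (ln (real N) / (real N * \<epsilon> N) *
                      (\<integral>x. p_alpha TYPE('d) \<alpha> p x * (norm (manifold_grad TYPE('d) M f x))\<^sup>2 \<partial>V)))}
         > 1 - 2 * real N powr (- 10)))"
proof -
  interpret man: manifold "TYPE('d)" M V using assms(1-3) by unfold_locales
  obtain a A where "kernel k0 a A" using admissible_kernelD[OF assms(4)] .
  then interpret ker: kernel k0 a A .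
  obtain G where GC: "man.gaussian_const G" by (rule man.gaussian_constE)
  note G = man.gaussian_constD[OF GC]
  \<comment> \<open>\<open>G\<close>, \<open>A\<close>, \<open>a\<close> and
    \<open>kernel_m2\<close> come from the manifold and the kernel alone, so \<open>C2\<close> is
    available before the density and the test functions are chosen.\<close>
  define D where "D = 2 * A * G * (a / 3) powr (- real CARD('d) / 2) + 1"
  define C2 where "C2 = sqrt (352 * D / kernel_m2 TYPE('d) k0)"
  have "D > 0" unfolding D_def using ker.A_pos G(1) by (simp add: add_nonneg_pos)
  then have C2: "C2 > 0" unfolding C2_def using ker.kernel_m2_pos[of "TYPE('d)"] by simp
  show ?thesis
  proof (rule exI[of _ C2], intro conjI allI impI C2, goal_cases)
    case (1 p \<alpha> f \<phi>)
    note p = 1(1) and f = 1(2) and \<phi> = 1(3)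
    interpret weighted_manifold "TYPE('d)" M V k0 a A p
    proof unfold_locales
      show "man.Ck_manifold k p" for k using p by (intro man.smooth_Ck_manifold) (simp add: smooth_density_def)
      show "p x > 0" if "x \<in> M" for x using p that unfolding smooth_density_def by force
    qed
    have p1: "(\<integral>x. p x \<partial>V) = 1" using p by (simp add: smooth_density_def)
    have "M \<noteq> {}" using p1 Bochner_Integration.integral_cong[of V V p "\<lambda>_. 0"] by (auto simp: man.space_V)
    note lim = laplacian_weak_consistency[OF p1 man.smooth_Ck_manifold[OF \<phi>] man.smooth_Ck_manifold[OF f] GC D_def C2_def, of \<alpha>, unfolded energy_def]
    show ?case
    proof (rule ex_forward[OF lim], elim conjE, intro conjI allI impI, assumption, goal_cases)
      case (1 C1 \<epsilon> \<epsilon>\<rho> k Ny Y \<rho>)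
      have b: "close_bandwidth (\<epsilon>\<rho> N) (\<rho> N)" for N
      proof (rule close_bandwidthI)
        show "continuous_on M (\<rho> N)" using 1(3,4) by (simp add: knn_bandwidth_continuous)
      qed (use 1(5) \<open>M \<noteq> {}\<close> in auto)
      then show ?case using 1(2)[rule_format, of \<epsilon>\<rho> \<rho> \<epsilon>] 1(6-9) by blast
    qed
  qed
qed

end
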